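(* Let $n \in \mathbb{N}$, $n \geq 2$, $N = 2^{\lfloor (n+1)/2 \rfloor}$, and let $V = \{V_{\ell,m}\}_{1 \leq \ell,m \leq N} \in [L^{\infty}(\mathbb{R}^n)]^{N \times N}$ be an a.e. self-adjoint matrix-valued potential satisfying, for some $C \in (0,\infty)$, $|V_{\ell,m}(x)| \leq C \langle x \rangle^{-2}$ for a.e. $x \in \mathbb{R}^n$, $1 \leq \ell,m \leq N$. Let $H = H_0 + V$, $\operatorname{dom}(H) = [W^{1,2}(\mathbb{R}^n)]^N$, be the associated massless Dirac operator in $[L^2(\mathbb{R}^n)]^N$. (i) If $n=2$, there are precisely four possible cases: Case (I): $0$ is regular for $H$. Case (II): $0$ is a (possibly degenerate) resonance of $H$. In this case, the resonance functions $\Psi$ satisfy $$\Psi \in [L^q(\mathbb{R}^2)]^2, \quad q \in (2,\infty) \cup \{\infty\}, \quad \nabla \Psi \in [L^2(\mathbb{R}^2)]^{2 \times 2}, \quad \Psi \notin [L^2(\mathbb{R}^2)]^2.$$ Case (III): $0$ is a (possibly degenerate) eigenvalue of $H$. In this case, the corresponding eigenfunctions $\Psi \in \operatorname{dom}(H) = [W^{1,2}(\mathbb{R}^2)]^2$ of $H\Psi = 0$ also satisfy $$\Psi \in [L^q(\mathbb{R}^2)]^2, \quad q \in [2,\infty) \cup \{\infty\}.$$ Case (IV): A possible mixture of Cases (II) and (III) (i.e., $0$ is both a resonance and an eigenvalue of $H$). (ii) If $n \geq 3$, there are precisely two possible cases: Case (I): $0$ is regular for $H$. Case (II): $0$ is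 a (possibly degenerate) eigenvalue of $H$. In this case, the corresponding eigenfunctions $\Psi \in \operatorname{dom}(H) = [W^{1,2}(\mathbb{R}^n)]^N$ of $H\Psi = 0$ also satisfy $$\Psi \in \big[L^q(\mathbb{R}^n)\big]^N, \quad q \in \begin{cases} (3/2,\infty) \cup \{\infty\}, & n=3, \\ (4/3,4), & n=4, \\ (2n/(n+2), 2n/(n-2)), & n \geq 5. \end{cases}$$ In particular, there are no zero-energy resonances of $H$ in dimension $n \geq 3$. (iii) The point $0$ is regular for $H$ if and only if $$\ker\big(\big[I_{[L^2(\mathbb{R}^n)]^N} + \overline{V_2 (H_0 - (0+i0) I_{[L^2(\mathbb{R}^n)]^N})^{-1} V_1^*}\big]\big) = \{0\}.$$
   Context: Notation: $\langle x \rangle = (1+|x|^2)^{1/2}$. Let $\alpha_j$, $1 \leq j \leq n$, $\alpha_{n+1} := \beta$, be $n+1$ anti-commuting Hermitian $N \times N$ matrices with squares equal to $I_N$: $\alpha_j^* = \alpha_j$, $\alpha_j\alpha_k + \alpha_k\alpha_j = 2\delta_{j,k} I_N$, $1 \leq j,k \leq n+1$. For $w \in \mathbb{R}^n$, $\alpha \cdot w = \sum_{j=1}^n \alpha_j w_j$. The free massless Dirac operator in $[L^2(\mathbb{R}^n)]^N$ is $H_0 = \alpha \cdot (-i\nabla) = \sum_{j=1}^n \alpha_j(-i\partial_j)$, $\operatorname{dom}(H_0) = [W^{1,2}(\mathbb{R}^n)]^N$. With the pointwise polar decomposition $V(\cdot) = U_V(\cdot)|V(\cdot)|$, factorize $V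 = V_1^* V_2 = |V|^{1/2} U_V |V|^{1/2}$, where $V_1 = V_1^* = |V|^{1/2}$ and $V_2 = U_V |V|^{1/2}$. $(H_0 - (0+i0) I_{[L^2(\mathbb{R}^n)]^N})^{-1}$ denotes the integral operator with matrix kernel $$G_0(0+i0;x,y) = i 2^{-1}\pi^{-n/2}\Gamma(n/2)\, \alpha \cdot \frac{(x-y)}{|x-y|^n}, \quad x \neq y,$$ which is the limit as $z \to 0$, $z \in \overline{\mathbb{C}_+}\setminus\{0\}$, of the Green's function of $H_0$. $\overline{V_2 (H_0 - (0+i0) I)^{-1} V_1^*}$ denotes the closure, i.e., the bounded operator in $[L^2(\mathbb{R}^n)]^N$ with integral kernel $V_2(x) G_0(0+i0;x,y) V_1(y)^*$. Definitions. (i) The point $0$ is called a (zero-energy) eigenvalue of $H$ if $H\Psi = 0$ has a nonzero distributional solution $\Psi \in \operatorname{dom}(H) = [W^{1,2}(\mathbb{R}^n)]^N$ (equivalently, $\ker(H) \supsetneqq \{0\}$). (ii) The point $0$ is called a zero-energy (or threshold) resonance of $H$ if $\ker\big(\big[I + \overline{V_2 (H_0 - (0+i0) I)^{-1} V_1^*}\big]\big) \supsetneqq \{0\}$ and if there exists $0 \neq \Phi$ in this kernel such that $\Psi$ defined by $$\Psi(x) = -\big((H_0 - (0+i0)I)^{-1} V_1^* \Phi\big)(x) = -i 2^{-1}\pi^{-n/2}\Gamma(n/2) \int_{\mathbb{R}^n} d^n y \, |x-y|^{-n} [\alpha \cdot (x-y)] V_1(y)^* \Phi(y)$$ for a.e.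 $x \in \mathbb{R}^n$, is a distributional solution of $H\Psi = 0$ satisfying $\Psi \notin [L^2(\mathbb{R}^n)]^N$. Such $\Psi$ are called resonance functions. (iii) $0$ is called regular for $H$ if it is neither a zero-energy eigenvalue nor a zero-energy resonance of $H$. In the case list, Case (II) of (i) means that $0$ is a resonance but not an eigenvalue, and Case (III) of (i) that $0$ is an eigenvalue but not a resonance. "Possibly degenerate" means that the multiplicity may exceed one. *)

theory Defs
  imports "HOL-Analysis.Analysis"
begin

section \<open>Matrices\<close>

definition cadjoint :: "complex^'N^'N \<Rightarrow> complex^'N^'N" where
  "cadjoint A = (\<chi> l m. cnj (A $ m $ l))"

text \<open>The library inner product on \<open>complex^'N\<close> is the real part of the Hermitian one; the
  quadratic form of a Hermitian matrix is real, so nothing is lost in \<open>psd\<close>.\<close>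

definition psd :: "complex^'N^'N \<Rightarrow> bool" where
  "psd A \<longleftrightarrow> cadjoint A = A \<and> (\<forall>v. 0 \<le> v \<bullet> (A *v v))"

definition matrix_sqrt :: "complex^'N^'N \<Rightarrow> complex^'N^'N" where
  "matrix_sqrt A = (THE B. psd B \<and> B ** B = A)"

definition matrix_abs :: "complex^'N^'N \<Rightarrow> complex^'N^'N" where
  "matrix_abs A = matrix_sqrt (cadjoint A ** A)"

text \<open>The partial isometry \<open>U\<close> with \<open>ker U = ker A\<close> in the polar decomposition \<open>A = U |A|\<close>.\<close>

definition polar_isometry :: "complex^'N^'N \<Rightarrow> complex^'N^'N" where
  "polar_isometry A =
     (THE U. A = U ** matrix_abs A \<and> U ** cadjoint U ** U = U \<and> (\<forall>v. U *v v = 0 \<longleftrightarrow> A *v v = 0))"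

definition dirac_matrices :: "('n \<Rightarrow> complex^'N^'N) \<Rightarrow> complex^'N^'N \<Rightarrow> bool" where
  "dirac_matrices \<alpha> \<beta> \<longleftrightarrow>
     (\<forall>j. cadjoint (\<alpha> j) = \<alpha> j) \<and> cadjoint \<beta> = \<beta> \<and>
     (\<forall>j k. \<alpha> j ** \<alpha> k + \<alpha> k ** \<alpha> j = (if j = k then mat 2 else 0)) \<and>
     (\<forall>j. \<alpha> j ** \<beta> + \<beta> ** \<alpha> j = 0) \<and> \<beta> ** \<beta> + \<beta> ** \<beta> = mat 2"

definition alpha_dot :: "('n::finite \<Rightarrow> complex^'N^'N) \<Rightarrow> real^'n \<Rightarrow> complex^'N^'N" where
  "alpha_dot \<alpha> w = (\<Sum>j\<in>UNIV. (w $ j) *\<^sub>R \<alpha> j)"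


section \<open>Function spaces\<close>

text \<open>Functions are everywhere defined representatives; identification a.e. is made explicit
  wherever it matters.\<close>

definition japanese :: "'a::real_normed_vector \<Rightarrow> real" where
  "japanese x = sqrt (1 + (norm x)\<^sup>2)"

definition Lp :: "real \<Rightarrow> ('a::euclidean_space \<Rightarrow> 'b::real_normed_vector) set" where
  "Lp q = {f. f \<in> borel_measurable lebesgue \<and> integrable lebesgue (\<lambda>x. norm (f x) powr q)}"

definition Linf :: "('a::euclidean_space \<Rightarrow> 'b::real_normed_vector) set" where
  "Linf = {f. f \<in> borel_measurable lebesgue \<and> (\<exists>B. AE x in lebesgue. norm (f x) \<le> B)}"

definition locally_integrable :: "('a::euclidean_space \<Rightarrow> 'b::euclidean_space) \<Rightarrow> bool" where
  "locally_integrable f \<longleftrightarrow>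
     f \<in> borel_measurable lebesgue \<and> (\<forall>K. compact K \<longrightarrow> set_integrable lebesgue K f)"

definition partial_deriv :: "'n \<Rightarrow> (real^'n::finite \<Rightarrow> complex) \<Rightarrow> real^'n \<Rightarrow> complex" where
  "partial_deriv j f x = frechet_derivative f (at x) (axis j 1)"

primrec Ck :: "nat \<Rightarrow> (real^'n::finite \<Rightarrow> complex) \<Rightarrow> bool" where
  "Ck 0 f \<longleftrightarrow> continuous_on UNIV f"
| "Ck (Suc k) f \<longleftrightarrow> f differentiable_on UNIV \<and> (\<forall>j. Ck k (partial_deriv j f))"

definition test_function :: "(real^'n::finite \<Rightarrow> complex) \<Rightarrow> bool" where
  "test_function \<phi> \<longleftrightarrow> (\<forall>k. Ck k \<phi>) \<and> compact (closure {x. \<phi> x \<noteq> 0})"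

definition distr_of :: "(real^'n::finite \<Rightarrow> complex^'N::finite) \<Rightarrow> (real^'n \<Rightarrow> complex) \<Rightarrow> complex^'N" where
  "distr_of f \<phi> = (LINT x|lebesgue. \<phi> x *s f x)"

definition weak_partial ::
    "'n \<Rightarrow> (real^'n::finite \<Rightarrow> complex^'N::finite) \<Rightarrow> (real^'n \<Rightarrow> complex^'N) \<Rightarrow> bool" where
  "weak_partial j f g \<longleftrightarrow> locally_integrable f \<and> locally_integrable g \<and>
     (\<forall>\<phi>. test_function \<phi> \<longrightarrow> distr_of g \<phi> = - distr_of f (partial_deriv j \<phi>))"

definition gradient_L2 :: "(real^'n::finite \<Rightarrow> complex^'N::finite) \<Rightarrow> bool" where
  "gradient_L2 f \<longleftrightarrow> (\<forall>j. \<exists>g\<in>Lp 2. weak_partial j f g)"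

definition W12 :: "(real^'n::finite \<Rightarrow> complex^'N::finite) set" where
  "W12 = {f. f \<in> Lp 2 \<and> gradient_L2 f}"


section \<open>The massless Dirac operator\<close>

text \<open>\<open>H_distr \<alpha> V \<Psi>\<close> is the distribution \<open>(\<Sum>j. \<alpha> j (-\<i> \<partial>\<^sub>j \<Psi>)) + V \<Psi>\<close>, where
  \<open>(\<partial>\<^sub>j \<Psi>)(\<phi>) = - \<Psi>(\<partial>\<^sub>j \<phi>)\<close>.\<close>

definition H_distr ::
    "('n::finite \<Rightarrow> complex^'N^'N) \<Rightarrow> (real^'n \<Rightarrow> complex^'N^'N) \<Rightarrow> (real^'n \<Rightarrow> complex^'N::finite)
      \<Rightarrow> (real^'n \<Rightarrow> complex) \<Rightarrow> complex^'N" where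
  "H_distr \<alpha> V \<Psi> \<phi> =
     (\<Sum>j\<in>UNIV. \<alpha> j *v ((- \<i>) *s (- distr_of \<Psi> (partial_deriv j \<phi>))))
     + distr_of (\<lambda>x. V x *v \<Psi> x) \<phi>"

definition distributional_solution ::
    "('n::finite \<Rightarrow> complex^'N^'N) \<Rightarrow> (real^'n \<Rightarrow> complex^'N^'N) \<Rightarrow> (real^'n \<Rightarrow> complex^'N::finite)
      \<Rightarrow> bool" where
  "distributional_solution \<alpha> V \<Psi> \<longleftrightarrow>
     locally_integrable \<Psi> \<and> locally_integrable (\<lambda>x. V x *v \<Psi> x) \<and>
     (\<forall>\<phi>. test_function \<phi> \<longrightarrow> H_distr \<alpha> V \<Psi> \<phi> = 0)"

definition V1 :: "(real^'n \<Rightarrow> complex^'N^'N) \<Rightarrow> real^'n \<Rightarrow> complex^'N^'N" where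
  "V1 V x = matrix_sqrt (matrix_abs (V x))"

definition V2 :: "(real^'n \<Rightarrow> complex^'N^'N) \<Rightarrow> real^'n \<Rightarrow> complex^'N^'N" where
  "V2 V x = polar_isometry (V x) ** matrix_sqrt (matrix_abs (V x))"

text \<open>The kernel \<open>G\<^sub>0(0 + \<i>0; x, y)\<close>; \<open>mat c ** A\<close> is the scalar multiple \<open>c A\<close>.\<close>

definition G0 :: "('n::finite \<Rightarrow> complex^'N^'N) \<Rightarrow> real^'n \<Rightarrow> real^'n \<Rightarrow> complex^'N^'N" where
  "G0 \<alpha> x y =
     mat (\<i> * complex_of_real (2 powr (-1) * pi powr (- (real CARD('n) / 2)) * Gamma (real CARD('n) / 2)))
     ** ((1 / norm (x - y) ^ CARD('n)) *\<^sub>R alpha_dot \<alpha> (x - y))"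

text \<open>The integral operator \<open>(H\<^sub>0 - (0 + \<i>0))\<inverse>\<close>.\<close>

definition R0 ::
    "('n::finite \<Rightarrow> complex^'N^'N) \<Rightarrow> (real^'n \<Rightarrow> complex^'N::finite) \<Rightarrow> real^'n \<Rightarrow> complex^'N" where
  "R0 \<alpha> f x = (LINT y|lebesgue. G0 \<alpha> x y *v f y)"

text \<open>The closure of \<open>V\<^sub>2 (H\<^sub>0 - (0 + \<i>0))\<inverse> V\<^sub>1\<^sup>*\<close>, given by its integral kernel.
  For \<open>|V(x)| \<le> C \<langle>x\<rangle>\<^sup>-\<^sup>2\<close> and \<open>\<Phi>\<close> in \<open>L\<^sup>2\<close> the integral converges absolutely
  for a.e. \<open>x\<close> (the kernel is bounded in norm by a multiple of
  \<open>\<langle>x\<rangle>\<^sup>-\<^sup>1 |x - y|\<^sup>1\<^sup>-\<^sup>n \<langle>y\<rangle>\<^sup>-\<^sup>1\<close>).\<close>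

definition BS ::
    "('n::finite \<Rightarrow> complex^'N^'N) \<Rightarrow> (real^'n \<Rightarrow> complex^'N^'N) \<Rightarrow> (real^'n \<Rightarrow> complex^'N::finite)
      \<Rightarrow> real^'n \<Rightarrow> complex^'N" where
  "BS \<alpha> V \<Phi> x = (LINT y|lebesgue. (V2 V x ** G0 \<alpha> x y ** cadjoint (V1 V y)) *v \<Phi> y)"

definition BS_ker ::
    "('n::finite \<Rightarrow> complex^'N^'N) \<Rightarrow> (real^'n \<Rightarrow> complex^'N^'N) \<Rightarrow> (real^'n \<Rightarrow> complex^'N::finite) set" where
  "BS_ker \<alpha> V = {\<Phi>. \<Phi> \<in> Lp 2 \<and> (AE x in lebesgue. \<Phi> x + BS \<alpha> V \<Phi> x = 0)}"

definition trivial_BS_ker ::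
    "('n::finite \<Rightarrow> complex^'N^'N) \<Rightarrow> (real^'n \<Rightarrow> complex^'N::finite^'N) \<Rightarrow> bool" where
  "trivial_BS_ker \<alpha> V \<longleftrightarrow> (\<forall>\<Phi>\<in>BS_ker \<alpha> V. AE x in lebesgue. \<Phi> x = 0)"


section \<open>Zero-energy eigenvalues and resonances\<close>

definition zero_eigenfunction ::
    "('n::finite \<Rightarrow> complex^'N^'N) \<Rightarrow> (real^'n \<Rightarrow> complex^'N^'N) \<Rightarrow> (real^'n \<Rightarrow> complex^'N::finite)
      \<Rightarrow> bool" where
  "zero_eigenfunction \<alpha> V \<Psi> \<longleftrightarrow>
     \<Psi> \<in> W12 \<and> \<not> (AE x in lebesgue. \<Psi> x = 0) \<and> distributional_solution \<alpha> V \<Psi>"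

definition zero_eigenvalue ::
    "('n::finite \<Rightarrow> complex^'N^'N) \<Rightarrow> (real^'n \<Rightarrow> complex^'N::finite^'N) \<Rightarrow> bool" where
  "zero_eigenvalue \<alpha> V \<longleftrightarrow> (\<exists>\<Psi>. zero_eigenfunction \<alpha> V \<Psi>)"

definition resonance_function ::
    "('n::finite \<Rightarrow> complex^'N^'N) \<Rightarrow> (real^'n \<Rightarrow> complex^'N^'N) \<Rightarrow> (real^'n \<Rightarrow> complex^'N::finite)
      \<Rightarrow> bool" where
  "resonance_function \<alpha> V \<Psi> \<longleftrightarrow>
     (\<exists>\<Phi>\<in>BS_ker \<alpha> V. \<not> (AE x in lebesgue. \<Phi> x = 0) \<and>
        (AE x in lebesgue. \<Psi> x = - R0 \<alpha> (\<lambda>y. cadjoint (V1 V y) *v \<Phi> y) x)) \<and>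
     distributional_solution \<alpha> V \<Psi> \<and> \<Psi> \<notin> Lp 2"

definition zero_resonance ::
    "('n::finite \<Rightarrow> complex^'N^'N) \<Rightarrow> (real^'n \<Rightarrow> complex^'N::finite^'N) \<Rightarrow> bool" where
  "zero_resonance \<alpha> V \<longleftrightarrow> \<not> trivial_BS_ker \<alpha> V \<and> (\<exists>\<Psi>. resonance_function \<alpha> V \<Psi>)"

definition zero_regular ::
    "('n::finite \<Rightarrow> complex^'N^'N) \<Rightarrow> (real^'n \<Rightarrow> complex^'N::finite^'N) \<Rightarrow> bool" where
  "zero_regular \<alpha> V \<longleftrightarrow> \<not> zero_eigenvalue \<alpha> V \<and> \<not> zero_resonance \<alpha> V"

end

theory Submission
  imports Defs
begin

text \<open>The kernel \<open>G\<^sub>0\<close> is \<open>\<i> / \<omega>\<close> times \<open>\<alpha> \<cdot> K\<close>, where \<open>K(z) = z / |z|\<^sup>n\<close> and \<open>\<omega>\<close> is the area of the unit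
  sphere. On test functions, \<open>\<zeta> = K * \<phi>\<close> is curl free with \<open>div \<zeta> = - \<omega> \<phi>\<close>, so by anticommutation \<open>R\<^sub>0\<close>
  inverts \<open>H\<^sub>0\<close> from both sides in the sense of distributions, as long as the functions decay enough for the
  tests \<open>\<chi> \<zeta>\<close> with cutoffs \<open>\<chi>\<close> to converge. Hence eigenfunctions satisfy \<open>\<Psi> = - R\<^sub>0 V \<Psi>\<close>, the kernel of
  \<open>I + V\<^sub>2 R\<^sub>0 V\<^sub>1\<^sup>*\<close> corresponds to the solutions \<open>\<Psi> = - R\<^sub>0 V\<^sub>1\<^sup>* \<Phi>\<close> through \<open>\<Phi> = V\<^sub>2 \<Psi>\<close>, and in both cases
  \<open>|\<Psi>|\<close> is bounded by the convolution of \<open>|z|\<^sup>1\<^sup>-\<^sup>n\<close> with \<open>|V \<Psi>|\<close>. Young's inequality, applied separately to the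
  kernel near and far from the origin, turns the decay of \<open>V\<close> into integrability of \<open>\<Psi>\<close>: a kernel element first gives
  \<open>\<Psi> \<in> L\<^sup>q\<close> for \<open>q\<close> slightly above \<open>2\<close>, and one more step reaches \<open>L\<^sup>2\<close> exactly when \<open>n \<ge> 3\<close>. That \<open>\<nabla> \<Psi>\<close> lies
  in \<open>L\<^sup>2\<close> is the energy identity for \<open>\<zeta>\<close> combined with the Riesz representation theorem.\<close>

section \<open>Functional calculus for Hermitian matrices\<close>

text \<open>The kernel |z|^(1-n) lies in no L^r. Its part in the unit ball does for r < n/(n-1), the
  rest for r > n/(n-1), so the splitting stands in for the Hardy-Littlewood-Sobolev inequality at
  the price of all endpoints. This is affordable: the claimed ranges are open except at 2, where
  eigenfunctions lie by definition, and at infinity, which is treated apart. All exponent conditions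
  are linear in reciprocals. A source bounded by (1+|x|)^(-m) |f| with f in L^q0 has its potential
  in L^q if 1/q0 - 1/n < 1/q and 1/q is below both 1 - 1/n and 1/q0 + (m-1)/n. For q0 = 2, m = 2 the
  two upper bounds cross at n = 4, whence the three ranges for eigenfunctions. For q0 = 2, m = 1,
  the case of a kernel element, 1/q = 1/2 is just missed; the second step has m = 2 and needs 1/2 <
  1 - 1/n, which fails only at n = 2. The definitions speak of Lebesgue measurable representatives
  while Fubini on \<open>lborel\<close> wants Borel functions, hence the constant passage between
  \<open>lebesgue\<close> and \<open>lborel\<close>.\<close>

lemma symmetric_exists_eigenvector:
  fixes T :: "'a::euclidean_space \<Rightarrow> 'a"
  assumes lin: "linear T" and sym: "\<And>x y. T x \<bullet> y = x \<bullet> T y"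
    and S: "subspace S" "S \<noteq> {0}" and inv: "\<And>x. x \<in> S \<Longrightarrow> T x \<in> S"
  obtains v l where "v \<in> S" "norm v = 1" "T v = l *\<^sub>R v"
proof -
  let ?K = "S \<inter> sphere 0 1"
  have K: "compact ?K"
    using S(1) closed_Int_compact closed_subspace compact_sphere by blast
  from S obtain x where x: "x \<in> S" "x \<noteq> 0"
    using subspace_0 by blast
  then have "(1 / norm x) *\<^sub>R x \<in> ?K"
    using S(1) subspace_scale by fastforce
  then have ne: "?K \<noteq> {}" by blast
  have "continuous_on ?K (\<lambda>v. v \<bullet> T v)"
    using lin by (intro continuous_intros linear_continuous_on linear_conv_bounded_linear[THEN iffD1])
  \<comment> \<open>Maximiser of the Rayleigh quotient on the compact unit sphere of
    \<open>S\<close>; its maximality will make it an eigenvector.\<close>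
  then obtain v where v: "v \<in> ?K" and vmax: "\<And>x. x \<in> ?K \<Longrightarrow> x \<bullet> T x \<le> v \<bullet> T v"
    using continuous_attains_sup[OF K ne] by blast
  define l where "l = v \<bullet> T v"
  have bound: "x \<bullet> T x \<le> l * (x \<bullet> x)" if "x \<in> S" for x
  proof (cases "x = 0")
    case True
    then show ?thesis by simp
  next
    case False
    then have "(1 / norm x) *\<^sub>R x \<in> ?K"
      using S(1) subspace_scale that by fastforce
    from vmax[OF this] have "(1 / norm x) *\<^sub>R x \<bullet> T ((1 / norm x) *\<^sub>R x) \<le> l"
      by (simp add: l_def)
    then have "(x \<bullet> T x) / (norm x)\<^sup>2 \<le> l"
      using linear_scale[OF lin] by (simp add: power2_eq_square field_simps)
    then show ?thesis
      using False by (simp add: dot_square_norm divide_simps mult.commute)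
  qed
  define w where "w = T v - l *\<^sub>R v"
  have vv: "v \<bullet> v = 1" "v \<in> S"
    using v by (auto simp: dot_square_norm)
  have wS: "w \<in> S"
    unfolding w_def using S(1) vv inv by (intro subspace_diff subspace_scale) auto
  \<comment> \<open>First variation along the residual \<open>w\<close>: inserting
    \<open>v + t *\<^sub>R w\<close> into \<open>bound\<close> cancels everything but
    \<open>2 * t * (w \<bullet> w) \<le> t\<^sup>2 * C\<close>, and a small positive
    \<open>t\<close> then forces \<open>w = 0\<close>.\<close>
  define C where "C = l * (w \<bullet> w) - w \<bullet> T w"
  have q: "2 * t * (w \<bullet> w) \<le> t\<^sup>2 * C" for t
  proof -
    have 1: "v + t *\<^sub>R w \<in> S" using S(1) vv wS by (intro subspace_add subspace_scale) auto
    have 2: "v \<bullet> T w = w \<bullet> T v" using sym by (metis inner_commute)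
    have 3: "w \<bullet> T v = w \<bullet> w + l * (w \<bullet> v)"
      unfolding w_def by (simp add: algebra_simps)
    have 4: "(v + t *\<^sub>R w) \<bullet> T (v + t *\<^sub>R w) = v \<bullet> T v + 2 * t * (w \<bullet> T v) + t\<^sup>2 * (w \<bullet> T w)"
      using 2 by (simp add: linear_add[OF lin] linear_scale[OF lin] inner_add power2_eq_square algebra_simps)
    have 5: "(v + t *\<^sub>R w) \<bullet> (v + t *\<^sub>R w) = 1 + 2 * t * (w \<bullet> v) + t\<^sup>2 * (w \<bullet> w)"
      using vv by (simp add: inner_add power2_eq_square algebra_simps inner_commute)
    from bound[OF 1] show ?thesis
      unfolding 4 5 C_def 3 l_def[symmetric] by (simp add: algebra_simps)
  qed
  have "w \<bullet> w \<le> 0"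
  proof (rule ccontr)
    assume "\<not> ?thesis"
    then have pos: "w \<bullet> w > 0" by linarith
    let ?t = "(w \<bullet> w) / (\<bar>C\<bar> + 1)"
    have t: "?t > 0" using pos by (simp add: divide_pos_pos)
    have "?t * (2 * (w \<bullet> w)) \<le> ?t * (?t * C)"
      using q[of ?t] by (simp only: power2_eq_square mult_ac)
    then have "2 * (w \<bullet> w) \<le> ?t * C"
      using t by (simp only: mult_le_cancel_left_pos)
    also have "\<dots> \<le> ?t * (\<bar>C\<bar> + 1)" using t by (intro mult_left_mono) auto
    also have "\<dots> = w \<bullet> w" by simp
    finally show False using pos by simp
  qed
  then have "w \<bullet> w = 0" using inner_ge_zero[of w] by linarith
  then have "w = 0" by simp
  then show ?thesis using that[of v l] v vv by (auto simp: w_def)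
qed

text \<open>Induction on the dimension: by symmetry the orthogonal complement in \<open>S\<close> of
  an eigenvector is again invariant. Of the spectral theorem the statement keeps that eigenvectors
  span \<open>S\<close>, which is what comparing two linear maps takes.\<close>

lemma symmetric_orthonormal_eigenbasis:
  fixes T :: "'a::euclidean_space \<Rightarrow> 'a"
  assumes lin: "linear T" and sym: "\<And>x y. T x \<bullet> y = x \<bullet> T y"
    and S: "subspace S" and inv: "\<And>x. x \<in> S \<Longrightarrow> T x \<in> S"
  shows "\<exists>B. finite B \<and> (\<forall>b\<in>B. \<exists>l. T b = l *\<^sub>R b) \<and> span B = S"
  using S inv
proof (induction "dim S" arbitrary: S rule: less_induct)
  case less
  show ?case
  proof (cases "S = {0}")
    case True
    then show ?thesis by (intro exI[of _ "{}"]) auto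
  next
    case False
    obtain v l where v: "v \<in> S" "norm v = 1" "T v = l *\<^sub>R v"
      using symmetric_exists_eigenvector[OF lin sym less.prems(1) False less.prems(2)] by blast
    define S' where "S' = S \<inter> {x. v \<bullet> x = 0}"
    have sub: "subspace S'"
      unfolding S'_def using less.prems(1) subspace_hyperplane[of v] by (rule subspace_inter)
    have inv': "T x \<in> S'" if "x \<in> S'" for x
    proof -
      have "v \<bullet> T x = T v \<bullet> x" using sym by metis
      also have "\<dots> = 0" using that v(3) by (simp add: S'_def)
      finally show ?thesis using that less.prems(2) by (simp add: S'_def)
    qed
    have vv: "v \<bullet> v = 1" using v(2) by (simp add: dot_square_norm)
    have "v \<notin> S'" using vv by (simp add: S'_def)
    moreover have "S' \<subseteq> S" by (auto simp: S'_def)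
    ultimately have "S' \<subset> S" using v(1) by blast
    then have "dim S' < dim S"
      using sub less.prems(1) by (intro dim_psubset) (simp add: span_eq_iff[THEN iffD2])
    from less.hyps[OF this sub inv'] obtain B where
      B: "finite B" "\<forall>b\<in>B. \<exists>l. T b = l *\<^sub>R b" "span B = S'" by blast
    have "span (insert v B) = S"
    proof
      show "span (insert v B) \<subseteq> S"
        using v(1) B(3) less.prems(1) span_superset[of B] by (intro span_minimal) (auto simp: S'_def)
      show "S \<subseteq> span (insert v B)"
      proof
        fix x assume x: "x \<in> S"
        have "x - (v \<bullet> x) *\<^sub>R v \<in> S'"
          unfolding S'_def using x v(1) less.prems(1) vv
          by (auto simp: inner_diff_right intro!: subspace_diff subspace_scale)
        then have "x - (v \<bullet> x) *\<^sub>R v \<in> span B" using B(3) by simp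
        then show "x \<in> span (insert v B)" by (auto simp: span_insert)
      qed
    qed
    then show ?thesis using B v(3) by (intro exI[of _ "insert v B"]) auto
  qed
qed

text \<open>With the real part of the Hermitian product as inner product, a Hermitian matrix is a
  symmetric real-linear map. The real spectral theorem then yields real eigenvalues and eigenvectors
  that span \<open>complex^'N\<close> over the reals.\<close>

lemma cadjoint_inner:
  fixes A :: "complex^'N::finite^'N"
  shows "(A *v v) \<bullet> w = v \<bullet> (cadjoint A *v w)"
proof -
  have "(A *v v) \<bullet> w = (\<Sum>i\<in>UNIV. \<Sum>j\<in>UNIV. Re (A $ i $ j * v $ j * cnj (w $ i)))"
    by (simp add: inner_vec_def matrix_vector_mult_def inner_complex_def sum_distrib_right
        flip: Re_sum) (simp add: sum_distrib_right sum_distrib_left flip: sum.distrib sum_subtractf)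
  also have "\<dots> = (\<Sum>j\<in>UNIV. \<Sum>i\<in>UNIV. Re (A $ i $ j * v $ j * cnj (w $ i)))"
    by (rule sum.swap)
  also have "\<dots> = v \<bullet> (cadjoint A *v w)"
    by (simp add: inner_vec_def matrix_vector_mult_def inner_complex_def cadjoint_def
       sum_distrib_left algebra_simps flip: sum.distrib sum_subtractf)
  finally show ?thesis .
qed

lemma mv_scaleR_right: "(A::complex^'N::finite^'M::finite) *v (c *\<^sub>R v) = c *\<^sub>R (A *v v)"
  by (simp add: matrix_vector_mult_def vec_eq_iff scaleR_sum_right)

lemma linear_mv: "linear ((*v) (A::complex^'N::finite^'N))"
  by (rule linearI) (simp_all add: matrix_vector_right_distrib mv_scaleR_right)

lemma matrix_eq_mv: "(\<And>v. A *v v = B *v v) \<Longrightarrow> A = (B::complex^'N::finite^'N)"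
  by (simp add: matrix_eq)

lemma cadjoint_mult: "cadjoint (A ** B) = cadjoint B ** cadjoint (A::complex^'N::finite^'N)"
  by (simp add: cadjoint_def matrix_matrix_mult_def vec_eq_iff mult.commute)

lemma hermitian_eigenbasis:
  fixes A :: "complex^'N::finite^'N"
  assumes "cadjoint A = A"
  obtains B :: "(complex^'N) set" where "finite B" "\<And>b. b \<in> B \<Longrightarrow> \<exists>l. A *v b = l *\<^sub>R b" "span B = UNIV"
  using symmetric_orthonormal_eigenbasis[OF linear_mv[of A], of UNIV] cadjoint_inner[of A] assms
  by auto

text \<open>Eigenvectors to real eigenvalues span the space over the reals, so agreement on them is
  equality. Most identities of the functional calculus below are reduced in this way to identities
  between real numbers.\<close>

lemma hermitian_eqI:
  fixes A B C :: "complex^'N::finite^'N"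
  assumes A: "cadjoint A = A" and eq: "\<And>v l. A *v v = l *\<^sub>R v \<Longrightarrow> B *v v = C *v v"
  shows "B = C"
proof -
  obtain E where E: "finite E" "\<And>b. b \<in> E \<Longrightarrow> \<exists>l. A *v b = l *\<^sub>R b" "span E = UNIV"
    using hermitian_eigenbasis[OF A] by blast
  have "B *v v = C *v v" for v
    using linear_eq_on[OF linear_mv linear_mv, of v E B C] E eq by auto
  then show ?thesis by (rule matrix_eq_mv)
qed

section \<open>Functional calculus through polynomials\<close>

primrec mpow :: "complex^'N::finite^'N \<Rightarrow> nat \<Rightarrow> complex^'N^'N" where
  "mpow A 0 = mat 1"
| "mpow A (Suc k) = A ** mpow A k"

definition mpoly :: "(nat \<Rightarrow> real) \<Rightarrow> nat \<Rightarrow> complex^'N::finite^'N \<Rightarrow> complex^'N^'N" where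
  "mpoly a n A = (\<Sum>i\<le>n. a i *\<^sub>R mpow A i)"

lemma mv_scaleR_left: "(c *\<^sub>R A) *v v = c *\<^sub>R ((A::complex^'N::finite^'N) *v v)"
  by (simp add: matrix_vector_mult_def vec_eq_iff scaleR_sum_right)

lemma mv_sum_left: "(\<Sum>i\<in>I. f i) *v v = (\<Sum>i\<in>I. (f i :: complex^'N::finite^'N) *v v)"
  by (induction I rule: infinite_finite_induct) (auto simp: matrix_vector_mult_add_rdistrib)

lemma mpow_eigen:
  assumes "A *v v = l *\<^sub>R v" shows "mpow A k *v v = (l ^ k) *\<^sub>R v"
  by (induction k) (simp_all add: assms mv_scaleR_right mult.commute flip: matrix_vector_mul_assoc)

lemma mpoly_eigen:
  assumes "A *v v = l *\<^sub>R v" shows "mpoly a n A *v v = (\<Sum>i\<le>n. a i * l ^ i) *\<^sub>R v"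
  by (simp add: mpoly_def mv_sum_left mv_scaleR_left mpow_eigen[OF assms] scaleR_sum_left)

lemma poly_interpolation:
  fixes f :: "real \<Rightarrow> real"
  assumes "finite S" shows "\<exists>p. \<forall>x\<in>S. poly p x = f x"
  using assms
proof (induction S)
  case (insert s S)
  then obtain p where p: "\<forall>x\<in>S. poly p x = f x" by blast
  define q where "q = (\<Prod>t\<in>S. [:- t, 1:])"
  have q: "poly q s \<noteq> 0" "\<And>x. x \<in> S \<Longrightarrow> poly q x = 0"
    using insert(1,2) by (auto simp: q_def poly_prod prod_zero_iff)
  show ?case
    using p q by (intro exI[of _ "p + smult ((f s - poly p s) / poly q s) q"]) auto
qed auto

text \<open>The matrix f(A), described by its action on all eigenvectors at once instead of through
  a chosen eigenbasis, so that nothing depends on choices. For Hermitian \<open>A\<close> the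
  description has exactly one solution.\<close>

definition fcal :: "(real \<Rightarrow> real) \<Rightarrow> complex^'N::finite^'N \<Rightarrow> complex^'N^'N" where
  "fcal f A = (THE B. \<forall>v l. A *v v = l *\<^sub>R v \<longrightarrow> B *v v = f l *\<^sub>R v)"

text \<open>The witness is a polynomial in \<open>A\<close> that interpolates \<open>f\<close> at
  the finitely many eigenvalues of a spanning family.\<close>

lemma fcal_ex:
  fixes A :: "complex^'N::finite^'N"
  assumes A: "cadjoint A = A"
  shows "\<exists>B. \<forall>v l. A *v v = l *\<^sub>R v \<longrightarrow> B *v v = f l *\<^sub>R v"
proof -
  obtain E where E: "finite E" "\<And>b. b \<in> E \<Longrightarrow> \<exists>l. A *v b = l *\<^sub>R b" "span E = UNIV"
    using hermitian_eigenbasis[OF A] by blast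
  then obtain lam where lam: "\<And>b. b \<in> E \<Longrightarrow> A *v b = lam b *\<^sub>R b" by metis
  obtain p where p: "\<And>x. x \<in> lam ` E \<Longrightarrow> poly p x = f x"
    using poly_interpolation[of "lam ` E" f] E(1) by blast
  have "mpoly (coeff p) (degree p) A *v v = f l *\<^sub>R v" if v: "A *v v = l *\<^sub>R v" for v l
  proof (cases "l \<in> lam ` E")
    case True
    then show ?thesis using mpoly_eigen[OF v] p by (simp add: poly_altdef)
  next
    case False
    \<comment> \<open>An eigenvalue missed by the family belongs to no nonzero vector: eigenvectors
      to different eigenvalues are orthogonal, so \<open>v\<close> is orthogonal to a spanning
      set.\<close>
    have "v \<bullet> b = 0" if b: "b \<in> E" for b
    proof -
      have "l * (v \<bullet> b) = (A *v v) \<bullet> b" by (simp add: v)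
      also have "\<dots> = lam b * (v \<bullet> b)" using cadjoint_inner[of A v b] A lam[OF b] by simp
      finally show ?thesis using False b by auto
    qed
    then have "v \<bullet> v = 0"
      using linear_eq_on[of "\<lambda>x. v \<bullet> x" "\<lambda>x. 0" v E] E(3)
      by (auto intro: bounded_linear.linear bounded_linear_inner_right linear_zero)
    then show ?thesis by simp
  qed
  then show ?thesis by blast
qed

lemma fcal_eigen:
  fixes A :: "complex^'N::finite^'N"
  assumes A: "cadjoint A = A" and v: "A *v v = l *\<^sub>R v"
  shows "fcal f A *v v = f l *\<^sub>R v"
proof -
  obtain B where B: "\<forall>v l. A *v v = l *\<^sub>R v \<longrightarrow> B *v v = f l *\<^sub>R v"
    using fcal_ex[OF A, of f] by blast
  have "fcal f A = B"
    unfolding fcal_def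
  proof (rule the_equality, rule B)
    fix C assume C: "\<forall>v l. A *v v = l *\<^sub>R v \<longrightarrow> C *v v = f l *\<^sub>R v"
    have "C *v v = B *v v" if "A *v v = l *\<^sub>R v" for v l using B C that by metis
    then show "C = B" by (rule hermitian_eqI[OF A])
  qed
  with B v show ?thesis by simp
qed

lemma fcal_mult:
  assumes A: "cadjoint A = A"
  shows "fcal f A ** fcal g A = fcal (\<lambda>x. f x * g x) A"
proof (rule hermitian_eqI[OF A])
  fix v l assume v: "A *v v = l *\<^sub>R v"
  show "(fcal f A ** fcal g A) *v v = fcal (\<lambda>x. f x * g x) A *v v"
    by (simp add: fcal_eigen[OF A v] mv_scaleR_right mult.commute flip: matrix_vector_mul_assoc)
qed

lemma fcal_id:
  assumes A: "cadjoint A = A" shows "fcal (\<lambda>x. x) A = A"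
  by (rule hermitian_eqI[OF A]) (metis fcal_eigen[OF A])

lemma fcal_hermitian:
  fixes A :: "complex^'N::finite^'N"
  assumes A: "cadjoint A = A" shows "cadjoint (fcal f A) = fcal f A"
proof -
  have 1: "(fcal f A *v v) \<bullet> w = v \<bullet> (fcal f A *v w)"
    if v: "A *v v = l *\<^sub>R v" and w: "A *v w = m *\<^sub>R w" for v w l m
  proof -
    have "l * (v \<bullet> w) = m * (v \<bullet> w)"
      using cadjoint_inner[of A v w] A by (simp add: v w)
    then show ?thesis by (auto simp: fcal_eigen[OF A v] fcal_eigen[OF A w])
  qed
  have 2: "cadjoint (fcal f A) *v w = fcal f A *v w" if w: "A *v w = m *\<^sub>R w" for w m
  proof -
    obtain E where E: "finite E" "\<And>b. b \<in> E \<Longrightarrow> \<exists>l. A *v b = l *\<^sub>R b" "span E = UNIV"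
      using hermitian_eigenbasis[OF A] by blast
    have "v \<bullet> (cadjoint (fcal f A) *v w) = v \<bullet> (fcal f A *v w)" for v
    proof (rule linear_eq_on[of "\<lambda>v. v \<bullet> (cadjoint (fcal f A) *v w)" "\<lambda>v. v \<bullet> (fcal f A *v w)" v E])
      show "linear (\<lambda>v. v \<bullet> (cadjoint (fcal f A) *v w))" "linear (\<lambda>v. v \<bullet> (fcal f A *v w))"
        by (auto intro!: bounded_linear.linear bounded_linear_inner_left)
      show "v \<in> span E" using E(3) by simp
      show "b \<bullet> (cadjoint (fcal f A) *v w) = b \<bullet> (fcal f A *v w)" if "b \<in> E" for b
        using E(2)[OF that] 1[OF _ w, of b] cadjoint_inner by metis
    qed
    then show ?thesis by (metis vector_eq_ldot)
  qed
  show ?thesis by (rule hermitian_eqI[OF A]) (use 2 in blast)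
qed

section \<open>Square root, modulus and polar decomposition of a Hermitian matrix\<close>

lemma psd_eigen_nonneg: "psd A \<Longrightarrow> A *v v = l *\<^sub>R v \<Longrightarrow> v \<noteq> 0 \<Longrightarrow> l \<ge> 0"
  unfolding psd_def
  by (metis inner_scaleR_right inner_gt_zero_iff linorder_not_less mult_neg_pos)

text \<open>On the spectrum \<open>f\<close> is the square of \<open>sqrt \<bar>f x\<bar>\<close>,
  so the quadratic form of f(A) is a squared norm. The absolute value covers arguments off the
  spectrum, where \<open>f\<close> may be negative.\<close>

lemma psd_fcal:
  fixes A :: "complex^'N::finite^'N"
  assumes A: "cadjoint A = A" and nn: "\<And>v l. A *v v = l *\<^sub>R v \<Longrightarrow> v \<noteq> 0 \<Longrightarrow> f l \<ge> 0"
  shows "psd (fcal f A)"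
proof -
  have "fcal (\<lambda>x. sqrt \<bar>f x\<bar> * sqrt \<bar>f x\<bar>) A = fcal f A"
  proof (rule hermitian_eqI[OF A])
    fix v l assume "A *v v = l *\<^sub>R v"
    then show "fcal (\<lambda>x. sqrt \<bar>f x\<bar> * sqrt \<bar>f x\<bar>) A *v v = fcal f A *v v"
      using nn[of v l] by (cases "v = 0") (simp_all add: fcal_eigen[OF A])
  qed
  then have "fcal f A = fcal (\<lambda>x. sqrt \<bar>f x\<bar>) A ** fcal (\<lambda>x. sqrt \<bar>f x\<bar>) A"
    by (simp add: fcal_mult[OF A])
  then have "v \<bullet> (fcal f A *v v) = (fcal (\<lambda>x. sqrt \<bar>f x\<bar>) A *v v) \<bullet> (fcal (\<lambda>x. sqrt \<bar>f x\<bar>) A *v v)" for v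
    using fcal_hermitian[OF A, of "\<lambda>x. sqrt \<bar>f x\<bar>"] cadjoint_inner[of "fcal (\<lambda>x. sqrt \<bar>f x\<bar>) A" v]
    by (simp flip: matrix_vector_mul_assoc)
  then show ?thesis unfolding psd_def using fcal_hermitian[OF A] by simp
qed

text \<open>Uniqueness compares any positive root \<open>D\<close> with \<open>fcal sqrt A\<close>
  on the eigenvectors of \<open>D\<close>, not of \<open>A\<close>: they are eigenvectors of
  \<open>A\<close> with the squared eigenvalue, and \<open>l \<ge> 0\<close> recovers
  \<open>l\<close> from \<open>l * l\<close>.\<close>

lemma matrix_sqrt_eq:
  fixes A B :: "complex^'N::finite^'N"
  assumes B: "psd B" "B ** B = A" shows "matrix_sqrt A = B"
  unfolding matrix_sqrt_def
proof (rule the_equality)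
  show "psd B \<and> B ** B = A" using B by simp
next
  fix C :: "complex^'N^'N" assume C: "psd C \<and> C ** C = A"
  have A: "cadjoint A = A" using B by (auto simp: psd_def cadjoint_mult)
  have *: "D = fcal sqrt A" if D: "psd D" "D ** D = A" for D
  proof (rule hermitian_eqI[of D])
    show "cadjoint D = D" using D(1) by (simp add: psd_def)
    fix v l assume v: "D *v v = l *\<^sub>R v"
    have "A *v v = (l * l) *\<^sub>R v"
      using v by (simp add: mv_scaleR_right flip: D(2) matrix_vector_mul_assoc)
    from fcal_eigen[OF A this, of sqrt] psd_eigen_nonneg[OF D(1) v]
    show "D *v v = fcal sqrt A *v v" by (cases "v = 0") (auto simp: v)
  qed
  show "C = B" using *[of C] *[of B] B C by simp
qed

lemma matrix_abs_hermitian: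
  fixes A :: "complex^'N::finite^'N"
  assumes A: "cadjoint A = A" shows "matrix_abs A = fcal abs A"
  unfolding matrix_abs_def
proof (rule matrix_sqrt_eq)
  show "psd (fcal abs A)" by (rule psd_fcal[OF A]) simp
  have "fcal abs A ** fcal abs A = fcal (\<lambda>x. x) A ** fcal (\<lambda>x. x) A"
    by (simp add: fcal_mult[OF A])
  then show "fcal abs A ** fcal abs A = cadjoint A ** A" by (simp add: fcal_id[OF A] A)
qed

lemma sqrt_matrix_abs_hermitian:
  fixes A :: "complex^'N::finite^'N"
  assumes A: "cadjoint A = A" shows "matrix_sqrt (matrix_abs A) = fcal (\<lambda>x. sqrt \<bar>x\<bar>) A"
  by (rule matrix_sqrt_eq) (simp_all add: psd_fcal[OF A] fcal_mult[OF A] matrix_abs_hermitian[OF A])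

text \<open>The convention \<open>sgn 0 = 0\<close> matches the requirement that \<open>U\<close>
  and \<open>A\<close> have the same kernel; on eigenvectors with \<open>l \<noteq> 0\<close> the
  factorisation already fixes \<open>U\<close>.\<close>

lemma polar_isometry_hermitian:
  fixes A :: "complex^'N::finite^'N"
  assumes A: "cadjoint A = A" shows "polar_isometry A = fcal sgn A"
  unfolding polar_isometry_def matrix_abs_hermitian[OF A]
proof (rule the_equality)
  have 1: "A = fcal sgn A ** fcal abs A" "A = fcal abs A ** fcal sgn A"
    by (simp_all add: fcal_mult[OF A] sgn_mult_abs abs_mult_sgn fcal_id[OF A])
  have 2: "fcal sgn A ** cadjoint (fcal sgn A) ** fcal sgn A = fcal sgn A"
  proof -
    have *: "(\<lambda>x. sgn x * sgn x * sgn x) = (sgn :: real \<Rightarrow> real)" by (simp add: sgn_real_def fun_eq_iff)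
    show ?thesis by (simp only: fcal_hermitian[OF A] fcal_mult[OF A] *)
  qed
  have "fcal sgn A *v v = 0 \<longleftrightarrow> A *v v = 0" for v
  proof
    assume "fcal sgn A *v v = 0"
    then show "A *v v = 0" by (subst 1(2)) (simp flip: matrix_vector_mul_assoc)
  next
    assume "A *v v = 0"
    then show "fcal sgn A *v v = 0" using fcal_eigen[OF A, of v 0 sgn] by simp
  qed
  with 1 2 show "A = fcal sgn A ** fcal abs A \<and> fcal sgn A ** cadjoint (fcal sgn A) ** fcal sgn A = fcal sgn A
     \<and> (\<forall>v. (fcal sgn A *v v = 0) = (A *v v = 0))" by blast
next
  fix U assume U: "A = U ** fcal abs A \<and> U ** cadjoint U ** U = U \<and> (\<forall>v. (U *v v = 0) = (A *v v = 0))"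
  show "U = fcal sgn A"
  proof (rule hermitian_eqI[OF A])
    fix v l assume v: "A *v v = l *\<^sub>R v"
    have "l *\<^sub>R v = \<bar>l\<bar> *\<^sub>R (U *v v)"
    proof -
      have "A *v v = U *v (fcal abs A *v v)"
        using U by (metis matrix_vector_mul_assoc)
      then show ?thesis by (simp add: v fcal_eigen[OF A v] mv_scaleR_right)
    qed
    moreover have "U *v v = 0" if "l = 0" using U v that by auto
    ultimately show "U *v v = fcal sgn A *v v"
    proof (cases "l < 0")
      case True
      moreover have "l *\<^sub>R v = l *\<^sub>R (- (U *v v))"
        using True \<open>l *\<^sub>R v = \<bar>l\<bar> *\<^sub>R (U *v v)\<close> by simp
      then have "v = - (U *v v)" using True by (metis less_irrefl scaleR_left_imp_eq)
      ultimately show ?thesis by (metis fcal_eigen[OF A v] sgn_neg scaleR_minus1_left minus_equation_iff)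
    qed (cases "l = 0"; auto simp: fcal_eigen[OF A v])
  qed
qed

lemma V1_fcal: "cadjoint (V x) = V x \<Longrightarrow> V1 V x = fcal (\<lambda>t. sqrt \<bar>t\<bar>) (V x)"
  by (simp add: V1_def sqrt_matrix_abs_hermitian)

lemma V2_fcal: "cadjoint (V x) = V x \<Longrightarrow> V2 V x = fcal (\<lambda>t. sgn t * sqrt \<bar>t\<bar>) (V x)"
  by (simp add: V2_def sqrt_matrix_abs_hermitian polar_isometry_hermitian fcal_mult)

lemma V1_hermitian: "cadjoint (V x) = V x \<Longrightarrow> cadjoint (V1 V x) = V1 V x"
  by (simp add: V1_fcal fcal_hermitian)

text \<open>The link between the two pictures: if \<Phi> = V2 \<Psi> then V1 \<Phi> = V \<Psi>, so
  the source of the potential can be read off from either function.\<close>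

lemma V1_V2: assumes V: "cadjoint (V x) = V x" shows "V1 V x ** V2 V x = V x"
proof -
  have "sqrt \<bar>t\<bar> * (sgn t * sqrt \<bar>t\<bar>) = t" for t by (simp add: sgn_real_def)
  then show ?thesis by (simp add: V1_fcal[of V x, OF V] V2_fcal[of V x, OF V] fcal_mult[OF V] fcal_id[OF V])
qed

text \<open>Rests on |f(A) v|^2 = v . |A| v together with the equality of the norms of |A| v and A
  v. The hypothesis on \<open>f\<close> covers both sqrt |t| and sgn t sqrt |t|, so each of the two
  factors of V inherits half of its decay.\<close>

lemma fcal_sqrt_bound:
  fixes A :: "complex^'N::finite^'N"
  assumes A: "cadjoint A = A" and f: "\<And>t. f t * f t = \<bar>t\<bar>"
    and L: "\<And>v. norm (A *v v) \<le> L * norm v"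
  shows "norm (fcal f A *v v) \<le> sqrt L * norm v"
proof -
  have abs: "norm (fcal abs A *v v) = norm (A *v v)"
  proof -
    have "(fcal abs A *v v) \<bullet> (fcal abs A *v v) = v \<bullet> ((fcal abs A ** fcal abs A) *v v)"
      using cadjoint_inner[of "fcal abs A" v] fcal_hermitian[OF A] by (simp flip: matrix_vector_mul_assoc)
    also have "fcal abs A ** fcal abs A = fcal (\<lambda>x. x) A ** fcal (\<lambda>x. x) A"
      by (simp add: fcal_mult[OF A])
    also have "v \<bullet> (\<dots> *v v) = (A *v v) \<bullet> (A *v v)"
      using cadjoint_inner[of A v] A by (simp add: fcal_id[OF A] flip: matrix_vector_mul_assoc)
    finally show ?thesis by (simp add: norm_eq_sqrt_inner)
  qed
  have "(norm (fcal f A *v v))\<^sup>2 = v \<bullet> ((fcal f A ** fcal f A) *v v)"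
    using cadjoint_inner[of "fcal f A" v] fcal_hermitian[OF A]
    by (simp add: power2_norm_eq_inner flip: matrix_vector_mul_assoc)
  also have "\<dots> = v \<bullet> (fcal abs A *v v)" using f by (simp add: fcal_mult[OF A])
  also have "\<dots> \<le> norm v * norm (A *v v)" using norm_cauchy_schwarz[of v] abs by metis
  also have "\<dots> \<le> norm v * (L * norm v)" using L by (intro mult_left_mono) auto
  finally have *: "(norm (fcal f A *v v))\<^sup>2 \<le> L * (norm v)\<^sup>2" by (simp add: power2_eq_square algebra_simps)
  then have "norm (fcal f A *v v) \<le> sqrt (L * (norm v)\<^sup>2)" by (rule real_le_rsqrt)
  then show ?thesis by (simp add: real_sqrt_mult)
qed

text \<open>The eigenvalues lie in [-L, L], where the polynomials converge; on an eigenvector the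
  claim is therefore a scalar limit, and linearity over the finite spanning family does the
  rest.\<close>

lemma fcal_limit:
  fixes A :: "complex^'N::finite^'N"
  assumes A: "cadjoint A = A" and L: "\<And>v. norm (A *v v) \<le> L * norm v"
    and lim: "\<And>t. \<bar>t\<bar> \<le> L \<Longrightarrow> (\<lambda>k. \<Sum>i\<le>d k. a k i * t ^ i) \<longlonglongrightarrow> f t"
  shows "(\<lambda>k. mpoly (a k) (d k) A) \<longlonglongrightarrow> fcal f A"
proof -
  obtain E where E: "finite E" "\<And>b. b \<in> E \<Longrightarrow> \<exists>l. A *v b = l *\<^sub>R b" "span E = UNIV"
    using hermitian_eigenbasis[OF A] by blast
  have "(\<lambda>k. mpoly (a k) (d k) A *v v) \<longlonglongrightarrow> fcal f A *v v" for v
  proof -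
    have "v \<in> span E" using E(3) by simp
    then show ?thesis
    proof (induction rule: span_induct_alt)
      case base
      then show ?case by simp
    next
      case (step c b y)
      from E(2)[OF step(1)] obtain l where l: "A *v b = l *\<^sub>R b" by blast
      have "(\<lambda>k. mpoly (a k) (d k) A *v b) \<longlonglongrightarrow> fcal f A *v b"
      proof (cases "b = 0")
        case False
        have "\<bar>l\<bar> * norm b \<le> L * norm b" using L[of b] by (simp add: l)
        then have "\<bar>l\<bar> \<le> L" using False by simp
        from lim[OF this] show ?thesis
          unfolding mpoly_eigen[OF l] fcal_eigen[OF A l] by (intro tendsto_intros)
      qed simp
      then show ?case
        using step(2) by (auto simp: matrix_vector_right_distrib mv_scaleR_right intro!: tendsto_intros)
    qed
  qed
  then have "(\<lambda>k. (mpoly (a k) (d k) A *v axis j 1) $ i) \<longlonglongrightarrow> (fcal f A *v axis j 1) $ i" for i j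
    by (intro tendsto_vec_nth)
  then show ?thesis
    by (intro vec_tendstoI) (simp add: matrix_vector_mul_component matrix_vector_mult_def axis_def if_distrib cong: if_cong)
qed

lemma continuous_real_limit_of_polys:
  fixes f :: "real \<Rightarrow> real"
  assumes "continuous_on UNIV f"
  obtains a d where "\<And>t. \<bar>t\<bar> \<le> L \<Longrightarrow> (\<lambda>k. \<Sum>i\<le>d k. a k i * t ^ i) \<longlonglongrightarrow> f t"
proof -
  have "\<exists>a n. \<forall>t\<in>{-L..L}. \<bar>f t - (\<Sum>i\<le>n. a i * t ^ i)\<bar> < 1 / Suc k" for k :: nat
  proof -
    obtain g where g: "real_polynomial_function g" "\<And>x. x \<in> {-L..L} \<Longrightarrow> \<bar>f x - g x\<bar> < 1 / Suc k"
      using Stone_Weierstrass_real_polynomial_function[of "{-L..L}" f "1 / Suc k"] assms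
      by (metis compact_Icc continuous_on_subset subset_UNIV zero_less_divide_1_iff of_nat_0_less_iff zero_less_Suc)
    then show ?thesis unfolding real_polynomial_function_iff_sum by blast
  qed
  then obtain a d where ad: "\<And>k t. t \<in> {-L..L} \<Longrightarrow> \<bar>f t - (\<Sum>i\<le>d k. a k i * t ^ i)\<bar> < 1 / Suc k"
    by metis
  have "(\<lambda>k. \<Sum>i\<le>d k. a k i * t ^ i) \<longlonglongrightarrow> f t" if "\<bar>t\<bar> \<le> L" for t
  proof (rule LIM_zero_cancel, rule Lim_null_comparison)
    have "norm ((\<Sum>i\<le>d k. a k i * t ^ i) - f t) \<le> 1 / Suc k" for k
    proof -
      have "\<bar>f t - (\<Sum>i\<le>d k. a k i * t ^ i)\<bar> < 1 / Suc k" using that by (intro ad) (auto simp: abs_le_iff)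
      then show ?thesis by (simp only: real_norm_def abs_minus_commute less_imp_le)
    qed
    then show "\<forall>\<^sub>F k in sequentially. norm ((\<Sum>i\<le>d k. a k i * t ^ i) - f t) \<le> 1 / Suc k" by simp
    show "(\<lambda>k. 1 / real (Suc k)) \<longlonglongrightarrow> 0" by (rule LIMSEQ_Suc[OF lim_1_over_n])
  qed
  then show ?thesis using that by blast
qed

lemma continuous_mpoly: "continuous_on UNIV (mpoly a n :: complex^'N::finite^'N \<Rightarrow> _)"
proof -
  have "continuous_on UNIV (\<lambda>A :: complex^'N::finite^'N. mpow A k)" for k
    by (induction k) (auto simp: matrix_matrix_mult_def intro!: continuous_intros)
  then show ?thesis unfolding mpoly_def by (intro continuous_intros)
qed

lemma borel_measurable_matrixI:
  fixes F :: "'a \<Rightarrow> complex^'N::finite^'M::finite"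
  assumes "\<And>l m. (\<lambda>x. F x $ l $ m) \<in> borel_measurable M"
  shows "F \<in> borel_measurable M"
proof -
  have ax: "axis l (axis m z) $ i $ j = (if l = i then if m = j then z else 0 else 0)"
    for l i :: 'M and m j :: 'N and z :: complex by (simp add: axis_def)
  have F: "F = (\<lambda>x. \<Sum>l\<in>UNIV. \<Sum>m\<in>UNIV. axis l (axis m (F x $ l $ m)))"
  proof (intro ext, simp only: vec_eq_iff, intro allI)
    fix x i j
    have "(\<Sum>l\<in>UNIV. \<Sum>m\<in>UNIV. axis l (axis m (F x $ l $ m))) $ i $ j
        = (\<Sum>l\<in>UNIV. if l = i then \<Sum>m\<in>UNIV. if m = j then F x $ l $ m else 0 else 0)"
      unfolding sum_component ax by (rule sum.cong[OF refl]) simp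
    also have "\<dots> = (\<Sum>m\<in>UNIV. if m = j then F x $ i $ m else 0)"
      by (subst sum.delta) simp_all
    also have "\<dots> = F x $ i $ j" by simp
    finally show "F x $ i $ j = (\<Sum>l\<in>UNIV. \<Sum>m\<in>UNIV. axis l (axis m (F x $ l $ m))) $ i $ j"
      by (rule sym)
  qed
  have cax: "continuous_on UNIV (\<lambda>z::complex. axis l (axis m z) :: complex^'N^'M)" for l m
  proof -
    have eq: "(\<lambda>z::complex. axis l (axis m z) :: complex^'N^'M) = (\<lambda>z. \<chi> i j. if l = i \<and> m = j then z else 0)"
      by (simp add: fun_eq_iff vec_eq_iff ax)
    have c: "continuous_on UNIV (\<lambda>z::complex. if l = i \<and> m = j then z else 0)" for i j
    proof (cases "l = i \<and> m = j")
      case True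
      show ?thesis unfolding if_P[OF True] by (rule continuous_on_id)
    next
      case False
      show ?thesis unfolding if_not_P[OF False] by (rule continuous_on_const)
    qed
    have "continuous_on UNIV (\<lambda>z::complex. (\<chi> i j. if l = i \<and> m = j then z else 0) :: complex^'N^'M)"
      by (intro continuous_on_vec_lambda c)
    then show ?thesis unfolding eq .
  qed
  have "(\<lambda>x. axis l (axis m (F x $ l $ m)) :: complex^'N^'M) \<in> borel_measurable M" for l m
    by (rule borel_measurable_continuous_on[OF cax assms])
  then have "(\<lambda>x. \<Sum>l\<in>UNIV. \<Sum>m\<in>UNIV. axis l (axis m (F x $ l $ m)) :: complex^'N^'M) \<in> borel_measurable M"
    by (intro borel_measurable_sum)
  then show ?thesis by (simp only: F[symmetric])
qed

text \<open>\<open>fcal\<close> is given by a definite description, which says nothing about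
  measurability in \<open>x\<close>. Polynomials in \<open>V x\<close> are measurable, and by
  Weierstrass on [-L, L] they converge to f(V x) wherever \<open>V x\<close> is Hermitian with norm
  at most \<open>L\<close>.\<close>

lemma measurable_fcal:
  fixes V :: "real^'n::finite \<Rightarrow> complex^'N::finite^'N"
  assumes V: "V \<in> borel_measurable lebesgue" and sa: "AE x in lebesgue. cadjoint (V x) = V x"
    and L: "AE x in lebesgue. \<forall>v. norm (V x *v v) \<le> L * norm v"
    and f: "continuous_on UNIV f" and W: "\<And>x. cadjoint (V x) = V x \<Longrightarrow> W x = fcal f (V x)"
  shows "W \<in> borel_measurable lebesgue"
proof -
  obtain a d where ad: "\<And>t. \<bar>t\<bar> \<le> L \<Longrightarrow> (\<lambda>k. \<Sum>i\<le>d k. a k i * t ^ i) \<longlonglongrightarrow> f t"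
    using continuous_real_limit_of_polys[OF f] by blast
  define P where "P x \<longleftrightarrow> cadjoint (V x) = V x \<and> (\<forall>v. norm (V x *v v) \<le> L * norm v)" for x
  have "AE x in lebesgue. P x" using sa L by eventually_elim (auto simp: P_def)
  then obtain N where N: "N \<in> null_sets lebesgue" "{x. \<not> P x} \<subseteq> N"
    by (rule AE_E3) auto
  \<comment> \<open>\<open>N\<close> is a measurable null set containing all bad points. Once the
    functions are set to 0 there, convergence holds everywhere, and completeness of
    \<open>lebesgue\<close> carries measurability over to \<open>W\<close>.\<close>
  have "(\<lambda>x. if x \<in> N then 0 else W x) \<in> borel_measurable lebesgue"
  proof (rule borel_measurable_LIMSEQ_metric)
    have Ns: "N \<in> sets lebesgue" using N(1) by auto
    have "{x \<in> space lebesgue. x \<in> N} \<in> sets lebesgue" using Ns by simp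
    then show "(\<lambda>x. if x \<in> N then 0 else mpoly (a k) (d k) (V x)) \<in> borel_measurable lebesgue" for k
      by (intro measurable_If borel_measurable_continuous_on[OF continuous_mpoly] V) auto
    show "(\<lambda>k. if x \<in> N then 0 else mpoly (a k) (d k) (V x)) \<longlonglongrightarrow> (if x \<in> N then 0 else W x)" for x
    proof (cases "x \<in> N")
      case False
      then have "P x" using N(2) by blast
      then show ?thesis using fcal_limit[of "V x" L a d f] ad W[of x] False by (auto simp: P_def)
    qed simp
  qed
  moreover have "AE x in lebesgue. (if x \<in> N then 0 else W x) = W x"
    using AE_not_in[OF N(1)] by eventually_elim simp
  ultimately show ?thesis
    by (rule borel_measurable_AE)
qed


section \<open>Test functions\<close>

definition smooth :: "(real^'n::finite \<Rightarrow> complex) \<Rightarrow> bool" where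
  "smooth f \<longleftrightarrow> (\<forall>k. Ck k f)"

text \<open>Coinduction: a class of differentiable functions that contains its own partial
  derivatives consists of smooth functions. It avoids inductions over the order in which the
  derivatives of a product or a potential change shape at each stage.\<close>

lemma smooth_coinduct:
  assumes "f \<in> S" and diff: "\<And>f. f \<in> S \<Longrightarrow> f differentiable_on UNIV"
    and part: "\<And>f j. f \<in> S \<Longrightarrow> partial_deriv j f \<in> S"
  shows "smooth f"
proof -
  have "f \<in> S \<Longrightarrow> Ck k f" for k f
    by (induction k arbitrary: f) (auto simp: diff part differentiable_imp_continuous_on)
  then show ?thesis using assms(1) by (simp add: smooth_def)
qed

lemma smooth_differentiable: "smooth f \<Longrightarrow> f differentiable at x"
  unfolding smooth_def by (metis Ck.simps(2) UNIV_I differentiable_on_def)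

lemma smooth_partial: "smooth f \<Longrightarrow> smooth (partial_deriv j f)"
  unfolding smooth_def by (metis Ck.simps(2))

lemma smooth_continuous: "smooth f \<Longrightarrow> continuous_on UNIV f"
  unfolding smooth_def by (metis Ck.simps(1))

lemma smooth_has_derivative: "smooth f \<Longrightarrow> (f has_derivative frechet_derivative f (at x)) (at x)"
  using smooth_differentiable frechet_derivative_works by blast

lemma partial_deriv_eqI: "(f has_derivative D) (at x) \<Longrightarrow> partial_deriv j f x = D (axis j 1)"
  unfolding partial_deriv_def by (metis frechet_derivative_at)

lemma partial_deriv_add:
  assumes "f differentiable at x" "g differentiable at x"
  shows "partial_deriv j (\<lambda>x. f x + g x) x = partial_deriv j f x + partial_deriv j g x"
proof -
  have "((\<lambda>x. f x + g x) has_derivative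
      (\<lambda>h. frechet_derivative f (at x) h + frechet_derivative g (at x) h)) (at x)"
    using assms by (intro derivative_intros) (auto simp: frechet_derivative_works)
  from partial_deriv_eqI[OF this] show ?thesis by (simp add: partial_deriv_def)
qed

lemma partial_deriv_mult:
  assumes "f differentiable at x" "g differentiable at x"
  shows "partial_deriv j (\<lambda>x. f x * g x) x = partial_deriv j f x * g x + f x * partial_deriv j g x"
proof -
  have "((\<lambda>x. f x * g x) has_derivative
      (\<lambda>h. f x * frechet_derivative g (at x) h + frechet_derivative f (at x) h * g x)) (at x)"
    using assms by (intro derivative_intros) (auto simp: frechet_derivative_works)
  from partial_deriv_eqI[OF this] show ?thesis by (simp add: partial_deriv_def)
qed

lemma partial_deriv_cnj:
  assumes "f differentiable at x"
  shows "partial_deriv j (\<lambda>x. cnj (f x)) x = cnj (partial_deriv j f x)"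
proof -
  have "((\<lambda>x. cnj (f x)) has_derivative (\<lambda>h. cnj (frechet_derivative f (at x) h))) (at x)"
    using assms by (intro bounded_linear.has_derivative[OF bounded_linear_cnj]) (auto simp: frechet_derivative_works)
  from partial_deriv_eqI[OF this] show ?thesis by (simp add: partial_deriv_def)
qed

lemma smooth_cnj: assumes "smooth f" shows "smooth (\<lambda>x. cnj (f x))"
proof (rule smooth_coinduct[of _ "{(\<lambda>x. cnj (f x)) |f. smooth f}"])
  show "(\<lambda>x. cnj (f x)) \<in> {\<lambda>x. cnj (f x) |f. smooth f}" using assms by blast
next
  fix g :: "real^'a \<Rightarrow> complex" and j
  assume "g \<in> {\<lambda>x. cnj (f x) |f. smooth f}"
  then obtain f where f: "g = (\<lambda>x. cnj (f x))" "smooth f" by blast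
  show "g differentiable_on UNIV"
    unfolding f differentiable_on_def differentiable_def
    using bounded_linear.has_derivative[OF bounded_linear_cnj smooth_has_derivative[OF f(2)]] by blast
  have "partial_deriv j g = (\<lambda>x. cnj (partial_deriv j f x))"
    unfolding f using partial_deriv_cnj smooth_differentiable[OF f(2)] by (auto simp: fun_eq_iff)
  then show "partial_deriv j g \<in> {\<lambda>x. cnj (f x) |f. smooth f}"
    using smooth_partial[OF f(2)] by blast
qed

text \<open>The flat function exp (- 1 / t), divided by powers of t. The powers make the family
  closed, up to linear combinations, under differentiation.\<close>

definition flat :: "nat \<Rightarrow> real \<Rightarrow> real" where
  "flat m t = (if t > 0 then exp (- 1 / t) / t ^ m else 0)"

text \<open>The inequality 1 + u <= exp u at u = 1 / (k t), raised to the k-th power.\<close>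

lemma exp_neg_inverse_le: "t > 0 \<Longrightarrow> k > 0 \<Longrightarrow> exp (- 1 / t) \<le> (real k * t) ^ k"
proof -
  assume t: "t > 0" and k: "k > 0"
  have "1 / (real k * t) \<le> exp (1 / (real k * t))"
    using exp_ge_add_one_self[of "1 / (real k * t)"] by linarith
  then have "(1 / (real k * t)) ^ k \<le> exp (1 / (real k * t)) ^ k"
    using t k by (intro power_mono) auto
  also have "\<dots> = exp (1 / t)" using k by (simp flip: exp_of_nat_mult)
  finally have "1 / exp (1 / t) \<le> 1 / (1 / (real k * t)) ^ k"
    using t k by (intro divide_left_mono mult_pos_pos) auto
  then show ?thesis using t k by (simp add: power_divide exp_minus inverse_eq_divide)
qed

lemma flat_nonneg: "0 \<le> flat m t" by (simp add: flat_def)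

text \<open>The exponent \<open>m + 2\<close> leaves a factor t^2 after division by t^m; one of its
  two powers survives in the difference quotient at 0 and makes it vanish.\<close>

lemma flat_le: "t > 0 \<Longrightarrow> flat m t \<le> real (m + 2) ^ (m + 2) * t\<^sup>2"
  using exp_neg_inverse_le[of t "m + 2"] by (simp add: flat_def power_mult_distrib divide_simps power_add power2_eq_square mult_ac)

lemma flat_has_derivative:
  "(flat m has_real_derivative (flat (m + 2) t - m * flat (m + 1) t)) (at t)"
proof (rule linorder_cases[of t 0])
  assume t: "t > 0"
  have "((\<lambda>t. exp (- 1 / t) / t ^ m) has_real_derivative (flat (m + 2) t - m * flat (m + 1) t)) (at t)"
  proof -
    have e: "((\<lambda>t. exp (- 1 / t)) has_real_derivative exp (- 1 / t) * (1 / t\<^sup>2)) (at t)"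
      using t by (auto intro!: derivative_eq_intros simp: power2_eq_square)
    have "(exp (- 1 / t) * (1 / t\<^sup>2) * t ^ m - exp (- 1 / t) * (real m * t ^ (m - Suc 0))) / (t ^ m * t ^ m)
        = flat (m + 2) t - m * flat (m + 1) t"
      using t by (cases m) (simp_all add: flat_def field_simps power2_eq_square)
    then show ?thesis using DERIV_divide[OF e DERIV_pow[of m t]] t by simp
  qed
  then show ?thesis
    by (rule has_field_derivative_transform_within_open[of _ _ _ "{0<..}"]) (use t in \<open>auto simp: flat_def\<close>)
next
  assume t: "t < 0"
  have "((\<lambda>t. 0) has_real_derivative (flat (m + 2) t - m * flat (m + 1) t)) (at t)"
    using t by (auto simp: flat_def)
  then show ?thesis
    by (rule has_field_derivative_transform_within_open[of _ _ _ "{..<0}"]) (use t in \<open>auto simp: flat_def\<close>)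
next
  assume t: "t = 0"
  have "((\<lambda>h. flat m h / h) \<longlongrightarrow> 0) (at 0)"
  proof (rule Lim_null_comparison)
    have "norm (flat m h / h) \<le> real (m + 2) ^ (m + 2) * \<bar>h\<bar>" for h
    proof (cases "h > 0")
      case True
      then show ?thesis using flat_le[of h m] flat_nonneg[of m h]
        by (simp add: abs_mult divide_simps power2_eq_square mult_ac)
    next
      case False
      then have "flat m h = 0" by (simp add: flat_def)
      then show ?thesis by (simp only: norm_zero div_0 zero_le_mult_iff abs_ge_zero zero_le_power of_nat_0_le_iff simp_thms)
    qed
    then show "\<forall>\<^sub>F h in at 0. norm (flat m h / h) \<le> real (m + 2) ^ (m + 2) * \<bar>h\<bar>" by simp
    show "((\<lambda>h. real (m + 2) ^ (m + 2) * \<bar>h\<bar>) \<longlongrightarrow> 0) (at 0)" by (auto intro!: tendsto_eq_intros)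
  qed
  then show ?thesis by (simp add: t has_field_derivative_iff flat_def)
qed

lemma flat_0_le_1: "flat 0 t \<le> 1" by (simp add: flat_def)

lemma flat_2_le: "flat 2 t \<le> 4"
  using exp_neg_inverse_le[of t 2] by (auto simp: flat_def divide_simps power_mult_distrib)

lemma continuous_flat [continuous_intros]: "continuous_on S f \<Longrightarrow> continuous_on S (\<lambda>x. flat m (f x))"
proof -
  have "continuous_on UNIV (flat m)"
    using flat_has_derivative by (meson DERIV_isCont continuous_at_imp_continuous_on)
  then show "continuous_on S f \<Longrightarrow> continuous_on S (\<lambda>x. flat m (f x))"
    by (metis continuous_on_compose2 subset_UNIV)
qed

lemma flat_quadratic_has_derivative:
  fixes a :: "real^'n::finite"
  shows "((\<lambda>x. complex_of_real (flat m (c + a \<bullet> x + b * (x \<bullet> x)))) has_derivative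
    (\<lambda>h. complex_of_real ((flat (m + 2) (c + a \<bullet> x + b * (x \<bullet> x)) - m * flat (m + 1) (c + a \<bullet> x + b * (x \<bullet> x)))
        * (a \<bullet> h + 2 * b * (x \<bullet> h))))) (at x)"
proof -
  have "((\<lambda>x. c + a \<bullet> x + b * (x \<bullet> x)) has_derivative (\<lambda>h. a \<bullet> h + 2 * b * (x \<bullet> h))) (at x)"
    by (auto intro!: derivative_eq_intros simp: fun_eq_iff inner_commute algebra_simps)
  from has_derivative_compose[OF this flat_has_derivative[of m, THEN has_field_derivative_imp_has_derivative]]
  have "((\<lambda>x. flat m (c + a \<bullet> x + b * (x \<bullet> x))) has_derivative
    (\<lambda>h. (flat (m + 2) (c + a \<bullet> x + b * (x \<bullet> x)) - m * flat (m + 1) (c + a \<bullet> x + b * (x \<bullet> x)))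
        * (a \<bullet> h + 2 * b * (x \<bullet> h)))) (at x)" .
  then show ?thesis by (rule bounded_linear.has_derivative[OF bounded_linear_of_real])
qed

text \<open>Made for \<open>smooth_coinduct\<close>: it contains the smooth functions and is closed
  under sums, products and partial derivatives. The argument of \<open>flat\<close> is a quadratic
  polynomial, whose derivatives are affine; this covers radial cutoffs as well as products of
  one-dimensional bumps.\<close>

inductive_set smooth_algebra :: "(real^'n::finite \<Rightarrow> complex) set" where
  smooth: "smooth f \<Longrightarrow> f \<in> smooth_algebra"
| const: "(\<lambda>x. c) \<in> smooth_algebra"
| linear: "(\<lambda>x. complex_of_real (a \<bullet> x)) \<in> smooth_algebra"
| flat: "(\<lambda>x. complex_of_real (flat m (c + a \<bullet> x + b * (x \<bullet> x)))) \<in> smooth_algebra"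
| add: "f \<in> smooth_algebra \<Longrightarrow> g \<in> smooth_algebra \<Longrightarrow> (\<lambda>x. f x + g x) \<in> smooth_algebra"
| mult: "f \<in> smooth_algebra \<Longrightarrow> g \<in> smooth_algebra \<Longrightarrow> (\<lambda>x. f x * g x) \<in> smooth_algebra"

lemma has_derivative_of_real_inner:
  "((\<lambda>x. complex_of_real (a \<bullet> x)) has_derivative (\<lambda>h. complex_of_real (a \<bullet> h))) (at x)"
  by (intro bounded_linear.has_derivative[OF bounded_linear_of_real] derivative_intros)

lemma smooth_algebra_partial:
  fixes f :: "real^'n::finite \<Rightarrow> complex"
  assumes "f \<in> smooth_algebra"
  shows "(\<forall>x. f differentiable at x) \<and> (\<forall>j. partial_deriv j f \<in> smooth_algebra)"
  using assms
proof induction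
  case (smooth f)
  then show ?case using smooth_differentiable smooth_partial smooth_algebra.smooth by blast
next
  case (const c)
  have "partial_deriv j (\<lambda>x::real^'n. c) = (\<lambda>x. 0)" for j
    using partial_deriv_eqI[OF has_derivative_const] by (auto simp: fun_eq_iff)
  then show ?case using smooth_algebra.const[of 0] by simp
next
  case (linear a)
  have "partial_deriv j (\<lambda>x. complex_of_real (a \<bullet> x)) = (\<lambda>x. complex_of_real (a \<bullet> axis j 1))" for j
    using partial_deriv_eqI[OF has_derivative_of_real_inner[of a]] by (auto simp: fun_eq_iff)
  then show ?case
    using smooth_algebra.const has_derivative_of_real_inner[of a] unfolding differentiable_def by metis
next
  case (flat m c a b)
  let ?P = "\<lambda>x. c + a \<bullet> x + b * (x \<bullet> x)"
  have "partial_deriv j (\<lambda>x. complex_of_real (flat m (?P x))) =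
     (\<lambda>x. (complex_of_real (flat (m + 2) (?P x)) + of_real (- m) * complex_of_real (flat (m + 1) (?P x)))
        * (complex_of_real (a \<bullet> axis j 1) + complex_of_real (2 * b) * complex_of_real (axis j 1 \<bullet> x)))" for j
    using partial_deriv_eqI[OF flat_quadratic_has_derivative[of m c a b]]
    by (auto simp: fun_eq_iff inner_commute[of "axis j 1"])
  then have "partial_deriv j (\<lambda>x. complex_of_real (flat m (?P x))) \<in> smooth_algebra" for j
    by (simp only:) (intro smooth_algebra.mult smooth_algebra.add smooth_algebra.flat
        smooth_algebra.const smooth_algebra.linear)
  then show ?case using flat_quadratic_has_derivative[of m c a b] unfolding differentiable_def by blast
next
  case (add f g)
  have "partial_deriv j (\<lambda>x. f x + g x) = (\<lambda>x. partial_deriv j f x + partial_deriv j g x)" for j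
    using add by (auto simp: fun_eq_iff intro!: partial_deriv_add)
  then show ?case using add by (auto intro!: smooth_algebra.add)
next
  case (mult f g)
  have "partial_deriv j (\<lambda>x. f x * g x) = (\<lambda>x. partial_deriv j f x * g x + f x * partial_deriv j g x)" for j
    using mult by (auto simp: fun_eq_iff intro!: partial_deriv_mult)
  then show ?case using mult by (auto intro!: smooth_algebra.add smooth_algebra.mult)
qed

lemma smooth_algebra_smooth: "f \<in> smooth_algebra \<Longrightarrow> smooth f"
  by (rule smooth_coinduct[of f smooth_algebra])
    (use smooth_algebra_partial in \<open>auto simp: differentiable_on_def\<close>)

lemma smooth_const: "smooth (\<lambda>x. c)"
  and smooth_flat: "smooth (\<lambda>x. complex_of_real (flat m (c' + a \<bullet> x + b * (x \<bullet> x))))"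
  and smooth_add: "smooth f \<Longrightarrow> smooth g \<Longrightarrow> smooth (\<lambda>x. f x + g x)"
  and smooth_mult: "smooth f \<Longrightarrow> smooth g \<Longrightarrow> smooth (\<lambda>x. f x * g x)"
  by (auto intro!: smooth_algebra_smooth intro: smooth_algebra.intros)

lemma smooth_prod: "(\<And>i. i \<in> I \<Longrightarrow> smooth (f i)) \<Longrightarrow> smooth (\<lambda>x. \<Prod>i\<in>I. f i x)"
  by (induction I rule: infinite_finite_induct) (auto intro!: smooth_const smooth_mult)

section \<open>Test functions, cutoffs and the fundamental lemma of the calculus of
  variations\<close>

lemma test_function_iff: "test_function \<phi> \<longleftrightarrow> smooth \<phi> \<and> bounded {x. \<phi> x \<noteq> 0}"
  unfolding test_function_def smooth_def compact_eq_bounded_closed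
  by (metis bounded_closure bounded_subset closed_closure closure_subset)

lemma test_function_smooth: "test_function \<phi> \<Longrightarrow> smooth \<phi>"
  by (simp add: test_function_iff)

lemma test_function_bounds:
  assumes "test_function \<phi>"
  obtains M R where "M > 0" "R > 0" "\<And>x. norm (\<phi> x) \<le> M" "\<And>x. norm x \<ge> R \<Longrightarrow> \<phi> x = 0"
proof -
  have sm: "smooth \<phi>" and b: "bounded {x. \<phi> x \<noteq> 0}" using assms by (auto simp: test_function_iff)
  from b obtain R where R: "R > 0" "\<And>x. \<phi> x \<noteq> 0 \<Longrightarrow> norm x < R"
    by (auto simp: bounded_pos_less)
  have "compact (\<phi> ` cball 0 R)"
    using smooth_continuous[OF sm] by (intro compact_continuous_image) (auto intro: continuous_on_subset)
  then obtain M where M: "M > 0" "\<And>x. x \<in> cball 0 R \<Longrightarrow> norm (\<phi> x) \<le> M"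
    by (auto dest!: compact_imp_bounded simp: bounded_pos)
  have "norm (\<phi> x) \<le> M" for x
    using M R(2)[of x] by (cases "\<phi> x = 0") (auto intro: less_imp_le)
  moreover have "\<phi> x = 0" if "norm x \<ge> R" for x using R(2)[of x] that by force
  ultimately show ?thesis using that M R by blast
qed

lemma partial_deriv_zero:
  assumes "open U" "x \<in> U" "\<And>y. y \<in> U \<Longrightarrow> f y = 0"
  shows "partial_deriv j f x = 0"
proof -
  have "((\<lambda>y. 0) has_derivative (\<lambda>h. 0)) (at x)" by simp
  then have "(f has_derivative (\<lambda>h. 0)) (at x)"
    by (rule has_derivative_transform_within_open[OF _ assms(1,2)]) (use assms(3) in auto)
  from partial_deriv_eqI[OF this] show ?thesis .
qed

lemma test_function_partial: assumes "test_function \<phi>" shows "test_function (partial_deriv j \<phi>)"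
proof -
  obtain M R where R: "M > 0" "R > 0" "\<And>x. norm (\<phi> x) \<le> M" "\<And>x. norm x \<ge> R \<Longrightarrow> \<phi> x = 0"
    using test_function_bounds[OF assms] by blast
  have "partial_deriv j \<phi> x = 0" if "norm x > R" for x
    using that R by (intro partial_deriv_zero[of "{x. R < norm x}"] open_Collect_less continuous_intros) auto
  then have "{x. partial_deriv j \<phi> x \<noteq> 0} \<subseteq> cball 0 R" by (force simp: not_less)
  then have "bounded {x. partial_deriv j \<phi> x \<noteq> 0}" using bounded_cball bounded_subset by blast
  then show ?thesis using assms smooth_partial by (auto simp: test_function_iff)
qed

lemma test_function_mult:
  assumes "test_function \<phi>" "smooth f"
  shows "test_function (\<lambda>x. \<phi> x * f x)" "test_function (\<lambda>x. f x * \<phi> x)"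
proof -
  have "bounded {x. \<phi> x * f x \<noteq> 0}" "bounded {x. f x * \<phi> x \<noteq> 0}"
    using assms(1) by (auto simp: test_function_iff elim: bounded_subset)
  then show "test_function (\<lambda>x. \<phi> x * f x)" "test_function (\<lambda>x. f x * \<phi> x)"
    using assms by (auto simp: test_function_iff intro!: smooth_mult)
qed

lemma test_function_add:
  assumes "test_function \<phi>" "test_function \<psi>" shows "test_function (\<lambda>x. \<phi> x + \<psi> x)"
proof -
  have "{x. \<phi> x + \<psi> x \<noteq> 0} \<subseteq> {x. \<phi> x \<noteq> 0} \<union> {x. \<psi> x \<noteq> 0}" by auto
  moreover have "bounded ({x. \<phi> x \<noteq> 0} \<union> {x. \<psi> x \<noteq> 0})"
    using assms by (simp add: test_function_iff)
  ultimately have "bounded {x. \<phi> x + \<psi> x \<noteq> 0}"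
    using bounded_subset by blast
  then show ?thesis using assms by (auto simp: test_function_iff intro!: smooth_add)
qed

lemma test_function_measurable: "test_function \<phi> \<Longrightarrow> \<phi> \<in> borel_measurable borel"
  by (intro borel_measurable_continuous_onI smooth_continuous test_function_smooth)

text \<open>\<open>flat 0 1\<close> equals \<open>exp (- 1)\<close>; the factor \<open>exp 1\<close>
  makes the cutoff 1 at the origin and lets it tend to 1 everywhere as \<open>R\<close>
  grows.\<close>

definition cutoff :: "real \<Rightarrow> real^'n::finite \<Rightarrow> complex" where
  "cutoff R x = of_real (exp 1 * flat 0 (1 - (x \<bullet> x) / R\<^sup>2))"

lemma cutoff_test: assumes "R > 0" shows "test_function (cutoff R)"
proof -
  have "smooth (\<lambda>x. of_real (exp 1) * complex_of_real (flat 0 (1 + 0 \<bullet> x + (- 1 / R\<^sup>2) * (x \<bullet> x))))"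
    by (intro smooth_mult smooth_const smooth_flat)
  then have "smooth (cutoff R)" unfolding cutoff_def by (simp add: divide_inverse mult_ac)
  moreover have "cutoff R x = 0" if "x \<notin> cball 0 R" for x :: "real^'n"
  proof -
    have "R\<^sup>2 < (norm x)\<^sup>2" using that assms by (intro power_strict_mono) auto
    then have "1 - (x \<bullet> x) / R\<^sup>2 < 0" using assms by (simp add: dot_square_norm)
    then show ?thesis by (simp add: cutoff_def flat_def)
  qed
  then have "bounded {x. cutoff R x \<noteq> 0}" by (intro bounded_subset[OF bounded_cball[of 0 R]]) blast
  ultimately show ?thesis by (simp add: test_function_iff)
qed

lemma cutoff_norm_le: "norm (cutoff R x) \<le> 1"
proof -
  have "flat 0 (1 - (x \<bullet> x) / R\<^sup>2) \<le> exp (- 1)"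
  proof (cases "1 - (x \<bullet> x) / R\<^sup>2 > 0")
    case True
    have "1 - (x \<bullet> x) / R\<^sup>2 \<le> 1" by simp
    then have "1 / (1 - (x \<bullet> x) / R\<^sup>2) \<ge> 1" using True by simp
    then show ?thesis using True by (simp add: flat_def)
  qed (simp add: flat_def)
  then have "exp 1 * flat 0 (1 - (x \<bullet> x) / R\<^sup>2) \<le> exp 1 * exp (- 1)" by simp
  then show ?thesis unfolding cutoff_def norm_of_real
    using flat_nonneg[of 0 "1 - (x \<bullet> x) / R\<^sup>2"] by (simp flip: exp_add)
qed

lemma cutoff_tendsto: "(\<lambda>k. cutoff (real (Suc k)) x) \<longlonglongrightarrow> 1"
proof -
  have "(\<lambda>k. (x \<bullet> x) * (1 / real (Suc k))\<^sup>2) \<longlonglongrightarrow> (x \<bullet> x) * 0\<^sup>2"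
    by (intro tendsto_intros LIMSEQ_Suc[OF lim_1_over_n])
  then have "(\<lambda>k. 1 - (x \<bullet> x) / (real (Suc k))\<^sup>2) \<longlonglongrightarrow> 1 - 0"
    by (intro tendsto_intros) (simp add: power_divide)
  moreover have "isCont (flat 0) 1" using flat_has_derivative DERIV_isCont by blast
  ultimately have "(\<lambda>k. flat 0 (1 - (x \<bullet> x) / (real (Suc k))\<^sup>2)) \<longlonglongrightarrow> flat 0 1"
    by (intro isCont_tendsto_compose[of 1 "flat 0"]) auto
  then have "(\<lambda>k. complex_of_real (exp 1 * flat 0 (1 - (x \<bullet> x) / (real (Suc k))\<^sup>2))) \<longlonglongrightarrow> of_real (exp 1 * flat 0 1)"
    by (intro tendsto_intros)
  then show ?thesis by (simp add: cutoff_def flat_def flip: exp_add)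
qed

text \<open>24 = 3 * 4 * 2 comes from e <= 3, \<open>flat 2\<close> <= 4 and 2 |x_j| / R^2 <= 2 / R.
  The second bound uses 1 + |x| <= 2 R on the support and is free of \<open>R\<close>: it serves as
  majorant when the cutoff is removed.\<close>

lemma cutoff_partial_bound:
  assumes "R \<ge> 1"
  shows "norm (partial_deriv j (cutoff R) x) \<le> 24 / R" "norm (partial_deriv j (cutoff R) x) \<le> 48 / (1 + norm x)"
proof -
  have *: "norm (partial_deriv j (cutoff R) x) \<le> 24 / R \<and> (norm x \<ge> R \<longrightarrow> partial_deriv j (cutoff R) x = 0)"
  proof -
    let ?t = "1 - (x \<bullet> x) / R\<^sup>2"
    have "((\<lambda>x. of_real (exp 1) * complex_of_real (flat 0 (1 + 0 \<bullet> x + (- 1 / R\<^sup>2) * (x \<bullet> x)))) has_derivative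
       (\<lambda>h. of_real (exp 1) * complex_of_real ((flat (0 + 2) (1 + 0 \<bullet> x + (- 1 / R\<^sup>2) * (x \<bullet> x)) - real 0 * flat (0 + 1) (1 + 0 \<bullet> x + (- 1 / R\<^sup>2) * (x \<bullet> x)))
        * (0 \<bullet> h + 2 * (- 1 / R\<^sup>2) * (x \<bullet> h))))) (at x)"
      by (rule bounded_linear.has_derivative[OF bounded_linear_mult_right flat_quadratic_has_derivative])
    also have "(\<lambda>x. of_real (exp 1) * complex_of_real (flat 0 (1 + 0 \<bullet> x + (- 1 / R\<^sup>2) * (x \<bullet> x)))) = cutoff R"
      by (simp add: cutoff_def fun_eq_iff divide_inverse mult_ac)
    finally have eq: "partial_deriv j (cutoff R) x = of_real (exp 1 * flat 2 ?t * (- 2 / R\<^sup>2 * x $ j))"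
      by (simp add: partial_deriv_eqI inner_axis divide_inverse mult_ac numeral_2_eq_2)
    show ?thesis
    proof (cases "norm x \<ge> R")
      case True
      then have "R\<^sup>2 \<le> (norm x)\<^sup>2" using assms by (intro power_mono) auto
      then have "?t \<le> 0" using assms by (simp add: dot_square_norm)
      then have "flat 2 ?t = 0" by (simp add: flat_def)
      then show ?thesis using assms by (simp only: eq) simp
    next
      case False
      have xj: "\<bar>x $ j\<bar> \<le> R" using component_le_norm_cart[of x j] False by linarith
      have "norm (partial_deriv j (cutoff R) x) = exp 1 * flat 2 ?t * (2 / R\<^sup>2 * \<bar>x $ j\<bar>)"
        unfolding eq norm_of_real using flat_nonneg[of 2 ?t] by (simp add: abs_mult)
      also have "\<dots> \<le> 3 * 4 * (2 / R\<^sup>2 * R)"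
        using flat_nonneg[of 2 ?t] flat_2_le[of ?t] exp_le xj assms by (intro mult_mono) auto
      also have "\<dots> = 24 / R" using assms by (simp add: power2_eq_square)
      finally show ?thesis using False by simp
    qed
  qed
  then show "norm (partial_deriv j (cutoff R) x) \<le> 24 / R" by blast
  show "norm (partial_deriv j (cutoff R) x) \<le> 48 / (1 + norm x)"
  proof (cases "norm x \<ge> R")
    case True
    then show ?thesis using * by simp
  next
    case False
    have pos: "1 + norm x > 0" using norm_ge_zero[of x] by linarith
    have "24 / R \<le> 48 / (1 + norm x)" using assms False pos by (simp add: field_simps)
    then show ?thesis using * by linarith
  qed
qed

lemma cutoff_partial_tendsto: "(\<lambda>k. partial_deriv j (cutoff (real (Suc k))) x) \<longlonglongrightarrow> 0"
proof (rule Lim_null_comparison)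
  show "\<forall>\<^sub>F k in sequentially. norm (partial_deriv j (cutoff (real (Suc k))) x) \<le> 24 * (1 / real (Suc k))"
    using cutoff_partial_bound(1)[of "real (Suc _)" j x] by (intro always_eventually) auto
  have "(\<lambda>k. 24 * (1 / real (Suc k))) \<longlonglongrightarrow> 24 * 0" by (intro tendsto_intros LIMSEQ_Suc[OF lim_1_over_n])
  then show "(\<lambda>k. 24 * (1 / real (Suc k))) \<longlonglongrightarrow> 0" by simp
qed

text \<open>As \<open>s\<close> grows this tends to the indicator of the open box, boundedly and
  with support in the closed box, so test functions detect integrals over boxes.\<close>

definition box_bump :: "real^'n::finite \<Rightarrow> real^'n \<Rightarrow> real \<Rightarrow> real^'n \<Rightarrow> complex" where
  "box_bump a b s x = (\<Prod>i\<in>UNIV. of_real (flat 0 (s * (x $ i - a $ i))) * of_real (flat 0 (s * (b $ i - x $ i))))"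

lemma box_bump_test: assumes "s > 0" shows "test_function (box_bump a b s)"
proof -
  have "smooth (\<lambda>x. complex_of_real (flat 0 (- s * a $ i + (s *\<^sub>R axis i 1) \<bullet> x + 0 * (x \<bullet> x)))
        * complex_of_real (flat 0 (s * b $ i + (- s *\<^sub>R axis i 1) \<bullet> x + 0 * (x \<bullet> x))))" for i
    by (intro smooth_mult smooth_flat)
  then have "smooth (\<lambda>x. of_real (flat 0 (s * (x $ i - a $ i))) * complex_of_real (flat 0 (s * (b $ i - x $ i))))" for i
    by (simp add: inner_axis' algebra_simps)
  then have "smooth (box_bump a b s)" unfolding box_bump_def by (intro smooth_prod)
  moreover have "box_bump a b s x = 0" if x: "x \<notin> cbox a b" for x
  proof -
    obtain i where "x $ i < a $ i \<or> b $ i < x $ i" using x by (auto simp: mem_box_cart not_le)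
    then have "s * (x $ i - a $ i) \<le> 0 \<or> s * (b $ i - x $ i) \<le> 0"
      using assms by (auto simp: mult_le_0_iff)
    then have "of_real (flat 0 (s * (x $ i - a $ i))) * complex_of_real (flat 0 (s * (b $ i - x $ i))) = 0"
      by (auto simp: flat_def)
    then show ?thesis unfolding box_bump_def by (intro prod_zero) auto
  qed
  then have "bounded {x. box_bump a b s x \<noteq> 0}" by (intro bounded_subset[OF bounded_cbox[of a b]]) blast
  ultimately show ?thesis by (simp add: test_function_iff)
qed

lemma flat_0_tendsto: "(\<lambda>k. flat 0 (real (Suc k) * t)) \<longlonglongrightarrow> (if t > 0 then 1 else 0)"
proof (cases "t > 0")
  case True
  have "(\<lambda>k. exp (- (1 / t) * (1 / real (Suc k)))) \<longlonglongrightarrow> exp (- (1 / t) * 0)"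
    by (intro tendsto_intros LIMSEQ_Suc[OF lim_1_over_n])
  then show ?thesis using True by (simp add: flat_def mult.commute)
next
  case False
  then have "flat 0 (real (Suc k) * t) = 0" for k by (auto simp: flat_def zero_less_mult_iff)
  then show ?thesis using False by simp
qed

lemma box_bump_tendsto: "(\<lambda>k. box_bump a b (real (Suc k)) x) \<longlonglongrightarrow> indicator (box a b) x"
proof -
  have "(\<lambda>k. box_bump a b (real (Suc k)) x) \<longlonglongrightarrow>
     (\<Prod>i\<in>UNIV. of_real (if x $ i - a $ i > 0 then 1 else 0) * of_real (if b $ i - x $ i > 0 then 1 else 0))"
    unfolding box_bump_def by (intro tendsto_intros flat_0_tendsto)
  also have "(\<Prod>i\<in>UNIV. of_real (if x $ i - a $ i > 0 then 1 else 0) * of_real (if b $ i - x $ i > 0 then 1 else 0))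
     = (indicator (box a b) x :: complex)"
  proof (cases "x \<in> box a b")
    case True
    then show ?thesis by (auto simp: mem_box_cart intro!: prod.neutral)
  next
    case False
    then obtain i where "\<not> (x $ i - a $ i > 0 \<and> b $ i - x $ i > 0)" by (auto simp: mem_box_cart)
    then show ?thesis using False by (auto intro!: prod_zero bexI[of _ i])
  qed
  finally show ?thesis .
qed

lemma box_bump_norm_le: assumes "s > 0" shows "norm (box_bump a b s x) \<le> indicator (cbox a b) x"
proof (cases "x \<in> cbox a b")
  case True
  have "norm (box_bump a b s x) \<le> (\<Prod>i\<in>(UNIV :: 'a set). 1)"
    unfolding box_bump_def prod_norm[symmetric]
    by (intro prod_mono) (auto simp: norm_mult flat_nonneg flat_0_le_1 intro!: mult_le_one)
  then show ?thesis using True by simp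
next
  case False
  then obtain i where "x $ i < a $ i \<or> b $ i < x $ i" by (auto simp: mem_box_cart not_le)
  then have "s * (x $ i - a $ i) \<le> 0 \<or> s * (b $ i - x $ i) \<le> 0"
    using assms by (auto simp: mult_le_0_iff)
  then have "of_real (flat 0 (s * (x $ i - a $ i))) * complex_of_real (flat 0 (s * (b $ i - x $ i))) = 0"
    by (auto simp: flat_def)
  then have "box_bump a b s x = 0" unfolding box_bump_def by (intro prod_zero) auto
  then show ?thesis by simp
qed

text \<open>The measures whose densities are the positive and the negative part of \<open>f\<close>
  agree on boxes, an intersection stable generator of the Borel sets that exhausts the space; hence
  the measures agree, and then their densities.\<close>

lemma AE_zero_if_box_integrals_zero:
  fixes f :: "'a::euclidean_space \<Rightarrow> real"
  assumes [measurable]: "f \<in> borel_measurable borel"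
    and int: "\<And>a b. set_integrable lborel (box a b) f"
    and zero: "\<And>a b. (LINT x:box a b|lborel. f x) = 0"
  shows "AE x in lborel. f x = 0"
proof -
  let ?p = "\<lambda>x. ennreal (f x)" and ?n = "\<lambda>x. ennreal (- f x)"
  let ?B = "range (\<lambda>(a::'a, b). box a b)"
  have eqb: "emeasure (density lborel ?p) (box a b) = emeasure (density lborel ?n) (box a b)
      \<and> emeasure (density lborel ?p) (box a b) \<noteq> \<infinity>" for a b
  proof -
    let ?g = "\<lambda>x. indicator (box a b) x * f x"
    have g: "integrable lborel ?g" using int[of a b] by (simp add: set_integrable_def)
    have 0: "integral\<^sup>L lborel ?g = 0" using zero[of a b] by (simp add: set_lebesgue_integral_def)
    have 1: "emeasure (density lborel ?p) (box a b) = (\<integral>\<^sup>+x. ennreal (?g x) \<partial>lborel)"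
            "emeasure (density lborel ?n) (box a b) = (\<integral>\<^sup>+x. ennreal (- ?g x) \<partial>lborel)"
      by (auto simp: emeasure_density intro!: nn_integral_cong split: split_indicator)
    have 2: "(\<integral>\<^sup>+x. ennreal (?g x) \<partial>lborel) \<noteq> \<infinity>" "(\<integral>\<^sup>+x. ennreal (- ?g x) \<partial>lborel) \<noteq> \<infinity>"
      using g by (auto simp: real_integrable_def)
    have "enn2real (\<integral>\<^sup>+x. ennreal (?g x) \<partial>lborel) = enn2real (\<integral>\<^sup>+x. ennreal (- ?g x) \<partial>lborel)"
      using 0 real_lebesgue_integral_def[OF g] by simp
    then show ?thesis using 1 2 by (metis ennreal_enn2real top.not_eq_extremum infinity_ennreal_def)
  qed
  have "density lborel ?p = density lborel ?n"
  proof (rule measure_eqI_generator_eq[where A="\<lambda>n::nat. box (- (real n *\<^sub>R One)) (real n *\<^sub>R One)"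
        and E="?B" and \<Omega>="UNIV"])
    show "Int_stable ?B" by (auto simp: Int_stable_def box_Int_box)
    show "sets (density lborel ?p) = sigma_sets UNIV ?B" "sets (density lborel ?n) = sigma_sets UNIV ?B"
      by (simp_all add: borel_eq_box)
    show "(\<Union>i::nat. box (- (real i *\<^sub>R One)) (real i *\<^sub>R One)) = (UNIV :: 'a set)" by (rule UN_box_eq_UNIV)
    show "emeasure (density lborel ?p) (box (- (real i *\<^sub>R One)) (real i *\<^sub>R One)) \<noteq> \<infinity>" for i
      using eqb by blast
  qed (use eqb in auto)
  then have "AE x in lborel. ?p x = ?n x" by (intro sigma_finite_measure.density_unique[OF sigma_finite_lborel]) auto
  then show ?thesis
  proof eventually_elim
    case (elim x)
    then show ?case by (metis ennreal_eq_0_iff neg_le_0_iff_le order_antisym_conv linorder_linear ennreal_neg)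
  qed
qed

text \<open>Dominated convergence along \<open>box_bump\<close> turns vanishing test integrals into
  vanishing box integrals, to which the real criterion applies for the real and the imaginary
  part.\<close>

lemma AE_zero_if_test_integrals_zero:
  fixes f :: "real^'n::finite \<Rightarrow> complex"
  assumes [measurable]: "f \<in> borel_measurable borel"
    and int: "\<And>K. compact K \<Longrightarrow> set_integrable lborel K f"
    and zero: "\<And>\<phi>. test_function \<phi> \<Longrightarrow> (LINT x|lborel. \<phi> x * f x) = 0"
  shows "AE x in lborel. f x = 0"
proof -
  have i: "set_integrable lborel (box a b) f" for a b
    by (rule set_integrable_subset[OF int[OF compact_cbox[of a b]]]) (auto simp: box_subset_cbox)
  have z: "(LINT x:box a b|lborel. f x) = 0" for a b
  proof -
    have "(\<lambda>k. LINT x|lborel. box_bump a b (real (Suc k)) x * f x) \<longlonglongrightarrow> (LINT x|lborel. indicator (box a b) x * f x)"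
    proof (rule integral_dominated_convergence[where w="\<lambda>x. norm (indicator (cbox a b) x *\<^sub>R f x)"])
      show "integrable lborel (\<lambda>x. norm (indicator (cbox a b) x *\<^sub>R f x))"
        using int[OF compact_cbox[of a b]] by (simp only: set_integrable_def integrable_norm)
      have [measurable]: "box_bump a b (real (Suc k)) \<in> borel_measurable borel" for k
        by (intro test_function_measurable box_bump_test) simp
      show "(\<lambda>x. box_bump a b (real (Suc k)) x * f x) \<in> borel_measurable lborel" for k by measurable
      show "(\<lambda>x. indicator (box a b) x * f x) \<in> borel_measurable lborel" by measurable
      show "AE x in lborel. (\<lambda>k. box_bump a b (real (Suc k)) x * f x) \<longlonglongrightarrow> indicator (box a b) x * f x"
        by (intro AE_I2 tendsto_intros box_bump_tendsto)
      show "AE x in lborel. norm (box_bump a b (real (Suc k)) x * f x) \<le> norm (indicator (cbox a b) x *\<^sub>R f x)" for k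
        using box_bump_norm_le[of "real (Suc k)" a b] by (intro AE_I2) (auto simp: norm_mult intro!: mult_right_mono)
    qed
    moreover have "(LINT x|lborel. box_bump a b (real (Suc k)) x * f x) = 0" for k
      by (intro zero box_bump_test) simp
    ultimately have "(LINT x|lborel. indicator (box a b) x * f x) = 0"
      by (simp add: LIMSEQ_const_iff)
    moreover have "indicator (box a b) x * f x = indicator (box a b) x *\<^sub>R f x" for x
      by (simp split: split_indicator)
    ultimately show ?thesis by (simp add: set_lebesgue_integral_def)
  qed
  have "AE x in lborel. Re (f x) = 0"
  proof (rule AE_zero_if_box_integrals_zero)
    show "set_integrable lborel (box a b) (\<lambda>x. Re (f x))" for a b
      using integrable_Re[OF i[of a b, unfolded set_integrable_def]] by (simp add: set_integrable_def)
    show "(LINT x:box a b|lborel. Re (f x)) = 0" for a b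
      using integral_Re[OF i[of a b, unfolded set_integrable_def]] z[of a b]
      by (simp add: set_lebesgue_integral_def)
  qed measurable
  moreover have "AE x in lborel. Im (f x) = 0"
  proof (rule AE_zero_if_box_integrals_zero)
    show "set_integrable lborel (box a b) (\<lambda>x. Im (f x))" for a b
      using integrable_Im[OF i[of a b, unfolded set_integrable_def]] by (simp add: set_integrable_def)
    show "(LINT x:box a b|lborel. Im (f x)) = 0" for a b
      using integral_Im[OF i[of a b, unfolded set_integrable_def]] z[of a b]
      by (simp add: set_lebesgue_integral_def)
  qed measurable
  ultimately show ?thesis by eventually_elim (simp add: complex_eq_iff)
qed


section \<open>Fractional integration\<close>

lemma lborel_distr_reflect:
  fixes a :: "'a::euclidean_space"
  shows "distr lborel borel (\<lambda>x. a - x) = lborel"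
  using lborel_affine[of "-1" a] by (simp add: density_1)

lemma nn_integral_lborel_translate:
  fixes a :: "'a::euclidean_space"
  assumes [measurable]: "f \<in> borel_measurable borel"
  shows "(\<integral>\<^sup>+x. f (a + x) \<partial>lborel) = (\<integral>\<^sup>+x. f x \<partial>lborel)"
proof -
  have "(\<integral>\<^sup>+x. f x \<partial>distr lborel borel ((+) a)) = (\<integral>\<^sup>+x. f (a + x) \<partial>lborel)"
    by (subst nn_integral_distr) auto
  then show ?thesis by (simp add: lborel_distr_plus)
qed

lemma
  fixes a :: "'a::euclidean_space" and f :: "'a \<Rightarrow> 'b::{banach, second_countable_topology}"
  assumes [measurable]: "f \<in> borel_measurable borel"
  shows integral_lborel_translate: "(LINT x|lborel. f (a + x)) = (LINT x|lborel. f x)"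
    and integral_lborel_reflect: "(LINT x|lborel. f (a - x)) = (LINT x|lborel. f x)"
    and integrable_lborel_translate: "integrable lborel (\<lambda>x. f (a + x)) \<longleftrightarrow> integrable lborel f"
    and integrable_lborel_reflect: "integrable lborel (\<lambda>x. f (a - x)) \<longleftrightarrow> integrable lborel f"
proof -
  have "(LINT x|distr lborel borel ((+) a). f x) = (LINT x|lborel. f (a + x))"
    by (subst integral_distr) auto
  then show "(LINT x|lborel. f (a + x)) = (LINT x|lborel. f x)" by (simp add: lborel_distr_plus)
  have "(LINT x|distr lborel borel (\<lambda>x. a - x). f x) = (LINT x|lborel. f (a - x))"
    by (subst integral_distr) auto
  then show "(LINT x|lborel. f (a - x)) = (LINT x|lborel. f x)" by (simp add: lborel_distr_reflect)
  have "integrable (distr lborel borel ((+) a)) f \<longleftrightarrow> integrable lborel (\<lambda>x. f (a + x))"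
    by (subst integrable_distr_eq) auto
  then show "integrable lborel (\<lambda>x. f (a + x)) \<longleftrightarrow> integrable lborel f" by (simp add: lborel_distr_plus)
  have "integrable (distr lborel borel (\<lambda>x. a - x)) f \<longleftrightarrow> integrable lborel (\<lambda>x. f (a - x))"
    by (subst integrable_distr_eq) auto
  then show "integrable lborel (\<lambda>x. f (a - x)) \<longleftrightarrow> integrable lborel f" by (simp add: lborel_distr_reflect)
qed

text \<open>Takes the place of polar coordinates: \<open>f\<close> is dominated by a sum of
  multiples of ball indicators. Radii 2^(k+1) serve for decay at infinity, radii 2^(-k) for a
  singularity at the origin.\<close>

lemma integrable_if_dyadic_bound:
  fixes f :: "'a::euclidean_space \<Rightarrow> real"
  assumes [measurable]: "f \<in> borel_measurable borel" and nn: "\<And>x. f x \<ge> 0"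
    and c: "\<And>k. c k \<ge> 0" and r: "\<And>k. r k \<ge> 0"
    and ex: "\<And>x. f x \<noteq> 0 \<Longrightarrow> \<exists>k. x \<in> cball 0 (r k) \<and> f x \<le> c k"
    and sm: "summable (\<lambda>k. c k * r k ^ DIM('a))"
  shows "integrable lborel f"
proof -
  have le: "ennreal (f x) \<le> (\<Sum>k. ennreal (c k) * indicator (cball 0 (r k)) x)" for x
  proof (cases "f x = 0")
    case False
    then obtain k where k: "x \<in> cball 0 (r k)" "f x \<le> c k" using ex by blast
    have "ennreal (f x) \<le> ennreal (c k) * indicator (cball 0 (r k)) x" using k by (simp add: ennreal_leI)
    also have "\<dots> \<le> (\<Sum>k. ennreal (c k) * indicator (cball 0 (r k)) x)"
    proof -
      have "sum (\<lambda>k. ennreal (c k) * indicator (cball 0 (r k)) x) {k} \<le> (\<Sum>k. ennreal (c k) * indicator (cball 0 (r k)) x)"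
        by (intro sum_le_suminf) auto
      then show ?thesis by (simp only: sum.insert finite.emptyI empty_iff not_False_eq_True sum.empty add_0_right)
    qed
    finally show ?thesis .
  qed simp
  have [measurable]: "cball 0 (r k) \<in> sets (borel :: 'a measure)" for k by simp
  have "(\<integral>\<^sup>+x. ennreal (f x) \<partial>lborel) \<le> (\<integral>\<^sup>+x. (\<Sum>k. ennreal (c k) * indicator (cball 0 (r k)) x) \<partial>(lborel::'a measure))"
    by (intro nn_integral_mono le)
  also have "\<dots> = (\<Sum>k. \<integral>\<^sup>+x. ennreal (c k) * indicator (cball 0 (r k)) x \<partial>(lborel::'a measure))"
    by (rule nn_integral_suminf) measurable
  also have "\<dots> = (\<Sum>k. ennreal (unit_ball_vol DIM('a) * (c k * r k ^ DIM('a))))"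
    using c r by (intro suminf_cong) (simp add: nn_integral_cmult emeasure_cball ennreal_mult'[symmetric] mult_ac)
  also have "\<dots> = ennreal (\<Sum>k. unit_ball_vol DIM('a) * (c k * r k ^ DIM('a)))"
    using sm c r by (intro suminf_ennreal_eq summable_sums summable_mult) auto
  finally have "(\<integral>\<^sup>+x. ennreal (f x) \<partial>lborel) < \<infinity>" by (simp add: order_le_less_trans)
  then show ?thesis using nn by (intro integrableI_bounded) auto
qed

lemma integrable_weight:
  assumes b: "b > real DIM('a)"
  shows "integrable lborel (\<lambda>x::'a::euclidean_space. (1 + norm x) powr (- b))"
proof (rule integrable_if_dyadic_bound[where c="\<lambda>k. 2 powr (- b * real k)" and r="\<lambda>k. 2 ^ (k + 1)"])
  fix x :: 'a
  define L where "L = log 2 (1 + norm x)"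
  define k where "k = nat \<lfloor>L\<rfloor>"
  have pos: "1 + norm x > 0" by (smt (verit) norm_ge_zero)
  have L0: "L \<ge> 0" unfolding L_def using zero_le_log_cancel_iff[of 2 "1 + norm x"] pos by simp
  have Lx: "2 powr L = 1 + norm x" unfolding L_def using pos by simp
  have kL: "real k \<le> L" "L < real k + 1" unfolding k_def using L0 by linarith+
  have "norm x \<le> 2 powr (real k + 1)"
    using kL Lx powr_mono[of L "real k + 1" 2] by (smt (verit))
  also have "\<dots> = 2 ^ (k + 1)" by (metis of_nat_1 of_nat_add powr_realpow zero_less_numeral)
  finally have 1: "x \<in> cball 0 (2 ^ (k + 1))" by simp
  have "(1 + norm x) powr (- b) = 2 powr (- b * L)" by (simp add: powr_powr mult.commute flip: Lx)
  also have "\<dots> \<le> 2 powr (- b * real k)"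
    using kL b by (intro powr_mono mult_left_mono_neg) auto
  finally show "\<exists>k. x \<in> cball 0 (2 ^ (k + 1)) \<and> (1 + norm x) powr (- b) \<le> 2 powr (- b * real k)"
    using 1 by blast
next
  have eq: "2 powr (- b * real k) * (2 ^ (k + 1)) ^ DIM('a) = 2 ^ DIM('a) * (2 powr (real DIM('a) - b)) ^ k" for k
  proof -
    have "(2::real) ^ (k * DIM('a)) = 2 powr (real k * real DIM('a))"
      by (metis of_nat_mult powr_realpow zero_less_numeral)
    moreover have "(2 powr (real DIM('a) - b)) ^ k = 2 powr (real k * real DIM('a)) * 2 powr (- b * real k)"
      by (simp add: powr_realpow[symmetric] powr_powr powr_add[symmetric] algebra_simps)
    ultimately show ?thesis by (simp add: power_mult[symmetric] power_mult_distrib mult_ac)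
  qed
  have "2 powr (real DIM('a) - b) < (1::real)" using b by (simp add: powr_less_one)
  then show "summable (\<lambda>k. 2 powr (- b * real k) * (2 ^ (k + 1)) ^ DIM('a))"
    unfolding eq by (intro summable_mult summable_geometric) simp
qed (auto simp: measurable_completion)

lemma integrable_near_singularity:
  assumes a: "0 \<le> a" "a < real DIM('a)"
  shows "integrable lborel (\<lambda>x::'a::euclidean_space. norm x powr (- a) * indicator (cball 0 1) x)"
proof (rule integrable_if_dyadic_bound[where c="\<lambda>k. 2 powr (a * (real k + 1))" and r="\<lambda>k. 2 powr (- real k)"])
  fix x :: 'a assume "norm x powr (- a) * indicator (cball 0 1) x \<noteq> 0"
  then have x: "x \<noteq> 0" "norm x \<le> 1" by (auto simp: indicator_def split: if_splits)
  define L where "L = - log 2 (norm x)"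
  define k where "k = nat \<lfloor>L\<rfloor>"
  have L0: "L \<ge> 0" unfolding L_def using x by simp
  have Lx: "2 powr (- L) = norm x" unfolding L_def using x by simp
  have kL: "real k \<le> L" "L < real k + 1" unfolding k_def using L0 by linarith+
  have "norm x \<le> 2 powr (- real k)" using kL by (simp flip: Lx)
  then have 1: "x \<in> cball 0 (2 powr (- real k))" by simp
  have "norm x powr (- a) = 2 powr (a * L)" by (simp add: powr_powr mult.commute flip: Lx)
  also have "\<dots> \<le> 2 powr (a * (real k + 1))"
    using kL a by (intro powr_mono mult_left_mono) auto
  finally show "\<exists>k. x \<in> cball 0 (2 powr (- real k)) \<and> norm x powr (- a) * indicator (cball 0 1) x \<le> 2 powr (a * (real k + 1))"
    using 1 x by (auto simp: indicator_def)
next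
  have "2 powr (a * (real k + 1)) * (2 powr (- real k)) ^ DIM('a) = 2 powr a * (2 powr (a - real DIM('a))) ^ k" for k
    by (simp add: powr_realpow[symmetric] powr_powr powr_add[symmetric] algebra_simps)
  moreover have "2 powr (a - real DIM('a)) < (1::real)" using a by (simp add: powr_less_one)
  ultimately show "summable (\<lambda>k. 2 powr (a * (real k + 1)) * (2 powr (- real k)) ^ DIM('a))"
    by (simp add: summable_mult summable_geometric)
next
  have [measurable]: "cball 0 1 \<in> sets (borel :: 'a measure)" by simp
  show "(\<lambda>x::'a. norm x powr - a * indicat_real (cball 0 1) x) \<in> borel_measurable borel" by measurable
qed auto

text \<open>Weighted arithmetic-geometric mean for X = k^r g^p / s, k^r and g^p with weights 1/q,
  1/r - 1/q and 1/p - 1/q, which sum to 1 by \<open>rel\<close>. The free parameter \<open>s\<close>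
  will be the integral of k^r g^p, so that X integrates to 1.\<close>

lemma weighted_young_pointwise:
  fixes k g s p q r :: real
  assumes k: "k \<ge> 0" and g: "g \<ge> 0" and s: "s > 0"
    and r: "r \<ge> 1" and p: "p \<ge> 1" and q: "q \<ge> 1" and rel: "1 / r + 1 / p = 1 + 1 / q"
  shows "k * g \<le> s powr (1 / q) * ((1 / q) * (k powr r * g powr p / s) + (1 / r - 1 / q) * k powr r + (1 / p - 1 / q) * g powr p)"
proof -
  have inv: "1 / r \<le> 1" "1 / p \<le> 1" "1 / q > 0" using r p q by auto
  show ?thesis
  proof (cases "k = 0 \<or> g = 0")
    case True
    have "1 / r - 1 / q \<ge> 0" "1 / p - 1 / q \<ge> 0" "1 / q \<ge> 0" using rel inv by linarith+
    then have "0 \<le> s powr (1 / q) * ((1 / q) * (k powr r * g powr p / s) + (1 / r - 1 / q) * k powr r + (1 / p - 1 / q) * g powr p)"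
      using s by (intro mult_nonneg_nonneg add_nonneg_nonneg) auto
    then show ?thesis using True by auto
  next
    case False
    then have kg: "k > 0" "g > 0" using k g by auto
    define a where "a = 1 / q"
    define b where "b = 1 / r - 1 / q"
    define c where "c = 1 / p - 1 / q"
    have abc: "a > 0" "b \<ge> 0" "c \<ge> 0" "a + b + c = 1" "(a + b) * r = 1" "(a + c) * p = 1"
      unfolding a_def b_def c_def using rel inv r p by (linarith, linarith, linarith, linarith, simp, simp)
    define X where "X = k powr r * g powr p / s"
    define M where "M = a * X + b * k powr r + c * g powr p"
    have X: "X > 0" "k powr r > 0" "g powr p > 0" using kg s by (auto simp: X_def)
    have M: "M > 0" unfolding M_def using abc X by (intro add_pos_nonneg mult_pos_pos mult_nonneg_nonneg) auto
    \<comment> \<open>The concave logarithm lies below its tangent at the mean \<open>M\<close>; the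
      weighted sum of the three tangent bounds is 0.\<close>
    have tangent: "ln t - ln M \<le> t / M - 1" if "t > 0" for t
      using ln_le_minus_one[of "t / M"] that M by (simp add: ln_div)
    have "a * (ln X - ln M) + b * (ln (k powr r) - ln M) + c * (ln (g powr p) - ln M)
        \<le> a * (X / M - 1) + b * (k powr r / M - 1) + c * (g powr p / M - 1)"
      using abc by (intro add_mono mult_left_mono tangent X) auto
    also have "\<dots> = (a * X + b * k powr r + c * g powr p) / M - (a + b + c)"
      by (simp add: algebra_simps add_divide_distrib)
    also have "\<dots> = M / M - (a + b + c)" by (simp only: M_def)
    also have "\<dots> = 0" using M abc by simp
    finally have "a * ln X + b * ln (k powr r) + c * ln (g powr p) \<le> (a + b + c) * ln M"
      by (simp add: algebra_simps)
    moreover have "ln X = r * ln k + p * ln g - ln s"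
      unfolding X_def using kg s by (simp add: ln_div ln_mult ln_powr)
    ultimately have "a * (r * ln k + p * ln g - ln s) + b * (r * ln k) + c * (p * ln g) \<le> ln M"
      using kg abc by (simp add: ln_powr)
    moreover have "a * (r * ln k + p * ln g - ln s) + b * (r * ln k) + c * (p * ln g)
        = ((a + b) * r) * ln k + ((a + c) * p) * ln g - a * ln s" by (simp add: algebra_simps)
    ultimately have "ln k + ln g \<le> a * ln s + ln M" using abc by simp
    then have "exp (ln k + ln g) \<le> exp (a * ln s + ln M)" by simp
    then have "k * g \<le> s powr a * M" using kg M s by (simp add: exp_add powr_def)
    then show ?thesis by (simp add: M_def X_def a_def b_def c_def)
  qed
qed

text \<open>Where \<open>S(x) = \<integral> k(x - y)\<^sup>r g(y)\<^sup>p dy\<close> is finite, the pointwise inequality bounds the convolution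
  by a constant times \<open>S(x)\<close> to the power \<open>1 / q\<close>, and \<open>S\<close> is integrable by Tonelli.\<close>

lemma young_convolution:
  fixes k g :: "'a::euclidean_space \<Rightarrow> real"
  assumes [measurable]: "k \<in> borel_measurable borel" "g \<in> borel_measurable borel"
    and k: "\<And>x. k x \<ge> 0" and g: "\<And>x. g x \<ge> 0"
    and ik: "integrable lborel (\<lambda>x. k x powr r)" and ig: "integrable lborel (\<lambda>x. g x powr p)"
    and r: "r \<ge> 1" and p: "p \<ge> 1" and q: "q \<ge> 1" and rel: "1 / r + 1 / p = 1 + 1 / q"
  shows "AE x in lborel. integrable lborel (\<lambda>y. k (x - y) * g y)"
    and "integrable lborel (\<lambda>x. (LINT y|lborel. k (x - y) * g y) powr q)"
proof -
  define S where "S x = (\<integral>\<^sup>+y. ennreal (k (x - y) powr r * g y powr p) \<partial>lborel)" for x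
  have [measurable]: "S \<in> borel_measurable borel" unfolding S_def by measurable
  define A where "A = (LINT x|lborel. k x powr r)"
  define B where "B = (LINT x|lborel. g x powr p)"
  have ikx: "integrable lborel (\<lambda>y. k (x - y) powr r)" "(LINT y|lborel. k (x - y) powr r) = A" for x
    using integrable_lborel_reflect[of "\<lambda>y. k y powr r" x] integral_lborel_reflect[of "\<lambda>y. k y powr r" x] ik
    by (simp_all add: A_def)
  have Sfin: "(\<integral>\<^sup>+x. S x \<partial>lborel) < \<infinity>"
  proof -
    have "(\<integral>\<^sup>+x. S x \<partial>lborel) = (\<integral>\<^sup>+y. (\<integral>\<^sup>+x. ennreal (k (x - y) powr r * g y powr p) \<partial>lborel) \<partial>lborel)"
      unfolding S_def by (rule lborel_pair.Fubini'[symmetric]) measurable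
    also have "\<dots> = (\<integral>\<^sup>+y. ennreal A * ennreal (g y powr p) \<partial>lborel)"
    proof (rule nn_integral_cong)
      fix y
      have "(\<integral>\<^sup>+x. ennreal (k (x - y) powr r * g y powr p) \<partial>lborel)
          = (\<integral>\<^sup>+x. ennreal (k (x - y) powr r) \<partial>lborel) * ennreal (g y powr p)"
        by (subst nn_integral_multc[symmetric]) (auto simp: ennreal_mult)
      also have "(\<integral>\<^sup>+x. ennreal (k (x - y) powr r) \<partial>lborel) = (\<integral>\<^sup>+x. ennreal (k x powr r) \<partial>lborel)"
        using nn_integral_lborel_translate[of "\<lambda>x. ennreal (k x powr r)" "- y"] by simp
      also have "\<dots> = ennreal A" unfolding A_def by (intro nn_integral_eq_integral ik) auto
      finally show "(\<integral>\<^sup>+x. ennreal (k (x - y) powr r * g y powr p) \<partial>lborel) = ennreal A * ennreal (g y powr p)" .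
    qed
    also have "\<dots> = ennreal A * ennreal B"
      unfolding B_def by (subst nn_integral_cmult) (auto simp: nn_integral_eq_integral[OF ig])
    also have "\<dots> < \<infinity>" by (simp add: ennreal_mult_less_top)
    finally show ?thesis .
  qed
  then have SAE: "AE x in lborel. S x \<noteq> \<infinity>" by (intro nn_integral_noteq_infinite) auto
  \<comment> \<open>Integral of the bracket in the pointwise inequality once \<open>s\<close> is the
    value of \<open>S x\<close>: the first term contributes 1/q, the others multiples of
    \<open>A\<close> and \<open>B\<close>.\<close>
  define D where "D = 1 / q + (1 / r - 1 / q) * A + (1 / p - 1 / q) * B"
  have nonneg: "1 / r - 1 / q \<ge> 0" "1 / p - 1 / q \<ge> 0" "1 / q \<ge> 0" "A \<ge> 0" "B \<ge> 0"
  proof -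
    have inv: "1 / r \<le> 1" "1 / p \<le> 1" "1 / q > 0" using r p q by auto
    show "1 / r - 1 / q \<ge> 0" "1 / p - 1 / q \<ge> 0" "1 / q \<ge> 0" using rel inv by linarith+
    show "A \<ge> 0" "B \<ge> 0" by (auto simp: A_def B_def)
  qed
  have D: "D \<ge> 0" unfolding D_def using nonneg by (intro add_nonneg_nonneg mult_nonneg_nonneg) auto
  have main: "integrable lborel (\<lambda>y. k (x - y) * g y) \<and>
      (LINT y|lborel. k (x - y) * g y) \<le> D * enn2real (S x) powr (1 / q)" if "S x \<noteq> \<infinity>" for x
  proof -
    define s where "s = enn2real (S x)"
    have Sx: "S x = ennreal s" unfolding s_def using that by (simp add: less_top)
    have iS: "integrable lborel (\<lambda>y. k (x - y) powr r * g y powr p)"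
      using that unfolding S_def by (intro integrableI_nonneg) (auto simp: less_top)
    have sI: "(LINT y|lborel. k (x - y) powr r * g y powr p) = s"
      unfolding s_def S_def by (intro integral_eq_nn_integral) auto
    show ?thesis
    proof (cases "s > 0")
      case True
      let ?R = "\<lambda>y. s powr (1 / q) * ((1 / q) * (k (x - y) powr r * g y powr p / s)
          + (1 / r - 1 / q) * k (x - y) powr r + (1 / p - 1 / q) * g y powr p)"
      have iR: "integrable lborel ?R"
        by (intro integrable_mult_right Bochner_Integration.integrable_add integrable_divide iS ikx ig)
      have R: "(LINT y|lborel. ?R y) = s powr (1 / q) * D"
        using True iS ikx ig by (simp add: sI D_def B_def)
      have le: "k (x - y) * g y \<le> ?R y" for y
        by (rule weighted_young_pointwise) (use k g True r p q rel in auto)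
      have "norm (k (x - y) * g y) \<le> norm (?R y)" for y
        using order_trans[OF le[of y] abs_ge_self] k g by (simp only: real_norm_def abs_mult abs_of_nonneg)
      then have 1: "integrable lborel (\<lambda>y. k (x - y) * g y)"
        by (intro Bochner_Integration.integrable_bound[OF iR] AE_I2) auto
      have "(LINT y|lborel. k (x - y) * g y) \<le> (LINT y|lborel. ?R y)"
        by (intro integral_mono 1 iR le)
      also have "\<dots> = s powr (1 / q) * D" by (rule R)
      also have "\<dots> = D * s powr (1 / q)" by (rule mult.commute)
      finally have "(LINT y|lborel. k (x - y) * g y) \<le> D * s powr (1 / q)" .
      with 1 show ?thesis by (simp only: s_def simp_thms)
    next
      \<comment> \<open>Normalising by \<open>s\<close> is impossible here, but a vanishing integral
        of k^r g^p makes the convolution integrand vanish almost everywhere.\<close>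
      case False
      then have "S x = 0" using Sx by (simp add: ennreal_neg)
      then have "AE y in lborel. ennreal (k (x - y) powr r * g y powr p) = 0"
        unfolding S_def by (subst (asm) nn_integral_0_iff_AE) auto
      then have ae: "AE y in lborel. k (x - y) * g y = 0"
        by eventually_elim (use k g in \<open>auto simp: ennreal_eq_0_iff mult_le_0_iff\<close>)
      have "integrable lborel (\<lambda>y. k (x - y) * g y) \<longleftrightarrow> integrable lborel (\<lambda>y::'a. 0::real)"
        using ae by (intro integrable_cong_AE) auto
      moreover have "(LINT y|lborel. k (x - y) * g y) = (LINT y|(lborel::'a measure). 0)"
        using ae by (intro integral_cong_AE) auto
      ultimately show ?thesis using D by simp
    qed
  qed
  show "AE x in lborel. integrable lborel (\<lambda>y. k (x - y) * g y)"
    using SAE by eventually_elim (use main in blast)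
  show "integrable lborel (\<lambda>x. (LINT y|lborel. k (x - y) * g y) powr q)"
  proof (rule Bochner_Integration.integrable_bound)
    show "integrable lborel (\<lambda>x. D powr q * enn2real (S x))"
      using Sfin by (intro integrable_mult_right integrableI_nonneg)
        (auto intro: order_le_less_trans[OF nn_integral_mono] simp: ennreal_enn2real_if)
    show "(\<lambda>x. (LINT y|lborel. k (x - y) * g y) powr q) \<in> borel_measurable lborel" by measurable
    show "AE x in lborel. norm ((LINT y|lborel. k (x - y) * g y) powr q) \<le> norm (D powr q * enn2real (S x))"
      using SAE
    proof eventually_elim
      case (elim x)
      have "(LINT y|lborel. k (x - y) * g y) powr q \<le> (D * enn2real (S x) powr (1 / q)) powr q"
        using main[OF elim] k g q by (intro powr_mono2) (auto intro!: integral_nonneg)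
      also have "\<dots> = D powr q * enn2real (S x)"
        using D q by (simp add: powr_mult powr_powr)
      finally show ?case by simp
    qed
  qed
qed

text \<open>The endpoint q = infinity. Applying a b <= a^r / r + b^p / p pointwise gives a bound
  that is not homogeneous but, by reflection invariance, the same for all \<open>x\<close>.\<close>

lemma hoelder_convolution:
  fixes k g :: "'a::euclidean_space \<Rightarrow> real"
  assumes [measurable]: "k \<in> borel_measurable borel" "g \<in> borel_measurable borel"
    and k: "\<And>x. k x \<ge> 0" and g: "\<And>x. g x \<ge> 0"
    and ik: "integrable lborel (\<lambda>x. k x powr r)" and ig: "integrable lborel (\<lambda>x. g x powr p)"
    and r: "r > 1" and p: "p > 1" and rel: "1 / r + 1 / p = 1"
  shows "\<exists>B. \<forall>x. integrable lborel (\<lambda>y. k (x - y) * g y) \<and> (LINT y|lborel. k (x - y) * g y) \<le> B"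
proof (intro exI allI)
  fix x
  let ?R = "\<lambda>y. k (x - y) powr r / r + g y powr p / p"
  have ikx: "integrable lborel (\<lambda>y. k (x - y) powr r)" "(LINT y|lborel. k (x - y) powr r) = (LINT x|lborel. k x powr r)"
    using integrable_lborel_reflect[of "\<lambda>y. k y powr r" x] integral_lborel_reflect[of "\<lambda>y. k y powr r" x] ik by simp_all
  have iR: "integrable lborel ?R" by (intro Bochner_Integration.integrable_add integrable_divide ikx ig)
  have le: "k (x - y) * g y \<le> ?R y" for y by (intro Youngs_inequality) (use k g r p rel in auto)
  have 1: "integrable lborel (\<lambda>y. k (x - y) * g y)"
    by (rule Bochner_Integration.integrable_bound[OF iR])
      (auto intro!: AE_I2 order_trans[OF _ abs_ge_self] le simp: k g abs_mult)
  moreover have "(LINT y|lborel. k (x - y) * g y) \<le> (LINT y|lborel. ?R y)"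
    by (intro integral_mono 1 iR le)
  moreover have "(LINT y|lborel. ?R y) = (LINT x|lborel. k x powr r) / r + (LINT y|lborel. g y powr p) / p"
    using ikx ig by simp
  ultimately show "integrable lborel (\<lambda>y. k (x - y) * g y) \<and>
      (LINT y|lborel. k (x - y) * g y) \<le> (LINT x|lborel. k x powr r) / r + (LINT y|lborel. g y powr p) / p" by simp
qed

text \<open>Modulus of the Riesz kernel z / |z|^n; at the origin \<open>powr\<close> gives the value
  0.\<close>

definition kap :: "'a::euclidean_space \<Rightarrow> real" where
  "kap z = norm z powr (1 - real DIM('a))"

lemma kap_nonneg [simp]: "kap z \<ge> 0" by (simp add: kap_def)

lemma kap_measurable [measurable]: "kap \<in> borel_measurable borel"
  unfolding kap_def by measurable

definition kap_near :: "'a::euclidean_space \<Rightarrow> real" where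
  "kap_near z = kap z * indicator (cball 0 1) z"

definition kap_far :: "'a::euclidean_space \<Rightarrow> real" where
  "kap_far z = kap z * indicator (- cball 0 1) z"

lemma kap_split: "kap z = kap_near z + kap_far z"
  by (simp add: kap_near_def kap_far_def indicator_def)

lemma kap_parts [simp, measurable]: "kap_near z \<ge> 0" "kap_far z \<ge> 0"
  "kap_near \<in> borel_measurable (borel :: 'a::euclidean_space measure)"
  "kap_far \<in> borel_measurable (borel :: 'a::euclidean_space measure)"
proof -
  have [measurable]: "cball 0 1 \<in> sets (borel :: 'a measure)" by simp
  show "kap_near z \<ge> 0" "kap_far z \<ge> 0" by (simp_all add: kap_near_def kap_far_def)
  show "kap_near \<in> borel_measurable (borel :: 'a measure)" "kap_far \<in> borel_measurable (borel :: 'a measure)"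
    unfolding kap_near_def[abs_def] kap_far_def[abs_def] by measurable
qed

lemma integrable_kap_near:
  assumes "r \<ge> 1" "(real DIM('a) - 1) * r < real DIM('a)"
  shows "integrable lborel (\<lambda>z::'a::euclidean_space. kap_near z powr r)"
proof -
  have D: "real DIM('a) \<ge> 1" by (simp add: Suc_leI)
  have "(\<lambda>z::'a. kap_near z powr r) = (\<lambda>z. norm z powr (- ((real DIM('a) - 1) * r)) * indicator (cball 0 1) z)"
    by (auto simp: fun_eq_iff kap_near_def kap_def powr_powr indicator_def algebra_simps)
  moreover have "integrable lborel (\<lambda>z::'a. norm z powr (- ((real DIM('a) - 1) * r)) * indicator (cball 0 1) z)"
    using assms D by (intro integrable_near_singularity) auto
  ultimately show ?thesis by simp
qed

lemma one_add_norm_pos [simp]: "0 < 1 + norm x" "1 + norm x \<noteq> 0" "0 \<le> 1 + norm x"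
  using norm_ge_zero[of x] by linarith+

lemma integrable_kap_far:
  assumes "r \<ge> 1" "(real DIM('a) - 1) * r > real DIM('a)"
  shows "integrable lborel (\<lambda>z::'a::euclidean_space. kap_far z powr r)"
proof (rule Bochner_Integration.integrable_bound)
  let ?b = "(real DIM('a) - 1) * r"
  show "integrable lborel (\<lambda>z::'a. 2 powr ?b * (1 + norm z) powr (- ?b))"
    by (intro integrable_mult_right integrable_weight assms)
  show "(\<lambda>z::'a. kap_far z powr r) \<in> borel_measurable lborel" by simp
  have D: "real DIM('a) \<ge> 1" by (simp add: Suc_leI)
  have "kap_far z powr r \<le> 2 powr ?b * (1 + norm z) powr (- ?b)" for z :: 'a
  proof (cases "norm z \<le> 1")
    case False
    then have "kap_far z powr r = norm z powr (- ?b)"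
      by (simp add: kap_far_def kap_def powr_powr algebra_simps)
    also have "\<dots> \<le> ((1 + norm z) / 2) powr (- ?b)"
      using False D assms(1) by (intro powr_mono2') auto
    also have "\<dots> = 2 powr ?b * (1 + norm z) powr (- ?b)"
      by (simp add: powr_divide powr_minus divide_simps)
    finally show ?thesis .
  qed (simp add: kap_far_def)
  then show "AE z::'a in lborel. norm (kap_far z powr r) \<le> norm (2 powr ?b * (1 + norm z) powr (- ?b))"
    by (intro AE_I2) simp
qed

lemma powr_add_le: "(a::real) \<ge> 0 \<Longrightarrow> b \<ge> 0 \<Longrightarrow> q \<ge> 0 \<Longrightarrow> (a + b) powr q \<le> 2 powr q * (a powr q + b powr q)"
proof -
  assume a: "a \<ge> 0" "b \<ge> 0" "q \<ge> 0"
  have "(a + b) powr q \<le> (2 * max a b) powr q" using a by (intro powr_mono2) auto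
  also have "\<dots> = 2 powr q * max a b powr q" using a by (simp add: powr_mult)
  also have "\<dots> \<le> 2 powr q * (a powr q + b powr q)" by (intro mult_left_mono) (auto simp: max_def)
  finally show ?thesis .
qed

text \<open>Young's inequality for each part of the kernel, with source exponent \<open>p1\<close>
  near and \<open>p2\<close> far. For 1/r = 1 + 1/q - 1/p1 the integrability condition (n - 1) r < n
  reads 1/p1 - 1/n < 1/q; the reversed condition for the far part reads 1/q < 1/p2 - 1/n.\<close>

lemma potential_Lq_two_sided:
  fixes g :: "'a::euclidean_space \<Rightarrow> real"
  assumes [measurable]: "g \<in> borel_measurable borel" and g: "\<And>x. g x \<ge> 0"
    and i1: "integrable lborel (\<lambda>x. g x powr p1)" and i2: "integrable lborel (\<lambda>x. g x powr p2)"
    and p: "p1 \<ge> 1" "p2 \<ge> 1" and q: "q \<ge> 1"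
    and near: "1 / p1 - 1 / real DIM('a) < 1 / q" "1 / q \<le> 1 / p1"
    and far: "1 / q < 1 / p2 - 1 / real DIM('a)"
  shows "AE x in lborel. integrable lborel (\<lambda>y. kap (x - y) * g y)"
    and "integrable lborel (\<lambda>x. (LINT y|lborel. kap (x - y) * g y) powr q)"
proof -
  let ?n = "real DIM('a)"
  have n: "?n \<ge> 1" by (simp add: Suc_leI)
  define r where "r = 1 / (1 + 1 / q - 1 / p1)"
  define s where "s = 1 / (1 + 1 / q - 1 / p2)"
  have p1: "1 / p1 \<le> 1" "1 / p2 \<le> 1" "1 / q > 0" "1 / ?n \<le> 1" "1 / ?n > 0" using p q n by auto
  have d: "1 + 1 / q - 1 / p1 > 0" "1 + 1 / q - 1 / p2 > 0" using p1 by linarith+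
  have r: "r \<ge> 1" "1 / r + 1 / p1 = 1 + 1 / q" "(?n - 1) * r < ?n"
  proof -
    show "r \<ge> 1" unfolding r_def using d near by simp
    show "1 / r + 1 / p1 = 1 + 1 / q" by (simp add: r_def)
    have "?n * (1 - 1 / ?n) < ?n * (1 + 1 / q - 1 / p1)" using near n by (intro mult_strict_left_mono) auto
    then have "?n - 1 < ?n * (1 + 1 / q - 1 / p1)" using n by (simp add: algebra_simps)
    then show "(?n - 1) * r < ?n" unfolding r_def using d by (simp add: pos_divide_less_eq)
  qed
  have s: "s \<ge> 1" "1 / s + 1 / p2 = 1 + 1 / q" "(?n - 1) * s > ?n"
  proof -
    have "1 + 1 / q - 1 / p2 \<le> 1" using far p1(5) by linarith
    then show "s \<ge> 1" unfolding s_def using d by (simp add: le_divide_eq)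
    show "1 / s + 1 / p2 = 1 + 1 / q" by (simp add: s_def)
    have "?n * (1 - 1 / ?n) > ?n * (1 + 1 / q - 1 / p2)" using far n by (intro mult_strict_left_mono) auto
    then have "?n - 1 > ?n * (1 + 1 / q - 1 / p2)" using n by (simp add: algebra_simps)
    then show "(?n - 1) * s > ?n" unfolding s_def using d by (simp add: pos_less_divide_eq)
  qed
  note N = young_convolution[of kap_near g r p1 q, OF _ _ _ g integrable_kap_near[OF r(1,3)] i1 r(1) p(1) q r(2), simplified]
  note F = young_convolution[of kap_far g s p2 q, OF _ _ _ g integrable_kap_far[OF s(1,3)] i2 s(1) p(2) q s(2), simplified]
  show "AE x in lborel. integrable lborel (\<lambda>y. kap (x - y) * g y)"
    using N(1) F(1) by eventually_elim (simp add: kap_split distrib_right)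
  show "integrable lborel (\<lambda>x. (LINT y|lborel. kap (x - y) * g y) powr q)"
  proof (rule Bochner_Integration.integrable_bound)
    let ?h1 = "\<lambda>x. LINT y|lborel. kap_near (x - y) * g y" and ?h2 = "\<lambda>x. LINT y|lborel. kap_far (x - y) * g y"
    show "integrable lborel (\<lambda>x. 2 powr q * (?h1 x powr q + ?h2 x powr q))"
      by (intro integrable_mult_right Bochner_Integration.integrable_add N(2) F(2))
    show "(\<lambda>x. (LINT y|lborel. kap (x - y) * g y) powr q) \<in> borel_measurable lborel" by measurable
    show "AE x in lborel. norm ((LINT y|lborel. kap (x - y) * g y) powr q) \<le> norm (2 powr q * (?h1 x powr q + ?h2 x powr q))"
      using N(1) F(1)
    proof eventually_elim
      case (elim x)
      then have "(LINT y|lborel. kap (x - y) * g y) = ?h1 x + ?h2 x"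
        by (simp add: kap_split distrib_right)
      moreover have "?h1 x \<ge> 0" "?h2 x \<ge> 0" by (auto intro!: integral_nonneg simp: g)
      ultimately show ?case using powr_add_le[of "?h1 x" "?h2 x" q] q by simp
    qed
  qed
qed

text \<open>The conjugate exponent p / (p - 1) lies below n / (n - 1) exactly when p > n: a source
  exponent above the dimension controls the singularity, one below it the tail.\<close>

lemma potential_bounded:
  fixes g :: "'a::euclidean_space \<Rightarrow> real"
  assumes [measurable]: "g \<in> borel_measurable borel" and g: "\<And>x. g x \<ge> 0"
    and i1: "integrable lborel (\<lambda>x. g x powr p1)" and i2: "integrable lborel (\<lambda>x. g x powr p2)"
    and p: "p1 > real DIM('a)" "p2 < real DIM('a)" "p2 > 1"
  shows "\<exists>B. \<forall>x. integrable lborel (\<lambda>y. kap (x - y) * g y) \<and> (LINT y|lborel. kap (x - y) * g y) \<le> B"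
proof -
  let ?n = "real DIM('a)"
  have n: "?n \<ge> 1" by (simp add: Suc_leI)
  have p1: "p1 > 1" using n p by linarith
  have r: "p1 / (p1 - 1) > 1" "1 / (p1 / (p1 - 1)) + 1 / p1 = 1" "(?n - 1) * (p1 / (p1 - 1)) < ?n"
    using p p1 by (auto simp: field_simps)
  have s: "p2 / (p2 - 1) > 1" "1 / (p2 / (p2 - 1)) + 1 / p2 = 1" "(?n - 1) * (p2 / (p2 - 1)) > ?n"
    using p by (auto simp: field_simps)
  obtain B1 where B1: "\<And>x. integrable lborel (\<lambda>y. kap_near (x - y) * g y) \<and> (LINT y|lborel. kap_near (x - y) * g y) \<le> B1"
    using hoelder_convolution[of kap_near g, OF _ _ _ g integrable_kap_near[OF less_imp_le[OF r(1)] r(3)] i1 r(1) p1 r(2)] by auto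
  obtain B2 where B2: "\<And>x. integrable lborel (\<lambda>y. kap_far (x - y) * g y) \<and> (LINT y|lborel. kap_far (x - y) * g y) \<le> B2"
    using hoelder_convolution[of kap_far g, OF _ _ _ g integrable_kap_far[OF less_imp_le[OF s(1)] s(3)] i2 s(1) p(3) s(2)] by auto
  have "integrable lborel (\<lambda>y. kap (x - y) * g y) \<and> (LINT y|lborel. kap (x - y) * g y) \<le> B1 + B2" for x
    using B1[of x] B2[of x] by (simp add: kap_split distrib_right)
  then show ?thesis by blast
qed

text \<open>Hoelder's inequality against the weight: decay of order \<open>m\<close> lowers the
  exponent from \<open>q0\<close> to any \<open>p\<close> with 1/p < 1/q0 + m/n. The bounds are
  required at every point, so that no null sets travel through the estimates.\<close>

lemma weighted_Lp:
  fixes f g :: "'a::euclidean_space \<Rightarrow> real"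
  assumes [measurable]: "g \<in> borel_measurable borel" "f \<in> borel_measurable borel"
    and f: "\<And>x. f x \<ge> 0" and g: "\<And>x. 0 \<le> g x" and C: "C \<ge> 0"
    and gf: "\<And>x. g x \<le> C * ((1 + norm x) powr (- m) * f x)"
    and i: "integrable lborel (\<lambda>x. f x powr q0)" and m: "m \<ge> 0"
    and p: "p > 0" "1 / q0 \<le> 1 / p" "1 / p < 1 / q0 + m / real DIM('a)" and q0: "q0 > 0"
  shows "integrable lborel (\<lambda>x. g x powr p)"
proof -
  have le: "g x powr p \<le> C powr p * ((1 + norm x) powr (- m * p) * f x powr p)" for x
  proof -
    have "g x powr p \<le> (C * ((1 + norm x) powr (- m) * f x)) powr p"
      using g gf p by (intro powr_mono2) auto
    also have "\<dots> = C powr p * ((1 + norm x) powr (- m * p) * f x powr p)"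
      using C f by (simp add: powr_mult powr_powr)
    finally show ?thesis .
  qed
  have pq: "p \<le> q0" using p q0 by (simp add: field_simps)
  have "integrable lborel (\<lambda>x. (1 + norm x) powr (- m * p) * f x powr p)"
  proof (cases "p = q0")
    case True
    show ?thesis
    proof (rule Bochner_Integration.integrable_bound[OF i])
      have "(1 + norm x) powr (- m * p) \<le> 1" for x :: 'a
        using m p ge_one_powr_ge_zero[of "1 + norm x" "m * p"] by (simp add: powr_minus inverse_le_1_iff)
      then show "AE x in lborel. norm ((1 + norm x) powr (- m * p) * f x powr p) \<le> norm (f x powr q0)"
        using True by (auto intro!: AE_I2 mult_left_le_one_le)
    qed measurable
  next
    case False
    define th where "th = p / q0"
    have th: "0 < th" "th < 1" using False pq p q0 by (auto simp: th_def)
    \<comment> \<open>Chosen so that the product of (f^q0)^th and ((1 + |x|)^(-b))^(1 - th) is the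
      integrand; b > n is then precisely the condition on \<open>p\<close>.\<close>
    define b where "b = m * p / (1 - th)"
    have "1 - th = p * (1 / p - 1 / q0)" using p q0 by (simp add: th_def algebra_simps)
    also have "\<dots> < p * (m / real DIM('a))" using p by (intro mult_strict_left_mono) auto
    finally have "real DIM('a) * (1 - th) < m * p" by (simp add: field_simps)
    then have b: "b > real DIM('a)" unfolding b_def using th by (simp add: pos_less_divide_eq)
    show ?thesis
    proof (rule Bochner_Integration.integrable_bound)
      show "integrable lborel (\<lambda>x. th * f x powr q0 + (1 - th) * (1 + norm x) powr (- b))"
        by (intro Bochner_Integration.integrable_add integrable_mult_right i integrable_weight b)
      have "(1 + norm x) powr (- m * p) * f x powr p \<le> th * f x powr q0 + (1 - th) * (1 + norm x) powr (- b)" for x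
      proof (cases "f x = 0")
        case False
        then have "f x powr q0 > 0" using f[of x] by simp
        then have "(f x powr q0) powr th * ((1 + norm x) powr (- b)) powr (1 - th)
            \<le> th * f x powr q0 + (1 - th) * (1 + norm x) powr (- b)"
          using th by (intro Youngs_inequality_0) auto
        moreover have "(f x powr q0) powr th = f x powr p" using q0 by (simp add: powr_powr th_def)
        moreover have "((1 + norm x) powr (- b)) powr (1 - th) = (1 + norm x) powr (- m * p)"
          using th by (simp add: powr_powr b_def)
        ultimately show ?thesis by (simp add: mult.commute)
      qed (use th in simp)
      then show "AE x in lborel. norm ((1 + norm x) powr (- m * p) * f x powr p)
          \<le> norm (th * f x powr q0 + (1 - th) * (1 + norm x) powr (- b))"
        by (intro AE_I2) (simp add: order_trans[OF _ abs_ge_self])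
    qed measurable
  qed
  then have "integrable lborel (\<lambda>x. C powr p * ((1 + norm x) powr (- m * p) * f x powr p))"
    by (rule integrable_mult_right)
  then show ?thesis
    by (rule Bochner_Integration.integrable_bound) (auto intro!: AE_I2 order_trans[OF le])
qed

lemma potential_Lq:
  fixes f g :: "'a::euclidean_space \<Rightarrow> real"
  assumes [measurable]: "g \<in> borel_measurable borel" "f \<in> borel_measurable borel"
    and f: "\<And>x. f x \<ge> 0" and g: "\<And>x. 0 \<le> g x" and C: "C \<ge> 0"
    and gf: "\<And>x. g x \<le> C * ((1 + norm x) powr (- m) * f x)"
    and i: "integrable lborel (\<lambda>x. f x powr q0)" and m: "m \<ge> 0" and q0: "q0 \<ge> 1" and q: "q > 0"
    and lower: "1 / q0 - 1 / real DIM('a) < 1 / q"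
    and upper: "1 / q < 1 - 1 / real DIM('a)" "1 / q < 1 / q0 + (m - 1) / real DIM('a)"
  shows "AE x in lborel. integrable lborel (\<lambda>y. kap (x - y) * g y)"
    and "integrable lborel (\<lambda>x. (LINT y|lborel. kap (x - y) * g y) powr q)"
proof -
  let ?n = "real DIM('a)"
  have n: "?n \<ge> 1" by (simp add: Suc_leI)
  then have n': "1 / ?n > 0" by simp
  have mn: "(m - 1) / ?n = m / ?n - 1 / ?n" by (simp add: diff_divide_distrib)
  have mn0: "m / ?n \<ge> 0" using m by simp
  have iq0: "1 / q0 > 0" "1 / q0 \<le> 1" using q0 by auto
  have iq: "1 / q > 0" using q by simp
  have q1: "q \<ge> 1" using upper(1) n' q by (smt (verit) le_divide_eq_1_pos)
  define u v w mw where "u = 1 / q0" and "v = 1 / q" and "w = 1 / ?n" and "mw = m / ?n"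
  note defs = u_def[symmetric] v_def[symmetric] w_def[symmetric] mw_def[symmetric]
  have uvw: "u - w < v" "v < 1 - w" "v < u + (mw - w)" "w > 0" "u > 0" "u \<le> 1" "v > 0" "mw \<ge> 0"
    using lower upper n' iq0 iq mn0 unfolding mn defs by auto
  \<comment> \<open>Reciprocals of the two source exponents, which may range over [u, u + mw) up to
    1. Near the singularity \<open>max u v\<close> is the smallest choice compatible with Young's
    inequality; far away \<open>b2\<close> is the midpoint of the gap between v + w and
    \<open>M\<close>, nonempty by the upper bounds on 1/q.\<close>
  define b1 where "b1 = max u v"
  define M where "M = min 1 (u + mw)"
  define b2 where "b2 = v / 2 + w / 2 + M / 2"
  have b1: "u \<le> b1" "v \<le> b1" "b1 \<le> 1" "b1 > 0" "b1 - w < v" "b1 < u + mw"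
    unfolding b1_def using uvw by (auto simp: max_def)
  have b2: "u \<le> b2" "b2 \<le> 1" "b2 > 0" "v < b2 - w" "b2 < u + mw"
  proof -
    have "M \<le> 1" "M \<le> u + mw" "v + w < M" unfolding M_def using uvw by auto
    then show "u \<le> b2" "b2 \<le> 1" "b2 > 0" "v < b2 - w" "b2 < u + mw"
      using uvw unfolding b2_def by - (linarith+)
  qed
  note b1 = b1[unfolded u_def v_def w_def mw_def] and b2 = b2[unfolded u_def v_def w_def mw_def]
  have g1: "integrable lborel (\<lambda>x. g x powr (1 / b1))"
    by (rule weighted_Lp[OF assms(1,2) f g C gf i m]) (use b1 q0 in auto)
  have g2: "integrable lborel (\<lambda>x. g x powr (1 / b2))"
    by (rule weighted_Lp[OF assms(1,2) f g C gf i m]) (use b2 q0 in auto)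
  show "AE x in lborel. integrable lborel (\<lambda>y. kap (x - y) * g y)"
    by (rule potential_Lq_two_sided(1)[OF assms(1) g g1 g2, of q]) (use b1 b2 q1 in auto)
  show "integrable lborel (\<lambda>x. (LINT y|lborel. kap (x - y) * g y) powr q)"
    by (rule potential_Lq_two_sided(2)[OF assms(1) g g1 g2, of q]) (use b1 b2 q1 in auto)
qed


section \<open>The fundamental solution\<close>

lemma integrable_dominated:
  fixes f :: "'a \<Rightarrow> 'b::{banach, second_countable_topology}"
  assumes "integrable M w" "f \<in> borel_measurable M" "\<And>x. norm (f x) \<le> (w x :: real)"
  shows "integrable M f"
  by (rule Bochner_Integration.integrable_bound[OF assms(1,2)])
    (auto intro!: AE_I2 order_trans[OF assms(3) abs_ge_self])

lemma integrable_indicator_ball [simp]: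
  "integrable lborel (indicat_real (cball c r) :: 'a::euclidean_space \<Rightarrow> real)"
  "integrable lborel (indicat_real (ball c r) :: 'a::euclidean_space \<Rightarrow> real)"
  using emeasure_lborel_cball_finite[of c r] emeasure_lborel_ball_finite[of c r]
  by (auto intro!: integrable_real_indicator)

lemma frechet_derivative_eq_sum:
  fixes \<phi> :: "real^'n::finite \<Rightarrow> complex"
  assumes "\<phi> differentiable at x"
  shows "frechet_derivative \<phi> (at x) h = (\<Sum>j\<in>UNIV. (h $ j) *\<^sub>R partial_deriv j \<phi> x)"
proof -
  have lin: "linear (frechet_derivative \<phi> (at x))"
    using assms frechet_derivative_works has_derivative_linear by blast
  have "h = (\<Sum>j\<in>UNIV. (h $ j) *\<^sub>R axis j 1)"
    using basis_expansion[of h] by (simp add: scalar_mult_eq_scaleR)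
  then have "frechet_derivative \<phi> (at x) h = frechet_derivative \<phi> (at x) (\<Sum>j\<in>UNIV. (h $ j) *\<^sub>R axis j 1)" by simp
  also have "\<dots> = (\<Sum>j\<in>UNIV. (h $ j) *\<^sub>R partial_deriv j \<phi> x)"
    using lin by (simp add: linear_sum linear_scale partial_deriv_def)
  finally show ?thesis .
qed

lemma test_function_lipschitz:
  fixes \<phi> :: "real^'n::finite \<Rightarrow> complex"
  assumes "test_function \<phi>"
  obtains L R where "L > 0" "R > 0" "\<And>x. norm (\<phi> x) \<le> L"
    "\<And>x h. norm (frechet_derivative \<phi> (at x) h) \<le> L * norm h"
    "\<And>x y. norm (\<phi> x - \<phi> y) \<le> L * norm (x - y)"
    "\<And>x. norm x \<ge> R \<Longrightarrow> \<phi> x = 0" "\<And>x h. norm x \<ge> R \<Longrightarrow> frechet_derivative \<phi> (at x) h = 0"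
proof -
  obtain M R where M: "M > 0" "R > 0" "\<And>x. norm (\<phi> x) \<le> M" "\<And>x. norm x \<ge> R \<Longrightarrow> \<phi> x = 0"
    using test_function_bounds[OF assms] by blast
  have "\<exists>M' R'. M' > 0 \<and> R' > 0 \<and> (\<forall>x. norm (partial_deriv j \<phi> x) \<le> M') \<and> (\<forall>x. norm x \<ge> R' \<longrightarrow> partial_deriv j \<phi> x = 0)" for j
    using test_function_bounds[OF test_function_partial[OF assms, of j]] by metis
  then obtain M' R' where M': "\<And>j. M' j > 0" "\<And>j. R' j > (0::real)"
      "\<And>j x. norm (partial_deriv j \<phi> x) \<le> M' j" "\<And>j x. norm x \<ge> R' j \<Longrightarrow> partial_deriv j \<phi> x = 0" by metis
  have sm: "\<phi> differentiable at x" for x using assms smooth_differentiable test_function_smooth by blast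
  define L where "L = M + (\<Sum>j\<in>UNIV. M' j)"
  define S where "S = R + (\<Sum>j\<in>UNIV. R' j)"
  have s0: "(\<Sum>j\<in>UNIV. M' j) \<ge> 0" "(\<Sum>j\<in>UNIV. R' j) \<ge> 0" using M'(1,2) by (auto intro!: sum_nonneg simp: less_imp_le)
  have SR: "R' j \<le> S" for j
    using member_le_sum[of j UNIV R'] M'(2) M(2) by (auto simp: S_def intro: less_imp_le add_increasing)
  have fd: "norm (frechet_derivative \<phi> (at x) h) \<le> L * norm h" for x h
  proof -
    have "norm (frechet_derivative \<phi> (at x) h) \<le> (\<Sum>j\<in>UNIV. norm ((h $ j) *\<^sub>R partial_deriv j \<phi> x))"
      unfolding frechet_derivative_eq_sum[OF sm] by (rule norm_sum)
    also have "\<dots> \<le> (\<Sum>j\<in>UNIV. norm h * M' j)"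
      using M'(3) by (intro sum_mono) (auto intro!: mult_mono component_le_norm_cart)
    also have "\<dots> = (\<Sum>j\<in>UNIV. M' j) * norm h" by (simp add: sum_distrib_left mult.commute)
    also have "\<dots> \<le> L * norm h" using M(1) by (intro mult_right_mono) (auto simp: L_def)
    finally show ?thesis .
  qed
  have L0: "L > 0" using M(1) s0 by (simp add: L_def)
  have lip: "norm (\<phi> x - \<phi> y) \<le> L * norm (x - y)" for x y
  proof (rule differentiable_bound[of UNIV \<phi> "\<lambda>x. frechet_derivative \<phi> (at x)"])
    show "(\<phi> has_derivative frechet_derivative \<phi> (at x)) (at x)" for x
      using sm frechet_derivative_works by blast
    show "onorm (frechet_derivative \<phi> (at x)) \<le> L" for x
      using fd by (intro onorm_le) (simp add: mult.commute)
  qed auto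
  have "norm (\<phi> x) \<le> L" for x using M(3)[of x] s0 by (simp add: L_def)
  moreover have "\<phi> x = 0" if "norm x \<ge> S" for x using that M(4)[of x] s0 by (auto simp: S_def)
  moreover have "frechet_derivative \<phi> (at x) h = 0" if "norm x \<ge> S" for x h
    unfolding frechet_derivative_eq_sum[OF sm] using M'(4) order_trans[OF SR that] by simp
  moreover have "S > 0" using M(2) s0 by (simp add: S_def)
  ultimately show ?thesis using that[of L S] fd L0 lip by blast
qed

lemma has_vector_derivative_line:
  fixes \<phi> :: "real^'n::finite \<Rightarrow> complex"
  assumes "\<phi> differentiable at x"
  shows "((\<lambda>s. \<phi> (x + s *\<^sub>R axis j 1)) has_vector_derivative partial_deriv j \<phi> x) (at 0)"
proof -
  have "((\<lambda>s::real. x + s *\<^sub>R axis j 1) has_derivative (\<lambda>s. s *\<^sub>R axis j 1)) (at 0)"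
    by (auto intro!: derivative_eq_intros)
  moreover have "(\<phi> has_derivative frechet_derivative \<phi> (at x)) (at (x + 0 *\<^sub>R axis j 1))"
    using assms by (simp add: frechet_derivative_works)
  ultimately have "((\<lambda>s. \<phi> (x + s *\<^sub>R axis j 1)) has_derivative (\<lambda>s. frechet_derivative \<phi> (at x) (s *\<^sub>R axis j 1))) (at 0)"
    using has_derivative_compose by fastforce
  moreover have "linear (frechet_derivative \<phi> (at x))"
    using assms frechet_derivative_works has_derivative_linear by blast
  ultimately show ?thesis
    by (simp add: has_vector_derivative_def linear_scale partial_deriv_def)
qed

text \<open>Integration by parts: the integral of a difference quotient vanishes by translation invariance.\<close>

lemma integral_line_derivative_zero:
  fixes F G :: "real^'n::finite \<Rightarrow> complex"
  assumes [measurable]: "F \<in> borel_measurable borel" "G \<in> borel_measurable borel"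
    and lip: "\<And>x y. norm (F x - F y) \<le> L * norm (x - y)"
    and supp: "\<And>x. norm x \<ge> R \<Longrightarrow> F x = 0"
    and der: "AE x in lborel. ((\<lambda>s. F (x + s *\<^sub>R axis j 1)) has_vector_derivative G x) (at 0)"
  shows "integrable lborel G" "(LINT x|lborel. G x) = 0"
proof -
  define e :: "real^'n" where "e = axis j 1"
  have ne: "norm e = 1" by (simp add: e_def)
  define s where "s k = 1 / real (Suc k)" for k
  have s: "s k > 0" "s k \<le> 1" for k by (auto simp: s_def)
  have s0: "s \<longlonglongrightarrow> 0" unfolding s_def by (rule LIMSEQ_Suc[OF lim_1_over_n])
  define q where "q k x = (F (x + s k *\<^sub>R e) - F x) /\<^sub>R s k" for k x
  \<comment> \<open>The extra 1 absorbs the shift by \<open>s k \<le> 1\<close> in the difference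
    quotients.\<close>
  define R' where "R' = \<bar>R\<bar> + 1"
  define w where "w x = \<bar>L\<bar> * indicator (cball (0::real^'n) R') x" for x
  have [measurable]: "cball (0::real^'n) R' \<in> sets borel" by simp
  have Fi: "integrable lborel F"
  proof (rule Bochner_Integration.integrable_bound)
    show "integrable lborel (\<lambda>x. (\<bar>L\<bar> * (2 * R')) * indicator (cball (0::real^'n) R') x)"
      by (intro integrable_mult_right integrable_indicator_ball)
    have "norm (F x) \<le> \<bar>L\<bar> * (2 * R') * indicator (cball 0 R') x" for x
    proof (cases "norm x \<le> R'")
      case True
      \<comment> \<open>A point where \<open>F\<close> vanishes; comparison with it makes the
        Lipschitz bound show that \<open>F\<close> is bounded.\<close>
      define p :: "real^'n" where "p = R' *\<^sub>R e"
      have np: "norm p = R'" using ne by (simp add: p_def R'_def)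
      have "norm (F x) = norm (F x - F p)" using supp[of p] np by (simp add: R'_def)
      also have "\<dots> \<le> L * norm (x - p)" by (rule lip)
      also have "\<dots> \<le> \<bar>L\<bar> * (2 * R')" using norm_triangle_ineq4[of x p] True np by (intro mult_mono) auto
      finally show ?thesis using True by simp
    next
      case False
      then show ?thesis using supp[of x] by (simp add: R'_def)
    qed
    then show "AE x in lborel. norm (F x) \<le> norm (\<bar>L\<bar> * (2 * R') * indicator (cball 0 R') x)"
      by (intro AE_I2) (auto intro: order_trans[OF _ abs_ge_self])
  qed simp
  have iq: "(LINT x|lborel. q k x) = 0" for k
  proof -
    have 1: "integrable lborel (\<lambda>x. F (x + s k *\<^sub>R e))" "(LINT x|lborel. F (x + s k *\<^sub>R e)) = (LINT x|lborel. F x)"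
      using integrable_lborel_translate[of F "s k *\<^sub>R e"] integral_lborel_translate[of F "s k *\<^sub>R e"] Fi
      by (simp_all add: add.commute)
    then show ?thesis unfolding q_def using Fi by simp
  qed
  have qb: "norm (q k x) \<le> w x" for k x
  proof (cases "norm x \<le> R'")
    case True
    have "norm (F (x + s k *\<^sub>R e) - F x) \<le> L * norm (s k *\<^sub>R e)" using lip[of "x + s k *\<^sub>R e" x] by simp
    also have "\<dots> = L * s k" using s(1)[of k] ne by simp
    also have "\<dots> \<le> \<bar>L\<bar> * s k" using s(1)[of k] by (intro mult_right_mono) auto
    finally show ?thesis using True s(1)[of k] by (simp add: q_def w_def divide_simps mult.commute)
  next
    case False
    have "norm (x + s k *\<^sub>R e) \<ge> norm x - norm (s k *\<^sub>R e)" by (metis diff_minus_eq_add norm_minus_cancel norm_triangle_ineq2)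
    then have "norm (x + s k *\<^sub>R e) \<ge> R" using False s[of k] ne by (simp add: R'_def)
    then show ?thesis using supp[of x] supp[of "x + s k *\<^sub>R e"] False by (simp add: q_def w_def R'_def)
  qed
  have lim: "AE x in lborel. (\<lambda>k. q k x) \<longlonglongrightarrow> G x"
    using der
  proof eventually_elim
    case (elim x)
    then have l: "((\<lambda>h. norm (F (x + h *\<^sub>R e) - F x - h *\<^sub>R G x) / norm h) \<longlongrightarrow> 0) (at 0)"
      unfolding has_vector_derivative_def has_derivative_at e_def by simp
    have "norm (F (x + h *\<^sub>R e) - F x - h *\<^sub>R G x) / norm h = norm ((F (x + h *\<^sub>R e) - F x) /\<^sub>R h - G x)"
      if "h \<noteq> 0" for h
    proof -
      have "(F (x + h *\<^sub>R e) - F x) /\<^sub>R h - G x = (F (x + h *\<^sub>R e) - F x - h *\<^sub>R G x) /\<^sub>R h"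
        using that by (simp add: scaleR_diff_right)
      then show ?thesis by (simp add: divide_inverse mult.commute)
    qed
    then have ev: "\<forall>\<^sub>F h in at 0. norm (F (x + h *\<^sub>R e) - F x - h *\<^sub>R G x) / norm h = norm ((F (x + h *\<^sub>R e) - F x) /\<^sub>R h - G x)"
      by (simp add: eventually_at_filter)
    have "((\<lambda>h. norm ((F (x + h *\<^sub>R e) - F x) /\<^sub>R h - G x)) \<longlongrightarrow> 0) (at 0)"
      by (rule tendsto_cong[THEN iffD1, OF ev l])
    then have "((\<lambda>h. (F (x + h *\<^sub>R e) - F x) /\<^sub>R h) \<longlongrightarrow> G x) (at 0)"
      by (rule LIM_zero_cancel[OF tendsto_norm_zero_cancel])
    then show ?case
      unfolding q_def by (rule filterlim_compose) (use s0 s(1) in \<open>auto simp: filterlim_at less_imp_neq[symmetric]\<close>)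
  qed
  have iw: "integrable lborel w"
    unfolding w_def by (intro integrable_mult_right integrable_indicator_ball)
  have [measurable]: "q k \<in> borel_measurable borel" for k unfolding q_def by measurable
  have m: "G \<in> borel_measurable lborel" "q k \<in> borel_measurable lborel" for k by auto
  show "integrable lborel G"
    by (rule integrable_dominated_convergence[OF m iw lim]) (use qb in auto)
  have "(\<lambda>k. LINT x|lborel. q k x) \<longlonglongrightarrow> (LINT x|lborel. G x)"
    by (rule integral_dominated_convergence[OF m iw lim]) (use qb in auto)
  then show "(LINT x|lborel. G x) = 0" by (simp add: iq LIMSEQ_const_iff)
qed

lemma integral_partial_deriv_zero:
  assumes "test_function \<phi>"
  shows "integrable lborel (partial_deriv j \<phi>)" "(LINT x|lborel. partial_deriv j \<phi> x) = 0"
proof -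
  obtain L R where L: "\<And>x y. norm (\<phi> x - \<phi> y) \<le> L * norm (x - y)" "\<And>x. norm x \<ge> R \<Longrightarrow> \<phi> x = 0"
    using test_function_lipschitz[OF assms] by metis
  have m: "\<phi> \<in> borel_measurable borel" "partial_deriv j \<phi> \<in> borel_measurable borel"
    using assms test_function_partial test_function_measurable by blast+
  have d: "AE x in lborel. ((\<lambda>s. \<phi> (x + s *\<^sub>R axis j 1)) has_vector_derivative partial_deriv j \<phi> x) (at 0)"
    using assms by (intro AE_I2 has_vector_derivative_line smooth_differentiable test_function_smooth)
  show "integrable lborel (partial_deriv j \<phi>)" "(LINT x|lborel. partial_deriv j \<phi> x) = 0"
    using integral_line_derivative_zero[OF m L d] by blast+
qed

section \<open>The Riesz kernel, its regularisation and the potential of a test function\<close>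

definition riesz :: "'n \<Rightarrow> real^'n::finite \<Rightarrow> real" where
  "riesz k z = z $ k / norm z ^ CARD('n)"

text \<open>The kernel made linear inside the ball of radius \<open>e\<close>. It is Lipschitz,
  differentiable along lines off the null sphere |z| = e, and has a symmetric Jacobian there; its
  divergence is n / e^n on the ball and 0 outside, an approximate identity of mass omega.\<close>

definition riesz_reg :: "real \<Rightarrow> 'n \<Rightarrow> real^'n::finite \<Rightarrow> real" where
  "riesz_reg e k z = z $ k / max (norm z) e ^ CARD('n)"

definition riesz_reg_deriv :: "real \<Rightarrow> 'n \<Rightarrow> 'n \<Rightarrow> real^'n::finite \<Rightarrow> real" where
  "riesz_reg_deriv e j k z = (if norm z < e then (if j = k then 1 / e ^ CARD('n) else 0)
     else (if j = k then 1 / norm z ^ CARD('n) else 0)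
       - real CARD('n) * (z $ j * z $ k) / norm z ^ (CARD('n) + 2))"

lemma riesz_measurable [measurable]: "riesz k \<in> borel_measurable borel"
  "riesz_reg e k \<in> borel_measurable borel" "riesz_reg_deriv e j k \<in> borel_measurable borel"
proof -
  have [measurable]: "(\<lambda>z::real^'a. z $ i) \<in> borel_measurable borel" for i
    by (intro borel_measurable_continuous_onI continuous_intros)
  show "riesz k \<in> borel_measurable borel" unfolding riesz_def[abs_def] by measurable
  show "riesz_reg e k \<in> borel_measurable borel" unfolding riesz_reg_def[abs_def] by measurable
  show "riesz_reg_deriv e j k \<in> borel_measurable borel" unfolding riesz_reg_deriv_def[abs_def] by measurable
qed

lemma kap_eq: "z \<noteq> 0 \<Longrightarrow> kap (z::real^'n::finite) = norm z / norm z ^ CARD('n)"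
  by (simp add: kap_def powr_diff powr_realpow)

lemma riesz_le_kap: "\<bar>riesz k z\<bar> \<le> kap z"
proof (cases "z = 0")
  case False
  then show ?thesis by (simp add: riesz_def kap_eq component_le_norm_cart divide_right_mono)
qed (simp add: riesz_def)

lemma riesz_reg_le_kap: assumes "e > 0" shows "\<bar>riesz_reg e k z\<bar> \<le> kap z"
proof (cases "z = 0")
  case False
  have "\<bar>z $ k\<bar> / max (norm z) e ^ CARD('a) \<le> norm z / norm z ^ CARD('a)"
    using False by (intro frac_le component_le_norm_cart power_mono) auto
  then show ?thesis using False assms by (simp add: riesz_reg_def kap_eq less_max_iff_disj)
qed (simp add: riesz_reg_def)

lemma riesz_reg_tendsto: "(\<lambda>i. riesz_reg (1 / real (Suc i)) k z) \<longlonglongrightarrow> riesz k z"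
proof (cases "z = 0")
  case False
  have "\<forall>\<^sub>F i in sequentially. 1 / real (Suc i) < norm z"
    using order_tendstoD(2)[OF LIMSEQ_Suc[OF lim_1_over_n], of "norm z"] False by simp
  then have "\<forall>\<^sub>F i in sequentially. riesz_reg (1 / real (Suc i)) k z = riesz k z"
    by eventually_elim (auto simp: riesz_reg_def riesz_def max_def)
  then show ?thesis by (rule tendsto_eventually)
qed (simp add: riesz_reg_def riesz_def)

lemma riesz_reg_lipschitz:
  fixes a b :: "real^'n::finite"
  assumes e: "e > 0"
  shows "\<bar>riesz_reg e k a - riesz_reg e k b\<bar> \<le> (real CARD('n) + 1) / e ^ CARD('n) * norm (a - b)"
proof -
  let ?n = "CARD('n)"
  define A where "A = max (norm a) e"
  define B where "B = max (norm b) e"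
  have AB: "A \<ge> e" "B \<ge> e" "A > 0" "B > 0" "norm b \<le> B" using e by (auto simp: A_def B_def)
  have dAB: "\<bar>A - B\<bar> \<le> norm (a - b)"
    unfolding A_def B_def using norm_triangle_ineq3[of a b] by (auto simp: max_def)
  \<comment> \<open>Scaling by \<open>e\<close> puts both quotients into [0, 1], where the n-th
    power has Lipschitz constant n.\<close>
  have "\<bar>(e / A) ^ ?n - (e / B) ^ ?n\<bar> \<le> real ?n * \<bar>e / A - e / B\<bar>"
    using norm_power_diff[of "e / A" "e / B" ?n] AB e by simp
  also have "e / A - e / B = e * (B - A) / (A * B)" using AB by (simp add: field_simps)
  also have "real ?n * \<bar>\<dots>\<bar> = real ?n * (e * \<bar>A - B\<bar> / (A * B))" using AB e by (simp add: abs_mult abs_minus_commute)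
  also have "(e / A) ^ ?n - (e / B) ^ ?n = e ^ ?n * (1 / A ^ ?n - 1 / B ^ ?n)" by (simp add: power_divide algebra_simps)
  finally have "e ^ ?n * \<bar>1 / A ^ ?n - 1 / B ^ ?n\<bar> \<le> real ?n * (e * \<bar>A - B\<bar> / (A * B))" using e by (simp add: abs_mult)
  then have p: "\<bar>1 / A ^ ?n - 1 / B ^ ?n\<bar> \<le> real ?n * (e * \<bar>A - B\<bar> / (A * B)) / e ^ ?n"
    by (simp only: pos_le_divide_eq[OF zero_less_power[OF e]] mult.commute)
  have "riesz_reg e k a - riesz_reg e k b = (a $ k - b $ k) / A ^ ?n + b $ k * (1 / A ^ ?n - 1 / B ^ ?n)"
    by (simp add: riesz_reg_def A_def B_def algebra_simps diff_divide_distrib)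
  then have "\<bar>riesz_reg e k a - riesz_reg e k b\<bar> \<le> \<bar>(a $ k - b $ k) / A ^ ?n\<bar> + \<bar>b $ k * (1 / A ^ ?n - 1 / B ^ ?n)\<bar>"
    by (simp only: abs_triangle_ineq)
  also have "\<bar>(a $ k - b $ k) / A ^ ?n\<bar> \<le> norm (a - b) / e ^ ?n"
    using component_le_norm_cart[of "a - b" k] AB e by (auto simp: abs_mult intro!: frac_le power_mono)
  also have "\<bar>b $ k * (1 / A ^ ?n - 1 / B ^ ?n)\<bar> \<le> B * (real ?n * (e * \<bar>A - B\<bar> / (A * B)) / e ^ ?n)"
    unfolding abs_mult using p AB component_le_norm_cart[of b k] by (intro mult_mono) auto
  also have "\<dots> = real ?n * ((e / A) * \<bar>A - B\<bar>) / e ^ ?n" using AB by simp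
  also have "\<dots> \<le> real ?n * (1 * norm (a - b)) / e ^ ?n"
    using AB e dAB by (intro divide_right_mono mult_left_mono mult_mono) auto
  finally show ?thesis by (simp add: algebra_simps add_divide_distrib)
qed

lemma riesz_reg_line_derivative:
  fixes z :: "real^'n::finite"
  assumes e: "e > 0" and z: "norm z \<noteq> e"
  shows "((\<lambda>s. riesz_reg e k (z + s *\<^sub>R axis j 1)) has_real_derivative riesz_reg_deriv e j k z) (at 0)"
proof -
  let ?n = "CARD('n)"
  let ?l = "\<lambda>s::real. z + s *\<^sub>R axis j 1"
  have lk: "?l s $ k = z $ k + (if j = k then s else 0)" for s by (simp add: axis_def)
  have "isCont (\<lambda>s. norm (?l s)) 0" by (intro continuous_intros)
  then have cont: "((\<lambda>s. norm (?l s)) \<longlongrightarrow> norm (?l 0)) (nhds 0)"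
    unfolding isCont_def by (rule tendsto_at_iff_tendsto_nhds[of "\<lambda>s. norm (?l s)" 0, THEN iffD1])
  have dk: "((\<lambda>s. ?l s $ k) has_real_derivative (if j = k then 1 else 0)) (at 0)"
    unfolding lk by (cases "j = k") (auto intro!: derivative_eq_intros)
  show ?thesis
  proof (cases "norm z < e")
    case True
    have ev: "\<forall>\<^sub>F s in nhds 0. norm (?l s) < e"
      using order_tendstoD(2)[OF cont, of e] True by simp
    have d: "((\<lambda>s. ?l s $ k / e ^ ?n) has_real_derivative (if j = k then 1 else 0) / e ^ ?n) (at 0)"
      by (rule DERIV_cdivide[OF dk])
    have "\<forall>\<^sub>F s in nhds 0. ?l s $ k / e ^ ?n = riesz_reg e k (?l s)"
      using ev by eventually_elim (simp add: riesz_reg_def max_def)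
    from DERIV_cong_ev[OF refl this refl, THEN iffD1, OF d] have "((\<lambda>s. riesz_reg e k (?l s)) has_real_derivative (if j = k then 1 else 0) / e ^ ?n) (at 0)" .
    then show ?thesis using True by (auto simp: riesz_reg_deriv_def)
  next
    case False
    then have ze: "norm z > e" and z0: "z \<noteq> 0" using z e by auto
    have ev: "\<forall>\<^sub>F s in nhds 0. norm (?l s) > e"
      using order_tendstoD(1)[OF cont, of e] ze by simp
    have "((\<lambda>s. norm (?l s)) has_derivative (\<lambda>s. (s *\<^sub>R axis j 1) \<bullet> sgn z)) (at 0)"
    proof (rule has_derivative_compose[of ?l "\<lambda>s. s *\<^sub>R axis j 1" 0 UNIV norm "\<lambda>h. h \<bullet> sgn z"])
      show "(?l has_derivative (\<lambda>s. s *\<^sub>R axis j 1)) (at 0)" by (auto intro!: derivative_eq_intros)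
      show "(norm has_derivative (\<lambda>h. h \<bullet> sgn z)) (at (z + 0 *\<^sub>R axis j 1))"
        using has_derivative_norm[OF z0] by (simp add: inner_commute)
    qed
    then have dn: "((\<lambda>s. norm (?l s)) has_real_derivative z $ j / norm z) (at 0)"
    proof -
      have "(\<lambda>s. (s *\<^sub>R axis j 1) \<bullet> sgn z) = (*) (z $ j / norm z)"
        by (simp add: fun_eq_iff inner_axis' sgn_div_norm divide_inverse mult_ac)
      with \<open>((\<lambda>s. norm (?l s)) has_derivative (\<lambda>s. (s *\<^sub>R axis j 1) \<bullet> sgn z)) (at 0)\<close>
      show ?thesis by (simp only: has_field_derivative_def)
    qed
    have "((\<lambda>s. ?l s $ k / norm (?l s) ^ ?n) has_real_derivative
       ((if j = k then 1 else 0) * norm (?l 0) ^ ?n - ?l 0 $ k * (real ?n * (norm (?l 0) ^ (?n - Suc 0) * (z $ j / norm z))))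
         / (norm (?l 0) ^ ?n * norm (?l 0) ^ ?n)) (at 0)"
      using z0 by (intro DERIV_divide dk DERIV_power dn[THEN DERIV_cong]) (auto intro!: DERIV_cong[OF DERIV_power[OF dn]])
    also have "((if j = k then 1 else 0) * norm (?l 0) ^ ?n - ?l 0 $ k * (real ?n * (norm (?l 0) ^ (?n - Suc 0) * (z $ j / norm z))))
         / (norm (?l 0) ^ ?n * norm (?l 0) ^ ?n) = riesz_reg_deriv e j k z"
    proof -
      obtain m where m: "?n = Suc m" using zero_less_card_finite gr0_implies_Suc by blast
      show ?thesis using ze z0 by (auto simp: riesz_reg_deriv_def m field_simps power_add power2_eq_square)
    qed
    finally have d: "((\<lambda>s. ?l s $ k / norm (?l s) ^ ?n) has_real_derivative riesz_reg_deriv e j k z) (at 0)" .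
    have "\<forall>\<^sub>F s in nhds 0. ?l s $ k / norm (?l s) ^ ?n = riesz_reg e k (?l s)"
      using ev by eventually_elim (simp add: riesz_reg_def max_def)
    from DERIV_cong_ev[OF refl this refl, THEN iffD1, OF d] show ?thesis .
  qed
qed

lemma riesz_reg_deriv_sym: "riesz_reg_deriv e j k z = riesz_reg_deriv e k j z"
  by (auto simp: riesz_reg_deriv_def mult.commute)

lemma riesz_reg_div:
  fixes z :: "real^'n::finite"
  assumes "e > 0"
  shows "(\<Sum>k\<in>UNIV. riesz_reg_deriv e k k z) = (real CARD('n) / e ^ CARD('n)) * indicator (ball 0 e) z"
proof (cases "norm z < e")
  case False
  then have z: "norm z \<noteq> 0" using assms by auto
  have "(\<Sum>k\<in>UNIV. z $ k * z $ k) = (norm z)\<^sup>2"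
    by (simp add: norm_vec_def L2_set_def real_sqrt_pow2 sum_nonneg power2_eq_square)
  then have "(\<Sum>k\<in>UNIV. riesz_reg_deriv e k k z) = real CARD('n) / norm z ^ CARD('n) - real CARD('n) * (norm z)\<^sup>2 / norm z ^ (CARD('n) + 2)"
    using False by (simp add: riesz_reg_deriv_def sum_subtractf sum_divide_distrib[symmetric] sum_distrib_left[symmetric])
  moreover have "real CARD('n) * (norm z)\<^sup>2 / norm z ^ (CARD('n) + 2) = real CARD('n) / norm z ^ CARD('n)"
    using z by (simp add: power_add power2_eq_square)
  ultimately have "(\<Sum>k\<in>UNIV. riesz_reg_deriv e k k z) = 0" by (simp only: diff_self)
  then show ?thesis using False by simp
qed (simp add: riesz_reg_deriv_def)

lemma kap_le_near: "kap z \<le> kap_near z + 1"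
proof (cases "norm z \<le> 1")
  case False
  have "real DIM('a) \<ge> 1" by (simp add: Suc_leI)
  then have "norm z powr (1 - real DIM('a)) \<le> norm z powr 0" using False by (intro powr_mono) auto
  moreover have "z \<noteq> 0" using False by auto
  ultimately show ?thesis using False by (simp add: kap_def kap_near_def)
qed (simp add: kap_near_def)

lemma integrable_kap_near_1: "integrable lborel (kap_near :: 'a::euclidean_space \<Rightarrow> real)"
  using integrable_kap_near[of 1, where 'a='a] by simp

text \<open>Integrable majorant of the kernel on the ball of radius \<open>r\<close>: off the unit
  ball the kernel is at most 1. A function supported in radius R and evaluated at y + z confines z
  to radius R + |y|.\<close>

definition kap_dom :: "real \<Rightarrow> 'a::euclidean_space \<Rightarrow> real" where
  "kap_dom r z = kap_near z + indicator (cball 0 r) z"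

lemma kap_dom_integrable: "integrable lborel (kap_dom r :: 'a::euclidean_space \<Rightarrow> real)"
  unfolding kap_dom_def[abs_def]
  by (intro Bochner_Integration.integrable_add integrable_kap_near_1 integrable_indicator_ball)

lemma kernel_bound:
  fixes f :: "'a::euclidean_space \<Rightarrow> complex"
  assumes K: "\<bar>K z\<bar> \<le> kap z" and M: "\<And>x. norm (f x) \<le> M" and R: "\<And>x. norm x \<ge> R \<Longrightarrow> f x = 0"
  shows "norm (of_real (K z) * f (y + z)) \<le> M * kap_dom (R + norm y) z"
proof (cases "norm (y + z) \<ge> R")
  case True
  have "0 \<le> M" using M[of 0] norm_ge_zero order_trans by blast
  then have "0 \<le> M * kap_dom (R + norm y) z" by (simp add: kap_dom_def)
  then show ?thesis using R[OF True] by simp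
next
  case False
  then have "norm z \<le> R + norm y" using norm_triangle_ineq4[of "y + z" y] by simp
  then have "kap z \<le> kap_dom (R + norm y) z" using kap_le_near[of z] by (simp add: kap_dom_def)
  then have "\<bar>K z\<bar> * norm (f (y + z)) \<le> kap_dom (R + norm y) z * M" using K M by (intro mult_mono) (auto simp: kap_dom_def)
  then show ?thesis by (simp add: norm_mult mult.commute)
qed

lemma kernel_integrable:
  fixes f :: "'a::euclidean_space \<Rightarrow> complex"
  assumes [measurable]: "K \<in> borel_measurable borel" "f \<in> borel_measurable borel"
    and K: "\<And>z. \<bar>K z\<bar> \<le> kap z" and M: "\<And>x. norm (f x) \<le> M" and R: "\<And>x. norm x \<ge> R \<Longrightarrow> f x = 0"
  shows "integrable lborel (\<lambda>z. of_real (K z) * f (y + z))"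
  by (rule Bochner_Integration.integrable_bound[of _ "\<lambda>z. M * kap_dom (R + norm y) z"])
    (auto intro!: integrable_mult_right kap_dom_integrable AE_I2 order_trans[OF kernel_bound[OF K M R] abs_ge_self])

text \<open>The variable \<open>y\<close> enters only through \<open>\<phi>\<close>, so derivatives
  fall on the test function and smoothness follows by coinduction. The operator is the transpose of
  convolution with the kernel, whence the minus sign in \<open>zeta_div\<close>.\<close>

definition zeta :: "'n \<Rightarrow> (real^'n::finite \<Rightarrow> complex) \<Rightarrow> real^'n \<Rightarrow> complex" where
  "zeta k \<phi> y = (LINT z|lborel. of_real (riesz k z) * \<phi> (y + z))"

lemma zeta_integrable:
  assumes "test_function \<phi>" shows "integrable lborel (\<lambda>z. of_real (riesz k z) * \<phi> (y + z))"
proof -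
  obtain M R where "\<And>x. norm (\<phi> x) \<le> M" "\<And>x. norm x \<ge> R \<Longrightarrow> \<phi> x = 0"
    using test_function_bounds[OF assms] by metis
  then show ?thesis
    using assms by (intro kernel_integrable[of "riesz k" \<phi> M R] riesz_le_kap test_function_measurable) auto
qed

text \<open>Dominated convergence is a statement about sequences, so the derivative of an integral
  is tested along sequences of increments.\<close>

lemma has_derivative_sequentiallyI:
  fixes f :: "'a::real_normed_vector \<Rightarrow> 'b::real_normed_vector"
  assumes "bounded_linear D"
    and "\<And>X. (\<And>i. X i \<noteq> 0) \<Longrightarrow> X \<longlonglongrightarrow> 0 \<Longrightarrow> (\<lambda>i. norm (f (x + X i) - f x - D (X i)) / norm (X i)) \<longlonglongrightarrow> 0"
  shows "(f has_derivative D) (at x)"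
  unfolding has_derivative_at tendsto_at_iff_sequentially comp_def using assms by simp

lemma has_derivative_sequentiallyD:
  fixes f :: "'a::real_normed_vector \<Rightarrow> 'b::real_normed_vector"
  assumes "(f has_derivative D) (at x)" "\<And>i. X i \<noteq> 0" "X \<longlonglongrightarrow> 0"
  shows "(\<lambda>i. norm (f (x + X i) - f x - D (X i)) / norm (X i)) \<longlonglongrightarrow> 0"
  using assms unfolding has_derivative_at tendsto_at_iff_sequentially comp_def by simp

lemma zeta_has_derivative:
  fixes \<phi> :: "real^'n::finite \<Rightarrow> complex"
  assumes \<phi>: "test_function \<phi>"
  shows "(zeta k \<phi> has_derivative (\<lambda>h. \<Sum>j\<in>UNIV. (h $ j) *\<^sub>R zeta k (partial_deriv j \<phi>) y)) (at y)"
proof (rule has_derivative_sequentiallyI)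
  show "bounded_linear (\<lambda>h. \<Sum>j\<in>UNIV. (h $ j) *\<^sub>R zeta k (partial_deriv j \<phi>) y)"
    by (intro bounded_linear_sum bounded_linear_scaleR_const bounded_linear_vec_nth)
next
  fix X :: "nat \<Rightarrow> real^'n" assume X: "\<And>i. X i \<noteq> 0" "X \<longlonglongrightarrow> 0"
  obtain H where H: "H > 0" "\<And>i. norm (X i) \<le> H"
    using X(2) convergentI convergent_imp_Bseq BseqE by metis
  obtain L R where L: "L > 0" "R > 0" "\<And>x. norm (\<phi> x) \<le> L"
    "\<And>x h. norm (frechet_derivative \<phi> (at x) h) \<le> L * norm h"
    "\<And>x y. norm (\<phi> x - \<phi> y) \<le> L * norm (x - y)"
    "\<And>x. norm x \<ge> R \<Longrightarrow> \<phi> x = 0" "\<And>x h. norm x \<ge> R \<Longrightarrow> frechet_derivative \<phi> (at x) h = 0"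
    using test_function_lipschitz[OF \<phi>] by metis
  have diff: "\<phi> differentiable at x" for x using \<phi> smooth_differentiable test_function_smooth by blast
  \<comment> \<open>Normalised first-order remainder of \<open>\<phi>\<close>. It is bounded by
    \<open>2 * L\<close>, vanishes outside radius \<open>R + H\<close> for every \<open>i\<close>
    and tends to 0 pointwise, so its potential tends to 0.\<close>
  define q where "q i x = (\<phi> (x + X i) - \<phi> x - (\<Sum>j\<in>UNIV. (X i $ j) *\<^sub>R partial_deriv j \<phi> x)) /\<^sub>R norm (X i)" for i x
  have [measurable]: "\<phi> \<in> borel_measurable borel" "partial_deriv j \<phi> \<in> borel_measurable borel" for j
    using \<phi> test_function_partial test_function_measurable by blast+
  have [measurable]: "q i \<in> borel_measurable borel" for i unfolding q_def by measurable
  have qM: "norm (q i x) \<le> 2 * L" for i x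
  proof -
    have "norm (\<phi> (x + X i) - \<phi> x - frechet_derivative \<phi> (at x) (X i)) \<le> L * norm (X i) + L * norm (X i)"
      using L(4)[of x "X i"] L(5)[of "x + X i" x] norm_triangle_ineq4[of "\<phi> (x + X i) - \<phi> x" "frechet_derivative \<phi> (at x) (X i)"] by simp
    then have "norm (\<phi> (x + X i) - \<phi> x - frechet_derivative \<phi> (at x) (X i)) / norm (X i) \<le> 2 * L"
      using X(1)[of i] by (simp add: pos_divide_le_eq)
    then show ?thesis
      by (simp add: q_def frechet_derivative_eq_sum[OF diff] divide_inverse mult.commute)
  qed
  have qR: "q i x = 0" if "norm x \<ge> R + H" for i x
  proof -
    have "norm (x + X i) \<ge> norm x - norm (X i)" by (metis diff_minus_eq_add norm_minus_cancel norm_triangle_ineq2)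
    then have "norm (x + X i) \<ge> R" using that H(2)[of i] by linarith
    then show ?thesis using L(6)[of x] L(6)[of "x + X i"] L(7)[of x "X i"] that H(1)
      by (simp add: q_def frechet_derivative_eq_sum[OF diff])
  qed
  have qlim: "(\<lambda>i. q i x) \<longlonglongrightarrow> 0" for x
  proof (rule tendsto_norm_zero_cancel)
    have "(\<phi> has_derivative frechet_derivative \<phi> (at x)) (at x)" using diff frechet_derivative_works by blast
    from has_derivative_sequentiallyD[OF this X] show "(\<lambda>i. norm (q i x)) \<longlonglongrightarrow> 0"
      by (simp add: q_def frechet_derivative_eq_sum[OF diff] divide_inverse mult.commute)
  qed
  have "(\<lambda>i. LINT z|lborel. of_real (riesz k z) * q i (y + z)) \<longlonglongrightarrow> (LINT z|(lborel :: (real^'n) measure). 0)"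
  proof (rule integral_dominated_convergence[where w="\<lambda>z. (2 * L) * kap_dom (R + H + norm y) z"])
    show "integrable lborel (\<lambda>z::real^'n. (2 * L) * kap_dom (R + H + norm y) z)"
      by (intro integrable_mult_right kap_dom_integrable)
    show "AE z in lborel. (\<lambda>i. of_real (riesz k z) * q i (y + z)) \<longlonglongrightarrow> 0"
      by (intro AE_I2 tendsto_mult_right_zero qlim)
    show "AE z in lborel. norm (of_real (riesz k z) * q i (y + z)) \<le> (2 * L) * kap_dom (R + H + norm y) z" for i
      by (intro AE_I2 kernel_bound riesz_le_kap qM qR)
  qed measurable
  moreover have "norm (LINT z|lborel. of_real (riesz k z) * q i (y + z)) =
     norm (zeta k \<phi> (y + X i) - zeta k \<phi> y - (\<Sum>j\<in>UNIV. (X i $ j) *\<^sub>R zeta k (partial_deriv j \<phi>) y)) / norm (X i)" for i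
  proof -
    have 1: "of_real (riesz k z) * q i (y + z) = (of_real (riesz k z) * \<phi> ((y + X i) + z) - of_real (riesz k z) * \<phi> (y + z)
        - (\<Sum>j\<in>UNIV. (X i $ j) *\<^sub>R (of_real (riesz k z) * partial_deriv j \<phi> (y + z)))) /\<^sub>R norm (X i)" for z
      by (simp add: q_def algebra_simps sum_distrib_left scaleR_diff_right)
    have "(LINT z|lborel. of_real (riesz k z) * q i (y + z)) =
       (zeta k \<phi> (y + X i) - zeta k \<phi> y - (\<Sum>j\<in>UNIV. (X i $ j) *\<^sub>R zeta k (partial_deriv j \<phi>) y)) /\<^sub>R norm (X i)"
      unfolding 1 zeta_def using \<phi> test_function_partial[OF \<phi>]
      by (simp add: zeta_integrable Bochner_Integration.integrable_diff Bochner_Integration.integrable_sum)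
    then show ?thesis by (simp add: divide_inverse mult.commute)
  qed
  ultimately show "(\<lambda>i. norm (zeta k \<phi> (y + X i) - zeta k \<phi> y - (\<Sum>j\<in>UNIV. (X i $ j) *\<^sub>R zeta k (partial_deriv j \<phi>) y)) / norm (X i)) \<longlonglongrightarrow> 0"
    using tendsto_norm_zero by fastforce
qed

lemma zeta_partial:
  assumes "test_function \<phi>" shows "partial_deriv j (zeta k \<phi>) = zeta k (partial_deriv j \<phi>)"
proof
  fix y
  have "partial_deriv j (zeta k \<phi>) y = (\<Sum>i\<in>UNIV. (axis j 1 $ i) *\<^sub>R zeta k (partial_deriv i \<phi>) y)"
    by (rule partial_deriv_eqI[OF zeta_has_derivative[OF assms]])
  also have "\<dots> = (\<Sum>i\<in>UNIV. if i = j then zeta k (partial_deriv i \<phi>) y else 0)"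
    by (intro sum.cong) (auto simp: axis_def)
  finally show "partial_deriv j (zeta k \<phi>) y = zeta k (partial_deriv j \<phi>) y" by simp
qed

lemma zeta_smooth: assumes "test_function \<phi>" shows "smooth (zeta k \<phi>)"
proof (rule smooth_coinduct[of _ "{zeta k \<phi> |\<phi>. test_function \<phi>}"])
  fix f j assume "f \<in> {zeta k \<phi> |\<phi>. test_function \<phi>}"
  then obtain \<psi> where f: "f = zeta k \<psi>" "test_function \<psi>" by blast
  show "f differentiable_on UNIV"
    unfolding f differentiable_on_def differentiable_def using zeta_has_derivative[OF f(2)] by blast
  show "partial_deriv j f \<in> {zeta k \<phi> |\<phi>. test_function \<phi>}"
    unfolding f zeta_partial[OF f(2)] using test_function_partial[OF f(2)] by blast
qed (use assms in blast)

text \<open>A derivative of the kernel itself has a singularity of order |z|^(-n), which is not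
  integrable. Integration by parts is therefore done with the regularised kernel, and the limit is
  taken afterwards; in this form the symmetry and the trace of the Jacobian become visible.\<close>

lemma zeta_partial_limit:
  fixes \<phi> :: "real^'n::finite \<Rightarrow> complex"
  assumes \<phi>: "test_function \<phi>"
  shows "integrable lborel (\<lambda>z. of_real (riesz_reg_deriv (1 / real (Suc i)) j k z) * \<phi> (y + z))"
    and "(\<lambda>i. - (LINT z|lborel. of_real (riesz_reg_deriv (1 / real (Suc i)) j k z) * \<phi> (y + z)))
           \<longlonglongrightarrow> partial_deriv j (zeta k \<phi>) y"
proof -
  define e where "e i = 1 / real (Suc i)" for i
  have e: "e i > 0" for i by (simp add: e_def)
  obtain L R where L: "L > 0" "R > 0" "\<And>x. norm (\<phi> x) \<le> L"
    "\<And>x y. norm (\<phi> x - \<phi> y) \<le> L * norm (x - y)" "\<And>x. norm x \<ge> R \<Longrightarrow> \<phi> x = 0"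
    using test_function_lipschitz[OF \<phi>] by metis
  have [measurable]: "\<phi> \<in> borel_measurable borel" "partial_deriv j \<phi> \<in> borel_measurable borel" for j
    using \<phi> test_function_partial test_function_measurable by blast+
  obtain M' R' where M': "\<And>x. norm (partial_deriv j \<phi> x) \<le> M'" "\<And>x. norm x \<ge> R' \<Longrightarrow> partial_deriv j \<phi> x = 0"
    using test_function_bounds[OF test_function_partial[OF \<phi>, of j]] by metis
  have i1: "integrable lborel (\<lambda>z. of_real (riesz_reg (e i) k z) * partial_deriv j \<phi> (y + z))" for i
    by (rule kernel_integrable[OF _ _ riesz_reg_le_kap[OF e] M']) auto
  have sph: "AE z in lborel. norm (z::real^'n) \<noteq> e i" for i
  proof -
    have "sphere (0::real^'n) (e i) \<in> null_sets lborel"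
      using negligible_sphere[of "0::real^'n" "e i"] by (auto simp: null_sets_completion_iff negligible_iff_null_sets)
    from AE_not_in[OF this] show ?thesis by eventually_elim simp
  qed
  have parts: "integrable lborel (\<lambda>z. of_real (riesz_reg_deriv (e i) j k z) * \<phi> (y + z)) \<and>
     (LINT z|lborel. of_real (riesz_reg (e i) k z) * partial_deriv j \<phi> (y + z))
      = - (LINT z|lborel. of_real (riesz_reg_deriv (e i) j k z) * \<phi> (y + z))" for i
  proof -
    define F where "F z = of_real (riesz_reg (e i) k z) * \<phi> (y + z)" for z
    define G where "G z = of_real (riesz_reg (e i) k z) * partial_deriv j \<phi> (y + z) + of_real (riesz_reg_deriv (e i) j k z) * \<phi> (y + z)" for z
    define n where "n = CARD('n)"
    have [measurable]: "F \<in> borel_measurable borel" "G \<in> borel_measurable borel"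
      unfolding F_def G_def by measurable
    define P where "P = (real n + 1) / e i ^ n"
    have P0: "P \<ge> 0" using e[of i] by (simp add: P_def)
    define B where "B = (\<bar>R\<bar> + norm y) / e i ^ n"
    have B0: "B \<ge> 0" using e[of i] by (simp add: B_def)
    have rb: "\<bar>riesz_reg (e i) k z\<bar> \<le> B" if "norm (y + z) < R" for z
    proof -
      have "norm z \<le> \<bar>R\<bar> + norm y" using that norm_triangle_ineq4[of "y + z" y] by simp
      then have "\<bar>z $ k\<bar> \<le> \<bar>R\<bar> + norm y" using component_le_norm_cart[of z k] by linarith
      then have "\<bar>z $ k\<bar> / max (norm z) (e i) ^ n \<le> (\<bar>R\<bar> + norm y) / e i ^ n"
        using e[of i] by (intro frac_le power_mono) auto
      then show ?thesis using e[of i] by (simp add: riesz_reg_def B_def n_def less_max_iff_disj)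
    qed
    \<comment> \<open>The bound \<open>B\<close> on the kernel is available where y + b lies in the
      ball carrying \<open>\<phi>\<close>, so the product estimate asks this of one endpoint. The
      general case follows by exchanging the endpoints or because both values vanish.\<close>
    have lip1: "norm (F a - F b) \<le> (P * L + B * L) * norm (a - b)" if b: "norm (y + b) < R" for a b
    proof -
      have "F a - F b = of_real (riesz_reg (e i) k a - riesz_reg (e i) k b) * \<phi> (y + a)
           + of_real (riesz_reg (e i) k b) * (\<phi> (y + a) - \<phi> (y + b))" by (simp add: F_def algebra_simps)
      then have "norm (F a - F b) \<le> \<bar>riesz_reg (e i) k a - riesz_reg (e i) k b\<bar> * norm (\<phi> (y + a))
           + \<bar>riesz_reg (e i) k b\<bar> * norm (\<phi> (y + a) - \<phi> (y + b))"
        by (metis norm_triangle_ineq norm_mult norm_of_real)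
      also have "\<dots> \<le> (P * norm (a - b)) * L + B * (L * norm (a - b))"
      proof (intro add_mono mult_mono)
        show "\<bar>riesz_reg (e i) k a - riesz_reg (e i) k b\<bar> \<le> P * norm (a - b)"
          unfolding P_def n_def by (rule riesz_reg_lipschitz[OF e])
        show "norm (\<phi> (y + a) - \<phi> (y + b)) \<le> L * norm (a - b)" using L(4)[of "y + a" "y + b"] by simp
        show "\<bar>riesz_reg (e i) k b\<bar> \<le> B" using rb b by blast
      qed (use L P0 B0 in auto)
      finally show ?thesis by (simp add: algebra_simps)
    qed
    have lip: "norm (F a - F b) \<le> (P * L + B * L) * norm (a - b)" for a b
    proof -
      consider "norm (y + b) < R" | "norm (y + a) < R" | "norm (y + a) \<ge> R" "norm (y + b) \<ge> R" by linarith
      then show ?thesis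
      proof cases
        case 2
        then show ?thesis using lip1[of a b] lip1[of b a] by (metis norm_minus_commute lip1)
      next
        case 3
        then show ?thesis using L P0 B0 by (simp add: F_def)
      qed (rule lip1)
    qed
    have supp: "F z = 0" if "norm z \<ge> R + norm y" for z
    proof -
      have "norm z \<le> norm (y + z) + norm y" using norm_triangle_ineq4[of "y + z" y] by simp
      then show ?thesis using L(5)[of "y + z"] that by (simp add: F_def)
    qed
    have der: "AE z in lborel. ((\<lambda>s. F (z + s *\<^sub>R axis j 1)) has_vector_derivative G z) (at 0)"
      using sph[of i]
    proof eventually_elim
      case (elim z)
      have "\<phi> differentiable at (y + z)" using \<phi> smooth_differentiable test_function_smooth by blast
      from has_vector_derivative_line[OF this, of j]
      have 1: "((\<lambda>s. \<phi> (y + (z + s *\<^sub>R axis j 1))) has_vector_derivative partial_deriv j \<phi> (y + z)) (at 0)"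
        by (simp add: add.assoc)
      have "((\<lambda>s. complex_of_real (riesz_reg (e i) k (z + s *\<^sub>R axis j 1))) has_vector_derivative
          of_real (riesz_reg_deriv (e i) j k z)) (at 0)"
        using riesz_reg_line_derivative[OF e elim, of k j]
        by (intro has_vector_derivative_of_real) (simp add: has_real_derivative_iff_has_vector_derivative)
      from has_vector_derivative_mult[OF this 1] show ?case by (simp add: F_def G_def add.commute)
    qed
    have G: "integrable lborel G" "integral\<^sup>L lborel G = 0"
      using integral_line_derivative_zero[of F G _ _ j, OF _ _ lip supp der] by auto
    have "(\<lambda>z. of_real (riesz_reg_deriv (e i) j k z) * \<phi> (y + z)) =
        (\<lambda>z. G z - of_real (riesz_reg (e i) k z) * partial_deriv j \<phi> (y + z))" by (simp add: G_def)
    then show ?thesis using G i1[of i] by simp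
  qed
  show "integrable lborel (\<lambda>z. of_real (riesz_reg_deriv (1 / real (Suc i)) j k z) * \<phi> (y + z))"
    using parts[of i] by (simp add: e_def)
  have "(\<lambda>i. LINT z|lborel. of_real (riesz_reg (e i) k z) * partial_deriv j \<phi> (y + z)) \<longlonglongrightarrow>
     (LINT z|lborel. of_real (riesz k z) * partial_deriv j \<phi> (y + z))"
  proof (rule integral_dominated_convergence[where w="\<lambda>z. M' * kap_dom (R' + norm y) z"])
    show "integrable lborel (\<lambda>z::real^'n. M' * kap_dom (R' + norm y) z)"
      by (intro integrable_mult_right kap_dom_integrable)
    show "AE z in lborel. (\<lambda>i. of_real (riesz_reg (e i) k z) * partial_deriv j \<phi> (y + z)) \<longlonglongrightarrow> of_real (riesz k z) * partial_deriv j \<phi> (y + z)"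
      unfolding e_def by (intro AE_I2 tendsto_intros riesz_reg_tendsto)
    show "AE z in lborel. norm (of_real (riesz_reg (e i) k z) * partial_deriv j \<phi> (y + z)) \<le> M' * kap_dom (R' + norm y) z" for i
      by (intro AE_I2 kernel_bound riesz_reg_le_kap e M')
  qed measurable
  then show "(\<lambda>i. - (LINT z|lborel. of_real (riesz_reg_deriv (1 / real (Suc i)) j k z) * \<phi> (y + z)))
           \<longlonglongrightarrow> partial_deriv j (zeta k \<phi>) y"
    using parts by (simp add: zeta_partial[OF \<phi>] zeta_def e_def)
qed

lemma zeta_curl: assumes "test_function \<phi>" shows "partial_deriv j (zeta k \<phi>) = partial_deriv k (zeta j \<phi>)"
proof
  fix y
  show "partial_deriv j (zeta k \<phi>) y = partial_deriv k (zeta j \<phi>) y"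
    using zeta_partial_limit(2)[OF assms, of j k y] zeta_partial_limit(2)[OF assms, of k j y]
    unfolding riesz_reg_deriv_sym[of _ j k] by (rule LIMSEQ_unique)
qed

definition omega :: "'n::finite itself \<Rightarrow> real" where
  "omega _ = real CARD('n) * unit_ball_vol (real CARD('n))"

lemma zeta_div:
  fixes \<phi> :: "real^'n::finite \<Rightarrow> complex"
  assumes \<phi>: "test_function \<phi>"
  shows "(\<Sum>k\<in>UNIV. partial_deriv k (zeta k \<phi>) y) = - (of_real (omega TYPE('n)) * \<phi> y)"
proof -
  obtain L where L: "L > 0" "\<And>x y. norm (\<phi> x - \<phi> y) \<le> L * norm (x - y)"
    using test_function_lipschitz[OF \<phi>] by metis
  have [measurable]: "\<phi> \<in> borel_measurable borel" using \<phi> test_function_measurable by blast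
  define e where "e i = 1 / real (Suc i)" for i
  have e: "e i > 0" for i by (simp add: e_def)
  define n where "n = CARD('n)"
  \<comment> \<open>The trace of the regularised Jacobian tested with \<open>\<phi>\<close>: an
    average over a ball shrinking to \<open>y\<close>, of total mass omega.\<close>
  define J where "J i = (LINT z|lborel. of_real (real n / e i ^ n * indicator (ball 0 (e i)) z) * \<phi> (y + z))" for i
  have lim: "(\<lambda>i. - J i) \<longlonglongrightarrow> (\<Sum>k\<in>UNIV. partial_deriv k (zeta k \<phi>) y)"
  proof -
    have "(\<Sum>k\<in>UNIV. (LINT z|lborel. of_real (riesz_reg_deriv (e i) k k z) * \<phi> (y + z))) = J i" for i
    proof -
      have "(\<Sum>k\<in>UNIV. (LINT z|lborel. of_real (riesz_reg_deriv (e i) k k z) * \<phi> (y + z)))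
          = (LINT z|lborel. (\<Sum>k\<in>UNIV. of_real (riesz_reg_deriv (e i) k k z) * \<phi> (y + z)))"
        using zeta_partial_limit(1)[OF \<phi>] by (simp add: Bochner_Integration.integral_sum e_def)
      also have "\<dots> = J i"
        unfolding J_def n_def riesz_reg_div[OF e, symmetric] by (simp add: sum_distrib_right)
      finally show ?thesis .
    qed
    moreover have "(\<lambda>i. \<Sum>k\<in>UNIV. - (LINT z|lborel. of_real (riesz_reg_deriv (e i) k k z) * \<phi> (y + z))) \<longlonglongrightarrow> (\<Sum>k\<in>UNIV. partial_deriv k (zeta k \<phi>) y)"
      unfolding e_def by (intro tendsto_sum zeta_partial_limit(2)[OF \<phi>])
    ultimately show ?thesis by (simp add: sum_negf)
  qed
  define w where "w = omega TYPE('n)"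
  have bi: "integrable lborel (\<lambda>z::real^'n. real n / e i ^ n * indicator (ball 0 (e i)) z)"
    "(LINT z|lborel. real n / e i ^ n * indicator (ball (0::real^'n) (e i)) z) = w" for i
  proof -
    show "integrable lborel (\<lambda>z::real^'n. real n / e i ^ n * indicator (ball 0 (e i)) z)"
      by (intro integrable_mult_right integrable_indicator_ball)
    have "(LINT z|lborel. indicator (ball (0::real^'n) (e i)) z) = unit_ball_vol (real n) * e i ^ n"
      using e[of i] content_ball[of "e i" "0::real^'n"] by (simp add: n_def)
    then show "(LINT z|lborel. real n / e i ^ n * indicator (ball (0::real^'n) (e i)) z) = w"
      using e[of i] by (simp add: w_def omega_def n_def)
  qed
  have est: "norm (J i - of_real w * \<phi> y) \<le> w * L * e i" for i
  proof -
    define b where "b z = real n / e i ^ n * indicator (ball (0::real^'n) (e i)) z" for z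
    have [measurable]: "ball (0::real^'n) (e i) \<in> sets borel" by simp
    have [measurable]: "b \<in> borel_measurable borel" unfolding b_def by measurable
    have b: "integrable lborel b" "integral\<^sup>L lborel b = w" unfolding b_def using bi by auto
    have b0: "b z \<ge> 0" for z using e[of i] by (simp add: b_def)
    have le: "norm (of_real (b z) * (\<phi> (y + z) - \<phi> y)) \<le> b z * (L * e i)" for z
    proof (cases "z \<in> ball 0 (e i)")
      case True
      have "norm (\<phi> (y + z) - \<phi> y) \<le> L * norm z" using L(2)[of "y + z" y] by simp
      also have "\<dots> \<le> L * e i" using True L by (intro mult_left_mono) auto
      finally show ?thesis using b0[of z] by (simp add: norm_mult mult_left_mono)
    qed (simp add: b_def)
    have i1: "integrable lborel (\<lambda>z. of_real (b z) * (\<phi> (y + z) - \<phi> y))"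
      by (rule Bochner_Integration.integrable_bound[of _ "\<lambda>z. b z * (L * e i)"])
        (auto intro!: integrable_mult_left b AE_I2 order_trans[OF le abs_ge_self])
    have i2: "integrable lborel (\<lambda>z. of_real (b z) * \<phi> y)" using b by (intro integrable_mult_left integrable_of_real)
    have "J i = (LINT z|lborel. of_real (b z) * (\<phi> (y + z) - \<phi> y) + of_real (b z) * \<phi> y)"
      unfolding J_def b_def[symmetric] by (intro Bochner_Integration.integral_cong) (simp_all add: algebra_simps)
    also have "\<dots> = (LINT z|lborel. of_real (b z) * (\<phi> (y + z) - \<phi> y)) + of_real w * \<phi> y"
      using i1 i2 b by (simp add: integral_of_real)
    finally have "norm (J i - of_real w * \<phi> y) = norm (LINT z|lborel. of_real (b z) * (\<phi> (y + z) - \<phi> y))" by simp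
    also have "\<dots> \<le> (LINT z|lborel. b z * (L * e i))"
      by (rule Bochner_Integration.integral_norm_bound_integral[OF i1]) (use b le in auto)
    also have "\<dots> = w * L * e i" using b by simp
    finally show ?thesis .
  qed
  have "(\<lambda>i. J i - of_real w * \<phi> y) \<longlonglongrightarrow> 0"
  proof (rule Lim_null_comparison)
    show "\<forall>\<^sub>F i in sequentially. norm (J i - of_real w * \<phi> y) \<le> w * L * e i" using est by simp
    have "(\<lambda>i. w * L * e i) \<longlonglongrightarrow> w * L * 0" unfolding e_def by (intro tendsto_intros LIMSEQ_Suc[OF lim_1_over_n])
    then show "(\<lambda>i. w * L * e i) \<longlonglongrightarrow> 0" by simp
  qed
  then have "J \<longlonglongrightarrow> of_real w * \<phi> y" by (rule LIM_zero_cancel)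
  then have "(\<lambda>i. - J i) \<longlonglongrightarrow> - (of_real w * \<phi> y)" by (rule tendsto_minus)
  from LIMSEQ_unique[OF lim this] show ?thesis by (simp add: w_def)
qed

text \<open>The bound rests on \<open>1 + |y| \<le> (1 + |z|) (1 + |y + z|)\<close>.\<close>

lemma kap_convolution_bound:
  fixes f :: "'a::euclidean_space \<Rightarrow> complex"
  assumes [measurable]: "f \<in> borel_measurable borel"
    and M: "\<And>x. norm (f x) \<le> M" and R: "\<And>x. norm x \<ge> R \<Longrightarrow> f x = 0"
  shows "\<exists>C\<ge>0. \<forall>y. integrable lborel (\<lambda>z. kap z * norm (f (y + z))) \<and>
     (LINT z|lborel. kap z * norm (f (y + z))) \<le> C * (1 + norm y) powr (1 - real DIM('a))"
proof -
  let ?d = "real DIM('a) - 1"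
  have d: "?d \<ge> 0" by (simp add: Suc_leI)
  have M0: "0 \<le> M" using M[of 0] norm_ge_zero order_trans by blast
  \<comment> \<open>Half of the product weight is carried by \<open>f\<close>, where it is bounded
    on the support. The other half, a power of 1 + |z|, is bounded near the origin and cancels
    against the kernel far away.\<close>
  define g where "g x = (1 + norm x) powr ?d * norm (f x)" for x
  define A where "A = (1 + \<bar>R\<bar>) powr ?d * M"
  have gA: "g x \<le> A * indicator (cball 0 \<bar>R\<bar>) x" for x
  proof (cases "norm x \<le> \<bar>R\<bar>")
    case True
    then have "(1 + norm x) powr ?d \<le> (1 + \<bar>R\<bar>) powr ?d" using d by (intro powr_mono2) auto
    then have "g x \<le> A" unfolding g_def A_def using M[of x] by (intro mult_mono) auto
    then show ?thesis using True by simp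
  next
    case False
    then show ?thesis using R[of x] by (simp add: g_def)
  qed
  have [measurable]: "g \<in> borel_measurable borel" unfolding g_def by measurable
  have g0: "g x \<ge> 0" for x by (simp add: g_def)
  have A0: "A \<ge> 0" using M0 by (simp add: A_def)
  have gi: "integrable lborel g"
  proof (rule Bochner_Integration.integrable_bound)
    show "integrable lborel (\<lambda>x::'a. A * indicator (cball 0 \<bar>R\<bar>) x)"
      by (intro integrable_mult_right integrable_indicator_ball)
    show "AE x in lborel. norm (g x) \<le> norm (A * indicator (cball 0 \<bar>R\<bar>) x)"
      using gA g0 by (intro AE_I2) (auto intro: order_trans[OF _ abs_ge_self])
  qed simp
  have main: "(1 + norm y) powr ?d * (kap z * norm (f (y + z))) \<le> 2 powr ?d * (A * kap_near z + g (y + z))" for y z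
  proof -
    have "norm y \<le> norm (y + z) + norm z" using norm_triangle_ineq4[of "y + z" z] by simp
    moreover have "(1 + norm z) * (1 + norm (y + z)) = 1 + norm z + norm (y + z) + norm z * norm (y + z)"
      by (simp add: algebra_simps)
    moreover have "0 \<le> norm z * norm (y + z)" by simp
    ultimately have "1 + norm y \<le> (1 + norm z) * (1 + norm (y + z))" by linarith
    then have "(1 + norm y) powr ?d \<le> ((1 + norm z) * (1 + norm (y + z))) powr ?d" using d by (intro powr_mono2) auto
    also have "\<dots> = (1 + norm z) powr ?d * (1 + norm (y + z)) powr ?d" by (simp add: powr_mult)
    finally have "(1 + norm y) powr ?d * (kap z * norm (f (y + z))) \<le> (1 + norm z) powr ?d * (1 + norm (y + z)) powr ?d * (kap z * norm (f (y + z)))"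
      by (intro mult_right_mono) auto
    also have "\<dots> = ((1 + norm z) powr ?d * kap z) * g (y + z)" by (simp add: g_def mult_ac)
    also have "\<dots> \<le> (2 powr ?d * (kap_near z + 1 * indicator (- cball 0 1) z)) * g (y + z)"
    proof (intro mult_right_mono g0)
      show "(1 + norm z) powr ?d * kap z \<le> 2 powr ?d * (kap_near z + 1 * indicator (- cball 0 1) z)"
      proof (cases "norm z \<le> 1")
        case True
        then have "(1 + norm z) powr ?d \<le> 2 powr ?d" using d by (intro powr_mono2) auto
        then show ?thesis using True by (simp add: kap_near_def mult_right_mono)
      next
        case False
        then have "(1 + norm z) powr ?d \<le> (2 * norm z) powr ?d" using d by (intro powr_mono2) auto
        also have "\<dots> = 2 powr ?d * norm z powr ?d" by (simp add: powr_mult)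
        finally have "(1 + norm z) powr ?d * kap z \<le> 2 powr ?d * norm z powr ?d * kap z" by (intro mult_right_mono) auto
        also have "\<dots> = 2 powr ?d * norm z powr (?d + (1 - real DIM('a)))" by (simp only: kap_def powr_add mult.assoc)
        also have "\<dots> = 2 powr ?d" using False by (cases "z = 0") simp_all
        finally show ?thesis using False by (simp add: kap_near_def)
      qed
    qed
    also have "\<dots> \<le> 2 powr ?d * (A * kap_near z + g (y + z))"
    proof -
      have "g (y + z) \<le> A" using gA[of "y + z"] A0 by (cases "norm (y + z) \<le> \<bar>R\<bar>") auto
      from mult_left_mono[OF this, of "kap_near z"] have "kap_near z * g (y + z) \<le> A * kap_near z"
        by (simp add: mult.commute)
      moreover have "1 * indicator (- cball 0 1) z * g (y + z) \<le> g (y + z)" using g0[of "y + z"] by (simp add: indicator_def)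
      ultimately have "(kap_near z + 1 * indicator (- cball 0 1) z) * g (y + z) \<le> A * kap_near z + g (y + z)"
        by (simp add: distrib_right)
      then show ?thesis by (simp add: mult.assoc mult_left_mono)
    qed
    finally show ?thesis .
  qed
  define C where "C = 2 powr ?d * (A * integral\<^sup>L lborel (kap_near :: 'a \<Rightarrow> real) + integral\<^sup>L lborel g)"
  have "C \<ge> 0" unfolding C_def using A0 g0 by (intro mult_nonneg_nonneg add_nonneg_nonneg integral_nonneg) auto
  moreover have "integrable lborel (\<lambda>z. kap z * norm (f (y + z))) \<and>
     (LINT z|lborel. kap z * norm (f (y + z))) \<le> C * (1 + norm y) powr (1 - real DIM('a))" for y
  proof -
    define u where "u = (1 + norm y) powr ?d"
    have u: "u > 0" by (simp add: u_def)
    have gt: "integrable lborel (\<lambda>z. g (y + z))" "(LINT z|lborel. g (y + z)) = integral\<^sup>L lborel g"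
      using integrable_lborel_translate[of g y] integral_lborel_translate[of g y] gi by auto
    have r: "integrable lborel (\<lambda>z. 2 powr ?d * (A * kap_near z + g (y + z)))"
      by (intro integrable_mult_right Bochner_Integration.integrable_add integrable_kap_near_1 gt)
    have 1: "integrable lborel (\<lambda>z. u * (kap z * norm (f (y + z))))"
      by (rule integrable_dominated[OF r]) (use main[of y] u in \<open>auto simp: abs_mult u_def\<close>)
    have "(LINT z|lborel. u * (kap z * norm (f (y + z)))) \<le> (LINT z|lborel. 2 powr ?d * (A * kap_near z + g (y + z)))"
      using main[of y] by (intro integral_mono 1 r) (simp add: u_def)
    also have "\<dots> = C"
      using Bochner_Integration.integral_add[OF integrable_mult_right[OF integrable_kap_near_1, of A] gt(1)] gt(2)
      by (simp add: C_def)
    finally have "u * (LINT z|lborel. kap z * norm (f (y + z))) \<le> C" by simp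
    then have "(LINT z|lborel. kap z * norm (f (y + z))) \<le> C / u" using u by (simp add: pos_le_divide_eq mult.commute)
    moreover have "C / u = C * (1 + norm y) powr (1 - real DIM('a))"
      using powr_minus[of "1 + norm y" ?d] by (simp add: u_def divide_inverse)
    moreover have "integrable lborel (\<lambda>z. kap z * norm (f (y + z)))"
      using 1 u by (simp add: integrable_mult_right_iff)
    ultimately show ?thesis by simp
  qed
  ultimately show ?thesis by blast
qed

lemma zeta_bound:
  fixes \<phi> :: "real^'n::finite \<Rightarrow> complex"
  assumes \<phi>: "test_function \<phi>"
  shows "\<exists>C\<ge>0. \<forall>y. norm (zeta k \<phi> y) \<le> C * (1 + norm y) powr (1 - real CARD('n))"
proof -
  have m: "\<phi> \<in> borel_measurable borel" using \<phi> test_function_measurable by blast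
  obtain M R where MR: "\<And>x. norm (\<phi> x) \<le> M" "\<And>x. norm x \<ge> R \<Longrightarrow> \<phi> x = 0"
    using test_function_bounds[OF \<phi>] by metis
  obtain C where C: "C \<ge> 0" "\<And>y. integrable lborel (\<lambda>z. kap z * norm (\<phi> (y + z)))"
     "\<And>y. (LINT z|lborel. kap z * norm (\<phi> (y + z))) \<le> C * (1 + norm y) powr (1 - real CARD('n))"
    using kap_convolution_bound[of \<phi> M R] m MR by auto
  have "norm (zeta k \<phi> y) \<le> (LINT z|lborel. kap z * norm (\<phi> (y + z)))" for y
    unfolding zeta_def
    by (rule Bochner_Integration.integral_norm_bound_integral[OF zeta_integrable[OF \<phi>] C(2)])
      (auto simp: norm_mult riesz_le_kap mult_right_mono)
  then show ?thesis using C(1,3) order_trans by blast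
qed


section \<open>The energy estimate\<close>

lemma test_function_integrable:
  assumes "test_function \<phi>"
  shows "integrable lborel \<phi>" "integrable lborel (\<lambda>x. (norm (\<phi> x))\<^sup>2)"
proof -
  have [measurable]: "\<phi> \<in> borel_measurable borel" using assms test_function_measurable by blast
  obtain M R where MR: "M > 0" "\<And>x. norm (\<phi> x) \<le> M" "\<And>x. norm x \<ge> R \<Longrightarrow> \<phi> x = 0"
    using test_function_bounds[OF assms] by metis
  have le: "norm (\<phi> x) \<le> M * indicator (cball 0 R) x" "norm ((norm (\<phi> x))\<^sup>2) \<le> M\<^sup>2 * indicator (cball 0 R) x" for x
    using MR(2)[of x] MR(3)[of x] MR(1) by (cases "norm x \<le> R"; auto intro!: power_mono)+
  show "integrable lborel \<phi>" "integrable lborel (\<lambda>x. (norm (\<phi> x))\<^sup>2)"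
    by (rule integrable_dominated[OF _ _ le(1)] integrable_dominated[OF _ _ le(2)];
        auto intro!: integrable_mult_right)+
qed

lemma cnj_measurable [measurable]: "cnj \<in> borel_measurable borel"
  by (intro borel_measurable_continuous_onI continuous_intros)

lemma partial_deriv_sum:
  assumes "\<And>i. i \<in> I \<Longrightarrow> f i differentiable at x"
  shows "partial_deriv j (\<lambda>x. \<Sum>i\<in>I. f i x) x = (\<Sum>i\<in>I. partial_deriv j (f i) x)"
proof -
  have "((\<lambda>x. \<Sum>i\<in>I. f i x) has_derivative (\<lambda>h. \<Sum>i\<in>I. frechet_derivative (f i) (at x) h)) (at x)"
    using assms by (intro has_derivative_sum) (auto simp: frechet_derivative_works)
  from partial_deriv_eqI[OF this] show ?thesis by (simp add: partial_deriv_def)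
qed

lemma partial_deriv_cmult:
  assumes "f differentiable at x"
  shows "partial_deriv j (\<lambda>x. c * f x) x = c * partial_deriv j f x"
proof -
  have "((\<lambda>x. c * f x) has_derivative (\<lambda>h. c * frechet_derivative f (at x) h)) (at x)"
    using assms by (intro derivative_intros) (auto simp: frechet_derivative_works)
  from partial_deriv_eqI[OF this] show ?thesis by (simp add: partial_deriv_def)
qed

text \<open>For a curl free field the Laplacian is the gradient of the divergence. The exchange of
  indices is curl freeness applied to the test function
  \<open>partial_deriv j \<phi>\<close>.\<close>

lemma zeta_laplace:
  fixes \<phi> :: "real^'n::finite \<Rightarrow> complex"
  assumes \<phi>: "test_function \<phi>"
  shows "(\<Sum>j\<in>UNIV. partial_deriv j (partial_deriv j (zeta k \<phi>)) y) = - (of_real (omega TYPE('n)) * partial_deriv k \<phi> y)"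
proof -
  have d: "partial_deriv j (zeta j \<phi>) differentiable at y" for j
    by (intro smooth_differentiable smooth_partial zeta_smooth \<phi>)
  have "(\<Sum>j\<in>UNIV. partial_deriv j (partial_deriv j (zeta k \<phi>)) y) = (\<Sum>j\<in>UNIV. partial_deriv k (partial_deriv j (zeta j \<phi>)) y)"
    using zeta_curl[OF test_function_partial[OF \<phi>]] by (simp add: zeta_partial[OF \<phi>])
  also have "\<dots> = partial_deriv k (\<lambda>y. \<Sum>j\<in>UNIV. partial_deriv j (zeta j \<phi>) y) y"
    by (subst partial_deriv_sum) (use d in auto)
  also have "(\<lambda>y. \<Sum>j\<in>UNIV. partial_deriv j (zeta j \<phi>) y) = (\<lambda>y. (- of_real (omega TYPE('n))) * \<phi> y)"
    using zeta_div[OF \<phi>] by (simp add: fun_eq_iff)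
  also have "partial_deriv k \<dots> y = (- of_real (omega TYPE('n))) * partial_deriv k \<phi> y"
    by (intro partial_deriv_cmult smooth_differentiable test_function_smooth \<phi>)
  finally show ?thesis by simp
qed

lemma weight_le_1: "a \<le> 0 \<Longrightarrow> (1 + norm y) powr a \<le> 1"
  using powr_mono[of a 0 "1 + norm y"] by simp

text \<open>The Riesz transforms are bounded on \<open>L\<^sup>2\<close>: integrate by parts twice, using that the
  Laplacian of the potential is a first derivative of \<open>\<phi>\<close>; the terms containing a derivative of the cutoff vanish
  in the limit because \<open>n \<ge> 2\<close>.\<close>

lemma zeta_energy:
  fixes \<phi> :: "real^'n::finite \<Rightarrow> complex"
  assumes \<phi>: "test_function \<phi>" and n2: "CARD('n) \<ge> 2"
  shows "integrable lborel (\<lambda>y. (norm (partial_deriv j (zeta k \<phi>) y))\<^sup>2)"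
    and "(LINT y|lborel. (norm (partial_deriv j (zeta k \<phi>) y))\<^sup>2) \<le> (omega TYPE('n))\<^sup>2 * (LINT y|lborel. (norm (\<phi> y))\<^sup>2)"
proof -
  define w where "w = omega TYPE('n)"
  define ch :: "nat \<Rightarrow> real^'n \<Rightarrow> complex" where "ch i = cutoff (real (Suc i))" for i
  define Z where "Z k = zeta k \<phi>" for k
  define D where "D j k = partial_deriv j (zeta k \<phi>)" for j k
  have cht: "test_function (ch i)" for i unfolding ch_def by (rule cutoff_test) simp
  have smZ: "smooth (Z k)" "smooth (D j k)" for j k
    unfolding Z_def D_def by (intro zeta_smooth smooth_partial \<phi>)+
  have DZ: "D j k = zeta k (partial_deriv j \<phi>)" for j k unfolding D_def by (rule zeta_partial[OF \<phi>])
  have [measurable]: "\<phi> \<in> borel_measurable borel" "ch i \<in> borel_measurable borel" "Z k \<in> borel_measurable borel"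
     "D j k \<in> borel_measurable borel" "partial_deriv j \<phi> \<in> borel_measurable borel"
     "partial_deriv j (ch i) \<in> borel_measurable borel" for i j k
    using \<phi> cht smZ test_function_partial test_function_measurable smooth_continuous borel_measurable_continuous_onI by blast+
  have "\<exists>C\<ge>0. \<forall>y. norm (Z k y) \<le> C * (1 + norm y) powr (1 - real CARD('n))" for k
    unfolding Z_def by (rule zeta_bound[OF \<phi>])
  then obtain C where C: "\<And>k. C k \<ge> 0" "\<And>k y. norm (Z k y) \<le> C k * (1 + norm y) powr (1 - real CARD('n))" by metis
  have "\<exists>C\<ge>0. \<forall>y. norm (D j k y) \<le> C * (1 + norm y) powr (1 - real CARD('n))" for j k
    unfolding DZ by (rule zeta_bound[OF test_function_partial[OF \<phi>]])
  then obtain C' where C': "\<And>j k. C' j k \<ge> 0" "\<And>j k y. norm (D j k y) \<le> C' j k * (1 + norm y) powr (1 - real CARD('n))" by metis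
  \<comment> \<open>Compactly supported functions whose derivatives integrate to 0. Those of
    \<open>f1\<close> produce the squared derivatives together with the Laplacian of zeta, which is
    \<open>- w\<close> times a derivative of \<open>\<phi>\<close>; \<open>f2\<close> moves that
    derivative back onto zeta.\<close>
  define f1 where "f1 i j k y = ch i y * (Z k y * cnj (D j k y))" for i j k y
  define f2 where "f2 i k y = ch i y * (Z k y * cnj (\<phi> y))" for i k y
  have t1: "test_function (f1 i j k)" for i j k
    unfolding f1_def by (intro test_function_mult(1) cht smooth_mult smooth_cnj smZ)
  have t2: "test_function (f2 i k)" for i k
    unfolding f2_def by (intro test_function_mult(1) cht smooth_mult smooth_cnj smZ test_function_smooth \<phi>)
  have df: "Z k differentiable at y" "D j k differentiable at y" "\<phi> differentiable at y" "ch i differentiable at y"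
     for i j k y using smooth_differentiable smZ test_function_smooth \<phi> cht by blast+
  have dc: "(\<lambda>x. cnj (f x)) differentiable at y" if "smooth f" for f :: "real^'n \<Rightarrow> complex" and y
    using smooth_differentiable smooth_cnj that by blast
  have d1: "partial_deriv j (f1 i j k) y = partial_deriv j (ch i) y * (Z k y * cnj (D j k y))
      + ch i y * (D j k y * cnj (D j k y)) + ch i y * (Z k y * cnj (partial_deriv j (D j k) y))" for i j k y
    unfolding f1_def
    by (subst partial_deriv_mult partial_deriv_cnj, (intro df differentiable_mult dc smZ)+)+
      (simp add: algebra_simps Z_def D_def)
  have d2: "partial_deriv k (f2 i k) y = partial_deriv k (ch i) y * (Z k y * cnj (\<phi> y))
      + ch i y * (D k k y * cnj (\<phi> y)) + ch i y * (Z k y * cnj (partial_deriv k \<phi> y))" for i k y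
    unfolding f2_def
    by (subst partial_deriv_mult partial_deriv_cnj, (intro df differentiable_mult dc smZ test_function_smooth \<phi>)+)+
      (simp add: algebra_simps Z_def D_def)
  \<comment> \<open>The weight \<open>w\<close> on the second family cancels the terms with a
    derivative of \<open>\<phi>\<close>. What remains is the energy \<open>A\<close>, the term
    \<open>E\<close> from the divergence and the terms \<open>B\<close> with a derivative of the
    cutoff.\<close>
  define F where "F i y = (\<Sum>k\<in>UNIV. \<Sum>j\<in>UNIV. partial_deriv j (f1 i j k) y) + of_real w * (\<Sum>k\<in>UNIV. partial_deriv k (f2 i k) y)" for i y
  define A where "A i y = ch i y * of_real (\<Sum>k\<in>UNIV. \<Sum>j\<in>UNIV. (norm (D j k y))\<^sup>2)" for i y
  define B where "B i y = (\<Sum>k\<in>UNIV. \<Sum>j\<in>UNIV. partial_deriv j (ch i) y * (Z k y * cnj (D j k y)))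
     + of_real w * (\<Sum>k\<in>UNIV. partial_deriv k (ch i) y * (Z k y * cnj (\<phi> y)))" for i y
  define E where "E i y = of_real (w\<^sup>2) * (ch i y * of_real ((norm (\<phi> y))\<^sup>2))" for i y
  have [measurable]: "B i \<in> borel_measurable borel" "E i \<in> borel_measurable borel" for i
    unfolding B_def E_def by measurable
  have FA: "A i y = F i y - B i y + E i y" for i y
  proof -
    have lap: "(\<Sum>j\<in>UNIV. ch i y * (Z k y * cnj (partial_deriv j (D j k) y))) = - (of_real w * (ch i y * (Z k y * cnj (partial_deriv k \<phi> y))))" for k
    proof -
      have "(\<Sum>j\<in>UNIV. ch i y * (Z k y * cnj (partial_deriv j (D j k) y)))
         = ch i y * (Z k y * cnj (\<Sum>j\<in>UNIV. partial_deriv j (D j k) y))" by (simp add: sum_distrib_left)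
      also have "(\<Sum>j\<in>UNIV. partial_deriv j (D j k) y) = - (of_real w * partial_deriv k \<phi> y)"
        unfolding D_def w_def by (rule zeta_laplace[OF \<phi>])
      finally show ?thesis by (simp add: algebra_simps)
    qed
    have div: "(\<Sum>k\<in>UNIV. ch i y * (D k k y * cnj (\<phi> y))) = - (of_real w * (ch i y * of_real ((norm (\<phi> y))\<^sup>2)))"
    proof -
      have "(\<Sum>k\<in>UNIV. ch i y * (D k k y * cnj (\<phi> y))) = ch i y * ((\<Sum>k\<in>UNIV. D k k y) * cnj (\<phi> y))"
        by (simp add: sum_distrib_left sum_distrib_right)
      also have "(\<Sum>k\<in>UNIV. D k k y) = - (of_real w * \<phi> y)" unfolding D_def w_def by (rule zeta_div[OF \<phi>])
      finally show ?thesis by (simp add: complex_norm_square[symmetric] mult.assoc mult.left_commute)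
    qed
    have sq: "(\<Sum>k\<in>UNIV. \<Sum>j\<in>UNIV. ch i y * (D j k y * cnj (D j k y))) = A i y"
      by (simp add: A_def complex_norm_square[symmetric] sum_distrib_left)
    have "F i y = (\<Sum>k\<in>UNIV. \<Sum>j\<in>UNIV. partial_deriv j (ch i) y * (Z k y * cnj (D j k y)))
        + (\<Sum>k\<in>UNIV. \<Sum>j\<in>UNIV. ch i y * (D j k y * cnj (D j k y)))
        + (\<Sum>k\<in>UNIV. \<Sum>j\<in>UNIV. ch i y * (Z k y * cnj (partial_deriv j (D j k) y)))
        + of_real w * ((\<Sum>k\<in>UNIV. partial_deriv k (ch i) y * (Z k y * cnj (\<phi> y)))
        + (\<Sum>k\<in>UNIV. ch i y * (D k k y * cnj (\<phi> y))) + (\<Sum>k\<in>UNIV. ch i y * (Z k y * cnj (partial_deriv k \<phi> y))))"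
      unfolding F_def d1 d2 by (simp only: sum.distrib)
    then show ?thesis
      unfolding sq div lap B_def E_def
      by (simp add: sum_negf sum_distrib_left[symmetric] power2_eq_square algebra_simps)
  qed
  have Fi: "integrable lborel (F i)" "integral\<^sup>L lborel (F i) = 0" for i
    unfolding F_def using integral_partial_deriv_zero[OF t1] integral_partial_deriv_zero[OF t2]
    by (simp_all add: Bochner_Integration.integrable_sum Bochner_Integration.integral_sum)
  have chn: "norm (ch i y) \<le> 1" "norm (partial_deriv j (ch i) y) \<le> 48 / (1 + norm y)" for i j y
    unfolding ch_def by (auto intro: cutoff_norm_le cutoff_partial_bound)
  have \<phi>i: "integrable lborel (\<lambda>y. (norm (\<phi> y))\<^sup>2)" "integrable lborel (\<lambda>y. norm (\<phi> y))"
    using test_function_integrable[OF \<phi>] by auto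
  have Ei: "integrable lborel (E i)" for i
    by (rule integrable_dominated[of _ "\<lambda>y. w\<^sup>2 * (norm (\<phi> y))\<^sup>2"])
      (use \<phi>i chn in \<open>auto simp: E_def norm_mult norm_power intro!: mult_left_mono mult_left_le_one_le\<close>)
  have Elim: "(\<lambda>i. integral\<^sup>L lborel (E i)) \<longlonglongrightarrow> (LINT y|lborel. of_real (w\<^sup>2) * (1 * of_real ((norm (\<phi> y))\<^sup>2)) :: complex)"
  proof (rule integral_dominated_convergence[where w="\<lambda>y. w\<^sup>2 * (norm (\<phi> y))\<^sup>2"])
    show "AE y in lborel. (\<lambda>i. E i y) \<longlonglongrightarrow> of_real (w\<^sup>2) * (1 * of_real ((norm (\<phi> y))\<^sup>2))"
      unfolding E_def ch_def by (intro AE_I2 tendsto_intros cutoff_tendsto)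
    show "AE y in lborel. norm (E i y) \<le> w\<^sup>2 * (norm (\<phi> y))\<^sup>2" for i
      using chn by (auto intro!: AE_I2 mult_left_mono mult_left_le_one_le simp: E_def norm_mult norm_power)
  qed (use \<phi>i in auto)
  \<comment> \<open>One power from the gradient of the cutoff and n - 1 from each of the two
    potentials; 2 n - 1 > n is where n >= 2 enters.\<close>
  define b where "b = 2 * real CARD('n) - 1"
  have b: "b > real DIM(real^'n)" using n2 by (simp add: b_def)
  define Bd where "Bd y = (\<Sum>k\<in>UNIV. \<Sum>j\<in>UNIV. 48 * (C k * C' j k) * (1 + norm y) powr (- b)) + \<bar>w\<bar> * (\<Sum>k\<in>UNIV. 48 * (C k * norm (\<phi> y)))" for y :: "real^'n"
  have Bdi: "integrable lborel Bd"
    unfolding Bd_def using integrable_weight[OF b] \<phi>i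
    by (intro Bochner_Integration.integrable_add Bochner_Integration.integrable_sum integrable_mult_right)
  have Bb: "norm (B i y) \<le> Bd y" for i y
  proof -
    have 1: "norm (partial_deriv j (ch i) y * (Z k y * cnj (D j k y))) \<le> 48 * (C k * C' j k) * (1 + norm y) powr (- b)" for j k
    proof -
      let ?p = "(1 + norm y) powr (1 - real CARD('n))"
      have "norm (partial_deriv j (ch i) y * (Z k y * cnj (D j k y))) \<le> 48 / (1 + norm y) * ((C k * ?p) * (C' j k * ?p))"
        unfolding norm_mult complex_mod_cnj
        by (intro mult_mono chn C C' mult_nonneg_nonneg) auto
      also have "\<dots> = 48 * (C k * C' j k) * ((1 + norm y) powr (- 1) * (?p * ?p))"
        using powr_minus_divide[of "1 + norm y" 1] by (simp add: divide_inverse mult_ac)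
      also have "(1 + norm y) powr (- 1) * (?p * ?p) = (1 + norm y) powr (- b)"
      proof -
        have "- b = - 1 + ((1 - real CARD('n)) + (1 - real CARD('n)))" by (simp add: b_def)
        then show ?thesis by (simp only: powr_add)
      qed
      finally show ?thesis .
    qed
    have 2: "norm (partial_deriv k (ch i) y * (Z k y * cnj (\<phi> y))) \<le> 48 * (C k * norm (\<phi> y))" for k
    proof -
      have "C k * (1 + norm y) powr (1 - real CARD('n)) \<le> C k * 1"
        using C(1) n2 by (intro mult_left_mono weight_le_1) auto
      then have "norm (Z k y) \<le> C k" using C(2)[of k y] by simp
      moreover have "48 / (1 + norm y) \<le> 48" by (simp add: divide_le_eq)
      then have "norm (partial_deriv k (ch i) y) \<le> 48" using chn(2)[of k i y] by linarith
      ultimately show ?thesis unfolding norm_mult complex_mod_cnj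
        using C(1)[of k] by (intro mult_mono) auto
    qed
    show ?thesis
      unfolding B_def Bd_def
      by (intro order_trans[OF norm_triangle_ineq] add_mono sum_norm_le 1)
        (auto simp: norm_mult intro!: mult_left_mono sum_norm_le 2[unfolded norm_mult, simplified])
  qed
  have Bi: "integrable lborel (B i)" for i by (rule integrable_dominated[OF Bdi _ Bb]) measurable
  have Blim: "(\<lambda>i. integral\<^sup>L lborel (B i)) \<longlonglongrightarrow> (LINT y|(lborel :: (real^'n) measure). 0)"
  proof (rule integral_dominated_convergence[OF _ _ Bdi])
    have "(\<lambda>i. B i y) \<longlonglongrightarrow> (\<Sum>k\<in>UNIV. \<Sum>j\<in>UNIV. 0 * (Z k y * cnj (D j k y)))
     + of_real w * (\<Sum>k\<in>UNIV. 0 * (Z k y * cnj (\<phi> y)))" for y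
      unfolding B_def ch_def by (intro tendsto_intros cutoff_partial_tendsto)
    then show "AE y in lborel. (\<lambda>i. B i y) \<longlonglongrightarrow> 0" by simp
  qed (use Bb in auto)
  define S where "S y = (\<Sum>k\<in>UNIV. \<Sum>j\<in>UNIV. (norm (D j k y))\<^sup>2)" for y
  have S0: "S y \<ge> 0" for y unfolding S_def by (intro sum_nonneg) auto
  have [measurable]: "S \<in> borel_measurable borel" unfolding S_def by measurable
  define N where "N = (LINT y|lborel. (norm (\<phi> y))\<^sup>2)"
  have Ai: "integrable lborel (A i)" for i unfolding FA using Fi Bi Ei by auto
  have Aint: "integral\<^sup>L lborel (A i) = integral\<^sup>L lborel (E i) - integral\<^sup>L lborel (B i)" for i
    unfolding FA using Fi Bi Ei by simp
  have Alim: "(\<lambda>i. integral\<^sup>L lborel (A i)) \<longlonglongrightarrow> of_real (w\<^sup>2 * N)"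
  proof -
    have "(LINT y|lborel. of_real (w\<^sup>2) * (1 * of_real ((norm (\<phi> y))\<^sup>2)) :: complex) = (LINT y|lborel. complex_of_real (w\<^sup>2 * (norm (\<phi> y))\<^sup>2))"
      by (simp only: mult_1_left of_real_mult)
    also have "\<dots> = of_real (LINT y|lborel. w\<^sup>2 * (norm (\<phi> y))\<^sup>2)"
      by (rule integral_complex_of_real)
    also have "\<dots> = of_real (w\<^sup>2 * N)" by (simp add: N_def)
    finally have e: "(LINT y|lborel. of_real (w\<^sup>2) * (1 * of_real ((norm (\<phi> y))\<^sup>2)) :: complex) = of_real (w\<^sup>2 * N)" .
    show ?thesis unfolding Aint using tendsto_diff[OF Elim Blim] unfolding e by simp
  qed
  define c where "c i y = exp 1 * flat 0 (1 - (y \<bullet> y) / (real (Suc i))\<^sup>2)" for i and y :: "real^'n"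
  have chc: "ch i y = of_real (c i y)" for i y by (simp add: ch_def cutoff_def c_def)
  have c0: "c i y \<ge> 0" for i y by (simp add: c_def flat_nonneg)
  have Ac: "A i = (\<lambda>y. of_real (c i y * S y))" for i by (simp add: fun_eq_iff A_def S_def chc)
  have cS: "integrable lborel (\<lambda>y. c i y * S y)" "of_real (LINT y|lborel. c i y * S y) = integral\<^sup>L lborel (A i)" for i
  proof -
    have "integrable lborel (\<lambda>y. complex_of_real (c i y * S y))" using Ai[of i] by (simp only: Ac)
    from integrable_Re[OF this] show "integrable lborel (\<lambda>y. c i y * S y)" by simp
    show "of_real (LINT y|lborel. c i y * S y) = integral\<^sup>L lborel (A i)"
      unfolding Ac by (rule integral_complex_of_real[symmetric])
  qed
  have cSlim: "(\<lambda>i. LINT y|lborel. c i y * S y) \<longlonglongrightarrow> w\<^sup>2 * N"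
    using Alim unfolding cS(2)[symmetric] by (simp only: tendsto_of_real_iff)
  have clim: "(\<lambda>i. c i y * S y) \<longlonglongrightarrow> S y" for y
  proof -
    have "(\<lambda>i. complex_of_real (c i y)) \<longlonglongrightarrow> of_real 1" using cutoff_tendsto[of y] unfolding chc[symmetric] ch_def by simp
    then have "(\<lambda>i. c i y) \<longlonglongrightarrow> 1" by (simp only: tendsto_of_real_iff)
    from tendsto_mult[OF this tendsto_const[of "S y"]] show ?thesis by simp
  qed
  \<comment> \<open>Fatou's lemma, since integrability of \<open>S\<close> is still to be shown; the
    integrals with cutoff converge to \<open>w\<^sup>2 * N\<close>.\<close>
  have nnS: "(\<integral>\<^sup>+y. ennreal (S y) \<partial>lborel) \<le> ennreal (w\<^sup>2 * N)"
  proof -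
    have [measurable]: "(\<lambda>y. c i y * S y) \<in> borel_measurable borel" for i
      using borel_measurable_integrable[OF cS(1)] by simp
    have "(\<integral>\<^sup>+y. ennreal (S y) \<partial>lborel) = (\<integral>\<^sup>+y. liminf (\<lambda>i. ennreal (c i y * S y)) \<partial>lborel)"
    proof (rule nn_integral_cong)
      fix y
      show "ennreal (S y) = liminf (\<lambda>i. ennreal (c i y * S y))"
        using tendsto_ennrealI[OF clim[of y]] by (intro lim_imp_Liminf[symmetric]) auto
    qed
    also have "\<dots> \<le> liminf (\<lambda>i. \<integral>\<^sup>+y. ennreal (c i y * S y) \<partial>lborel)"
      by (intro nn_integral_liminf) measurable
    also have "(\<lambda>i. \<integral>\<^sup>+y. ennreal (c i y * S y) \<partial>lborel) = (\<lambda>i. ennreal (LINT y|lborel. c i y * S y))"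
      using cS(1) c0 S0 by (intro ext nn_integral_eq_integral) auto
    also have "liminf \<dots> = ennreal (w\<^sup>2 * N)"
      using cSlim by (intro lim_imp_Liminf tendsto_ennrealI) auto
    finally show ?thesis .
  qed
  have Si: "integrable lborel S"
    using nnS S0 by (intro integrableI_nonneg) (auto simp: less_top[symmetric] top_unique)
  have N0: "N \<ge> 0" unfolding N_def by simp
  have SN: "integral\<^sup>L lborel S \<le> w\<^sup>2 * N"
    using nnS nn_integral_eq_integral[OF Si] S0 N0 by simp
  have le: "(norm (D j k y))\<^sup>2 \<le> S y" for j k y
  proof -
    have "(norm (D j k y))\<^sup>2 \<le> (\<Sum>j\<in>UNIV. (norm (D j k y))\<^sup>2)" by (rule member_le_sum) auto
    also have "\<dots> \<le> S y" unfolding S_def by (rule member_le_sum) (auto intro: sum_nonneg)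
    finally show ?thesis .
  qed
  have i: "integrable lborel (\<lambda>y. (norm (D j k y))\<^sup>2)" by (rule integrable_dominated[OF Si]) (use le in auto)
  then show "integrable lborel (\<lambda>y. (norm (partial_deriv j (zeta k \<phi>) y))\<^sup>2)" by (simp add: D_def)
  have "(LINT y|lborel. (norm (D j k y))\<^sup>2) \<le> integral\<^sup>L lborel S" by (intro integral_mono i Si le)
  then show "(LINT y|lborel. (norm (partial_deriv j (zeta k \<phi>) y))\<^sup>2) \<le> (omega TYPE('n))\<^sup>2 * (LINT y|lborel. (norm (\<phi> y))\<^sup>2)"
    using SN by (simp add: D_def N_def w_def)
qed


section \<open>Square integrable weak derivatives\<close>

lemma norm_diff_sq_le: "(norm (a - b))\<^sup>2 \<le> 2 * (norm a)\<^sup>2 + 2 * (norm b)\<^sup>2"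
proof -
  have "(norm (a - b))\<^sup>2 \<le> (norm a + norm b)\<^sup>2" by (intro power_mono norm_triangle_ineq4) auto
  also have "\<dots> \<le> 2 * (norm a)\<^sup>2 + 2 * (norm b)\<^sup>2"
    using sum_squares_bound[of "norm a" "norm b"] by (simp add: power2_sum)
  finally show ?thesis .
qed

text \<open>Weighting the squared increments by \<open>2\<^sup>k\<close> gives almost everywhere convergence and
  a square integrable majorant at the same time.\<close>

lemma L2_fast_Cauchy:
  fixes f :: "nat \<Rightarrow> 'a \<Rightarrow> complex"
  assumes [measurable]: "\<And>k. f k \<in> borel_measurable M"
    and f0: "integrable M (\<lambda>x. (norm (f 0 x))\<^sup>2)"
    and i: "\<And>k. integrable M (\<lambda>x. (norm (f (Suc k) x - f k x))\<^sup>2)"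
    and le: "\<And>k. (LINT x|M. (norm (f (Suc k) x - f k x))\<^sup>2) \<le> C * (1 / 4) ^ k"
  obtains h w where "h \<in> borel_measurable M" "integrable M w" "AE x in M. (\<lambda>k. f k x) \<longlonglongrightarrow> h x"
    "AE x in M. \<forall>k. (norm (f k x))\<^sup>2 \<le> w x"
proof -
  define u where "u k x = 2 ^ k * (norm (f (Suc k) x - f k x))\<^sup>2" for k x
  have [measurable]: "u k \<in> borel_measurable M" for k unfolding u_def by measurable
  define G where "G x = (\<Sum>k. ennreal (u k x))" for x
  have [measurable]: "G \<in> borel_measurable M" unfolding G_def by measurable
  have "0 \<le> (LINT x|M. (norm (f (Suc 0) x - f 0 x))\<^sup>2)" by simp
  also have "\<dots> \<le> C" using le[of 0] by simp
  finally have C0: "C \<ge> 0" .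
  have "(\<integral>\<^sup>+x. G x \<partial>M) = (\<Sum>k. \<integral>\<^sup>+x. ennreal (u k x) \<partial>M)"
    unfolding G_def by (rule nn_integral_suminf) measurable
  also have "\<dots> \<le> (\<Sum>k. ennreal (C * (1 / 2) ^ k))"
  proof (intro suminf_le summableI)
    fix k
    have "(\<integral>\<^sup>+x. ennreal (u k x) \<partial>M) = ennreal (LINT x|M. u k x)"
      unfolding u_def by (intro nn_integral_eq_integral integrable_mult_right i) auto
    also have "(LINT x|M. u k x) \<le> 2 ^ k * (C * (1 / 4) ^ k)" using le[of k] by (simp add: u_def)
    also have "2 ^ k * (C * (1 / 4) ^ k) = C * (1 / 2) ^ k"
      by (simp add: power_divide flip: power_mult_distrib) (simp add: power_mult_distrib[symmetric] divide_simps)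
    finally show "(\<integral>\<^sup>+x. ennreal (u k x) \<partial>M) \<le> ennreal (C * (1 / 2) ^ k)" by (simp add: ennreal_leI)
  qed
  also have "\<dots> = ennreal (\<Sum>k. C * (1 / 2) ^ k)"
    using C0 by (intro suminf_ennreal_eq summable_sums summable_mult) auto
  finally have Gf: "(\<integral>\<^sup>+x. G x \<partial>M) < \<infinity>" by (simp add: order_le_less_trans)
  then have GAE: "AE x in M. G x \<noteq> \<infinity>" by (intro nn_integral_noteq_infinite) auto
  define g where "g x = enn2real (G x)" for x
  have g0: "g x \<ge> 0" for x by (simp add: g_def)
  have [measurable]: "g \<in> borel_measurable M" unfolding g_def by measurable
  have gi: "integrable M g"
    using Gf unfolding g_def
    by (intro integrableI_nonneg) (auto intro: order_le_less_trans[OF nn_integral_mono] simp: ennreal_enn2real_if)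
  \<comment> \<open>The weights 2^k turn \<open>u k x \<le> g x\<close> into increments of size at
    most sqrt (g x) * rho^k, a geometric bound; its sum \<open>S\<close> enters the majorant
    \<open>w\<close>.\<close>
  define rho :: real where "rho = sqrt (1 / 2)"
  have rho: "0 \<le> rho" "rho < 1" "rho\<^sup>2 = 1 / 2" unfolding rho_def by (auto simp: real_sqrt_lt_1_iff)
  define S where "S = (\<Sum>k. rho ^ k)"
  have sumr: "summable (\<lambda>k. rho ^ k)" using rho by (intro summable_geometric) simp
  have S0: "S \<ge> 0" unfolding S_def using rho sumr by (intro suminf_nonneg) auto
  define w where "w x = 2 * (norm (f 0 x))\<^sup>2 + 2 * (S\<^sup>2 * g x)" for x
  have iw: "integrable M w" unfolding w_def
    by (intro Bochner_Integration.integrable_add integrable_mult_right f0 gi)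
  have main: "convergent (\<lambda>k. f k x) \<and> (\<forall>k. (norm (f k x))\<^sup>2 \<le> w x)" if G: "G x \<noteq> \<infinity>" for x
  proof -
    have ug: "u k x \<le> g x" for k
    proof -
      have "sum (\<lambda>k. ennreal (u k x)) {k} \<le> G x" unfolding G_def by (intro sum_le_suminf) auto
      then have "ennreal (u k x) \<le> ennreal (g x)" using G by (simp add: g_def less_top)
      then show ?thesis using g0 by (simp add: ennreal_le_iff)
    qed
    have d: "norm (f (Suc k) x - f k x) \<le> sqrt (g x) * rho ^ k" for k
    proof -
      have "(norm (f (Suc k) x - f k x))\<^sup>2 = u k x * (1 / 2) ^ k" by (simp add: u_def power_divide)
      also have "\<dots> \<le> g x * (1 / 2) ^ k" using ug by (intro mult_right_mono) auto
      also have "\<dots> = (sqrt (g x) * rho ^ k)\<^sup>2"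
      proof -
        have "(rho ^ k)\<^sup>2 = (1 / 2) ^ k" by (metis power_mult mult.commute rho(3))
        then show ?thesis using g0[of x] by (simp add: power_mult_distrib)
      qed
      finally have "(norm (f (Suc k) x - f k x))\<^sup>2 \<le> (sqrt (g x) * rho ^ k)\<^sup>2" .
      then show ?thesis by (rule power2_le_imp_le) (simp add: g0 rho(1))
    qed
    have sm: "summable (\<lambda>k. norm (f (Suc k) x - f k x))"
    proof (rule summable_comparison_test')
      show "summable (\<lambda>k. sqrt (g x) * rho ^ k)" by (rule summable_mult[OF sumr])
      show "norm (norm (f (Suc k) x - f k x)) \<le> sqrt (g x) * rho ^ k" if "k \<ge> 0" for k using d[of k] by simp
    qed
    have tel: "f k x = f 0 x + (\<Sum>i<k. f (Suc i) x - f i x)" for k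
      using sum_lessThan_telescope[of "\<lambda>i. f i x" k] by simp
    have "(\<lambda>k. \<Sum>i<k. f (Suc i) x - f i x) \<longlonglongrightarrow> (\<Sum>i. f (Suc i) x - f i x)"
      by (rule summable_LIMSEQ[OF summable_norm_cancel[OF sm]])
    then have "(\<lambda>k. f 0 x + (\<Sum>i<k. f (Suc i) x - f i x)) \<longlonglongrightarrow> f 0 x + (\<Sum>i. f (Suc i) x - f i x)"
      by (intro tendsto_intros)
    then have conv: "convergent (\<lambda>k. f k x)" unfolding tel[symmetric] by (rule convergentI)
    have "(norm (f k x))\<^sup>2 \<le> w x" for k
    proof -
      have "norm (\<Sum>i<k. f (Suc i) x - f i x) \<le> (\<Sum>i<k. sqrt (g x) * rho ^ i)"
        by (intro sum_norm_le d)
      also have "\<dots> = sqrt (g x) * (\<Sum>i<k. rho ^ i)" by (simp add: sum_distrib_left)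
      also have "\<dots> \<le> sqrt (g x) * S"
        unfolding S_def using g0[of x] rho by (intro mult_left_mono sum_le_suminf sumr) auto
      finally have "(norm (\<Sum>i<k. f (Suc i) x - f i x))\<^sup>2 \<le> (sqrt (g x) * S)\<^sup>2" by (intro power_mono) auto
      also have "\<dots> = S\<^sup>2 * g x" using g0[of x] by (simp add: power_mult_distrib mult.commute)
      finally show ?thesis
        using norm_diff_sq_le[of "f 0 x" "- (\<Sum>i<k. f (Suc i) x - f i x)"]
        by (simp add: w_def flip: tel)
    qed
    then show ?thesis using conv by blast
  qed
  show ?thesis
  proof (rule that[of "\<lambda>x. lim (\<lambda>k. f k x)" w])
    show "AE x in M. (\<lambda>k. f k x) \<longlonglongrightarrow> lim (\<lambda>k. f k x)"
      using GAE by eventually_elim (use main in \<open>auto simp: convergent_LIMSEQ_iff\<close>)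
    show "AE x in M. \<forall>k. (norm (f k x))\<^sup>2 \<le> w x" using GAE by eventually_elim (use main in auto)
  qed (use iw in measurable)
qed

section \<open>Riesz representation over test functions\<close>

definition sqint :: "(real^'n::finite \<Rightarrow> complex) \<Rightarrow> real" where
  "sqint f = (LINT x|lborel. (norm (f x))\<^sup>2)"

lemma sq_integrable_mult:
  fixes f g :: "'a \<Rightarrow> complex"
  assumes "f \<in> borel_measurable M" "g \<in> borel_measurable M"
    and "integrable M (\<lambda>x. (norm (f x))\<^sup>2)" "integrable M (\<lambda>x. (norm (g x))\<^sup>2)"
  shows "integrable M (\<lambda>x. f x * g x)"
proof (rule integrable_dominated[where w="\<lambda>x. (norm (f x))\<^sup>2 + (norm (g x))\<^sup>2"])
  show "norm (f x * g x) \<le> (norm (f x))\<^sup>2 + (norm (g x))\<^sup>2" for x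
    using sum_squares_bound[of "norm (f x)" "norm (g x)"] zero_le_power2[of "norm (f x)"] zero_le_power2[of "norm (g x)"]
      mult_nonneg_nonneg[OF norm_ge_zero[of "f x"] norm_ge_zero[of "g x"]]
    unfolding norm_mult by linarith
qed (use assms in auto)

text \<open>A nonnegative parabola through the origin has its minimum at \<open>t = 0\<close>, so
  its slope there vanishes; this is the form in which first variations are used.\<close>

lemma real_affine_bound_zero:
  fixes a b :: real
  assumes "\<And>t. 0 \<le> t\<^sup>2 * b + 2 * t * a"
  shows "a = 0"
proof (rule ccontr)
  assume a: "a \<noteq> 0"
  define t where "t = - a / (\<bar>b\<bar> + 1)"
  have p: "\<bar>b\<bar> + 1 > 0" by linarith
  have "t\<^sup>2 * b + 2 * t * a = (a\<^sup>2 / (\<bar>b\<bar> + 1)\<^sup>2) * b - 2 * a\<^sup>2 / (\<bar>b\<bar> + 1)"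
    by (simp add: t_def power2_eq_square)
  also have "(a\<^sup>2 / (\<bar>b\<bar> + 1)\<^sup>2) * b \<le> (a\<^sup>2 / (\<bar>b\<bar> + 1)\<^sup>2) * (\<bar>b\<bar> + 1)" by (intro mult_left_mono) auto
  also have "\<dots> = a\<^sup>2 / (\<bar>b\<bar> + 1)" using p by (simp add: power2_eq_square)
  finally have "t\<^sup>2 * b + 2 * t * a \<le> - (a\<^sup>2 / (\<bar>b\<bar> + 1))" by simp
  moreover have "a\<^sup>2 / (\<bar>b\<bar> + 1) > 0" using a p by simp
  ultimately show False using assms[of t] by linarith
qed

lemma norm_add_scaled_sq: "(norm (a + of_real t * b))\<^sup>2 = (norm a)\<^sup>2 + 2 * t * Re (a * cnj b) + t\<^sup>2 * (norm b)\<^sup>2"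
  for a b :: complex
  unfolding cmod_power2 by (simp add: power2_eq_square algebra_simps)

text \<open>Riesz representation on the non-complete space of test functions: a minimising sequence of
  \<open>N(\<phi>) - 2 Re \<ell>(\<phi>)\<close> is Cauchy by the parallelogram law.\<close>

lemma riesz_representation:
  fixes l :: "(real^'n::finite \<Rightarrow> complex) \<Rightarrow> complex"
  assumes add: "\<And>\<phi> \<psi>. test_function \<phi> \<Longrightarrow> test_function \<psi> \<Longrightarrow> l (\<lambda>x. \<phi> x + \<psi> x) = l \<phi> + l \<psi>"
    and scale: "\<And>c \<phi>. test_function \<phi> \<Longrightarrow> l (\<lambda>x. c * \<phi> x) = c * l \<phi>"
    and bound: "\<And>\<phi>. test_function \<phi> \<Longrightarrow> 2 * Re (l \<phi>) \<le> sqint \<phi> + K"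
  obtains h where "h \<in> borel_measurable borel" "integrable lborel (\<lambda>x. (norm (h x))\<^sup>2)"
    "\<And>\<phi>. test_function \<phi> \<Longrightarrow> l \<phi> = (LINT x|lborel. \<phi> x * h x)"
proof -
  define J where "J \<phi> = sqint \<phi> - 2 * Re (l \<phi>)" for \<phi>
  have cmult: "test_function (\<lambda>x. c * \<phi> x)" if "test_function \<phi>" for c and \<phi> :: "real^'n \<Rightarrow> complex"
    using test_function_mult(2)[OF that smooth_const] .
  have comb: "test_function (\<lambda>x. \<phi> x + of_real t * \<psi> x)" if "test_function \<phi>" "test_function \<psi>" for \<phi> \<psi> :: "real^'n \<Rightarrow> complex" and t
    using test_function_add[OF that(1) cmult[OF that(2)]] .
  have meas: "\<phi> \<in> borel_measurable borel" if "test_function \<phi>" for \<phi> :: "real^'n \<Rightarrow> complex"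
    using that test_function_measurable by blast
  have prod: "integrable lborel (\<lambda>x. \<phi> x * cnj (\<psi> x))" if "test_function \<phi>" "test_function \<psi>" for \<phi> \<psi> :: "real^'n \<Rightarrow> complex"
    using test_function_integrable(1)[OF test_function_mult(1)[OF that(1) smooth_cnj[OF test_function_smooth[OF that(2)]]]] .
  have N: "sqint (\<lambda>x. \<phi> x + of_real t * \<psi> x) = sqint \<phi> + 2 * t * Re (LINT x|lborel. \<phi> x * cnj (\<psi> x)) + t\<^sup>2 * sqint \<psi>"
    if "test_function \<phi>" "test_function \<psi>" for \<phi> \<psi> :: "real^'n \<Rightarrow> complex" and t
  proof -
    have "sqint (\<lambda>x. \<phi> x + of_real t * \<psi> x) = (LINT x|lborel. (norm (\<phi> x))\<^sup>2 + 2 * t * Re (\<phi> x * cnj (\<psi> x)) + t\<^sup>2 * (norm (\<psi> x))\<^sup>2)"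
      by (simp only: sqint_def norm_add_scaled_sq)
    also have "\<dots> = sqint \<phi> + 2 * t * (LINT x|lborel. Re (\<phi> x * cnj (\<psi> x))) + t\<^sup>2 * sqint \<psi>"
    proof -
      have 1: "integrable lborel (\<lambda>x. (norm (\<phi> x))\<^sup>2)" "integrable lborel (\<lambda>x. 2 * t * Re (\<phi> x * cnj (\<psi> x)))"
         "integrable lborel (\<lambda>x. t\<^sup>2 * (norm (\<psi> x))\<^sup>2)"
        by (rule test_function_integrable(2)[OF that(1)]
            integrable_mult_right[OF integrable_Re[OF prod[OF that]]]
            integrable_mult_right[OF test_function_integrable(2)[OF that(2)]])+
      show ?thesis
        unfolding Bochner_Integration.integral_add[OF Bochner_Integration.integrable_add[OF 1(1,2)] 1(3)] Bochner_Integration.integral_add[OF 1(1,2)]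
        by (simp add: sqint_def)
    qed
    also have "(LINT x|lborel. Re (\<phi> x * cnj (\<psi> x))) = Re (LINT x|lborel. \<phi> x * cnj (\<psi> x))"
      by (rule integral_Re[OF prod[OF that]])
    finally show ?thesis .
  qed
  have Jt: "J (\<lambda>x. \<phi> x + of_real t * \<psi> x) = J \<phi> + 2 * t * (Re (LINT x|lborel. \<phi> x * cnj (\<psi> x)) - Re (l \<psi>)) + t\<^sup>2 * sqint \<psi>"
    if "test_function \<phi>" "test_function \<psi>" for \<phi> \<psi> t
    unfolding J_def N[OF that] by (simp add: add[OF that(1) cmult[OF that(2)]] scale[OF that(2)] algebra_simps)
  define T :: "(real^'n \<Rightarrow> complex) set" where "T = {\<phi>. test_function \<phi>}"
  have ne: "J ` T \<noteq> {}" using cutoff_test[of 1] by (auto simp: T_def)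
  \<comment> \<open>Boundedness of \<open>l\<close> is assumed in the quadratic form 2 Re l <= N +
    K, which is literally a lower bound for the functional \<open>J\<close>.\<close>
  have bdd: "bdd_below (J ` T)"
  proof (rule bdd_belowI2[of _ "- K"])
    fix \<phi> assume "\<phi> \<in> T"
    then have "2 * Re (l \<phi>) \<le> sqint \<phi> + K" using bound by (simp add: T_def)
    then show "- K \<le> J \<phi>" unfolding J_def by linarith
  qed
  define m where "m = Inf (J ` T)"
  have mle: "m \<le> J \<phi>" if "test_function \<phi>" for \<phi>
    unfolding m_def using that by (intro cInf_lower bdd) (auto simp: T_def)
  have "\<exists>\<phi>. test_function \<phi> \<and> J \<phi> < m + (1 / 4) ^ k" for k
    using cInf_lessD[OF ne, of "m + (1 / 4) ^ k"] unfolding m_def T_def by auto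
  then obtain f where f: "\<And>k. test_function (f k)" "\<And>k. J (f k) < m + (1 / 4) ^ k" by metis
  have [measurable]: "f k \<in> borel_measurable borel" for k using f(1) meas by blast
  have diffT: "test_function (\<lambda>x. f (Suc k) x - f k x)" for k
    using comb[OF f(1)[of "Suc k"] f(1)[of k], of "- 1"] by simp
  \<comment> \<open>Two near-minimisers and their midpoint: the outer values exceed \<open>m\<close>
    by less than (1/4)^k and (1/4)^(k+1), while the midpoint value is at least \<open>m\<close>. The
    parallelogram law then puts the squared distance well below 8 * (1/4)^k.\<close>
  have step: "sqint (\<lambda>x. f (Suc k) x - f k x) \<le> 8 * (1 / 4) ^ k" for k
  proof -
    let ?a = "f k" and ?b = "\<lambda>x. f (Suc k) x - f k x"
    define r where "r = Re (LINT x|lborel. ?a x * cnj (?b x)) - Re (l ?b)"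
    have 1: "J (f (Suc k)) = J ?a + 2 * r + sqint ?b"
      using Jt[OF f(1)[of k] diffT[of k], of 1] by (simp add: r_def)
    have 2: "m \<le> J ?a + r + sqint ?b / 4"
      using Jt[OF f(1)[of k] diffT[of k], of "1 / 2"] mle[OF comb[OF f(1)[of k] diffT[of k], of "1 / 2"]]
      by (simp add: r_def power2_eq_square)
    have "(1 / 4 :: real) ^ Suc k \<le> (1 / 4) ^ k" "(1 / 4 :: real) ^ k \<ge> 0" by simp_all
    then show ?thesis using 1 2 f(2)[of k] f(2)[of "Suc k"] by linarith
  qed
  have fm: "f k \<in> borel_measurable lborel" for k by simp
  have fi: "integrable lborel (\<lambda>x. (norm (f 0 x))\<^sup>2)" "integrable lborel (\<lambda>x. (norm (f (Suc k) x - f k x))\<^sup>2)" for k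
    by (rule test_function_integrable(2)[OF f(1)] test_function_integrable(2)[OF diffT])+
  have fle: "(LINT x|lborel. (norm (f (Suc k) x - f k x))\<^sup>2) \<le> 8 * (1 / 4) ^ k" for k
    using step[of k] by (simp add: sqint_def)
  obtain h w where h: "h \<in> borel_measurable lborel" "integrable lborel w" "AE x in lborel. (\<lambda>k. f k x) \<longlonglongrightarrow> h x"
    "AE x in lborel. \<forall>k. (norm (f k x))\<^sup>2 \<le> w x"
    using L2_fast_Cauchy[OF fm fi fle] by blast
  have [measurable]: "h \<in> borel_measurable borel" using h(1) by simp
  have hi: "integrable lborel (\<lambda>x. (norm (h x))\<^sup>2)"
  proof (rule Bochner_Integration.integrable_bound[OF h(2)])
    show "AE x in lborel. norm ((norm (h x))\<^sup>2) \<le> norm (w x)"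
      using h(3,4)
    proof eventually_elim
      case (elim x)
      have "(\<lambda>k. (norm (f k x))\<^sup>2) \<longlonglongrightarrow> (norm (h x))\<^sup>2" using elim(1) by (intro tendsto_intros)
      then have "(norm (h x))\<^sup>2 \<le> w x" by (rule LIMSEQ_le_const2) (use elim(2) in auto)
      then show ?case by simp
    qed
  qed measurable
  have lim: "(\<lambda>k. LINT x|lborel. f k x * cnj (\<psi> x)) \<longlonglongrightarrow> (LINT x|lborel. h x * cnj (\<psi> x))" if \<psi>: "test_function \<psi>" for \<psi>
  proof (rule integral_dominated_convergence[where w="\<lambda>x. w x + (norm (\<psi> x))\<^sup>2"])
    have [measurable]: "\<psi> \<in> borel_measurable borel" using meas[OF \<psi>] .
    show "(\<lambda>x. h x * cnj (\<psi> x)) \<in> borel_measurable lborel" "(\<lambda>x. f k x * cnj (\<psi> x)) \<in> borel_measurable lborel" for k by measurable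
    show "integrable lborel (\<lambda>x. w x + (norm (\<psi> x))\<^sup>2)"
      using h(2) test_function_integrable(2)[OF \<psi>] by simp
    show "AE x in lborel. (\<lambda>k. f k x * cnj (\<psi> x)) \<longlonglongrightarrow> h x * cnj (\<psi> x)"
      using h(3) by eventually_elim (intro tendsto_intros)
    show "AE x in lborel. norm (f k x * cnj (\<psi> x)) \<le> w x + (norm (\<psi> x))\<^sup>2" for k
      using h(4)
    proof eventually_elim
      case (elim x)
      show ?case
        using elim[rule_format, of k] sum_squares_bound[of "norm (f k x)" "norm (\<psi> x)"]
          mult_nonneg_nonneg[OF norm_ge_zero[of "f k x"] norm_ge_zero[of "\<psi> x"]]
        unfolding norm_mult complex_mod_cnj by linarith
    qed
  qed
  \<comment> \<open>First variation. The limit \<open>h\<close> need not be a test function, so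
    minimality is used for \<open>f k\<close> with error (1/4)^k and then passed to the
    limit.\<close>
  have EL: "Re (LINT x|lborel. h x * cnj (\<psi> x)) = Re (l \<psi>)" if \<psi>: "test_function \<psi>" for \<psi>
  proof -
    let ?d = "Re (LINT x|lborel. h x * cnj (\<psi> x)) - Re (l \<psi>)"
    have "0 \<le> t\<^sup>2 * sqint \<psi> + 2 * t * ?d" for t
    proof (rule LIMSEQ_le_const)
      show "(\<lambda>k. t\<^sup>2 * sqint \<psi> + 2 * t * (Re (LINT x|lborel. f k x * cnj (\<psi> x)) - Re (l \<psi>)) + (1 / 4) ^ k)
          \<longlonglongrightarrow> t\<^sup>2 * sqint \<psi> + 2 * t * ?d"
        using tendsto_add[OF tendsto_add[OF tendsto_const[of "t\<^sup>2 * sqint \<psi>"]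
            tendsto_mult[OF tendsto_const[of "2 * t"] tendsto_diff[OF tendsto_Re[OF lim[OF \<psi>]] tendsto_const[of "Re (l \<psi>)"]]]]
            LIMSEQ_realpow_zero[of "1 / 4"]] by simp
      have "0 \<le> t\<^sup>2 * sqint \<psi> + 2 * t * (Re (LINT x|lborel. f k x * cnj (\<psi> x)) - Re (l \<psi>)) + (1 / 4) ^ k" for k
        using Jt[OF f(1)[of k] \<psi>, of t] mle[OF comb[OF f(1)[of k] \<psi>, of t]] f(2)[of k] by linarith
      then show "\<exists>N. \<forall>k\<ge>N. 0 \<le> t\<^sup>2 * sqint \<psi> + 2 * t * (Re (LINT x|lborel. f k x * cnj (\<psi> x)) - Re (l \<psi>)) + (1 / 4) ^ k"
        by blast
    qed
    then have "?d = 0" by (rule real_affine_bound_zero)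
    then show ?thesis by simp
  qed
  \<comment> \<open>Only real parts are controlled so far; testing with
    \<open>\<i> * \<psi> x\<close> supplies the imaginary part. The pairing is sesquilinear here,
    hence the conjugate of \<open>h\<close> in the final representation.\<close>
  have rep: "(LINT x|lborel. h x * cnj (\<psi> x)) = cnj (l \<psi>)" if \<psi>: "test_function \<psi>" for \<psi>
  proof -
    have [measurable]: "\<psi> \<in> borel_measurable borel" using meas[OF \<psi>] .
    have "integrable lborel (\<lambda>x. h x * cnj (\<psi> x))"
      by (rule sq_integrable_mult) (use hi test_function_integrable(2)[OF \<psi>] in auto)
    then have "(LINT x|lborel. h x * cnj (\<i> * \<psi> x)) = - \<i> * (LINT x|lborel. h x * cnj (\<psi> x))"
      by (simp add: mult.left_commute)
    then have "Re (- \<i> * (LINT x|lborel. h x * cnj (\<psi> x))) = Re (\<i> * l \<psi>)"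
      using EL[OF cmult[OF \<psi>, of \<i>]] by (simp add: scale[OF \<psi>])
    then show ?thesis using EL[OF \<psi>] by (simp add: complex_eq_iff)
  qed
  show ?thesis
  proof (rule that[of "\<lambda>x. cnj (h x)"])
    show "l \<phi> = (LINT x|lborel. \<phi> x * cnj (h x))" if \<phi>: "test_function \<phi>" for \<phi>
    proof -
      have "(LINT x|lborel. \<phi> x * cnj (h x)) = (LINT x|lborel. cnj (h x * cnj (\<phi> x)))"
        by (simp add: mult.commute)
      also have "\<dots> = cnj (LINT x|lborel. h x * cnj (\<phi> x))"
        by (rule integral_bounded_linear[OF bounded_linear_cnj])
          (rule sq_integrable_mult, use hi test_function_integrable(2)[OF \<phi>] meas[OF \<phi>] in auto)
      finally show ?thesis using rep[OF \<phi>] by simp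
    qed
  qed (use hi in auto)
qed

section \<open>Convolution with the Riesz kernel and its weak derivatives\<close>

definition pot :: "'n \<Rightarrow> (real^'n::finite \<Rightarrow> complex) \<Rightarrow> real^'n \<Rightarrow> complex" where
  "pot k g x = (LINT y|lborel. of_real (riesz k (x - y)) * g y)"

text \<open>The weight is the decay rate of \<open>zeta\<close>, so sources of this class have
  absolutely convergent pairings with potentials of test functions.\<close>

definition admissible :: "(real^'n::finite \<Rightarrow> complex) \<Rightarrow> bool" where
  "admissible g \<longleftrightarrow> g \<in> borel_measurable borel \<and> integrable lborel (\<lambda>y. (1 + norm y) powr (1 - real CARD('n)) * norm (g y))"

lemma pot_measurable: "admissible g \<Longrightarrow> pot k g \<in> borel_measurable borel"
proof -
  assume "admissible g"
  then have [measurable]: "g \<in> borel_measurable borel" by (simp add: admissible_def)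
  show ?thesis unfolding pot_def by measurable
qed

text \<open>Absolute convergence of the double integral is \<open>kap_convolution_bound\<close>
  against the weight in \<open>admissible\<close>. Asking of \<open>f\<close> just boundedness and
  bounded support admits indicators of balls, which give local integrability of the potential and
  convergence of its integral almost everywhere.\<close>

lemma pot_fubini:
  fixes f g :: "real^'n::finite \<Rightarrow> complex"
  assumes g: "admissible g" and [measurable]: "f \<in> borel_measurable borel"
    and M: "\<And>x. norm (f x) \<le> M" and R: "\<And>x. norm x \<ge> R \<Longrightarrow> f x = 0"
  shows "AE x in lborel. f x \<noteq> 0 \<longrightarrow> integrable lborel (\<lambda>y. of_real (riesz k (x - y)) * g y)"
    and "integrable lborel (\<lambda>x. f x * pot k g x)"
    and "(LINT x|lborel. f x * pot k g x) = (LINT y|lborel. g y * zeta k f y)"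
    and "integrable lborel (\<lambda>y. g y * zeta k f y)"
proof -
  have [measurable]: "g \<in> borel_measurable borel" using g by (simp add: admissible_def)
  obtain C where C: "C \<ge> 0" "\<And>y. integrable lborel (\<lambda>z. kap z * norm (f (y + z)))"
     "\<And>y. (LINT z|lborel. kap z * norm (f (y + z))) \<le> C * (1 + norm y) powr (1 - real CARD('n))"
    using kap_convolution_bound[of f M R] M R by auto
  define F where "F y x = g y * (of_real (riesz k (x - y)) * f x)" for y x
  have [measurable]: "case_prod F \<in> borel_measurable (lborel \<Otimes>\<^sub>M lborel)" unfolding F_def by measurable
  have shift: "integrable lborel (\<lambda>x. of_real (riesz k (x - y)) * f x)"
     "(LINT x|lborel. of_real (riesz k (x - y)) * f x) = zeta k f y"
     "integrable lborel (\<lambda>x. norm (of_real (riesz k (x - y)) * f x))"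
     "(LINT x|lborel. norm (of_real (riesz k (x - y)) * f x)) \<le> C * (1 + norm y) powr (1 - real CARD('n))" for y
  proof -
    have i: "integrable lborel (\<lambda>z. of_real (riesz k z) * f (y + z))"
      by (rule kernel_integrable[of "riesz k" f M R]) (use riesz_le_kap M R in auto)
    show 1: "integrable lborel (\<lambda>x. of_real (riesz k (x - y)) * f x)"
      using integrable_lborel_translate[of "\<lambda>x. of_real (riesz k (x - y)) * f x" y] i by (simp add: add.commute)
    show "(LINT x|lborel. of_real (riesz k (x - y)) * f x) = zeta k f y"
      unfolding zeta_def using integral_lborel_translate[of "\<lambda>x. of_real (riesz k (x - y)) * f x" y] by (simp add: add.commute)
    show "integrable lborel (\<lambda>x. norm (of_real (riesz k (x - y)) * f x))" using 1 by (rule integrable_norm)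
    have "(LINT x|lborel. norm (of_real (riesz k (x - y)) * f x)) = (LINT z|lborel. norm (of_real (riesz k z) * f (y + z)))"
      using integral_lborel_translate[of "\<lambda>x. norm (of_real (riesz k (x - y)) * f x)" y] by (simp add: add.commute)
    also have "\<dots> \<le> (LINT z|lborel. kap z * norm (f (y + z)))"
      by (intro integral_mono integrable_norm i C(2)) (auto simp: norm_mult riesz_le_kap mult_right_mono)
    also note C(3)[of y]
    finally show "(LINT x|lborel. norm (of_real (riesz k (x - y)) * f x)) \<le> C * (1 + norm y) powr (1 - real CARD('n))" .
  qed
  have int: "integrable (lborel \<Otimes>\<^sub>M lborel) (case_prod F)"
  proof (rule lborel_pair.Fubini_integrable)
    show "integrable lborel (\<lambda>y. LINT x|lborel. norm (case_prod F (y, x)))"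
    proof (rule integrable_dominated)
      show "integrable lborel (\<lambda>y. C * ((1 + norm y) powr (1 - real CARD('n)) * norm (g y)))"
        using g by (intro integrable_mult_right) (simp add: admissible_def)
      show "(\<lambda>y. LINT x|lborel. norm (case_prod F (y, x))) \<in> borel_measurable lborel" by measurable
      show "norm (LINT x|lborel. norm (case_prod F (y, x))) \<le> C * ((1 + norm y) powr (1 - real CARD('n)) * norm (g y))" for y
      proof -
        have "(LINT x|lborel. norm (case_prod F (y, x))) = norm (g y) * (LINT x|lborel. norm (of_real (riesz k (x - y)) * f x))"
          by (simp add: F_def norm_mult)
        also have "\<dots> \<le> norm (g y) * (C * (1 + norm y) powr (1 - real CARD('n)))" by (intro mult_left_mono shift) auto
        finally have "(LINT x|lborel. norm (case_prod F (y, x))) \<le> C * ((1 + norm y) powr (1 - real CARD('n)) * norm (g y))"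
          by (simp add: mult_ac)
        then show ?thesis by (simp add: integral_nonneg)
      qed
    qed
    show "AE y in lborel. integrable lborel (\<lambda>x. case_prod F (y, x))"
      using shift(1) by (intro AE_I2) (simp add: F_def)
  qed measurable
  have swap: "(LINT x|lborel. LINT y|lborel. F y x) = (LINT y|lborel. LINT x|lborel. F y x)"
    by (rule lborel_pair.Fubini_integral[OF int])
  have inner: "(LINT y|lborel. F y x) = f x * pot k g x" for x
  proof -
    have "(LINT y|lborel. F y x) = (LINT y|lborel. f x * (of_real (riesz k (x - y)) * g y))" by (simp add: F_def mult_ac)
    then show ?thesis by (simp add: pot_def)
  qed
  have outer: "(LINT x|lborel. F y x) = g y * zeta k f y" for y
    unfolding F_def using shift(1,2)[of y] by simp
  show "(LINT x|lborel. f x * pot k g x) = (LINT y|lborel. g y * zeta k f y)" using swap by (simp only: inner outer)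
  show "integrable lborel (\<lambda>y. g y * zeta k f y)"
    using lborel_pair.integrable_fst[OF int] by (simp only: outer)
  show "integrable lborel (\<lambda>x. f x * pot k g x)"
    using lborel_pair.integrable_snd[OF int] by (simp only: inner)
  show "AE x in lborel. f x \<noteq> 0 \<longrightarrow> integrable lborel (\<lambda>y. of_real (riesz k (x - y)) * g y)"
    using lborel_pair.AE_integrable_snd[OF int]
  proof eventually_elim
    case (elim x)
    show ?case
    proof
      assume fx: "f x \<noteq> 0"
      from elim have "integrable lborel (\<lambda>y. inverse (f x) * F y x)" by (rule integrable_mult_right)
      moreover have "inverse (f x) * F y x = of_real (riesz k (x - y)) * g y" for y
        using fx by (simp add: F_def)
      ultimately show "integrable lborel (\<lambda>y. of_real (riesz k (x - y)) * g y)" by (simp only:)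
    qed
  qed
qed

lemma pot_AE_integrable:
  assumes g: "admissible g"
  shows "AE x in lborel. integrable lborel (\<lambda>y. of_real (riesz k (x - y)) * g y)"
proof -
  have "AE x in lborel. \<forall>m::nat. indicator (ball 0 (real m)) x \<noteq> (0::complex) \<longrightarrow> integrable lborel (\<lambda>y. of_real (riesz k (x - y)) * g y)"
    unfolding AE_all_countable
  proof
    fix m :: nat
    show "AE x in lborel. indicator (ball 0 (real m)) x \<noteq> (0::complex) \<longrightarrow> integrable lborel (\<lambda>y. of_real (riesz k (x - y)) * g y)"
      by (rule pot_fubini(1)[OF g, of _ 1 "real m"]) (auto simp: indicator_def)
  qed
  then show ?thesis
  proof eventually_elim
    case (elim x)
    obtain m :: nat where "norm x < real m" using reals_Archimedean2 by blast
    then show ?case using elim[rule_format, of m] by simp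
  qed
qed

lemma pot_set_integrable:
  fixes g :: "real^'n::finite \<Rightarrow> complex"
  assumes g: "admissible g" and K: "compact K"
  shows "set_integrable lborel K (pot k g)"
proof -
  obtain r where r: "K \<subseteq> ball 0 r" using K compact_imp_bounded bounded_subset_ballD by blast
  have "integrable lborel (\<lambda>x. indicator (ball 0 r) x * pot k g x)"
    by (rule pot_fubini(2)[OF g, of _ 1 r]) (auto simp: indicator_def)
  moreover have "indicator (ball 0 r) x * pot k g x = indicator (ball 0 r) x *\<^sub>R pot k g x" for x
    by (simp split: split_indicator)
  ultimately have "set_integrable lborel (ball 0 r) (pot k g)" by (simp add: set_integrable_def)
  then show ?thesis by (rule set_integrable_subset) (use r K in \<open>auto intro: borel_compact\<close>)
qed

lemma pot_test:
  assumes "admissible g" "test_function \<phi>"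
  shows "integrable lborel (\<lambda>x. \<phi> x * pot k g x)"
    and "integrable lborel (\<lambda>y. g y * zeta k \<phi> y)"
    and "(LINT x|lborel. \<phi> x * pot k g x) = (LINT y|lborel. g y * zeta k \<phi> y)"
proof -
  obtain M R where MR: "\<And>x. norm (\<phi> x) \<le> M" "\<And>x. norm x \<ge> R \<Longrightarrow> \<phi> x = 0"
    using test_function_bounds[OF assms(2)] by metis
  have m: "\<phi> \<in> borel_measurable borel" using assms(2) test_function_measurable by blast
  show "integrable lborel (\<lambda>x. \<phi> x * pot k g x)" "integrable lborel (\<lambda>y. g y * zeta k \<phi> y)"
    "(LINT x|lborel. \<phi> x * pot k g x) = (LINT y|lborel. g y * zeta k \<phi> y)"
    using pot_fubini(2,3,4)[OF assms(1) m, of M R k] MR by auto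
qed

lemma zeta_add:
  assumes "test_function \<phi>" "test_function \<psi>"
  shows "zeta k (\<lambda>x. \<phi> x + \<psi> x) y = zeta k \<phi> y + zeta k \<psi> y"
  unfolding zeta_def using zeta_integrable[OF assms(1)] zeta_integrable[OF assms(2)] by (simp add: distrib_left)

lemma zeta_scale: "zeta k (\<lambda>x. c * \<phi> x) y = c * zeta k \<phi> y"
proof -
  have "zeta k (\<lambda>x. c * \<phi> x) y = (LINT z|lborel. c * (of_real (riesz k z) * \<phi> (y + z)))"
    unfolding zeta_def by (simp add: mult.left_commute)
  then show ?thesis by (simp add: zeta_def)
qed

lemma omega_pos: "omega TYPE('n::finite) > 0"
  by (simp add: omega_def)

text \<open>By duality the distributional derivative sends \<open>\<phi>\<close> to an integral of
  \<open>g\<close> against a derivative of \<open>zeta k \<phi>\<close>, which the energy estimate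
  bounds in L^2; Riesz representation turns this functional into a function.\<close>

lemma pot_weak_derivative:
  fixes g :: "real^'n::finite \<Rightarrow> complex"
  assumes g: "admissible g" and g2: "integrable lborel (\<lambda>x. (norm (g x))\<^sup>2)" and n2: "CARD('n) \<ge> 2"
  obtains h where "h \<in> borel_measurable borel" "integrable lborel (\<lambda>x. (norm (h x))\<^sup>2)"
    "\<And>\<phi>. test_function \<phi> \<Longrightarrow> (LINT x|lborel. \<phi> x * h x) = - (LINT x|lborel. partial_deriv j \<phi> x * pot k g x)"
proof -
  define w where "w = omega TYPE('n)"
  have w: "w > 0" unfolding w_def by (rule omega_pos)
  define l where "l \<phi> = - (LINT x|lborel. partial_deriv j \<phi> x * pot k g x)" for \<phi>
  have [measurable]: "g \<in> borel_measurable borel" using g by (simp add: admissible_def)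
  have l: "l \<phi> = - (LINT y|lborel. g y * partial_deriv j (zeta k \<phi>) y)"
     "integrable lborel (\<lambda>y. g y * partial_deriv j (zeta k \<phi>) y)" if "test_function \<phi>" for \<phi>
    unfolding l_def zeta_partial[OF that] using pot_test[OF g test_function_partial[OF that]] by simp_all
  have pd: "partial_deriv j (zeta k (\<lambda>x. \<phi> x + \<psi> x)) y = partial_deriv j (zeta k \<phi>) y + partial_deriv j (zeta k \<psi>) y"
    if "test_function \<phi>" "test_function \<psi>" for \<phi> \<psi> y
  proof -
    have "partial_deriv j (\<lambda>x. \<phi> x + \<psi> x) = (\<lambda>x. partial_deriv j \<phi> x + partial_deriv j \<psi> x)"
      using that smooth_differentiable test_function_smooth by (intro ext partial_deriv_add) blast+
    then show ?thesis
      using zeta_add[OF test_function_partial[OF that(1)] test_function_partial[OF that(2)]]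
      by (simp add: that zeta_partial test_function_add)
  qed
  have ps: "partial_deriv j (zeta k (\<lambda>x. c * \<phi> x)) y = c * partial_deriv j (zeta k \<phi>) y"
    if "test_function \<phi>" for c \<phi> y
  proof -
    have "partial_deriv j (\<lambda>x. c * \<phi> x) = (\<lambda>x. c * partial_deriv j \<phi> x)"
      using that smooth_differentiable test_function_smooth by (intro ext partial_deriv_cmult) blast
    then show ?thesis
      using that test_function_mult(2)[OF that smooth_const] by (simp add: zeta_partial zeta_scale)
  qed
  have bound: "2 * Re (l \<phi>) \<le> sqint \<phi> + w\<^sup>2 * sqint g" if \<phi>: "test_function \<phi>" for \<phi>
  proof -
    let ?d = "partial_deriv j (zeta k \<phi>)"
    note en = zeta_energy[OF \<phi> n2, of j k]
    have "2 * Re (l \<phi>) \<le> norm (2 * (LINT y|lborel. g y * ?d y))"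
      using complex_Re_le_cmod[of "l \<phi>"] by (simp add: l(1)[OF \<phi>] norm_mult)
    also have "2 * (LINT y|lborel. g y * ?d y) = (LINT y|lborel. 2 * (g y * ?d y))" by simp
    \<comment> \<open>Young's inequality weighted by \<open>w\<close>, so that after
      \<open>zeta_energy\<close> the second term is at most \<open>sqint \<phi>\<close> with
      constant 1, as \<open>riesz_representation\<close> demands.\<close>
    also have "norm \<dots> \<le> (LINT y|lborel. w\<^sup>2 * (norm (g y))\<^sup>2 + (norm (?d y))\<^sup>2 / w\<^sup>2)"
    proof (rule Bochner_Integration.integral_norm_bound_integral)
      show "integrable lborel (\<lambda>y. 2 * (g y * ?d y))" using l(2)[OF \<phi>] by simp
      show "integrable lborel (\<lambda>y. w\<^sup>2 * (norm (g y))\<^sup>2 + (norm (?d y))\<^sup>2 / w\<^sup>2)" using g2 en(1) by simp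
      show "norm (2 * (g y * ?d y)) \<le> w\<^sup>2 * (norm (g y))\<^sup>2 + (norm (?d y))\<^sup>2 / w\<^sup>2" for y
        using sum_squares_bound[of "w * norm (g y)" "norm (?d y) / w"] w
        by (simp add: norm_mult power_mult_distrib power_divide)
    qed
    also have "\<dots> = w\<^sup>2 * sqint g + sqint ?d / w\<^sup>2" using g2 en(1) by (simp add: sqint_def)
    also have "\<dots> \<le> w\<^sup>2 * sqint g + sqint \<phi>"
      using en(2) w by (simp add: sqint_def w_def pos_divide_le_eq mult.commute)
    finally show ?thesis by simp
  qed
  show ?thesis
  proof (rule riesz_representation[of l "w\<^sup>2 * sqint g"])
    show "l (\<lambda>x. \<phi> x + \<psi> x) = l \<phi> + l \<psi>" if "test_function \<phi>" "test_function \<psi>" for \<phi> \<psi>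
      using l(2)[OF that(1)] l(2)[OF that(2)] by (simp add: l(1) that test_function_add pd distrib_left)
    show "l (\<lambda>x. c * \<phi> x) = c * l \<phi>" if "test_function \<phi>" for c \<phi>
    proof -
      have "(LINT y|lborel. g y * (c * partial_deriv j (zeta k \<phi>) y)) = (LINT y|lborel. c * (g y * partial_deriv j (zeta k \<phi>) y))"
        by (simp add: mult.left_commute)
      then show ?thesis using test_function_mult(2)[OF that smooth_const] by (simp add: l(1) that ps)
    qed
    show "2 * Re (l \<phi>) \<le> sqint \<phi> + w\<^sup>2 * sqint g" if "test_function \<phi>" for \<phi> by (rule bound[OF that])
    fix h assume "h \<in> borel_measurable borel" "integrable lborel (\<lambda>x. (norm (h x))\<^sup>2)"
      "\<And>\<phi>. test_function \<phi> \<Longrightarrow> l \<phi> = (LINT x|lborel. \<phi> x * h x)"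
    then show thesis using that by (simp add: l_def)
  qed
qed


section \<open>The Dirac potential\<close>

lemma AE_lebesgue_iff: "(AE x in lebesgue. P x) \<longleftrightarrow> (AE x in lborel. P x)"
  by (rule AE_completion_iff)

lemma borel_imp_lebesgue: "f \<in> borel_measurable borel \<Longrightarrow> f \<in> borel_measurable lebesgue"
  by (simp add: measurable_completion)

lemma borel_representative:
  fixes f :: "'a::euclidean_space \<Rightarrow> 'b::euclidean_space"
  assumes "f \<in> borel_measurable lebesgue"
  obtains f' where "f' \<in> borel_measurable borel" "AE x in lborel. f x = f' x"
proof -
  have "\<exists>g\<in>borel_measurable lborel. AE x in lborel. f x \<bullet> b = g x" for b
    using completion_ex_borel_measurable_real[of "\<lambda>x. f x \<bullet> b" lborel] assms by simp
  then obtain g where g: "\<And>b. g b \<in> borel_measurable lborel" "\<And>b. AE x in lborel. f x \<bullet> b = g b x" by metis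
  show ?thesis
  proof (rule that[of "\<lambda>x. \<Sum>b\<in>Basis. g b x *\<^sub>R b"])
    show "(\<lambda>x. \<Sum>b\<in>Basis. g b x *\<^sub>R b) \<in> borel_measurable borel" using g(1) by simp
    have "AE x in lborel. \<forall>b\<in>Basis. f x \<bullet> b = g b x" using g(2) by (simp add: AE_ball_countable countable_finite)
    then show "AE x in lborel. f x = (\<Sum>b\<in>Basis. g b x *\<^sub>R b)"
    proof eventually_elim
      case (elim x)
      then have "(\<Sum>b\<in>Basis. g b x *\<^sub>R b) = (\<Sum>b\<in>Basis. (f x \<bullet> b) *\<^sub>R b)" by simp
      then show ?case by (simp add: euclidean_representation)
    qed
  qed
qed

lemma bounded_linear_mv: "bounded_linear ((*v) (A::complex^'N::finite^'N))"
  using linear_mv linear_conv_bounded_linear by blast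

lemma bounded_linear_smult: "bounded_linear ((*s) c :: complex^'N::finite \<Rightarrow> complex^'N)"
proof -
  have "linear ((*s) c :: complex^'N \<Rightarrow> complex^'N)"
    by (rule linearI) (simp_all add: vec_eq_iff distrib_left scaleR_conv_of_real)
  then show ?thesis using linear_conv_bounded_linear by blast
qed

lemma bounded_linear_axis: "bounded_linear (axis l :: complex \<Rightarrow> complex^'N::finite)"
proof -
  have "linear (axis l :: complex \<Rightarrow> complex^'N)"
    by (rule linearI) (simp_all add: vec_eq_iff axis_def)
  then show ?thesis using linear_conv_bounded_linear by blast
qed

lemma vec_sum_axis: "(v::complex^'N::finite) = (\<Sum>l\<in>UNIV. axis l (v $ l))"
proof -
  have "(\<Sum>l\<in>UNIV. axis l (v $ l)) $ i = (\<Sum>l\<in>UNIV. if l = i then v $ l else 0)" for i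
    unfolding sum_component by (intro sum.cong) (auto simp: axis_def)
  then show ?thesis by (simp add: vec_eq_iff)
qed

lemma borel_measurable_vecI:
  fixes F :: "'a \<Rightarrow> complex^'N::finite"
  assumes "\<And>l. (\<lambda>x. F x $ l) \<in> borel_measurable M"
  shows "F \<in> borel_measurable M"
proof -
  have "(\<lambda>x. axis l (F x $ l) :: complex^'N) \<in> borel_measurable M" for l
    by (rule borel_measurable_continuous_on[OF linear_continuous_on[OF bounded_linear_axis] assms])
  then have "(\<lambda>x. \<Sum>l\<in>UNIV. axis l (F x $ l)) \<in> borel_measurable M" by (rule borel_measurable_sum)
  then show ?thesis by (simp only: vec_sum_axis[symmetric])
qed

lemma borel_measurable_component:
  fixes F :: "'a \<Rightarrow> complex^'N::finite"
  assumes "F \<in> borel_measurable M" shows "(\<lambda>x. F x $ l) \<in> borel_measurable M"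
  by (rule borel_measurable_continuous_on[OF _ assms]) (intro continuous_intros)

lemma integrable_vecI:
  fixes F :: "'a \<Rightarrow> complex^'N::finite"
  assumes "\<And>l. integrable M (\<lambda>x. F x $ l)"
  shows "integrable M F"
proof -
  have "integrable M (\<lambda>x. \<Sum>l\<in>UNIV. axis l (F x $ l) :: complex^'N)"
    by (intro Bochner_Integration.integrable_sum integrable_bounded_linear[OF bounded_linear_axis] assms)
  then show ?thesis by (simp only: vec_sum_axis[symmetric])
qed

lemma integral_component:
  fixes F :: "'a \<Rightarrow> complex^'N::finite"
  assumes "integrable M F" shows "(LINT x|M. F x) $ l = (LINT x|M. F x $ l)"
  by (rule integral_bounded_linear[OF bounded_linear_vec_nth assms, symmetric])

lemma integrable_component:
  fixes F :: "'a \<Rightarrow> complex^'N::finite"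
  assumes "integrable M F" shows "integrable M (\<lambda>x. F x $ l)"
  by (rule integrable_bounded_linear[OF bounded_linear_vec_nth assms])

lemma integral_mv:
  fixes F :: "'a \<Rightarrow> complex^'N::finite" and A :: "complex^'N^'N"
  assumes "integrable M F"
  shows "integrable M (\<lambda>x. A *v F x)" "(LINT x|M. A *v F x) = A *v (LINT x|M. F x)"
  by - (rule integrable_bounded_linear[OF bounded_linear_mv assms] integral_bounded_linear[OF bounded_linear_mv assms])+

lemma integral_smult:
  fixes F :: "'a \<Rightarrow> complex^'N::finite"
  assumes "integrable M F"
  shows "integrable M (\<lambda>x. c *s F x)" "(LINT x|M. c *s F x) = c *s (LINT x|M. F x)"
  by - (rule integrable_bounded_linear[OF bounded_linear_smult assms] integral_bounded_linear[OF bounded_linear_smult assms])+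

lemma mv_sum_right: "(A::complex^'N::finite^'N) *v (\<Sum>i\<in>I. f i) = (\<Sum>i\<in>I. A *v f i)"
  by (rule linear_sum[OF linear_mv])

lemma mv_smult: "(A::complex^'N::finite^'N) *v (c *s v) = c *s (A *v v)"
  by (simp add: vec_eq_iff matrix_vector_mult_def sum_distrib_left mult_ac)

lemma smult_sum: "c *s (\<Sum>i\<in>I. f i) = (\<Sum>i\<in>I. c *s (f i :: complex^'N::finite))"
  by (rule linear_sum[OF bounded_linear.linear[OF bounded_linear_smult]])

lemma norm_smult: "norm (c *s (v::complex^'N::finite)) = norm c * norm v"
  by (simp add: norm_vec_def norm_mult L2_set_right_distrib)

definition matrix_const :: "complex^'N::finite^'N \<Rightarrow> real" where
  "matrix_const A = (\<Sum>l\<in>UNIV. \<Sum>m\<in>UNIV. norm (A $ l $ m))"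

lemma norm_mv_le: "norm ((A::complex^'N::finite^'N) *v v) \<le> matrix_const A * norm v"
proof -
  have "norm (A *v v) \<le> (\<Sum>l\<in>UNIV. norm ((A *v v) $ l))" unfolding norm_vec_def by (rule L2_set_le_sum) simp
  also have "\<dots> \<le> (\<Sum>l\<in>UNIV. \<Sum>m\<in>UNIV. norm (A $ l $ m) * norm v)"
  proof (rule sum_mono)
    fix l
    have "norm ((A *v v) $ l) \<le> (\<Sum>m\<in>UNIV. norm (A $ l $ m * v $ m))"
      unfolding matrix_vector_mult_def by (simp add: norm_sum)
    also have "\<dots> \<le> (\<Sum>m\<in>UNIV. norm (A $ l $ m) * norm v)"
      by (intro sum_mono) (auto simp: norm_mult Finite_Cartesian_Product.norm_nth_le intro!: mult_left_mono)
    finally show "norm ((A *v v) $ l) \<le> (\<Sum>m\<in>UNIV. norm (A $ l $ m) * norm v)" .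
  qed
  also have "\<dots> = matrix_const A * norm v" by (simp add: matrix_const_def sum_distrib_right)
  finally show ?thesis .
qed

text \<open>Adding the sum to itself with exchanged indices leaves anticommutators, hence the trace.
  For second derivatives as array this is the identity that the square of the free Dirac operator is
  minus the Laplacian.\<close>

lemma clifford_sum:
  fixes \<alpha> :: "'n::finite \<Rightarrow> complex^'N::finite^'N"
  assumes anti: "\<And>j k. \<alpha> j ** \<alpha> k + \<alpha> k ** \<alpha> j = (if j = k then mat 2 else 0)"
    and sym: "\<And>j k. M j k = M k j"
  shows "(\<Sum>j\<in>UNIV. \<Sum>k\<in>UNIV. \<alpha> j *v (\<alpha> k *v M j k)) = (\<Sum>j\<in>UNIV. M j j)"
proof -
  let ?S = "\<Sum>j\<in>UNIV. \<Sum>k\<in>UNIV. \<alpha> j *v (\<alpha> k *v M j k)"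
  have "?S = (\<Sum>k\<in>UNIV. \<Sum>j\<in>UNIV. \<alpha> j *v (\<alpha> k *v M j k))" by (rule sum.swap)
  then have "?S + ?S = (\<Sum>j\<in>UNIV. \<Sum>k\<in>UNIV. \<alpha> j *v (\<alpha> k *v M j k)) + (\<Sum>j\<in>UNIV. \<Sum>k\<in>UNIV. \<alpha> k *v (\<alpha> j *v M j k))"
    by (simp add: sym)
  also have "\<dots> = (\<Sum>j\<in>UNIV. \<Sum>k\<in>UNIV. (\<alpha> j ** \<alpha> k + \<alpha> k ** \<alpha> j) *v M j k)"
    by (simp add: matrix_vector_mult_add_rdistrib matrix_vector_mul_assoc sum.distrib)
  also have "\<dots> = (\<Sum>j\<in>UNIV. \<Sum>k\<in>UNIV. if j = k then 2 *\<^sub>R M j k else 0)"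
  proof (intro sum.cong refl)
    fix j k
    have "(mat 2 :: complex^'N^'N) = 2 *\<^sub>R mat 1" by (simp add: vec_eq_iff mat_def scaleR_conv_of_real)
    then have "mat 2 *v v = 2 *\<^sub>R v" for v :: "complex^'N" by (simp add: mv_scaleR_left)
    then show "(\<alpha> j ** \<alpha> k + \<alpha> k ** \<alpha> j) *v M j k = (if j = k then 2 *\<^sub>R M j k else 0)"
      by (simp add: anti)
  qed
  also have "\<dots> = 2 *\<^sub>R (\<Sum>j\<in>UNIV. M j j)" by (simp add: scaleR_sum_right)
  finally have "2 *\<^sub>R ?S = 2 *\<^sub>R (\<Sum>j\<in>UNIV. M j j)" by (simp add: scaleR_2)
  then show ?thesis by simp
qed

definition vadm :: "(real^'n::finite \<Rightarrow> complex^'N::finite) \<Rightarrow> bool" where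
  "vadm F \<longleftrightarrow> F \<in> borel_measurable borel \<and> integrable lborel (\<lambda>y. (1 + norm y) powr (1 - real CARD('n)) * norm (F y))"

lemma vadm_component:
  fixes F :: "real^'n::finite \<Rightarrow> complex^'N::finite"
  assumes "vadm F" shows "admissible (\<lambda>y. F y $ l)"
proof -
  have m: "F \<in> borel_measurable borel" and i: "integrable lborel (\<lambda>y. (1 + norm y) powr (1 - real CARD('n)) * norm (F y))"
    using assms by (auto simp: vadm_def)
  have [measurable]: "(\<lambda>y. F y $ l) \<in> borel_measurable borel" by (rule borel_measurable_component[OF m])
  have "integrable lborel (\<lambda>y. (1 + norm y) powr (1 - real CARD('n)) * norm (F y $ l))"
    by (rule integrable_dominated[OF i]) (auto simp: abs_mult Finite_Cartesian_Product.norm_nth_le intro!: mult_left_mono)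
  then show ?thesis by (simp add: admissible_def)
qed

definition vpot :: "'n \<Rightarrow> (real^'n::finite \<Rightarrow> complex^'N::finite) \<Rightarrow> real^'n \<Rightarrow> complex^'N" where
  "vpot k F x = (\<chi> l. pot k (\<lambda>y. F y $ l) x)"

definition cdir :: "'n::finite itself \<Rightarrow> complex" where
  "cdir _ = \<i> / of_real (omega TYPE('n))"

text \<open>The operator \<open>R0\<close> assembled from scalar potentials. For a source in
  \<open>vadm\<close> it is Borel measurable and pairs with test functions; agreement with
  \<open>R0\<close>, almost everywhere, is shown separately.\<close>

definition dirac_pot :: "('n::finite \<Rightarrow> complex^'N::finite^'N) \<Rightarrow> (real^'n \<Rightarrow> complex^'N) \<Rightarrow> real^'n \<Rightarrow> complex^'N" where
  "dirac_pot \<alpha> F x = cdir TYPE('n) *s (\<Sum>k\<in>UNIV. \<alpha> k *v vpot k F x)"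

lemma vpot_measurable: "vadm F \<Longrightarrow> vpot k F \<in> borel_measurable borel"
  by (rule borel_measurable_vecI) (simp add: vpot_def pot_measurable vadm_component)

lemma borel_measurable_mv:
  fixes F :: "'a \<Rightarrow> complex^'N::finite" and A :: "complex^'N^'N"
  assumes "F \<in> borel_measurable M" shows "(\<lambda>x. A *v F x) \<in> borel_measurable M"
  by (rule borel_measurable_continuous_on[OF linear_continuous_on[OF bounded_linear_mv] assms])

lemma borel_measurable_smult:
  fixes F :: "'a \<Rightarrow> complex^'N::finite"
  assumes "F \<in> borel_measurable M" shows "(\<lambda>x. c *s F x) \<in> borel_measurable M"
  by (rule borel_measurable_continuous_on[OF linear_continuous_on[OF bounded_linear_smult] assms])

lemma dirac_pot_measurable: "vadm F \<Longrightarrow> dirac_pot \<alpha> F \<in> borel_measurable borel"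
  unfolding dirac_pot_def[abs_def]
  by (intro borel_measurable_smult borel_measurable_sum borel_measurable_mv vpot_measurable)

lemma vpot_test:
  fixes F :: "real^'n::finite \<Rightarrow> complex^'N::finite"
  assumes F: "vadm F" and \<phi>: "test_function \<phi>"
  shows "integrable lborel (\<lambda>x. \<phi> x *s vpot k F x)"
    and "integrable lborel (\<lambda>y. zeta k \<phi> y *s F y)"
    and "(LINT x|lborel. \<phi> x *s vpot k F x) = (LINT y|lborel. zeta k \<phi> y *s F y)"
proof -
  note t = pot_test[OF vadm_component[OF F] \<phi>]
  show 1: "integrable lborel (\<lambda>x. \<phi> x *s vpot k F x)"
    by (rule integrable_vecI) (use t(1) in \<open>simp add: vpot_def\<close>)
  show 2: "integrable lborel (\<lambda>y. zeta k \<phi> y *s F y)"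
    by (rule integrable_vecI) (use t(2) in \<open>simp add: mult.commute\<close>)
  show "(LINT x|lborel. \<phi> x *s vpot k F x) = (LINT y|lborel. zeta k \<phi> y *s F y)"
    unfolding vec_eq_iff integral_component[OF 1] integral_component[OF 2]
    using t(3) by (simp add: vpot_def mult.commute)
qed

lemma dirac_pot_test:
  fixes F :: "real^'n::finite \<Rightarrow> complex^'N::finite" and \<alpha> :: "'n \<Rightarrow> complex^'N^'N"
  assumes F: "vadm F" and \<phi>: "test_function \<phi>"
  shows "integrable lborel (\<lambda>x. \<phi> x *s dirac_pot \<alpha> F x)"
    and "(LINT x|lborel. \<phi> x *s dirac_pot \<alpha> F x) = cdir TYPE('n) *s (\<Sum>k\<in>UNIV. \<alpha> k *v (LINT y|lborel. zeta k \<phi> y *s F y))"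
proof -
  have eq: "\<phi> x *s dirac_pot \<alpha> F x = cdir TYPE('n) *s (\<Sum>k\<in>UNIV. \<alpha> k *v (\<phi> x *s vpot k F x))" for x
    unfolding dirac_pot_def mv_smult
    by (simp add: smult_sum vector_smult_assoc mult.commute)
  have i: "integrable lborel (\<lambda>x. \<alpha> k *v (\<phi> x *s vpot k F x))" for k by (intro integral_mv vpot_test F \<phi>)
  have s: "integrable lborel (\<lambda>x. \<Sum>k\<in>UNIV. \<alpha> k *v (\<phi> x *s vpot k F x))" by (intro Bochner_Integration.integrable_sum i)
  show "integrable lborel (\<lambda>x. \<phi> x *s dirac_pot \<alpha> F x)" unfolding eq by (rule integral_smult[OF s])
  show "(LINT x|lborel. \<phi> x *s dirac_pot \<alpha> F x) = cdir TYPE('n) *s (\<Sum>k\<in>UNIV. \<alpha> k *v (LINT y|lborel. zeta k \<phi> y *s F y))"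
    unfolding eq integral_smult(2)[OF s]
    using i by (simp add: Bochner_Integration.integral_sum integral_mv(2)[OF vpot_test(1)[OF F \<phi>]] vpot_test(3)[OF F \<phi>])
qed

text \<open>Against a test function the operator lands on \<open>zeta\<close>. Its array of
  derivatives is symmetric because it is curl free, so the Clifford identity leaves the divergence,
  and i * (i / omega) * (- omega) = 1.\<close>

lemma dirac_pot_solves:
  fixes F :: "real^'n::finite \<Rightarrow> complex^'N::finite" and \<alpha> :: "'n \<Rightarrow> complex^'N^'N"
  assumes F: "vadm F" and \<phi>: "test_function \<phi>"
    and anti: "\<And>j k. \<alpha> j ** \<alpha> k + \<alpha> k ** \<alpha> j = (if j = k then mat 2 else 0)"
    and \<phi>F: "integrable lborel (\<lambda>x. \<phi> x *s F x)"
  shows "(\<Sum>j\<in>UNIV. \<alpha> j *v (\<i> *s (LINT x|lborel. partial_deriv j \<phi> x *s dirac_pot \<alpha> F x))) = (LINT x|lborel. \<phi> x *s F x)"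
proof -
  define M where "M j k = (LINT y|lborel. partial_deriv j (zeta k \<phi>) y *s F y)" for j k
  let ?c = "cdir TYPE('n)"
  have Mi: "integrable lborel (\<lambda>y. partial_deriv j (zeta k \<phi>) y *s F y)" for j k
    unfolding zeta_partial[OF \<phi>] by (rule vpot_test(2)[OF F test_function_partial[OF \<phi>]])
  have sym: "M j k = M k j" for j k unfolding M_def by (simp add: zeta_curl[OF \<phi>, of j k])
  have "(\<Sum>j\<in>UNIV. \<alpha> j *v (\<i> *s (LINT x|lborel. partial_deriv j \<phi> x *s dirac_pot \<alpha> F x)))
     = (\<Sum>j\<in>UNIV. \<alpha> j *v (\<i> *s (?c *s (\<Sum>k\<in>UNIV. \<alpha> k *v M j k))))"
    unfolding dirac_pot_test(2)[OF F test_function_partial[OF \<phi>]] M_def zeta_partial[OF \<phi>] ..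
  also have "\<dots> = (\<i> * ?c) *s (\<Sum>j\<in>UNIV. \<Sum>k\<in>UNIV. \<alpha> j *v (\<alpha> k *v M j k))"
    by (simp add: mv_smult smult_sum mv_sum_right vector_smult_assoc)
  also have "(\<Sum>j\<in>UNIV. \<Sum>k\<in>UNIV. \<alpha> j *v (\<alpha> k *v M j k)) = (\<Sum>j\<in>UNIV. M j j)"
    by (rule clifford_sum[OF anti sym])
  also have "\<dots> = (LINT y|lborel. (\<Sum>j\<in>UNIV. partial_deriv j (zeta j \<phi>) y *s F y))"
    unfolding M_def by (rule Bochner_Integration.integral_sum[symmetric]) (rule Mi)
  also have "\<dots> = (LINT y|lborel. (\<Sum>j\<in>UNIV. partial_deriv j (zeta j \<phi>) y) *s F y)"
    by (simp only: vec.scale_sum_left)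
  also have "\<dots> = (LINT y|lborel. (- of_real (omega TYPE('n))) *s (\<phi> y *s F y))"
    by (simp add: zeta_div[OF \<phi>] vector_smult_assoc)
  also have "\<dots> = (- of_real (omega TYPE('n))) *s (LINT y|lborel. \<phi> y *s F y)"
    by (rule integral_smult(2)[OF \<phi>F])
  also have "(\<i> * ?c) *s \<dots> = (LINT y|lborel. \<phi> y *s F y)"
    using omega_pos[where 'n='n] by (simp add: cdir_def vector_smult_assoc)
  finally show ?thesis .
qed


section \<open>Uniqueness\<close>

lemma weighted_test_integrable:
  fixes \<Psi> :: "real^'n::finite \<Rightarrow> complex^'N::finite"
  assumes [measurable]: "\<Psi> \<in> borel_measurable borel" "f \<in> borel_measurable borel"
    and i: "integrable lborel (\<lambda>y. (1 + norm y) powr (- a) * norm (\<Psi> y))"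
    and le: "\<And>y. norm (f y) \<le> C * (1 + norm y) powr (- a)"
  shows "integrable lborel (\<lambda>y. (f y :: complex) *s \<Psi> y)"
proof (rule integrable_dominated[OF integrable_mult_right[OF i, of C]])
  have "(\<lambda>y. (\<Psi> y) $ l) \<in> borel_measurable borel" for l by (rule borel_measurable_component) measurable
  then have "(\<lambda>y. (f y *s \<Psi> y) $ l) \<in> borel_measurable borel" for l by simp
  then show "(\<lambda>y. f y *s \<Psi> y) \<in> borel_measurable lborel" using borel_measurable_vecI by fastforce
  show "norm (f y *s \<Psi> y) \<le> C * ((1 + norm y) powr (- a) * norm (\<Psi> y))" for y
    using mult_right_mono[OF le[of y], of "norm (\<Psi> y)"] by (simp add: norm_smult mult.assoc)
qed

lemma test_function_weight_bound:
  assumes "test_function \<phi>" "a \<ge> 0"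
  shows "\<exists>C. \<forall>y. norm (\<phi> y) \<le> C * (1 + norm y) powr (- a)"
proof -
  obtain M R where MR: "M > 0" "R > 0" "\<And>x. norm (\<phi> x) \<le> M" "\<And>x. norm x \<ge> R \<Longrightarrow> \<phi> x = 0"
    using test_function_bounds[OF assms(1)] by blast
  have "norm (\<phi> y) \<le> (M * (1 + R) powr a) * (1 + norm y) powr (- a)" for y
  proof (cases "norm y \<ge> R")
    case False
    have "(1 + norm y) powr a \<le> (1 + R) powr a" using False assms(2) by (intro powr_mono2) auto
    then have "1 \<le> (1 + R) powr a * (1 + norm y) powr (- a)"
      by (simp add: powr_minus divide_inverse[symmetric])
    then have "M * 1 \<le> M * ((1 + R) powr a * (1 + norm y) powr (- a))" using MR by (intro mult_left_mono) auto
    then show ?thesis using MR(3)[of y] by (simp add: mult.assoc)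
  qed (use MR in simp)
  then show ?thesis by blast
qed

lemma borel_measurable_smult_fun:
  fixes \<Psi> :: "'a \<Rightarrow> complex^'N::finite"
  assumes "f \<in> borel_measurable M" "\<Psi> \<in> borel_measurable M"
  shows "(\<lambda>y. (f y :: complex) *s \<Psi> y) \<in> borel_measurable M"
proof (rule borel_measurable_vecI)
  show "(\<lambda>y. (f y *s \<Psi> y) $ l) \<in> borel_measurable M" for l
    using assms(1) borel_measurable_component[OF assms(2), of l] by simp
qed

lemma tendsto_smult:
  assumes "f \<longlonglongrightarrow> (a::complex)"
  shows "(\<lambda>i. f i *s (v::complex^'N::finite)) \<longlonglongrightarrow> a *s v"
  by (rule vec_tendstoI) (simp add: tendsto_mult_right[OF assms])

lemma tendsto_mv:
  assumes "f \<longlonglongrightarrow> a"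
  shows "(\<lambda>i. (A::complex^'N::finite^'N) *v f i) \<longlonglongrightarrow> A *v a"
  by (rule bounded_linear.tendsto[OF bounded_linear_mv assms])

lemma tendsto_smult_right:
  assumes "f \<longlonglongrightarrow> a"
  shows "(\<lambda>i. c *s (f i::complex^'N::finite)) \<longlonglongrightarrow> c *s a"
  by (rule bounded_linear.tendsto[OF bounded_linear_smult assms])

lemma integral_smult_limit:
  fixes \<Psi> :: "real^'n::finite \<Rightarrow> complex^'N::finite"
  assumes m: "\<Psi> \<in> borel_measurable borel" "\<And>i. f i \<in> borel_measurable borel" "h \<in> borel_measurable borel"
    and i: "integrable lborel (\<lambda>y. w y * norm (\<Psi> y))"
    and le: "\<And>i y. norm (f i y) \<le> C * w y" and lim: "\<And>y. (\<lambda>i. f i y) \<longlonglongrightarrow> (h y :: complex)"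
  shows "(\<lambda>i. LINT y|lborel. f i y *s \<Psi> y) \<longlonglongrightarrow> (LINT y|lborel. h y *s \<Psi> y)"
proof (rule integral_dominated_convergence[OF _ _ integrable_mult_right[OF i, of C]])
  show "(\<lambda>y. h y *s \<Psi> y) \<in> borel_measurable lborel" "(\<lambda>y. f i y *s \<Psi> y) \<in> borel_measurable lborel" for i
    using borel_measurable_smult_fun[OF m(3,1)] borel_measurable_smult_fun[OF m(2,1)] by auto
  show "AE y in lborel. (\<lambda>i. f i y *s \<Psi> y) \<longlonglongrightarrow> h y *s \<Psi> y" by (intro AE_I2 tendsto_smult lim)
  have "norm (f i y *s \<Psi> y) \<le> C * (w y * norm (\<Psi> y))" for i y
    using mult_right_mono[OF le[of i y], of "norm (\<Psi> y)"] by (simp add: norm_smult mult.assoc)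
  then show "AE y in lborel. norm (f i y *s \<Psi> y) \<le> C * (w y * norm (\<Psi> y))" for i by simp
qed

text \<open>The equation is tested with the components of \<open>zeta\<close>, cut off because they
  are not compactly supported. A derivative of the cutoff times \<open>zeta\<close> is bounded by a
  multiple of (1 + |y|)^(-n), which is the weight assumed for \<open>\<Psi>\<close>; the source is
  paired with \<open>zeta\<close> as in \<open>vadm\<close>.\<close>

lemma dirac_pot_unique_test:
  fixes \<Psi> F :: "real^'n::finite \<Rightarrow> complex^'N::finite" and \<alpha> :: "'n \<Rightarrow> complex^'N^'N"
  assumes F: "vadm F" and m\<Psi>: "\<Psi> \<in> borel_measurable borel"
    and i\<Psi>: "integrable lborel (\<lambda>y. (1 + norm y) powr (- real CARD('n)) * norm (\<Psi> y))"
    and anti: "\<And>j k. \<alpha> j ** \<alpha> k + \<alpha> k ** \<alpha> j = (if j = k then mat 2 else 0)"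
    and eq: "\<And>\<phi>. test_function \<phi> \<Longrightarrow>
      (\<Sum>j\<in>UNIV. \<alpha> j *v (\<i> *s (LINT x|lborel. partial_deriv j \<phi> x *s \<Psi> x))) + (LINT x|lborel. \<phi> x *s F x) = 0"
    and \<phi>: "test_function \<phi>"
  shows "(LINT x|lborel. \<phi> x *s \<Psi> x) = - (LINT x|lborel. \<phi> x *s dirac_pot \<alpha> F x)"
proof -
  define w where "w = omega TYPE('n)"
  have w: "w > 0" unfolding w_def by (rule omega_pos)
  define ch :: "nat \<Rightarrow> real^'n \<Rightarrow> complex" where "ch i = cutoff (real (Suc i))" for i
  have cht: "test_function (ch i)" for i unfolding ch_def by (rule cutoff_test) simp
  have chn: "norm (ch i y) \<le> 1" "norm (partial_deriv j (ch i) y) \<le> 48 / (1 + norm y)" for i j y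
    unfolding ch_def by (auto intro: cutoff_norm_le cutoff_partial_bound)
  have chlim: "(\<lambda>i. ch i y) \<longlonglongrightarrow> 1" "(\<lambda>i. partial_deriv j (ch i) y) \<longlonglongrightarrow> 0" for j y
    unfolding ch_def by (rule cutoff_tendsto cutoff_partial_tendsto)+
  define Z where "Z k = zeta k \<phi>" for k
  have smZ: "smooth (Z k)" "smooth (partial_deriv j (Z k))" for j k
    unfolding Z_def by (intro zeta_smooth smooth_partial \<phi>)+
  have mF: "F \<in> borel_measurable borel" and iF: "integrable lborel (\<lambda>y. (1 + norm y) powr (1 - real CARD('n)) * norm (F y))"
    using F by (auto simp: vadm_def)
  have tests: "integrable lborel (\<lambda>x. \<psi> x *s \<Psi> x)" if \<psi>: "test_function \<psi>" for \<psi>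
  proof -
    obtain C where C: "\<And>y. norm (\<psi> y) \<le> C * (1 + norm y) powr (- real CARD('n))"
      using test_function_weight_bound[OF \<psi>, of "real CARD('n)"] by auto
    show ?thesis by (rule weighted_test_integrable[OF m\<Psi> test_function_measurable[OF \<psi>] i\<Psi> C])
  qed
  \<comment> \<open>The derivative of cutoff times potential splits into the cutoff terms
    \<open>a\<close>, which will vanish in the limit, and the main terms \<open>m\<close>;
    \<open>f\<close> is the contribution of the source.\<close>
  define a where "a i j k = (LINT x|lborel. (partial_deriv j (ch i) x * Z k x) *s \<Psi> x)" for i j k
  define m where "m i k j = (LINT x|lborel. (ch i x * partial_deriv j (Z k) x) *s \<Psi> x)" for i j k
  define f where "f i k = (LINT x|lborel. (ch i x * Z k x) *s F x)" for i k
  have t1: "test_function (\<lambda>x. partial_deriv j (ch i) x * Z k x)" for i j k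
    by (intro test_function_mult(1) test_function_partial cht smZ)
  have t2: "test_function (\<lambda>x. ch i x * partial_deriv j (Z k) x)" for i j k by (intro test_function_mult(1) cht smZ)
  have t3: "test_function (\<lambda>x. ch i x * Z k x)" for i k by (intro test_function_mult(1) cht smZ)
  have split: "(LINT x|lborel. partial_deriv j (\<lambda>x. ch i x * Z k x) x *s \<Psi> x) = a i j k + m i k j" for i j k
  proof -
    have "partial_deriv j (\<lambda>x. ch i x * Z k x) x *s \<Psi> x = (partial_deriv j (ch i) x * Z k x) *s \<Psi> x + (ch i x * partial_deriv j (Z k) x) *s \<Psi> x" for x
      by (subst partial_deriv_mult) (auto intro: smooth_differentiable smZ test_function_smooth cht simp: vector_sadd_rdistrib)
    then show ?thesis unfolding a_def m_def using tests[OF t1] tests[OF t2] by simp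
  qed
  have msym: "m i k j = m i j k" for i j k unfolding m_def Z_def by (simp add: zeta_curl[OF \<phi>, of j k])
  have mtr: "(\<Sum>j\<in>UNIV. m i j j) = (- of_real w) *s (LINT x|lborel. (ch i x * \<phi> x) *s \<Psi> x)" for i
  proof -
    have "(\<Sum>j\<in>UNIV. m i j j) = (LINT x|lborel. (\<Sum>j\<in>UNIV. (ch i x * partial_deriv j (Z j) x) *s \<Psi> x))"
      unfolding m_def by (rule Bochner_Integration.integral_sum[symmetric]) (rule tests[OF t2])
    also have "\<dots> = (LINT x|lborel. (- of_real w) *s ((ch i x * \<phi> x) *s \<Psi> x))"
    proof (rule Bochner_Integration.integral_cong[OF refl])
      fix x
      have "(\<Sum>j\<in>UNIV. (ch i x * partial_deriv j (Z j) x) *s \<Psi> x) = (ch i x * (\<Sum>j\<in>UNIV. partial_deriv j (Z j) x)) *s \<Psi> x"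
        by (simp only: vec.scale_sum_left sum_distrib_left)
      also have "(\<Sum>j\<in>UNIV. partial_deriv j (Z j) x) = - (of_real w * \<phi> x)" unfolding Z_def w_def by (rule zeta_div[OF \<phi>])
      finally show "(\<Sum>j\<in>UNIV. (ch i x * partial_deriv j (Z j) x) *s \<Psi> x) = (- of_real w) *s ((ch i x * \<phi> x) *s \<Psi> x)"
        by (simp add: vector_smult_assoc mult_ac)
    qed
    also have "\<dots> = (- of_real w) *s (LINT x|lborel. (ch i x * \<phi> x) *s \<Psi> x)"
      by (rule integral_smult(2)[OF tests]) (intro test_function_mult(1) cht test_function_smooth \<phi>)
    finally show ?thesis .
  qed
  \<comment> \<open>The equation tested with \<open>ch i x * Z k x\<close>, multiplied by
    \<open>\<alpha> k\<close> and summed over \<open>k\<close>. The outer matrix thus carries the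
    index of \<open>zeta\<close>, and the Clifford identity reduces the main terms to their
    trace.\<close>
  have zero: "\<i> *s (\<Sum>k\<in>UNIV. \<Sum>j\<in>UNIV. \<alpha> k *v (\<alpha> j *v a i j k))
     + \<i> *s ((- of_real w) *s (LINT x|lborel. (ch i x * \<phi> x) *s \<Psi> x)) + (\<Sum>k\<in>UNIV. \<alpha> k *v f i k) = 0" for i
  proof -
    have "(\<Sum>k\<in>UNIV. \<alpha> k *v ((\<Sum>j\<in>UNIV. \<alpha> j *v (\<i> *s (a i j k + m i k j))) + f i k)) = 0"
      using eq[OF t3] unfolding split f_def by (simp add: linear_0[OF linear_mv])
    moreover have "(\<Sum>k\<in>UNIV. \<alpha> k *v ((\<Sum>j\<in>UNIV. \<alpha> j *v (\<i> *s (a i j k + m i k j))) + f i k))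
      = \<i> *s (\<Sum>k\<in>UNIV. \<Sum>j\<in>UNIV. \<alpha> k *v (\<alpha> j *v a i j k)) + \<i> *s (\<Sum>k\<in>UNIV. \<Sum>j\<in>UNIV. \<alpha> k *v (\<alpha> j *v m i k j)) + (\<Sum>k\<in>UNIV. \<alpha> k *v f i k)"
      by (simp add: matrix_vector_right_distrib vector_add_ldistrib mv_smult mv_sum_right smult_sum sum.distrib)
    moreover have "(\<Sum>k\<in>UNIV. \<Sum>j\<in>UNIV. \<alpha> k *v (\<alpha> j *v m i k j)) = (\<Sum>j\<in>UNIV. m i j j)"
      by (rule clifford_sum[OF anti msym])
    ultimately show ?thesis by (simp only: mtr)
  qed
  obtain C where C: "\<And>k. C k \<ge> 0" "\<And>k y. norm (Z k y) \<le> C k * (1 + norm y) powr (1 - real CARD('n))"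
    using zeta_bound[OF \<phi>] unfolding Z_def by metis
  have mZ: "Z k \<in> borel_measurable borel" for k using smZ(1) smooth_continuous borel_measurable_continuous_onI by blast
  have mch: "ch i \<in> borel_measurable borel" "partial_deriv j (ch i) \<in> borel_measurable borel" for i j
    using cht test_function_partial test_function_measurable by blast+
  have m\<phi>: "\<phi> \<in> borel_measurable borel" using \<phi> test_function_measurable by blast
  have alim: "(\<lambda>i. a i j k) \<longlonglongrightarrow> 0" for j k
  proof -
    have "(\<lambda>i. LINT y|lborel. (partial_deriv j (ch i) y * Z k y) *s \<Psi> y) \<longlonglongrightarrow> (LINT y|lborel. (0 * Z k y) *s \<Psi> y)"
    proof (rule integral_smult_limit[OF m\<Psi> _ _ i\<Psi>])
      show "(\<lambda>y. partial_deriv j (ch i) y * Z k y) \<in> borel_measurable borel" "(\<lambda>y. 0 * Z k y) \<in> borel_measurable borel" for i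
        using mch mZ by auto
      show "(\<lambda>i. partial_deriv j (ch i) y * Z k y) \<longlonglongrightarrow> 0 * Z k y" for y by (intro tendsto_intros chlim)
      show "norm (partial_deriv j (ch i) y * Z k y) \<le> (48 * C k) * (1 + norm y) powr (- real CARD('n))" for i y
      proof -
        have "norm (partial_deriv j (ch i) y * Z k y) \<le> 48 / (1 + norm y) * (C k * (1 + norm y) powr (1 - real CARD('n)))"
          unfolding norm_mult by (intro mult_mono chn C) auto
        also have "\<dots> = 48 * C k * ((1 + norm y) powr (- 1) * (1 + norm y) powr (1 - real CARD('n)))"
          using powr_minus_divide[of "1 + norm y" 1] by (simp add: divide_inverse mult_ac)
        also have "(1 + norm y) powr (- 1) * (1 + norm y) powr (1 - real CARD('n)) = (1 + norm y) powr (- real CARD('n))"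
        proof -
          have "- real CARD('n) = - 1 + (1 - real CARD('n))" by simp
          then show ?thesis by (simp only: powr_add)
        qed
        finally show ?thesis .
      qed
    qed
    then show ?thesis by (simp add: a_def)
  qed
  have \<phi>lim: "(\<lambda>i. LINT x|lborel. (ch i x * \<phi> x) *s \<Psi> x) \<longlonglongrightarrow> (LINT x|lborel. \<phi> x *s \<Psi> x)"
  proof -
    obtain C' where C': "\<And>y. norm (\<phi> y) \<le> C' * (1 + norm y) powr (- real CARD('n))"
      using test_function_weight_bound[OF \<phi>, of "real CARD('n)"] by auto
    have "(\<lambda>i. LINT y|lborel. (ch i y * \<phi> y) *s \<Psi> y) \<longlonglongrightarrow> (LINT y|lborel. (1 * \<phi> y) *s \<Psi> y)"
    proof (rule integral_smult_limit[OF m\<Psi> _ _ i\<Psi>])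
      show "(\<lambda>y. ch i y * \<phi> y) \<in> borel_measurable borel" "(\<lambda>y. 1 * \<phi> y) \<in> borel_measurable borel" for i
        using mch m\<phi> by auto
      show "(\<lambda>i. ch i y * \<phi> y) \<longlonglongrightarrow> 1 * \<phi> y" for y by (intro tendsto_intros chlim)
      show "norm (ch i y * \<phi> y) \<le> C' * (1 + norm y) powr (- real CARD('n))" for i y
        using order_trans[OF mult_left_le_one_le[OF norm_ge_zero norm_ge_zero chn(1)] C'] by (simp add: norm_mult)
    qed
    then show ?thesis by simp
  qed
  have flim: "(\<lambda>i. f i k) \<longlonglongrightarrow> (LINT x|lborel. Z k x *s F x)" for k
  proof -
    have "(\<lambda>i. LINT y|lborel. (ch i y * Z k y) *s F y) \<longlonglongrightarrow> (LINT y|lborel. (1 * Z k y) *s F y)"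
    proof (rule integral_smult_limit[OF mF _ _ iF])
      show "(\<lambda>y. ch i y * Z k y) \<in> borel_measurable borel" "(\<lambda>y. 1 * Z k y) \<in> borel_measurable borel" for i
        using mch mZ by auto
      show "(\<lambda>i. ch i y * Z k y) \<longlonglongrightarrow> 1 * Z k y" for y by (intro tendsto_intros chlim)
      show "norm (ch i y * Z k y) \<le> C k * (1 + norm y) powr (1 - real CARD('n))" for i y
        using order_trans[OF mult_left_le_one_le[OF norm_ge_zero norm_ge_zero chn(1)] C(2)] by (simp add: norm_mult)
    qed
    then show ?thesis by (simp add: f_def)
  qed
  have "(\<lambda>i. \<i> *s (\<Sum>k\<in>UNIV. \<Sum>j\<in>UNIV. \<alpha> k *v (\<alpha> j *v a i j k))
     + \<i> *s ((- of_real w) *s (LINT x|lborel. (ch i x * \<phi> x) *s \<Psi> x)) + (\<Sum>k\<in>UNIV. \<alpha> k *v f i k))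
     \<longlonglongrightarrow> \<i> *s (\<Sum>k\<in>UNIV. \<Sum>j\<in>UNIV. \<alpha> k *v (\<alpha> j *v 0))
     + \<i> *s ((- of_real w) *s (LINT x|lborel. \<phi> x *s \<Psi> x)) + (\<Sum>k\<in>UNIV. \<alpha> k *v (LINT x|lborel. Z k x *s F x))"
    by (intro tendsto_add tendsto_smult_right tendsto_sum tendsto_mv alim \<phi>lim flim)
  then have "\<i> *s ((- of_real w) *s (LINT x|lborel. \<phi> x *s \<Psi> x)) + (\<Sum>k\<in>UNIV. \<alpha> k *v (LINT x|lborel. Z k x *s F x)) = 0"
    unfolding zero by (simp add: LIMSEQ_const_iff linear_0[OF linear_mv])
  then have "(\<Sum>k\<in>UNIV. \<alpha> k *v (LINT x|lborel. Z k x *s F x)) = (\<i> * of_real w) *s (LINT x|lborel. \<phi> x *s \<Psi> x)"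
    by (simp add: vector_smult_assoc vec_eq_iff add_eq_0_iff)
  then have "(LINT x|lborel. \<phi> x *s dirac_pot \<alpha> F x) = cdir TYPE('n) *s ((\<i> * of_real w) *s (LINT x|lborel. \<phi> x *s \<Psi> x))"
    unfolding dirac_pot_test(2)[OF F \<phi>] Z_def by simp
  also have "\<dots> = - (LINT x|lborel. \<phi> x *s \<Psi> x)"
    using w by (simp add: cdir_def w_def[symmetric] vector_smult_assoc)
  finally show ?thesis by simp
qed

lemma vpot_integrable_indicator:
  fixes F :: "real^'n::finite \<Rightarrow> complex^'N::finite"
  assumes F: "vadm F" and K: "compact K"
  shows "integrable lborel (\<lambda>x. indicator K x *\<^sub>R vpot k F x)"
proof (rule integrable_vecI)
  show "integrable lborel (\<lambda>x. (indicator K x *\<^sub>R vpot k F x) $ l)" for l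
    using pot_set_integrable[OF vadm_component[OF F] K, of k l] by (simp add: set_integrable_def vpot_def)
qed

lemma dirac_pot_set_integrable:
  fixes F :: "real^'n::finite \<Rightarrow> complex^'N::finite"
  assumes F: "vadm F" and K: "compact K"
  shows "set_integrable lborel K (dirac_pot \<alpha> F)"
proof -
  have eq: "indicator K x *\<^sub>R dirac_pot \<alpha> F x = cdir TYPE('n) *s (\<Sum>k\<in>UNIV. \<alpha> k *v (indicator K x *\<^sub>R vpot k F x))" for x
    by (cases "x \<in> K") (simp_all add: dirac_pot_def linear_0[OF linear_mv])
  show ?thesis unfolding set_integrable_def eq
    by (intro integral_smult(1) Bochner_Integration.integrable_sum integral_mv(1) vpot_integrable_indicator F K)
qed

lemma dirac_pot_unique:
  fixes \<Psi> F :: "real^'n::finite \<Rightarrow> complex^'N::finite" and \<alpha> :: "'n \<Rightarrow> complex^'N^'N"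
  assumes F: "vadm F" and m\<Psi>: "\<Psi> \<in> borel_measurable borel"
    and i\<Psi>: "integrable lborel (\<lambda>y. (1 + norm y) powr (- real CARD('n)) * norm (\<Psi> y))"
    and anti: "\<And>j k. \<alpha> j ** \<alpha> k + \<alpha> k ** \<alpha> j = (if j = k then mat 2 else 0)"
    and eq: "\<And>\<phi>. test_function \<phi> \<Longrightarrow>
      (\<Sum>j\<in>UNIV. \<alpha> j *v (\<i> *s (LINT x|lborel. partial_deriv j \<phi> x *s \<Psi> x))) + (LINT x|lborel. \<phi> x *s F x) = 0"
  shows "AE x in lborel. \<Psi> x = - dirac_pot \<alpha> F x"
proof -
  define u where "u x = \<Psi> x + dirac_pot \<alpha> F x" for x
  have mu: "u \<in> borel_measurable borel" unfolding u_def using m\<Psi> dirac_pot_measurable[OF F] by simp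
  have z: "AE x in lborel. u x $ l = 0" for l
  proof (rule AE_zero_if_test_integrals_zero)
    show "(\<lambda>x. u x $ l) \<in> borel_measurable borel" by (rule borel_measurable_component[OF mu])
    show "set_integrable lborel K (\<lambda>x. u x $ l)" if K: "compact K" for K
    proof -
      obtain R where R: "R > 0" "\<And>x. x \<in> K \<Longrightarrow> norm x \<le> R"
        using compact_imp_bounded[OF K] by (auto simp: bounded_pos)
      have "integrable lborel (\<lambda>x. indicator K x *s \<Psi> x)"
      proof (rule weighted_test_integrable[OF m\<Psi> _ i\<Psi>])
        show "(indicator K :: real^'n \<Rightarrow> complex) \<in> borel_measurable borel" using borel_compact[OF K] by simp
        show "norm (indicator K y :: complex) \<le> (1 + R) powr real CARD('n) * (1 + norm y) powr (- real CARD('n))" for y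
        proof (cases "y \<in> K")
          case True
          have "(1 + norm y) powr real CARD('n) \<le> (1 + R) powr real CARD('n)" using R(2)[OF True] by (intro powr_mono2) auto
          then show ?thesis using True by (simp add: powr_minus divide_inverse[symmetric])
        qed simp
      qed
      moreover have "indicator K x *s \<Psi> x = indicator K x *\<^sub>R \<Psi> x" for x by (simp split: split_indicator)
      ultimately have "integrable lborel (\<lambda>x. indicator K x *\<^sub>R u x)"
        using dirac_pot_set_integrable[OF F K, of \<alpha>] by (simp add: set_integrable_def u_def scaleR_add_right)
      from integrable_component[OF this, of l] show ?thesis by (simp add: set_integrable_def)
    qed
    show "(LINT x|lborel. \<phi> x * u x $ l) = 0" if \<phi>: "test_function \<phi>" for \<phi>
    proof -
      obtain C where C: "\<And>y. norm (\<phi> y) \<le> C * (1 + norm y) powr (- real CARD('n))"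
        using test_function_weight_bound[OF \<phi>, of "real CARD('n)"] by auto
      have 1: "integrable lborel (\<lambda>x. \<phi> x *s \<Psi> x)"
        by (rule weighted_test_integrable[OF m\<Psi> test_function_measurable[OF \<phi>] i\<Psi> C])
      have 2: "integrable lborel (\<lambda>x. \<phi> x *s dirac_pot \<alpha> F x)" by (rule dirac_pot_test(1)[OF F \<phi>])
      have e: "\<phi> x *s u x = \<phi> x *s \<Psi> x + \<phi> x *s dirac_pot \<alpha> F x" for x by (simp add: u_def vector_add_ldistrib)
      have 3: "integrable lborel (\<lambda>x. \<phi> x *s u x)" unfolding e using 1 2 by simp
      have "(LINT x|lborel. \<phi> x *s u x) = 0"
        unfolding e using 1 2 dirac_pot_unique_test[OF F m\<Psi> i\<Psi> anti eq \<phi>] by simp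
      then have "(LINT x|lborel. \<phi> x *s u x) $ l = 0" by simp
      then show ?thesis unfolding integral_component[OF 3] by simp
    qed
  qed
  have "AE x in lborel. \<forall>l\<in>UNIV. u x $ l = 0" using z by (intro AE_finite_allI) auto
  then show ?thesis
  proof eventually_elim
    case (elim x)
    then have "u x = 0" by (simp add: vec_eq_iff)
    then show ?case by (simp add: u_def eq_neg_iff_add_eq_0)
  qed
qed


section \<open>Lebesgue classes of the Dirac potential\<close>

text \<open>The area of the unit sphere is 2 pi^(n/2) / Gamma (n/2), by Gamma (n/2 + 1) = (n/2)
  Gamma (n/2); the constant of \<open>G0\<close> is i divided by it.\<close>

lemma cdir_eq:
  "\<i> * complex_of_real (2 powr (-1) * pi powr (- (real CARD('n) / 2)) * Gamma (real CARD('n) / 2)) = cdir TYPE('n::finite)"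
proof -
  let ?n = "real CARD('n)"
  have n: "?n > 0" by simp
  have G: "Gamma (?n / 2 + 1) = ?n / 2 * Gamma (?n / 2)"
    using nonpos_Ints_nonpos[of "?n / 2"] n by (intro Gamma_plus1) linarith
  have Gp: "Gamma (?n / 2) > 0" using n by (intro Gamma_real_pos) simp
  have om: "omega TYPE('n) = 2 * pi powr (?n / 2) / Gamma (?n / 2)"
    using n Gp by (simp add: omega_def unit_ball_vol_def G)
  have "2 powr (-1) * pi powr (- (?n / 2)) * Gamma (?n / 2) = 1 / omega TYPE('n)"
    unfolding om using Gp by (simp add: powr_minus divide_simps)
  then show ?thesis by (simp add: cdir_def)
qed

lemma alpha_dot_mv: "alpha_dot \<alpha> w *v v = (\<Sum>k\<in>UNIV. (w $ k) *\<^sub>R (\<alpha> k *v v))"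
  by (simp add: alpha_dot_def mv_sum_left mv_scaleR_left)

lemma G0_mv:
  fixes \<alpha> :: "'n::finite \<Rightarrow> complex^'N::finite^'N"
  shows "G0 \<alpha> x y *v v = cdir TYPE('n) *s (\<Sum>k\<in>UNIV. \<alpha> k *v (of_real (riesz k (x - y)) *s v))"
proof -
  have m: "mat c *v u = c *s u" for c :: complex and u :: "complex^'N"
  proof -
    have "(mat c *v u) $ i = (\<Sum>j\<in>UNIV. if i = j then c * u $ j else 0)" for i
      unfolding matrix_vector_mult_def mat_def by (simp add: if_distrib[of "\<lambda>a. a * _"] cong: if_cong)
    then show ?thesis by (simp add: vec_eq_iff)
  qed
  have r: "of_real t *s u = t *\<^sub>R u" for t and u :: "complex^'N" unfolding vec_eq_iff vector_scaleR_component by (simp add: scaleR_conv_of_real)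
  have e: "((1 / norm (x - y) ^ CARD('n)) *\<^sub>R alpha_dot \<alpha> (x - y)) *v v = (\<Sum>k\<in>UNIV. \<alpha> k *v (of_real (riesz k (x - y)) *s v))"
    unfolding r mv_scaleR_right riesz_def mv_scaleR_left alpha_dot_mv scaleR_sum_right by simp
  show ?thesis unfolding G0_def cdir_eq matrix_vector_mul_assoc[symmetric] m by (simp only: e)
qed

text \<open>Integrability of the integrand is part of the conclusion because \<open>BS_eq\<close>
  pulls a matrix out of this integral. At exceptional points the integral may only have its default
  value, so the equality is claimed almost everywhere.\<close>

lemma R0_eq_dirac_pot:
  fixes F' F :: "real^'n::finite \<Rightarrow> complex^'N::finite" and \<alpha> :: "'n \<Rightarrow> complex^'N^'N"
  assumes F: "vadm F" and eq: "AE x in lborel. F' x = F x"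
  shows "AE x in lborel. integrable lebesgue (\<lambda>y. G0 \<alpha> x y *v F' y) \<and> R0 \<alpha> F' x = dirac_pot \<alpha> F x"
proof -
  have "AE x in lborel. \<forall>k\<in>UNIV. \<forall>l\<in>UNIV. integrable lborel (\<lambda>y. of_real (riesz k (x - y)) * F y $ l)"
    by (intro AE_finite_allI pot_AE_integrable vadm_component F) auto
  then show ?thesis
  proof eventually_elim
    case (elim x)
    have i: "integrable lborel (\<lambda>y. of_real (riesz k (x - y)) *s F y)" for k
      by (rule integrable_vecI) (use elim in simp)
    have v: "(LINT y|lborel. of_real (riesz k (x - y)) *s F y) = vpot k F x" for k
      by (simp add: vec_eq_iff integral_component[OF i] vpot_def pot_def)
    have s: "integrable lborel (\<lambda>y. \<Sum>k\<in>UNIV. \<alpha> k *v (of_real (riesz k (x - y)) *s F y))"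
      by (intro Bochner_Integration.integrable_sum integral_mv(1) i)
    have 1: "integrable lborel (\<lambda>y. G0 \<alpha> x y *v F y)"
      unfolding G0_mv by (rule integral_smult(1)[OF s])
    have 2: "(LINT y|lborel. G0 \<alpha> x y *v F y) = dirac_pot \<alpha> F x"
      unfolding G0_mv integral_smult(2)[OF s] dirac_pot_def
      by (simp add: Bochner_Integration.integral_sum integral_mv i v)
    have m: "(\<lambda>y. G0 \<alpha> x y *v F y) \<in> borel_measurable lborel" using 1 by simp
    have ae: "AE y in lebesgue. G0 \<alpha> x y *v F y = G0 \<alpha> x y *v F' y"
      using eq unfolding AE_lebesgue_iff by eventually_elim simp
    have m1: "(\<lambda>y. G0 \<alpha> x y *v F y) \<in> borel_measurable lebesgue" using m by (simp add: measurable_completion)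
    have m2: "(\<lambda>y. G0 \<alpha> x y *v F' y) \<in> borel_measurable lebesgue" by (rule borel_measurable_AE[OF m1 ae])
    have "integrable lebesgue (\<lambda>y. G0 \<alpha> x y *v F y)" "(LINT y|lebesgue. G0 \<alpha> x y *v F y) = dirac_pot \<alpha> F x"
      using 1 2 m by (simp_all add: integrable_completion integral_completion)
    then show ?case
      unfolding R0_def using integrable_cong_AE[OF m1 m2 ae] integral_cong_AE[OF m1 m2 ae] by simp
  qed
qed

section \<open>Lebesgue classes up to null sets and bounds for the potential\<close>

lemma Lp_iff_lborel:
  fixes f :: "'a::euclidean_space \<Rightarrow> 'b::euclidean_space"
  assumes m: "f' \<in> borel_measurable borel" and eq: "AE x in lborel. f x = f' x"
  shows "f \<in> Lp q \<longleftrightarrow> integrable lborel (\<lambda>x. norm (f' x) powr q)"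
proof -
  have m': "f' \<in> borel_measurable lebesgue" by (rule borel_imp_lebesgue[OF m])
  have eq': "AE x in lebesgue. f' x = f x" using eq unfolding AE_lebesgue_iff by eventually_elim simp
  have mf: "f \<in> borel_measurable lebesgue" by (rule borel_measurable_AE[OF m' eq'])
  have "integrable lebesgue (\<lambda>x. norm (f x) powr q) \<longleftrightarrow> integrable lebesgue (\<lambda>x. norm (f' x) powr q)"
    using mf m' eq' by (intro integrable_cong_AE) auto
  also have "\<dots> \<longleftrightarrow> integrable lborel (\<lambda>x. norm (f' x) powr q)"
    using m by (intro integrable_completion) simp
  finally show ?thesis using mf by (simp add: Lp_def)
qed

lemma Lp_AE_cong:
  fixes f g :: "'a::euclidean_space \<Rightarrow> 'b::euclidean_space"
  assumes "AE x in lborel. norm (f x) = norm (g x)" "g \<in> borel_measurable lebesgue" "f \<in> Lp q"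
  shows "g \<in> Lp q"
proof -
  have f: "f \<in> borel_measurable lebesgue" "integrable lebesgue (\<lambda>x. norm (f x) powr q)" using assms(3) by (auto simp: Lp_def)
  have "AE x in lebesgue. norm (f x) powr q = norm (g x) powr q"
    using assms(1) unfolding AE_lebesgue_iff by eventually_elim simp
  then have "integrable lebesgue (\<lambda>x. norm (g x) powr q)"
    using f assms(2) by (subst integrable_cong_AE[of _ lebesgue "\<lambda>x. norm (f x) powr q"]) auto
  then show ?thesis using assms(2) by (simp add: Lp_def)
qed

lemma Linf_AE_cong:
  fixes f g :: "'a::euclidean_space \<Rightarrow> 'b::euclidean_space"
  assumes "AE x in lborel. norm (f x) = norm (g x)" "g \<in> borel_measurable lebesgue" "f \<in> Linf"
  shows "g \<in> Linf"
proof -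
  obtain B where "AE x in lebesgue. norm (f x) \<le> B" using assms(3) by (auto simp: Linf_def)
  then have "AE x in lebesgue. norm (g x) \<le> B"
    using assms(1) unfolding AE_lebesgue_iff by eventually_elim simp
  then show ?thesis using assms(2) by (auto simp: Linf_def)
qed

lemma Lp_interpolate_Linf:
  fixes f :: "'a::euclidean_space \<Rightarrow> 'b::euclidean_space"
  assumes f: "f \<in> Lp p" "f \<in> Linf" and q: "q \<ge> p" "p > 0"
  shows "f \<in> Lp q"
proof -
  obtain B where B: "AE x in lebesgue. norm (f x) \<le> B" using f(2) by (auto simp: Linf_def)
  have m: "f \<in> borel_measurable lebesgue" and i: "integrable lebesgue (\<lambda>x. norm (f x) powr p)" using f(1) by (auto simp: Lp_def)
  have "integrable lebesgue (\<lambda>x. norm (f x) powr q)"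
  proof (rule Bochner_Integration.integrable_bound)
    show "integrable lebesgue (\<lambda>x. \<bar>B\<bar> powr (q - p) * norm (f x) powr p)" using i by (rule integrable_mult_right)
    show "AE x in lebesgue. norm (norm (f x) powr q) \<le> norm (\<bar>B\<bar> powr (q - p) * norm (f x) powr p)"
      using B
    proof eventually_elim
      case (elim x)
      have "norm (f x) powr q = norm (f x) powr (q - p) * norm (f x) powr p" by (simp flip: powr_add)
      also have "\<dots> \<le> \<bar>B\<bar> powr (q - p) * norm (f x) powr p"
        using elim q by (intro mult_right_mono powr_mono2) auto
      finally show ?case by simp
    qed
  qed (use m in simp)
  then show ?thesis using m by (simp add: Lp_def)
qed

text \<open>Truncation by the minimum turns a bound that holds almost everywhere into one that holds
  at every point, the form which the potential estimates ask for.\<close>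

lemma weighted_representative:
  fixes F :: "'a::euclidean_space \<Rightarrow> 'b::euclidean_space" and f :: "'a \<Rightarrow> 'c::euclidean_space"
  assumes mF: "F \<in> borel_measurable borel" and f: "f \<in> Lp q" and C: "C \<ge> 0"
    and le: "AE x in lborel. norm (F x) \<le> C * ((1 + norm x) powr (- m) * norm (f x))"
  obtains g h where "g \<in> borel_measurable borel" "h \<in> borel_measurable borel" "\<And>x. 0 \<le> g x" "\<And>x. (0::real) \<le> h x"
    "\<And>x. g x \<le> C * ((1 + norm x) powr (- m) * h x)" "AE x in lborel. norm (F x) = g x"
    "integrable lborel (\<lambda>x. h x powr q)"
proof -
  have mf: "f \<in> borel_measurable lebesgue" using f by (simp add: Lp_def)
  obtain f' where f': "f' \<in> borel_measurable borel" "AE x in lborel. f x = f' x" using borel_representative[OF mf] .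
  have [measurable]: "F \<in> borel_measurable borel" "f' \<in> borel_measurable borel" using mF f' by auto
  let ?b = "\<lambda>x. C * ((1 + norm x) powr (- m) * norm (f' x))"
  show ?thesis
  proof (rule that[of "\<lambda>x. min (norm (F x)) (?b x)" "\<lambda>x. norm (f' x)"])
    show "AE x in lborel. norm (F x) = min (norm (F x)) (?b x)"
      using le f'(2) by eventually_elim auto
    show "integrable lborel (\<lambda>x. norm (f' x) powr q)" using f Lp_iff_lborel[OF f'] by blast
  qed (use C in auto)
qed

lemma weighted_in_Lp:
  fixes F :: "'a::euclidean_space \<Rightarrow> 'b::euclidean_space" and f :: "'a \<Rightarrow> 'c::euclidean_space"
  assumes mF: "F \<in> borel_measurable borel" and f: "f \<in> Lp q0" and C: "C \<ge> 0"
    and le: "AE x in lborel. norm (F x) \<le> C * ((1 + norm x) powr (- m) * norm (f x))"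
    and m: "m \<ge> 0" and p: "p > 0" "1 / q0 \<le> 1 / p" "1 / p < 1 / q0 + m / real DIM('a)" and q0: "q0 > 0"
  shows "integrable lborel (\<lambda>x. norm (F x) powr p)"
proof -
  obtain g h where g: "g \<in> borel_measurable borel" "h \<in> borel_measurable borel" "\<And>x. 0 \<le> g x" "\<And>x. (0::real) \<le> h x"
    "\<And>x. g x \<le> C * ((1 + norm x) powr (- m) * h x)" "AE x in lborel. norm (F x) = g x"
    "integrable lborel (\<lambda>x. h x powr q0)"
    using weighted_representative[OF mF f C le] by blast
  have "integrable lborel (\<lambda>x. g x powr p)" by (rule weighted_Lp[OF g(1,2,4,3) C g(5,7) m p q0])
  moreover have "AE x in lborel. norm (F x) powr p = g x powr p" using g(6) by eventually_elim simp
  ultimately show ?thesis using mF g(1) by (subst integrable_cong_AE) auto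
qed

definition dirac_const :: "('n::finite \<Rightarrow> complex^'N::finite^'N) \<Rightarrow> real" where
  "dirac_const \<alpha> = norm (cdir TYPE('n)) * (\<Sum>k\<in>UNIV. matrix_const (\<alpha> k) * real CARD('N))"

lemma dirac_const_nonneg: "dirac_const \<alpha> \<ge> 0"
  unfolding dirac_const_def matrix_const_def by (intro mult_nonneg_nonneg sum_nonneg) auto

lemma dirac_pot_norm_le:
  fixes F :: "real^'n::finite \<Rightarrow> complex^'N::finite" and \<alpha> :: "'n \<Rightarrow> complex^'N^'N"
  assumes mF: "F \<in> borel_measurable borel" and i: "integrable lborel (\<lambda>y. kap (x - y) * norm (F y))"
  shows "norm (dirac_pot \<alpha> F x) \<le> dirac_const \<alpha> * (LINT y|lborel. kap (x - y) * norm (F y))"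
proof -
  let ?I = "LINT y|lborel. kap (x - y) * norm (F y)"
  have p: "norm (pot k (\<lambda>y. F y $ l) x) \<le> ?I" for k l
  proof -
    have [measurable]: "(\<lambda>y. F y $ l) \<in> borel_measurable borel" by (rule borel_measurable_component[OF mF])
    have le: "norm (of_real (riesz k (x - y)) * F y $ l) \<le> kap (x - y) * norm (F y)" for y
      unfolding norm_mult norm_of_real by (intro mult_mono riesz_le_kap Finite_Cartesian_Product.norm_nth_le) auto
    have "integrable lborel (\<lambda>y. of_real (riesz k (x - y)) * F y $ l)"
      by (rule integrable_dominated[OF i _ le]) measurable
    then show ?thesis unfolding pot_def by (rule Bochner_Integration.integral_norm_bound_integral[OF _ i]) (rule le)
  qed
  have v: "norm (vpot k F x) \<le> real CARD('N) * ?I" for k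
  proof -
    have "norm (vpot k F x) \<le> (\<Sum>l\<in>UNIV. norm (vpot k F x $ l))" unfolding norm_vec_def by (rule L2_set_le_sum) simp
    also have "\<dots> \<le> (\<Sum>l\<in>(UNIV :: 'N set). ?I)" by (intro sum_mono) (simp add: vpot_def p)
    finally show ?thesis by simp
  qed
  have "norm (dirac_pot \<alpha> F x) = norm (cdir TYPE('n)) * norm (\<Sum>k\<in>UNIV. \<alpha> k *v vpot k F x)"
    by (simp add: dirac_pot_def norm_smult)
  also have "\<dots> \<le> norm (cdir TYPE('n)) * (\<Sum>k\<in>UNIV. matrix_const (\<alpha> k) * (real CARD('N) * ?I))"
  proof (intro mult_left_mono sum_norm_le)
    show "norm (\<alpha> k *v vpot k F x) \<le> matrix_const (\<alpha> k) * (real CARD('N) * ?I)" for k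
      by (rule order_trans[OF norm_mv_le mult_left_mono[OF v]]) (auto simp: matrix_const_def intro!: sum_nonneg)
  qed auto
  also have "\<dots> = dirac_const \<alpha> * ?I" by (simp add: dirac_const_def sum_distrib_right sum_distrib_left mult_ac)
  finally show ?thesis .
qed

lemma dirac_pot_Lp:
  fixes F :: "real^'n::finite \<Rightarrow> complex^'N::finite" and \<alpha> :: "'n \<Rightarrow> complex^'N^'N"
    and f :: "real^'n \<Rightarrow> complex^'N"
  assumes F: "vadm F" and f: "f \<in> Lp q0" and C: "C \<ge> 0"
    and le: "AE x in lborel. norm (F x) \<le> C * ((1 + norm x) powr (- m) * norm (f x))"
    and m: "m \<ge> 0" and q0: "q0 \<ge> 1" and q: "q > 0"
    and lower: "1 / q0 - 1 / real CARD('n) < 1 / q"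
    and upper: "1 / q < 1 - 1 / real CARD('n)" "1 / q < 1 / q0 + (m - 1) / real CARD('n)"
  shows "dirac_pot \<alpha> F \<in> Lp q"
proof -
  have mF: "F \<in> borel_measurable borel" using F by (simp add: vadm_def)
  obtain g h where g: "g \<in> borel_measurable borel" "h \<in> borel_measurable borel" "\<And>x. 0 \<le> g x" "\<And>x. (0::real) \<le> h x"
    "\<And>x. g x \<le> C * ((1 + norm x) powr (- m) * h x)" "AE x in lborel. norm (F x) = g x"
    "integrable lborel (\<lambda>x. h x powr q0)"
    using weighted_representative[OF mF f C le] by blast
  have [measurable]: "F \<in> borel_measurable borel" "g \<in> borel_measurable borel" using mF g by auto
  note PL = potential_Lq[OF g(1,2,4,3) C g(5,7) m q0 q, simplified, OF lower upper]
  have same: "integrable lborel (\<lambda>y. kap (x - y) * norm (F y)) \<longleftrightarrow> integrable lborel (\<lambda>y. kap (x - y) * g y)"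
     "(LINT y|lborel. kap (x - y) * norm (F y)) = (LINT y|lborel. kap (x - y) * g y)" for x :: "real^'n"
  proof -
    have ae: "AE y in lborel. kap (x - y) * norm (F y) = kap (x - y) * g y" using g(6) by eventually_elim simp
    show "integrable lborel (\<lambda>y. kap (x - y) * norm (F y)) \<longleftrightarrow> integrable lborel (\<lambda>y. kap (x - y) * g y)"
      by (rule integrable_cong_AE[OF _ _ ae]) measurable
    show "(LINT y|lborel. kap (x - y) * norm (F y)) = (LINT y|lborel. kap (x - y) * g y)"
      by (rule integral_cong_AE[OF _ _ ae]) measurable
  qed
  have md [measurable]: "dirac_pot \<alpha> F \<in> borel_measurable borel" by (rule dirac_pot_measurable[OF F])
  have "integrable lborel (\<lambda>x. norm (dirac_pot \<alpha> F x) powr q)"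
  proof (rule Bochner_Integration.integrable_bound)
    show "integrable lborel (\<lambda>x. dirac_const \<alpha> powr q * (LINT y|lborel. kap (x - y) * g y) powr q)"
      by (rule integrable_mult_right[OF PL(2)])
    show "AE x in lborel. norm (norm (dirac_pot \<alpha> F x) powr q) \<le> norm (dirac_const \<alpha> powr q * (LINT y|lborel. kap (x - y) * g y) powr q)"
      using PL(1)
    proof eventually_elim
      case (elim x)
      have "norm (dirac_pot \<alpha> F x) \<le> dirac_const \<alpha> * (LINT y|lborel. kap (x - y) * g y)"
        using dirac_pot_norm_le[OF mF, of x \<alpha>] elim same[of x] by simp
      moreover have "(LINT y|lborel. kap (x - y) * g y) \<ge> 0" using g(3) by (intro Bochner_Integration.integral_nonneg) auto
      ultimately show ?case using q dirac_const_nonneg[of \<alpha>]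
        by (simp add: powr_mult[symmetric] powr_mono2)
    qed
  qed measurable
  then show ?thesis using Lp_iff_lborel[OF md, of "dirac_pot \<alpha> F" q] by simp
qed

lemma dirac_pot_Linf:
  fixes F :: "real^'n::finite \<Rightarrow> complex^'N::finite" and \<alpha> :: "'n \<Rightarrow> complex^'N^'N"
  assumes F: "vadm F" and i: "integrable lborel (\<lambda>x. norm (F x) powr p1)" "integrable lborel (\<lambda>x. norm (F x) powr p2)"
    and p: "p1 > real CARD('n)" "p2 < real CARD('n)" "p2 > 1"
  shows "dirac_pot \<alpha> F \<in> Linf"
proof -
  have mF: "F \<in> borel_measurable borel" using F by (simp add: vadm_def)
  obtain B where B: "\<And>x. integrable lborel (\<lambda>y. kap (x - y) * norm (F y)) \<and> (LINT y|lborel. kap (x - y) * norm (F y)) \<le> B"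
    using potential_bounded[of "\<lambda>x. norm (F x)" p1 p2] mF i p by auto
  have "norm (dirac_pot \<alpha> F x) \<le> dirac_const \<alpha> * B" for x
    using order_trans[OF dirac_pot_norm_le[OF mF] mult_left_mono[OF _ dirac_const_nonneg]] B by blast
  then show ?thesis using borel_imp_lebesgue[OF dirac_pot_measurable[OF F]] by (auto simp: Linf_def)
qed

section \<open>Square integrable fields and the gradient of the potential\<close>

definition sqi :: "('a::euclidean_space \<Rightarrow> complex^'N::finite) \<Rightarrow> bool" where
  "sqi f \<longleftrightarrow> f \<in> borel_measurable borel \<and> integrable lborel (\<lambda>x. (norm (f x))\<^sup>2)"

lemma sqi_add: assumes "sqi f" "sqi g" shows "sqi (\<lambda>x. f x + g x)"
proof -
  have [measurable]: "f \<in> borel_measurable borel" "g \<in> borel_measurable borel"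
    and i: "integrable lborel (\<lambda>x. 2 * (norm (f x))\<^sup>2 + 2 * (norm (g x))\<^sup>2)" using assms by (auto simp: sqi_def)
  have "integrable lborel (\<lambda>x. (norm (f x + g x))\<^sup>2)"
    by (rule integrable_dominated[OF i]) (use norm_diff_sq_le[of "f _" "- g _"] in auto)
  then show ?thesis by (simp add: sqi_def)
qed

lemma sqi_zero: "sqi (\<lambda>x. 0)" by (simp add: sqi_def)

lemma sqi_sum: "(\<And>i. i \<in> I \<Longrightarrow> sqi (f i)) \<Longrightarrow> sqi (\<lambda>x. \<Sum>i\<in>I. f i x)"
  by (induction I rule: infinite_finite_induct) (auto intro: sqi_add sqi_zero)

lemma sqi_linear:
  assumes "\<And>v. norm (T v) \<le> K * norm v" "bounded_linear T" "sqi f"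
  shows "sqi (\<lambda>x. T (f x))"
proof -
  have m: "(\<lambda>x. T (f x)) \<in> borel_measurable borel"
    by (rule borel_measurable_continuous_on[OF linear_continuous_on[OF assms(2)]]) (use assms(3) in \<open>simp add: sqi_def\<close>)
  have le: "norm ((norm (T (f x)))\<^sup>2) \<le> K\<^sup>2 * (norm (f x))\<^sup>2" for x
    using power_mono[OF assms(1)[of "f x"], of 2] by (simp add: power_mult_distrib)
  have "integrable lborel (\<lambda>x. K\<^sup>2 * (norm (f x))\<^sup>2)" using assms(3) by (simp add: sqi_def)
  then have "integrable lborel (\<lambda>x. (norm (T (f x)))\<^sup>2)"
    by (rule integrable_dominated[OF _ _ le]) (use m in simp)
  then show ?thesis using m by (simp add: sqi_def)
qed

lemma powr_2_eq: "norm x powr 2 = (norm x)\<^sup>2"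
  by (cases "x = 0") (auto simp: powr_numeral)

lemma sqi_Lp: "sqi f \<Longrightarrow> f \<in> Lp 2"
  using Lp_iff_lborel[of f f 2] by (simp add: sqi_def powr_2_eq)

lemma locally_integrable_lborel:
  fixes f :: "real^'n::finite \<Rightarrow> complex^'N::finite"
  assumes m: "f' \<in> borel_measurable borel" and eq: "AE x in lborel. f x = f' x"
    and i: "\<And>K. compact K \<Longrightarrow> set_integrable lborel K f'"
  shows "locally_integrable f"
proof -
  have m': "f' \<in> borel_measurable lebesgue" by (rule borel_imp_lebesgue[OF m])
  have eq': "AE x in lebesgue. f' x = f x" using eq unfolding AE_lebesgue_iff by eventually_elim simp
  have mf: "f \<in> borel_measurable lebesgue" by (rule borel_measurable_AE[OF m' eq'])
  have "set_integrable lebesgue K f" if K: "compact K" for K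
  proof -
    have Kb: "K \<in> sets borel" using K by (rule borel_compact)
    have 1: "integrable lebesgue (\<lambda>x. indicator K x *\<^sub>R f' x)"
      using i[OF K] m Kb by (subst integrable_completion) (auto simp: set_integrable_def)
    have mi: "(\<lambda>x. indicator K x *\<^sub>R f' x) \<in> borel_measurable lebesgue" using 1 by (rule borel_measurable_integrable)
    have ae: "AE x in lebesgue. indicator K x *\<^sub>R f' x = indicator K x *\<^sub>R f x" using eq' by eventually_elim simp
    have mi2: "(\<lambda>x. indicator K x *\<^sub>R f x) \<in> borel_measurable lebesgue" by (rule borel_measurable_AE[OF mi ae])
    show ?thesis unfolding set_integrable_def using integrable_cong_AE[OF mi mi2 ae] 1 by simp
  qed
  then show ?thesis using mf by (simp add: locally_integrable_def)
qed

lemma sqi_set_integrable: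
  fixes f :: "real^'n::finite \<Rightarrow> complex^'N::finite"
  assumes f: "sqi f" and K: "compact K" shows "set_integrable lborel K f"
  unfolding set_integrable_def
proof (rule integrable_dominated)
  have Kb [measurable]: "K \<in> sets borel" using K by (rule borel_compact)
  have [measurable]: "f \<in> borel_measurable borel" using f by (simp add: sqi_def)
  show "integrable lborel (\<lambda>x. indicator K x + (norm (f x))\<^sup>2)"
    using f emeasure_compact_finite[OF K] Kb
    by (intro Bochner_Integration.integrable_add integrable_real_indicator) (auto simp: sqi_def)
  show "(\<lambda>x. indicator K x *\<^sub>R f x) \<in> borel_measurable lborel" by measurable
  show "norm (indicator K x *\<^sub>R f x) \<le> indicator K x + (norm (f x))\<^sup>2" for x
  proof (cases "x \<in> K")
    case True
    have "norm (f x) \<le> 1 + (norm (f x))\<^sup>2"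
    proof -
      have "2 * norm (f x) \<le> (norm (f x))\<^sup>2 + 1" using sum_squares_bound[of "norm (f x)" 1] by simp
      then show ?thesis using norm_ge_zero[of "f x"] by linarith
    qed
    then show ?thesis using True by simp
  qed simp
qed

lemma distr_of_lborel:
  fixes f :: "real^'n::finite \<Rightarrow> complex^'N::finite"
  assumes m: "f' \<in> borel_measurable borel" and eq: "AE x in lborel. f x = f' x" and \<phi>: "test_function \<phi>"
  shows "distr_of f \<phi> = (LINT x|lborel. \<phi> x *s f' x)"
proof -
  have mb: "(\<lambda>x. \<phi> x *s f' x) \<in> borel_measurable borel"
    by (rule borel_measurable_smult_fun[OF test_function_measurable[OF \<phi>] m])
  have ml: "(\<lambda>x. \<phi> x *s f' x) \<in> borel_measurable lebesgue" by (rule borel_imp_lebesgue[OF mb])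
  have ae: "AE x in lebesgue. \<phi> x *s f' x = \<phi> x *s f x" using eq unfolding AE_lebesgue_iff by eventually_elim simp
  have ml2: "(\<lambda>x. \<phi> x *s f x) \<in> borel_measurable lebesgue" by (rule borel_measurable_AE[OF ml ae])
  have "distr_of f \<phi> = (LINT x|lebesgue. \<phi> x *s f' x)"
    unfolding distr_of_def by (rule integral_cong_AE[OF ml ml2 ae, symmetric])
  also have "\<dots> = (LINT x|lborel. \<phi> x *s f' x)" using mb by (intro integral_completion) simp
  finally show ?thesis .
qed

lemma dirac_pot_gradient:
  fixes F :: "real^'n::finite \<Rightarrow> complex^'N::finite" and \<alpha> :: "'n \<Rightarrow> complex^'N^'N"
  assumes F: "vadm F" and F2: "integrable lborel (\<lambda>x. (norm (F x))\<^sup>2)" and n2: "CARD('n) \<ge> 2"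
    and eq: "AE x in lborel. \<Psi> x = - dirac_pot \<alpha> F x"
  shows "gradient_L2 \<Psi>"
  unfolding gradient_L2_def
proof
  fix j :: 'n
  have mF [measurable]: "F \<in> borel_measurable borel" using F by (simp add: vadm_def)
  define P where "P k l h \<longleftrightarrow> h \<in> borel_measurable borel \<and> integrable lborel (\<lambda>x. (norm (h x))\<^sup>2) \<and>
     (\<forall>\<phi>. test_function \<phi> \<longrightarrow> (LINT x|lborel. \<phi> x * h x) = - (LINT x|lborel. partial_deriv j \<phi> x * pot k (\<lambda>y. F y $ l) x))"
    for k l and h :: "real^'n \<Rightarrow> complex"
  have "\<exists>h. P k l h" for k l
  proof -
    have [measurable]: "(\<lambda>y. F y $ l) \<in> borel_measurable borel" by (rule borel_measurable_component[OF mF])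
    have "integrable lborel (\<lambda>x. (norm (F x $ l))\<^sup>2)"
      by (rule integrable_dominated[OF F2]) (auto intro!: power_mono Finite_Cartesian_Product.norm_nth_le)
    from pot_weak_derivative[OF vadm_component[OF F] this n2, where j=j and k=k] show ?thesis unfolding P_def by blast
  qed
  then obtain h where hP: "\<And>k l. P k l (h k l)" by metis
  have h: "h k l \<in> borel_measurable borel" "integrable lborel (\<lambda>x. (norm (h k l x))\<^sup>2)"
    "test_function \<phi> \<Longrightarrow> (LINT x|lborel. \<phi> x * h k l x) = - (LINT x|lborel. partial_deriv j \<phi> x * pot k (\<lambda>y. F y $ l) x)" for k l \<phi>
    using hP[of k l] unfolding P_def by blast+
  define H where "H k x = (\<chi> l. h k l x)" for k x
  have sH: "sqi (H k)" for k
  proof -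
    have m: "H k \<in> borel_measurable borel" by (rule borel_measurable_vecI) (simp add: H_def h)
    have "integrable lborel (\<lambda>x. \<Sum>l\<in>UNIV. (norm (h k l x))\<^sup>2)" by (intro Bochner_Integration.integrable_sum h)
    moreover have "(norm (H k x))\<^sup>2 = (\<Sum>l\<in>UNIV. (norm (h k l x))\<^sup>2)" for x
      by (simp add: H_def norm_vec_def L2_set_def sum_nonneg)
    ultimately show ?thesis using m by (simp add: sqi_def)
  qed
  let ?c = "cdir TYPE('n)"
  define g where "g x = - (?c *s (\<Sum>k\<in>UNIV. \<alpha> k *v H k x))" for x
  have sg': "sqi (\<lambda>x. ?c *s (\<Sum>k\<in>UNIV. \<alpha> k *v H k x))"
    by (intro sqi_linear[OF _ bounded_linear_smult, of _ "norm ?c"] sqi_sum sqi_linear[OF norm_mv_le bounded_linear_mv] sH)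
      (simp add: norm_smult)
  then have sg: "sqi g" by (simp add: sqi_def g_def[abs_def])
  have mg: "g \<in> borel_measurable borel" using sg by (simp add: sqi_def)
  have md: "(\<lambda>x. - dirac_pot \<alpha> F x) \<in> borel_measurable borel" using dirac_pot_measurable[OF F, of \<alpha>] by simp
  have "weak_partial j \<Psi> g"
    unfolding weak_partial_def
  proof (intro conjI allI impI)
    show "locally_integrable \<Psi>"
      by (rule locally_integrable_lborel[OF md eq]) (use dirac_pot_set_integrable[OF F, of _ \<alpha>] in \<open>simp add: set_integrable_def\<close>)
    show "locally_integrable g" by (rule locally_integrable_lborel[OF mg _ sqi_set_integrable[OF sg]]) auto
    fix \<phi> :: "real^'n \<Rightarrow> complex" assume \<phi>: "test_function \<phi>"
    have i1: "integrable lborel (\<lambda>x. \<phi> x *s H k x)" for k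
      by (rule integrable_vecI)
        (use sq_integrable_mult[of \<phi> lborel] h test_function_measurable[OF \<phi>] test_function_integrable(2)[OF \<phi>] in \<open>simp add: H_def\<close>)
    have Hk: "(LINT x|lborel. \<phi> x *s H k x) = - (LINT x|lborel. partial_deriv j \<phi> x *s vpot k F x)" for k
      unfolding vec_eq_iff vector_uminus_component integral_component[OF i1]
        integral_component[OF vpot_test(1)[OF F test_function_partial[OF \<phi>]]]
      by (simp add: H_def vpot_def h(3)[OF \<phi>])
    have s: "integrable lborel (\<lambda>x. \<Sum>k\<in>UNIV. \<alpha> k *v (\<phi> x *s H k x))"
      by (intro Bochner_Integration.integrable_sum integral_mv i1)
    have e: "\<phi> x *s g x = - (?c *s (\<Sum>k\<in>UNIV. \<alpha> k *v (\<phi> x *s H k x)))" for x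
      unfolding g_def mv_smult by (simp add: smult_sum vector_smult_assoc mult.commute vec_eq_iff sum_negf)
    have "distr_of g \<phi> = (LINT x|lborel. \<phi> x *s g x)" by (rule distr_of_lborel[OF mg _ \<phi>]) simp
    also have "\<dots> = - (?c *s (\<Sum>k\<in>UNIV. \<alpha> k *v (LINT x|lborel. \<phi> x *s H k x)))"
      unfolding e Bochner_Integration.integral_minus integral_smult(2)[OF s]
      by (simp add: Bochner_Integration.integral_sum integral_mv i1)
    also have "\<dots> = ?c *s (\<Sum>k\<in>UNIV. \<alpha> k *v (LINT x|lborel. partial_deriv j \<phi> x *s vpot k F x))"
      unfolding Hk by (simp add: linear_neg[OF linear_mv] sum_negf vec_eq_iff)
    also have "\<dots> = (LINT x|lborel. partial_deriv j \<phi> x *s dirac_pot \<alpha> F x)"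
      unfolding dirac_pot_test(2)[OF F test_function_partial[OF \<phi>]] vpot_test(3)[OF F test_function_partial[OF \<phi>]] ..
    also have "\<dots> = - (LINT x|lborel. partial_deriv j \<phi> x *s (- dirac_pot \<alpha> F x))"
      by (simp add: vector_smult_rneg)
    also have "\<dots> = - distr_of \<Psi> (partial_deriv j \<phi>)"
      by (simp add: distr_of_lborel[OF md eq test_function_partial[OF \<phi>]])
    finally show "distr_of g \<phi> = - distr_of \<Psi> (partial_deriv j \<phi>)" .
  qed
  then show "\<exists>g\<in>Lp 2. weak_partial j \<Psi> g" using sqi_Lp[OF sg] by blast
qed


section \<open>Zero-energy solutions\<close>

lemma measurable_mv_fun:
  fixes A :: "real^'n::finite \<Rightarrow> complex^'N::finite^'N" and f :: "real^'n \<Rightarrow> complex^'N"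
  assumes "A \<in> borel_measurable lebesgue" "f \<in> borel_measurable lebesgue"
  shows "(\<lambda>x. A x *v f x) \<in> borel_measurable lebesgue"
proof (rule borel_measurable_vecI)
  fix l
  have "(\<lambda>x. A x $ l $ m) \<in> borel_measurable lebesgue" for m
    by (rule borel_measurable_continuous_on[OF _ assms(1)]) (intro continuous_intros)
  then show "(\<lambda>x. (A x *v f x) $ l) \<in> borel_measurable lebesgue"
    unfolding matrix_vector_mult_def using borel_measurable_component[OF assms(2)] by simp
qed

lemma Lp_2_sq:
  fixes f :: "'a::euclidean_space \<Rightarrow> 'b::euclidean_space"
  assumes "f' \<in> borel_measurable borel" "AE x in lborel. f x = f' x" "f \<in> Lp 2"
  shows "integrable lborel (\<lambda>x. (norm (f' x))\<^sup>2)"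
  using Lp_iff_lborel[OF assms(1,2), of 2] assms(3) by (simp add: powr_2_eq)

lemma weight_sq_integrable: "integrable lborel (\<lambda>x::'a::euclidean_space. (1 + norm x) powr (- (2 * real DIM('a))))"
  by (rule integrable_weight) simp

lemma weight_times_le: "(1 + norm x) powr (- a) * t \<le> (1 + norm x) powr (- (2 * a)) + (t::real)\<^sup>2"
proof -
  let ?w = "(1 + norm x) powr (- a)"
  have "2 * (?w * t) \<le> ?w\<^sup>2 + t\<^sup>2" using sum_squares_bound[of ?w t] by simp
  moreover have "?w\<^sup>2 = (1 + norm x) powr (- (2 * a))"
    by (simp add: power2_eq_square flip: powr_add)
  moreover have "?w * t \<le> max 0 (2 * (?w * t))" by (cases "t \<ge> 0") (auto simp: mult_nonneg_nonpos)
  moreover have "0 \<le> ?w\<^sup>2 + t\<^sup>2" by simp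
  ultimately show ?thesis by linarith
qed

text \<open>Common to the sources V \<Psi> (m = 2) and V1 \<Phi> (m = 1). For m >= 1 the weight in
  \<open>vadm\<close> times the source is at most a multiple of (1 + |y|)^(-n) |f|, a product of two
  square integrable functions since 2 n > n.\<close>

lemma weighted_source:
  fixes F' f :: "real^'n::finite \<Rightarrow> complex^'N::finite"
  assumes mF: "F' \<in> borel_measurable lebesgue" and f: "f \<in> Lp 2" and C: "C \<ge> 0" and m: "m \<ge> 1"
    and le: "AE x in lborel. norm (F' x) \<le> C * ((1 + norm x) powr (- m) * norm (f x))"
  obtains F where "vadm F" "AE x in lborel. F' x = F x" "integrable lborel (\<lambda>x. (norm (F x))\<^sup>2)"
    "AE x in lborel. norm (F x) \<le> C * ((1 + norm x) powr (- m) * norm (f x))"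
proof -
  obtain F where F: "F \<in> borel_measurable borel" "AE x in lborel. F' x = F x" using borel_representative[OF mF] .
  have leF: "AE x in lborel. norm (F x) \<le> C * ((1 + norm x) powr (- m) * norm (f x))"
    using le F(2) by eventually_elim simp
  obtain g h where g: "g \<in> borel_measurable borel" "h \<in> borel_measurable borel" "\<And>x. 0 \<le> g x" "\<And>x. (0::real) \<le> h x"
    "\<And>x. g x \<le> C * ((1 + norm x) powr (- m) * h x)" "AE x in lborel. norm (F x) = g x"
    "integrable lborel (\<lambda>x. h x powr 2)"
    using weighted_representative[OF F(1) f C leF] by blast
  have [measurable]: "F \<in> borel_measurable borel" by (rule F(1))
  have h2: "integrable lborel (\<lambda>x. (h x)\<^sup>2)" using g(7) powr_2_eq[of "h _"] g(4) by simp
  have "integrable lborel (\<lambda>y. (1 + norm y) powr (1 - real CARD('n)) * norm (F y))"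
  proof (rule Bochner_Integration.integrable_bound)
    show "integrable lborel (\<lambda>y::real^'n. C * ((1 + norm y) powr (- (2 * real CARD('n))) + (h y)\<^sup>2))"
      using weight_sq_integrable[where 'a="real^'n"] h2 by (intro integrable_mult_right Bochner_Integration.integrable_add) simp_all
    show "AE y in lborel. norm ((1 + norm y) powr (1 - real CARD('n)) * norm (F y)) \<le> norm (C * ((1 + norm y) powr (- (2 * real CARD('n))) + (h y)\<^sup>2))"
      using g(6)
    proof eventually_elim
      case (elim y)
      have "(1 + norm y) powr (1 - real CARD('n)) * norm (F y) \<le> (1 + norm y) powr (1 - real CARD('n)) * (C * ((1 + norm y) powr (- m) * h y))"
        using elim g(5)[of y] by (intro mult_left_mono) auto
      also have "\<dots> = C * ((1 + norm y) powr (1 - real CARD('n) + - m) * h y)" by (simp only: powr_add) (simp add: mult_ac)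
      also have "\<dots> \<le> C * ((1 + norm y) powr (- real CARD('n)) * h y)"
        using C m g(4) by (intro mult_left_mono mult_right_mono powr_mono) auto
      also have "\<dots> \<le> C * ((1 + norm y) powr (- (2 * real CARD('n))) + (h y)\<^sup>2)"
        using C by (intro mult_left_mono weight_times_le)
      finally show ?case using C by (simp add: abs_mult)
    qed
  qed measurable
  then have v: "vadm F" using F(1) by (simp add: vadm_def)
  have "integrable lborel (\<lambda>x. norm (F x) powr 2)"
    by (rule weighted_in_Lp[OF F(1) f C leF]) (use m in auto)
  then have "integrable lborel (\<lambda>x. (norm (F x))\<^sup>2)" by (simp add: powr_2_eq)
  then show ?thesis using that v F(2) leF by blast
qed

text \<open>The quantifier over vectors stands inside the almost everywhere statement of
  \<open>V_bound\<close>, so one null set serves all of them and the bound applies to vectors that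
  depend on \<open>x\<close>.\<close>

locale dirac_setup =
  fixes \<alpha> :: "'n::finite \<Rightarrow> complex^'N::finite^'N" and V :: "real^'n \<Rightarrow> complex^'N^'N" and C :: real
  assumes n2: "CARD('n) \<ge> 2"
    and anti: "\<And>j k. \<alpha> j ** \<alpha> k + \<alpha> k ** \<alpha> j = (if j = k then mat 2 else 0)"
    and V_meas: "V \<in> borel_measurable lebesgue"
    and V_sa: "AE x in lborel. cadjoint (V x) = V x"
    and C: "C \<ge> 0"
    and V_bound: "AE x in lborel. \<forall>v. norm (V x *v v) \<le> C * (1 + norm x) powr (- 2) * norm v"
begin

lemma V1_meas: "V1 V \<in> borel_measurable lebesgue" and V2_meas: "V2 V \<in> borel_measurable lebesgue"
proof -
  have b: "AE x in lebesgue. \<forall>v. norm (V x *v v) \<le> C * norm v"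
    using V_bound unfolding AE_lebesgue_iff
  proof eventually_elim
    case (elim x)
    have "C * (1 + norm x) powr (- 2) \<le> C * 1" using C by (intro mult_left_mono weight_le_1) auto
    then have "C * (1 + norm x) powr (- 2) * norm v \<le> C * norm v" for v :: "complex^'N"
      by (intro mult_right_mono) auto
    then show ?case using elim order_trans by blast
  qed
  have s: "AE x in lebesgue. cadjoint (V x) = V x" using V_sa by (simp add: AE_lebesgue_iff)
  show "V1 V \<in> borel_measurable lebesgue"
  proof (rule measurable_fcal[OF V_meas s b])
    show "continuous_on UNIV (\<lambda>t::real. sqrt \<bar>t\<bar>)" by (intro continuous_intros)
    show "V1 V x = fcal (\<lambda>t. sqrt \<bar>t\<bar>) (V x)" if "cadjoint (V x) = V x" for x using that by (rule V1_fcal)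
  qed
  \<comment> \<open>The jump of \<open>sgn\<close> at 0 is damped by the square root; continuity is
    what makes this function a limit of polynomials.\<close>
  have c: "continuous_on UNIV (\<lambda>t. sgn t * sqrt \<bar>t\<bar> :: real)"
  proof (rule continuous_at_imp_continuous_on, rule ballI)
    fix t :: real
    show "isCont (\<lambda>t. sgn t * sqrt \<bar>t\<bar>) t"
    proof (cases "t = 0")
      case True
      have "((\<lambda>t. sgn t * sqrt \<bar>t\<bar>) \<longlongrightarrow> 0) (at (0::real))"
      proof (rule Lim_null_comparison)
        show "\<forall>\<^sub>F t in at 0. norm (sgn t * sqrt \<bar>t\<bar>) \<le> sqrt \<bar>t\<bar>"
          by (intro always_eventually allI) (simp add: abs_mult sgn_real_def)
        show "((\<lambda>t. sqrt \<bar>t\<bar>) \<longlongrightarrow> 0) (at (0::real))" by (auto intro!: tendsto_eq_intros)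
      qed
      then show ?thesis using True by (simp add: isCont_def)
    qed (auto intro!: continuous_intros)
  qed
  show "V2 V \<in> borel_measurable lebesgue"
  proof (rule measurable_fcal[OF V_meas s b c])
    show "V2 V x = fcal (\<lambda>t. sgn t * sqrt \<bar>t\<bar>) (V x)" if "cadjoint (V x) = V x" for x using that by (rule V2_fcal)
  qed
qed

lemma V12_bound:
  "AE x in lborel. \<forall>v. norm (V1 V x *v v) \<le> sqrt C * ((1 + norm x) powr (- 1) * norm v)"
  "AE x in lborel. \<forall>v. norm (V2 V x *v v) \<le> sqrt C * ((1 + norm x) powr (- 1) * norm v)"
proof -
  have s: "sqrt (C * (1 + norm x) powr (- 2)) = sqrt C * (1 + norm x) powr (- 1)" for x :: "real^'n"
  proof -
    have "(- 2 :: real) = - 1 + - 1" by simp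
    then have "(1 + norm x) powr (- 2) = ((1 + norm x) powr (- 1))\<^sup>2"
      by (simp only: power2_eq_square powr_add)
    then show ?thesis by (simp add: real_sqrt_mult)
  qed
  show "AE x in lborel. \<forall>v. norm (V1 V x *v v) \<le> sqrt C * ((1 + norm x) powr (- 1) * norm v)"
    using V_sa V_bound
  proof eventually_elim
    case (elim x)
    have "norm (V1 V x *v v) \<le> sqrt (C * (1 + norm x) powr (- 2)) * norm v" for v
      unfolding V1_fcal[of V x, OF elim(1)] by (rule fcal_sqrt_bound[OF elim(1)]) (use elim in auto)
    then show ?case by (simp add: s mult.assoc)
  qed
  show "AE x in lborel. \<forall>v. norm (V2 V x *v v) \<le> sqrt C * ((1 + norm x) powr (- 1) * norm v)"
    using V_sa V_bound
  proof eventually_elim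
    case (elim x)
    have "norm (V2 V x *v v) \<le> sqrt (C * (1 + norm x) powr (- 2)) * norm v" for v
      unfolding V2_fcal[of V x, OF elim(1)]
      by (rule fcal_sqrt_bound[OF elim(1)]) (use elim in \<open>auto simp: sgn_real_def\<close>)
    then show ?case by (simp add: s mult.assoc)
  qed
qed

section \<open>Eigenfunctions, kernel elements and their integral equations\<close>

lemma test_integrable_vadm:
  fixes F :: "real^'n \<Rightarrow> complex^'N"
  assumes "vadm F" and \<phi>: "test_function \<phi>"
  shows "integrable lborel (\<lambda>x. \<phi> x *s F x)"
proof -
  have F: "F \<in> borel_measurable borel" "integrable lborel (\<lambda>y. (1 + norm y) powr (- (real CARD('n) - 1)) * norm (F y))"
    using assms(1) by (auto simp: vadm_def)
  obtain c where c: "\<And>y. norm (\<phi> y) \<le> c * (1 + norm y) powr (- (real CARD('n) - 1))"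
    using test_function_weight_bound[OF \<phi>, of "real CARD('n) - 1"] n2 by auto
  show ?thesis by (rule weighted_test_integrable[OF F(1) test_function_measurable[OF \<phi>] F(2) c])
qed

text \<open>An L^2 function is integrable against (1 + |y|)^(-n), the growth allowed in
  \<open>dirac_pot_unique\<close>, which is applied with source V \<Psi>.\<close>

lemma eigenfunction_representation:
  assumes \<Psi>: "zero_eigenfunction \<alpha> V \<Psi>"
  obtains F where "vadm F" "AE x in lborel. V x *v \<Psi> x = F x" "integrable lborel (\<lambda>x. (norm (F x))\<^sup>2)"
    "AE x in lborel. norm (F x) \<le> C * ((1 + norm x) powr (- 2) * norm (\<Psi> x))"
    "AE x in lborel. \<Psi> x = - dirac_pot \<alpha> F x"
proof -
  have L2: "\<Psi> \<in> Lp 2" and sol: "distributional_solution \<alpha> V \<Psi>" using \<Psi> by (auto simp: zero_eigenfunction_def W12_def)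
  have m\<Psi>: "\<Psi> \<in> borel_measurable lebesgue" using L2 by (simp add: Lp_def)
  have le: "AE x in lborel. norm (V x *v \<Psi> x) \<le> C * ((1 + norm x) powr (- 2) * norm (\<Psi> x))"
    using V_bound by eventually_elim (simp add: mult.assoc)
  obtain F where F: "vadm F" "AE x in lborel. V x *v \<Psi> x = F x" "integrable lborel (\<lambda>x. (norm (F x))\<^sup>2)"
    "AE x in lborel. norm (F x) \<le> C * ((1 + norm x) powr (- 2) * norm (\<Psi> x))"
    using weighted_source[OF measurable_mv_fun[OF V_meas m\<Psi>] L2 C _ le] by auto
  obtain P where P: "P \<in> borel_measurable borel" "AE x in lborel. \<Psi> x = P x" using borel_representative[OF m\<Psi>] .
  have [measurable]: "P \<in> borel_measurable borel" by (rule P(1))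
  have mF: "F \<in> borel_measurable borel" using F(1) by (simp add: vadm_def)
  have P2: "integrable lborel (\<lambda>x. (norm (P x))\<^sup>2)" by (rule Lp_2_sq[OF P L2])
  have iP: "integrable lborel (\<lambda>y. (1 + norm y) powr (- real CARD('n)) * norm (P y))"
  proof (rule integrable_dominated)
    show "integrable lborel (\<lambda>y::real^'n. (1 + norm y) powr (- (2 * real CARD('n))) + (norm (P y))\<^sup>2)"
      using weight_sq_integrable[where 'a="real^'n"] P2 by simp
    show "norm ((1 + norm y) powr (- real CARD('n)) * norm (P y)) \<le> (1 + norm y) powr (- (2 * real CARD('n))) + (norm (P y))\<^sup>2" for y
      using weight_times_le[of y "real CARD('n)" "norm (P y)"] by (simp add: abs_mult)
  qed measurable
  have "AE x in lborel. P x = - dirac_pot \<alpha> F x"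
  proof (rule dirac_pot_unique[OF F(1) P(1) iP anti])
    fix \<phi> :: "real^'n \<Rightarrow> complex" assume \<phi>: "test_function \<phi>"
    have "H_distr \<alpha> V \<Psi> \<phi> = 0" using sol \<phi> by (simp add: distributional_solution_def)
    then show "(\<Sum>j\<in>UNIV. \<alpha> j *v (\<i> *s (LINT x|lborel. partial_deriv j \<phi> x *s P x))) + (LINT x|lborel. \<phi> x *s F x) = 0"
      unfolding H_distr_def distr_of_lborel[OF P test_function_partial[OF \<phi>]] distr_of_lborel[OF mF F(2) \<phi>]
      by (simp add: vector_smult_lneg vector_smult_rneg)
  qed
  then have "AE x in lborel. \<Psi> x = - dirac_pot \<alpha> F x" using P(2) by eventually_elim simp
  then show ?thesis using that F by blast
qed

text \<open>Turns the integral equation back into the differential one: by \<open>VF\<close> the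
  source of the potential is V \<Psi> itself, so the two parts of H cancel.\<close>

lemma dirac_pot_distributional_solution:
  assumes F: "vadm F" "integrable lborel (\<lambda>x. (norm (F x))\<^sup>2)"
    and eq: "AE x in lborel. \<Psi> x = - dirac_pot \<alpha> F x" and VF: "AE x in lborel. V x *v \<Psi> x = F x"
  shows "distributional_solution \<alpha> V \<Psi>"
  unfolding distributional_solution_def
proof (intro conjI allI impI)
  have mF: "F \<in> borel_measurable borel" using F(1) by (simp add: vadm_def)
  have md: "(\<lambda>x. - dirac_pot \<alpha> F x) \<in> borel_measurable borel" using dirac_pot_measurable[OF F(1), of \<alpha>] by simp
  show "locally_integrable \<Psi>"
    by (rule locally_integrable_lborel[OF md eq]) (use dirac_pot_set_integrable[OF F(1), of _ \<alpha>] in \<open>simp add: set_integrable_def\<close>)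
  show "locally_integrable (\<lambda>x. V x *v \<Psi> x)"
    by (rule locally_integrable_lborel[OF mF VF sqi_set_integrable]) (use mF F(2) in \<open>auto simp: sqi_def\<close>)
  fix \<phi> :: "real^'n \<Rightarrow> complex" assume \<phi>: "test_function \<phi>"
  have n: "(LINT x|lborel. partial_deriv j \<phi> x *s (- dirac_pot \<alpha> F x)) = - (LINT x|lborel. partial_deriv j \<phi> x *s dirac_pot \<alpha> F x)" for j
    by (simp add: vector_smult_rneg)
  have "H_distr \<alpha> V \<Psi> \<phi> = (\<Sum>j\<in>UNIV. - (\<alpha> j *v (\<i> *s (LINT x|lborel. partial_deriv j \<phi> x *s dirac_pot \<alpha> F x)))) + (LINT x|lborel. \<phi> x *s F x)"
    unfolding H_distr_def distr_of_lborel[OF md eq test_function_partial[OF \<phi>]] distr_of_lborel[OF mF VF \<phi>] n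
    by (simp add: vector_smult_lneg linear_neg[OF linear_mv])
  also have "\<dots> = 0"
    using dirac_pot_solves[OF F(1) \<phi> anti test_integrable_vadm[OF F(1) \<phi>]] by (simp add: sum_negf)
  finally show "H_distr \<alpha> V \<Psi> \<phi> = 0" .
qed

lemma BS_eq:
  assumes i: "integrable lebesgue (\<lambda>y. G0 \<alpha> x y *v (cadjoint (V1 V y) *v \<Phi> y))"
  shows "BS \<alpha> V \<Phi> x = V2 V x *v R0 \<alpha> (\<lambda>y. cadjoint (V1 V y) *v \<Phi> y) x"
  unfolding BS_def R0_def integral_mv(2)[OF i, symmetric]
  by (simp add: matrix_vector_mul_assoc matrix_mul_assoc)

lemma V1_adj: "AE x in lborel. cadjoint (V1 V x) = V1 V x"
  using V_sa by eventually_elim (rule V1_hermitian)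

lemma V1_V2_AE: "AE x in lborel. \<forall>v. V1 V x *v (V2 V x *v v) = V x *v v"
  using V_sa by eventually_elim (simp add: matrix_vector_mul_assoc V1_V2)

text \<open>With F = V1 \<Phi> the kernel equation reads \<Phi> = - V2 R0 F. Applying V1 gives F = V
  (- R0 F), so - R0 F satisfies the integral equation of an eigenfunction without being known to lie
  in L^2.\<close>

lemma kernel_representation:
  assumes \<Phi>: "\<Phi> \<in> BS_ker \<alpha> V"
  obtains F where "vadm F" "integrable lborel (\<lambda>x. (norm (F x))\<^sup>2)"
    "AE x in lborel. norm (F x) \<le> sqrt C * ((1 + norm x) powr (- 1) * norm (\<Phi> x))"
    "AE x in lborel. - R0 \<alpha> (\<lambda>y. cadjoint (V1 V y) *v \<Phi> y) x = - dirac_pot \<alpha> F x"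
    "AE x in lborel. \<Phi> x = V2 V x *v (- dirac_pot \<alpha> F x)"
    "AE x in lborel. V x *v (- dirac_pot \<alpha> F x) = F x"
proof -
  have L2: "\<Phi> \<in> Lp 2" and ker: "AE x in lborel. \<Phi> x + BS \<alpha> V \<Phi> x = 0" using \<Phi> by (auto simp: BS_ker_def AE_lebesgue_iff)
  have m\<Phi>: "\<Phi> \<in> borel_measurable lebesgue" using L2 by (simp add: Lp_def)
  let ?F = "\<lambda>y. cadjoint (V1 V y) *v \<Phi> y"
  have eqF: "AE y in lborel. V1 V y *v \<Phi> y = ?F y" using V1_adj by eventually_elim simp
  have le: "AE x in lborel. norm (?F x) \<le> sqrt C * ((1 + norm x) powr (- 1) * norm (\<Phi> x))"
    using V12_bound(1) eqF by eventually_elim metis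
  have mF': "?F \<in> borel_measurable lebesgue"
    by (rule borel_measurable_AE[OF measurable_mv_fun[OF V1_meas m\<Phi>]]) (use eqF in \<open>simp add: AE_lebesgue_iff\<close>)
  obtain F where F: "vadm F" "AE x in lborel. ?F x = F x" "integrable lborel (\<lambda>x. (norm (F x))\<^sup>2)"
    "AE x in lborel. norm (F x) \<le> sqrt C * ((1 + norm x) powr (- 1) * norm (\<Phi> x))"
    using weighted_source[OF mF' L2 _ _ le] C by auto
  have R: "AE x in lborel. integrable lebesgue (\<lambda>y. G0 \<alpha> x y *v ?F y) \<and> R0 \<alpha> ?F x = dirac_pot \<alpha> F x"
    by (rule R0_eq_dirac_pot[OF F(1,2)])
  then have 1: "AE x in lborel. - R0 \<alpha> ?F x = - dirac_pot \<alpha> F x" by eventually_elim simp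
  have 2: "AE x in lborel. \<Phi> x = V2 V x *v (- dirac_pot \<alpha> F x)"
    using R ker
  proof eventually_elim
    case (elim x)
    then have "BS \<alpha> V \<Phi> x = V2 V x *v dirac_pot \<alpha> F x" using BS_eq by simp
    then show ?case using elim(2) by (simp add: linear_neg[OF linear_mv] eq_neg_iff_add_eq_0)
  qed
  have 3: "AE x in lborel. V x *v (- dirac_pot \<alpha> F x) = F x"
    using 2 V1_V2_AE F(2) eqF by eventually_elim metis
  show ?thesis using that F(1,3,4) 1 2 3 by blast
qed

lemma eigenfunction_Lp:
  assumes \<Psi>: "zero_eigenfunction \<alpha> V \<Psi>" and q: "q > 0"
    "1 / 2 - 1 / real CARD('n) < 1 / q" "1 / q < 1 - 1 / real CARD('n)" "1 / q < 1 / 2 + 1 / real CARD('n)"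
  shows "\<Psi> \<in> Lp q"
proof -
  have L2: "\<Psi> \<in> Lp 2" using \<Psi> by (auto simp: zero_eigenfunction_def W12_def)
  then have m\<Psi>: "\<Psi> \<in> borel_measurable lebesgue" by (simp add: Lp_def)
  obtain F where F: "vadm F" "AE x in lborel. V x *v \<Psi> x = F x" "integrable lborel (\<lambda>x. (norm (F x))\<^sup>2)"
    "AE x in lborel. norm (F x) \<le> C * ((1 + norm x) powr (- 2) * norm (\<Psi> x))"
    "AE x in lborel. \<Psi> x = - dirac_pot \<alpha> F x"
    using eigenfunction_representation[OF \<Psi>] by blast
  have "dirac_pot \<alpha> F \<in> Lp q" by (rule dirac_pot_Lp[OF F(1) L2 C F(4)]) (use q in auto)
  moreover have "AE x in lborel. norm (dirac_pot \<alpha> F x) = norm (\<Psi> x)" using F(5) by eventually_elim simp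
  ultimately show ?thesis using Lp_AE_cong m\<Psi> by blast
qed

lemma eigenfunction_Linf:
  assumes \<Psi>: "zero_eigenfunction \<alpha> V \<Psi>" and n: "CARD('n) \<le> 3"
  shows "\<Psi> \<in> Linf"
proof -
  have n23: "CARD('n) = 2 \<or> CARD('n) = 3" using n n2 by linarith
  have L2: "\<Psi> \<in> Lp 2" using \<Psi> by (auto simp: zero_eigenfunction_def W12_def)
  then have m\<Psi>: "\<Psi> \<in> borel_measurable lebesgue" by (simp add: Lp_def)
  \<comment> \<open>Boundedness asks for one source exponent above the dimension and one strictly
    between 1 and the dimension; 4 and 3/2 do this for n = 2 and n = 3. The exponent 4 takes a
    preliminary gain from L^2.\<close>
  have L4: "\<Psi> \<in> Lp 4" by (rule eigenfunction_Lp[OF \<Psi>]) (use n23 in auto)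
  obtain F where F: "vadm F" "AE x in lborel. V x *v \<Psi> x = F x" "integrable lborel (\<lambda>x. (norm (F x))\<^sup>2)"
    "AE x in lborel. norm (F x) \<le> C * ((1 + norm x) powr (- 2) * norm (\<Psi> x))"
    "AE x in lborel. \<Psi> x = - dirac_pot \<alpha> F x"
    using eigenfunction_representation[OF \<Psi>] by blast
  have mF: "F \<in> borel_measurable borel" using F(1) by (simp add: vadm_def)
  have F4: "integrable lborel (\<lambda>x. norm (F x) powr 4)"
    by (rule weighted_in_Lp[OF mF L4 C F(4)]) (use n23 in auto)
  have F32: "integrable lborel (\<lambda>x. norm (F x) powr (3 / 2))"
    by (rule weighted_in_Lp[OF mF L2 C F(4)]) (use n23 in auto)
  have "dirac_pot \<alpha> F \<in> Linf" by (rule dirac_pot_Linf[OF F(1) F4 F32]) (use n23 in auto)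
  moreover have "AE x in lborel. norm (dirac_pot \<alpha> F x) = norm (\<Psi> x)" using F(5) by eventually_elim simp
  ultimately show ?thesis using Linf_AE_cong m\<Psi> by blast
qed

text \<open>Two bounds on the same source are played against each other: as V1 \<Phi> it has decay 1
  with \<Phi> in L^2, which gives first exponents for \<Psi>; as V \<Psi> it has decay 2, which
  feeds the result back.\<close>

lemma kernel_function_properties:
  assumes \<Phi>: "\<Phi> \<in> BS_ker \<alpha> V" and m\<Psi>: "\<Psi> \<in> borel_measurable lebesgue"
    and eq: "AE x in lborel. \<Psi> x = - R0 \<alpha> (\<lambda>y. cadjoint (V1 V y) *v \<Phi> y) x"
  shows kernel_function_solution: "distributional_solution \<alpha> V \<Psi>"
    and kernel_function_gradient: "gradient_L2 \<Psi>"
    and kernel_function_inverse: "AE x in lborel. \<Phi> x = V2 V x *v \<Psi> x"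
    and kernel_function_Lp: "\<And>q. q > 0 \<Longrightarrow> 1 / 2 - 1 / real CARD('n) < 1 / q \<Longrightarrow> 1 / q < 1 / 2 \<Longrightarrow> \<Psi> \<in> Lp q"
    and kernel_function_Linf: "CARD('n) = 2 \<Longrightarrow> \<Psi> \<in> Linf"
    and kernel_function_L2: "CARD('n) \<ge> 3 \<Longrightarrow> \<Psi> \<in> Lp 2"
proof -
  have L2: "\<Phi> \<in> Lp 2" using \<Phi> by (simp add: BS_ker_def)
  obtain F where F: "vadm F" "integrable lborel (\<lambda>x. (norm (F x))\<^sup>2)"
    "AE x in lborel. norm (F x) \<le> sqrt C * ((1 + norm x) powr (- 1) * norm (\<Phi> x))"
    "AE x in lborel. - R0 \<alpha> (\<lambda>y. cadjoint (V1 V y) *v \<Phi> y) x = - dirac_pot \<alpha> F x"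
    "AE x in lborel. \<Phi> x = V2 V x *v (- dirac_pot \<alpha> F x)"
    "AE x in lborel. V x *v (- dirac_pot \<alpha> F x) = F x"
    using kernel_representation[OF \<Phi>] by blast
  have mF: "F \<in> borel_measurable borel" using F(1) by (simp add: vadm_def)
  have e: "AE x in lborel. \<Psi> x = - dirac_pot \<alpha> F x" using eq F(4) by eventually_elim simp
  have VF: "AE x in lborel. V x *v \<Psi> x = F x" using e F(6) by eventually_elim simp
  have ne: "AE x in lborel. norm (dirac_pot \<alpha> F x) = norm (\<Psi> x)" using e by eventually_elim simp
  show "distributional_solution \<alpha> V \<Psi>" by (rule dirac_pot_distributional_solution[OF F(1,2) e VF])
  show "gradient_L2 \<Psi>" by (rule dirac_pot_gradient[OF F(1,2) n2 e])
  show "AE x in lborel. \<Phi> x = V2 V x *v \<Psi> x" using e F(5) by eventually_elim simp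
  have leV: "AE x in lborel. norm (F x) \<le> C * ((1 + norm x) powr (- 2) * norm (\<Psi> x))"
    using V_bound VF by eventually_elim (metis mult.assoc)
  show Lq: "\<Psi> \<in> Lp q" if "q > 0" "1 / 2 - 1 / real CARD('n) < 1 / q" "1 / q < 1 / 2" for q
  proof -
    have n: "1 / real CARD('n) \<le> 1 / 2" using n2 by (intro divide_left_mono) auto
    have "dirac_pot \<alpha> F \<in> Lp q"
    proof (rule dirac_pot_Lp[OF F(1) L2 _ F(3)])
      show "1 / q < 1 - 1 / real CARD('n)" using that n by linarith
    qed (use that C in auto)
    then show ?thesis using Lp_AE_cong[OF ne m\<Psi>] by blast
  qed
  show "\<Psi> \<in> Linf" if n: "CARD('n) = 2"
  proof -
    have L4: "\<Psi> \<in> Lp 4" by (rule Lq) (use n in auto)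
    have F4: "integrable lborel (\<lambda>x. norm (F x) powr 4)"
      by (rule weighted_in_Lp[OF mF L4 C leV]) (use n in auto)
    have F32: "integrable lborel (\<lambda>x. norm (F x) powr (3 / 2))"
      by (rule weighted_in_Lp[OF mF L2 _ F(3)]) (use n C in auto)
    have "dirac_pot \<alpha> F \<in> Linf" by (rule dirac_pot_Linf[OF F(1) F4 F32]) (use n in auto)
    then show ?thesis using Linf_AE_cong[OF ne m\<Psi>] by blast
  qed
  show "\<Psi> \<in> Lp 2" if n: "CARD('n) \<ge> 3"
  proof -
    let ?n = "real CARD('n)"
    define u where "u = 1 / ?n"
    have "1 / ?n \<le> 1 / 3" using n by (intro divide_left_mono) auto
    then have u: "0 < u" "u \<le> 1 / 3" using n by (auto simp: u_def)
    \<comment> \<open>1/q0 is the midpoint of the range 1/2 - u < 1/q < 1/2 just obtained. The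
      second step reaches 2 because 1/q0 - u < 1/2 < 1/q0 + u and 1/2 < 1 - u, the last being n >=
      3.\<close>
    define q0 where "q0 = 1 / (1 / 2 - u / 2)"
    have iq0: "1 / q0 = 1 / 2 - u / 2" by (simp add: q0_def)
    have q0: "q0 > 0" "q0 \<ge> 1" unfolding q0_def using u by (auto simp: le_divide_eq)
    have Lq0: "\<Psi> \<in> Lp q0" by (rule Lq) (use q0 u in \<open>auto simp: iq0 u_def[symmetric]\<close>)
    have "dirac_pot \<alpha> F \<in> Lp 2"
      by (rule dirac_pot_Lp[OF F(1) Lq0 C leV]) (use q0 u in \<open>auto simp: iq0 u_def[symmetric]\<close>)
    then show ?thesis using Lp_AE_cong[OF ne m\<Psi>] by blast
  qed
qed

text \<open>The kernel element is \<Phi> = V2 \<Psi>. If it vanished, so would the source V1 \<Phi>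
  = V \<Psi>, and with it \<Psi> = - R0 V \<Psi>.\<close>

lemma eigenvalue_imp_kernel:
  assumes "zero_eigenvalue \<alpha> V" shows "\<not> trivial_BS_ker \<alpha> V"
proof
  assume triv: "trivial_BS_ker \<alpha> V"
  obtain \<Psi> where \<Psi>: "zero_eigenfunction \<alpha> V \<Psi>" using assms by (auto simp: zero_eigenvalue_def)
  have L2: "\<Psi> \<in> Lp 2" and nz: "\<not> (AE x in lebesgue. \<Psi> x = 0)" using \<Psi> by (auto simp: zero_eigenfunction_def W12_def)
  then have m\<Psi>: "\<Psi> \<in> borel_measurable lebesgue" by (simp add: Lp_def)
  obtain F where F: "vadm F" "AE x in lborel. V x *v \<Psi> x = F x" "integrable lborel (\<lambda>x. (norm (F x))\<^sup>2)"
    "AE x in lborel. norm (F x) \<le> C * ((1 + norm x) powr (- 2) * norm (\<Psi> x))"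
    "AE x in lborel. \<Psi> x = - dirac_pot \<alpha> F x"
    using eigenfunction_representation[OF \<Psi>] by blast
  define \<Phi> where "\<Phi> x = V2 V x *v \<Psi> x" for x
  have m\<Phi>: "\<Phi> \<in> borel_measurable lebesgue" unfolding \<Phi>_def[abs_def] by (rule measurable_mv_fun[OF V2_meas m\<Psi>])
  have \<Phi>F: "AE x in lborel. cadjoint (V1 V x) *v \<Phi> x = F x"
    using V1_adj V1_V2_AE F(2) by eventually_elim (simp add: \<Phi>_def)
  have \<Phi>le: "AE x in lborel. norm (\<Phi> x) \<le> sqrt C * norm (\<Psi> x)"
    using V12_bound(2)
  proof eventually_elim
    case (elim x)
    have "(1 + norm x) powr (- 1) * norm (\<Psi> x) \<le> 1 * norm (\<Psi> x)" by (intro mult_right_mono weight_le_1) auto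
    then have "sqrt C * ((1 + norm x) powr (- 1) * norm (\<Psi> x)) \<le> sqrt C * norm (\<Psi> x)" using C by (intro mult_left_mono) auto
    then show ?case using elim[rule_format, of "\<Psi> x"] by (simp add: \<Phi>_def)
  qed
  have \<Phi>2: "\<Phi> \<in> Lp 2"
  proof -
    have "integrable lebesgue (\<lambda>x. norm (\<Phi> x) powr 2)"
    proof (rule Bochner_Integration.integrable_bound)
      show "integrable lebesgue (\<lambda>x. sqrt C powr 2 * norm (\<Psi> x) powr 2)"
        using L2 by (intro integrable_mult_right) (simp add: Lp_def)
      show "AE x in lebesgue. norm (norm (\<Phi> x) powr 2) \<le> norm (sqrt C powr 2 * norm (\<Psi> x) powr 2)"
        using \<Phi>le unfolding AE_lebesgue_iff
      proof eventually_elim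
        case (elim x)
        have "norm (\<Phi> x) powr 2 \<le> (sqrt C * norm (\<Psi> x)) powr 2" using elim by (intro powr_mono2) auto
        then show ?case using C by (simp add: powr_mult)
      qed
    qed (use m\<Phi> in simp)
    then show ?thesis using m\<Phi> by (simp add: Lp_def)
  qed
  have R: "AE x in lborel. integrable lebesgue (\<lambda>y. G0 \<alpha> x y *v (cadjoint (V1 V y) *v \<Phi> y))
     \<and> R0 \<alpha> (\<lambda>y. cadjoint (V1 V y) *v \<Phi> y) x = dirac_pot \<alpha> F x"
    by (rule R0_eq_dirac_pot[OF F(1) \<Phi>F])
  have "AE x in lborel. \<Phi> x + BS \<alpha> V \<Phi> x = 0"
    using R F(5)
  proof eventually_elim
    case (elim x)
    then have "BS \<alpha> V \<Phi> x = V2 V x *v dirac_pot \<alpha> F x" using BS_eq by simp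
    also have "\<dots> = - \<Phi> x" using elim(2) by (simp add: \<Phi>_def linear_neg[OF linear_mv])
    finally show ?case by simp
  qed
  then have "\<Phi> \<in> BS_ker \<alpha> V" using \<Phi>2 by (simp add: BS_ker_def AE_lebesgue_iff)
  then have \<Phi>0: "AE x in lborel. \<Phi> x = 0" using triv by (auto simp: trivial_BS_ker_def AE_lebesgue_iff)
  have F0: "AE x in lborel. (0 :: complex^'N) = F x"
    using \<Phi>0 \<Phi>F by eventually_elim (simp add: linear_0[OF linear_mv])
  \<comment> \<open>The potential of a source that vanishes almost everywhere is evaluated through
    \<open>R0\<close> of the zero function.\<close>
  have "AE x in lborel. integrable lebesgue (\<lambda>y. G0 \<alpha> x y *v 0) \<and> R0 \<alpha> (\<lambda>y. 0) x = dirac_pot \<alpha> F x"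
    by (rule R0_eq_dirac_pot[OF F(1) F0])
  then have "AE x in lborel. \<Psi> x = 0"
    using F(5) by eventually_elim (simp add: R0_def linear_0[OF linear_mv])
  then show False using nz by (simp add: AE_lebesgue_iff)
qed

text \<open>Whether the solution attached to a kernel element lies in L^2 decides between eigenvalue
  and resonance. In the first case it is nonzero since \<Phi> = V2 \<Psi> recovers \<Phi>.\<close>

lemma kernel_imp_eigenvalue_or_resonance:
  assumes nt: "\<not> trivial_BS_ker \<alpha> V" shows "zero_eigenvalue \<alpha> V \<or> zero_resonance \<alpha> V"
proof -
  obtain \<Phi> where \<Phi>: "\<Phi> \<in> BS_ker \<alpha> V" "\<not> (AE x in lebesgue. \<Phi> x = 0)" using nt by (auto simp: trivial_BS_ker_def)
  obtain F where F: "vadm F" "AE x in lborel. - R0 \<alpha> (\<lambda>y. cadjoint (V1 V y) *v \<Phi> y) x = - dirac_pot \<alpha> F x"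
    using kernel_representation[OF \<Phi>(1)] by blast
  define \<Psi> where "\<Psi> x = - dirac_pot \<alpha> F x" for x
  have m: "\<Psi> \<in> borel_measurable lebesgue"
    unfolding \<Psi>_def[abs_def] using dirac_pot_measurable[OF F(1), of \<alpha>] by (intro borel_imp_lebesgue) simp
  have e: "AE x in lborel. \<Psi> x = - R0 \<alpha> (\<lambda>y. cadjoint (V1 V y) *v \<Phi> y) x"
    using F(2) by eventually_elim (simp add: \<Psi>_def)
  note K = kernel_function_properties[OF \<Phi>(1) m e]
  show ?thesis
  proof (cases "\<Psi> \<in> Lp 2")
    case True
    have "\<not> (AE x in lebesgue. \<Psi> x = 0)"
    proof
      assume "AE x in lebesgue. \<Psi> x = 0"
      then have "AE x in lborel. \<Phi> x = 0"
        using K(3) unfolding AE_lebesgue_iff by eventually_elim (simp add: linear_0[OF linear_mv])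
      then show False using \<Phi>(2) by (simp add: AE_lebesgue_iff)
    qed
    then have "zero_eigenfunction \<alpha> V \<Psi>" using True K(1,2) by (simp add: zero_eigenfunction_def W12_def)
    then show ?thesis by (auto simp: zero_eigenvalue_def)
  next
    case False
    then have "resonance_function \<alpha> V \<Psi>"
      using \<Phi> e K(1) unfolding resonance_function_def AE_lebesgue_iff by blast
    then show ?thesis using nt by (auto simp: zero_resonance_def)
  qed
qed

section \<open>Regularity, resonances and the exponent ranges\<close>

lemma regular_iff: "zero_regular \<alpha> V \<longleftrightarrow> trivial_BS_ker \<alpha> V"
  using eigenvalue_imp_kernel kernel_imp_eigenvalue_or_resonance
  by (auto simp: zero_regular_def zero_resonance_def)

text \<open>Measurability of \<Psi> comes with the local integrability in
  \<open>distributional_solution\<close>.\<close>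

lemma resonance_function_kernel:
  assumes "resonance_function \<alpha> V \<Psi>"
  obtains \<Phi> where "\<Phi> \<in> BS_ker \<alpha> V" "\<Psi> \<in> borel_measurable lebesgue"
    "AE x in lborel. \<Psi> x = - R0 \<alpha> (\<lambda>y. cadjoint (V1 V y) *v \<Phi> y) x"
  using assms unfolding resonance_function_def distributional_solution_def locally_integrable_def AE_lebesgue_iff by blast

lemma resonance_function_plane:
  assumes \<Psi>: "resonance_function \<alpha> V \<Psi>" and n: "CARD('n) = 2"
  shows "(\<forall>q>2. \<Psi> \<in> Lp q) \<and> \<Psi> \<in> Linf \<and> gradient_L2 \<Psi> \<and> \<Psi> \<notin> Lp 2"
proof -
  obtain \<Phi> where \<Phi>: "\<Phi> \<in> BS_ker \<alpha> V" "\<Psi> \<in> borel_measurable lebesgue"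
    "AE x in lborel. \<Psi> x = - R0 \<alpha> (\<lambda>y. cadjoint (V1 V y) *v \<Phi> y) x"
    using resonance_function_kernel[OF \<Psi>] by blast
  note K = kernel_function_properties[OF \<Phi>]
  have "\<Psi> \<in> Lp q" if "q > 2" for q by (rule K(4)) (use that n in auto)
  then show ?thesis using K(2,5) n \<Psi> by (simp add: resonance_function_def)
qed

lemma no_resonance: "CARD('n) \<ge> 3 \<Longrightarrow> \<not> zero_resonance \<alpha> V"
proof
  assume n: "CARD('n) \<ge> 3" and "zero_resonance \<alpha> V"
  then obtain \<Psi> where \<Psi>: "resonance_function \<alpha> V \<Psi>" by (auto simp: zero_resonance_def)
  obtain \<Phi> where \<Phi>: "\<Phi> \<in> BS_ker \<alpha> V" "\<Psi> \<in> borel_measurable lebesgue"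
    "AE x in lborel. \<Psi> x = - R0 \<alpha> (\<lambda>y. cadjoint (V1 V y) *v \<Phi> y) x"
    using resonance_function_kernel[OF \<Psi>] by blast
  show False using kernel_function_properties(6)[OF \<Phi> n] \<Psi> by (simp add: resonance_function_def)
qed

lemma eigenfunction_plane:
  assumes \<Psi>: "zero_eigenfunction \<alpha> V \<Psi>" and n: "CARD('n) = 2"
  shows "(\<forall>q\<ge>2. \<Psi> \<in> Lp q) \<and> \<Psi> \<in> Linf"
proof -
  have L2: "\<Psi> \<in> Lp 2" using \<Psi> by (auto simp: zero_eigenfunction_def W12_def)
  have Li: "\<Psi> \<in> Linf" by (rule eigenfunction_Linf[OF \<Psi>]) (use n in simp)
  then show ?thesis using Lp_interpolate_Linf[OF L2 Li] by auto
qed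

lemma eigenfunction_higher:
  assumes \<Psi>: "zero_eigenfunction \<alpha> V \<Psi>"
  shows "CARD('n) = 3 \<longrightarrow> (\<forall>q>3/2. \<Psi> \<in> Lp q) \<and> \<Psi> \<in> Linf"
    and "CARD('n) = 4 \<longrightarrow> (\<forall>q\<in>{4/3<..<4}. \<Psi> \<in> Lp q)"
    and "CARD('n) \<ge> 5 \<longrightarrow> (\<forall>q\<in>{2 * real CARD('n) / (real CARD('n) + 2)
           <..<2 * real CARD('n) / (real CARD('n) - 2)}. \<Psi> \<in> Lp q)"
proof -
  show "CARD('n) = 3 \<longrightarrow> (\<forall>q>3/2. \<Psi> \<in> Lp q) \<and> \<Psi> \<in> Linf"
  proof (intro impI conjI allI)
    assume n: "CARD('n) = 3"
    show Li: "\<Psi> \<in> Linf" by (rule eigenfunction_Linf[OF \<Psi>]) (use n in simp)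
    have L4: "\<Psi> \<in> Lp 4" by (rule eigenfunction_Lp[OF \<Psi>]) (use n in auto)
    fix q :: real assume q: "q > 3 / 2"
    show "\<Psi> \<in> Lp q"
    \<comment> \<open>A single potential step gives 3/2 < q < 6. The exponent 4 inside this range is
      the anchor from which the bound on \<Psi> reaches all larger exponents.\<close>
    proof (cases "q \<ge> 4")
      case True
      then show ?thesis using Lp_interpolate_Linf[OF L4 Li] by simp
    next
      case False
      show ?thesis by (rule eigenfunction_Lp[OF \<Psi>]) (use n q False in \<open>auto simp: field_simps\<close>)
    qed
  qed
  show "CARD('n) = 4 \<longrightarrow> (\<forall>q\<in>{4/3<..<4}. \<Psi> \<in> Lp q)"
  proof (intro impI ballI)
    fix q :: real assume n: "CARD('n) = 4" and q: "q \<in> {4/3<..<4}"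
    show "\<Psi> \<in> Lp q" by (rule eigenfunction_Lp[OF \<Psi>]) (use n q in \<open>auto simp: field_simps\<close>)
  qed
  show "CARD('n) \<ge> 5 \<longrightarrow> (\<forall>q\<in>{2 * real CARD('n) / (real CARD('n) + 2)
           <..<2 * real CARD('n) / (real CARD('n) - 2)}. \<Psi> \<in> Lp q)"
  proof (intro impI ballI)
    fix q assume n: "CARD('n) \<ge> 5" and q: "q \<in> {2 * real CARD('n) / (real CARD('n) + 2)
           <..<2 * real CARD('n) / (real CARD('n) - 2)}"
    define N where "N = real CARD('n)"
    have N: "N \<ge> 5" using n by (simp add: N_def)
    have "2 * N / (N + 2) > 0" using N by simp
    moreover have "2 * N / (N + 2) < q" using q by (simp add: N_def)
    ultimately have q0: "q > 0" by linarith
    have 1: "2 * N < q * (N + 2)" "q * (N - 2) < 2 * N" using q N by (auto simp: N_def[symmetric] field_simps)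
    have a: "1 / q < 1 / 2 + 1 / N" using 1 q0 N by (simp add: field_simps)
    have b: "1 / 2 - 1 / N < 1 / q" using 1 q0 N by (simp add: field_simps)
    \<comment> \<open>From n >= 5 follows 1/2 + 1/n < 1 - 1/n, so the second upper bound on 1/q is
      implied by the first.\<close>
    have "1 / N \<le> 1 / 5" using N by (intro divide_left_mono) auto
    then have c: "1 / q < 1 - 1 / N" using a by linarith
    show "\<Psi> \<in> Lp q" by (rule eigenfunction_Lp[OF \<Psi> q0]) (use a b c in \<open>simp_all add: N_def\<close>)
  qed
qed

end

section \<open>From entrywise decay of the potential to a bound on its matrix norm\<close>

lemma japanese_decay: "japanese (x::'a::real_normed_vector) powr (-2) \<le> 2 * (1 + norm x) powr (-2)"
proof -
  have pos: "1 + (norm x)\<^sup>2 > 0" by (smt (verit) zero_le_power2)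
  have "japanese x powr (-2) = 1 / (1 + (norm x)\<^sup>2)"
    using pos by (simp add: japanese_def powr_minus_divide powr_numeral)
  also have "\<dots> \<le> 2 / (1 + norm x)\<^sup>2"
  proof -
    have "(1 + norm x)\<^sup>2 \<le> 2 * (1 + (norm x)\<^sup>2)"
      using sum_squares_bound[of 1 "norm x"] by (simp add: power2_sum)
    then show ?thesis using pos by (simp add: divide_simps)
  qed
  also have "2 / (1 + norm x)\<^sup>2 = 2 * (1 + norm x) powr (-2)" by (simp add: powr_minus_divide powr_numeral)
  finally show ?thesis .
qed

theorem theorem3p8:
  fixes \<alpha> :: "'n::finite \<Rightarrow> complex^'N::finite^'N" and \<beta> :: "complex^'N^'N"
    and V :: "real^'n \<Rightarrow> complex^'N^'N"
  assumes n_ge_2: "CARD('n) \<ge> 2"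
    and N_eq: "CARD('N) = 2 ^ ((CARD('n) + 1) div 2)"
    and dirac: "dirac_matrices \<alpha> \<beta>"
    and V_Linf: "\<And>l m. (\<lambda>x. V x $ l $ m) \<in> Linf"
    and V_selfadjoint: "AE x in lebesgue. cadjoint (V x) = V x"
    and V_decay: "\<exists>C>0. \<forall>l m. AE x in lebesgue. cmod (V x $ l $ m) \<le> C * japanese x powr (-2)"
  shows
    "(CARD('n) = 2 \<longrightarrow>
        zero_regular \<alpha> V
      \<or> (zero_resonance \<alpha> V \<and> \<not> zero_eigenvalue \<alpha> V \<and>
          (\<forall>\<Psi>. resonance_function \<alpha> V \<Psi> \<longrightarrow>
             (\<forall>q>2. \<Psi> \<in> Lp q) \<and> \<Psi> \<in> Linf \<and> gradient_L2 \<Psi> \<and> \<Psi> \<notin> Lp 2))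
      \<or> (zero_eigenvalue \<alpha> V \<and> \<not> zero_resonance \<alpha> V \<and>
          (\<forall>\<Psi>. zero_eigenfunction \<alpha> V \<Psi> \<longrightarrow> (\<forall>q\<ge>2. \<Psi> \<in> Lp q) \<and> \<Psi> \<in> Linf))
      \<or> (zero_resonance \<alpha> V \<and> zero_eigenvalue \<alpha> V \<and>
          (\<forall>\<Psi>. resonance_function \<alpha> V \<Psi> \<longrightarrow>
             (\<forall>q>2. \<Psi> \<in> Lp q) \<and> \<Psi> \<in> Linf \<and> gradient_L2 \<Psi> \<and> \<Psi> \<notin> Lp 2) \<and>
          (\<forall>\<Psi>. zero_eigenfunction \<alpha> V \<Psi> \<longrightarrow> (\<forall>q\<ge>2. \<Psi> \<in> Lp q) \<and> \<Psi> \<in> Linf)))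
   \<and> (CARD('n) \<ge> 3 \<longrightarrow>
        (zero_regular \<alpha> V
         \<or> (zero_eigenvalue \<alpha> V \<and>
             (\<forall>\<Psi>. zero_eigenfunction \<alpha> V \<Psi> \<longrightarrow>
                (CARD('n) = 3 \<longrightarrow> (\<forall>q>3/2. \<Psi> \<in> Lp q) \<and> \<Psi> \<in> Linf) \<and>
                (CARD('n) = 4 \<longrightarrow> (\<forall>q\<in>{4/3<..<4}. \<Psi> \<in> Lp q)) \<and>
                (CARD('n) \<ge> 5 \<longrightarrow>
                   (\<forall>q\<in>{2 * real CARD('n) / (real CARD('n) + 2)
                        <..<2 * real CARD('n) / (real CARD('n) - 2)}. \<Psi> \<in> Lp q)))))
        \<and> \<not> zero_resonance \<alpha> V)
   \<and> (zero_regular \<alpha> V \<longleftrightarrow> trivial_BS_ker \<alpha> V)"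
proof -
  obtain C where C: "C > 0" "\<And>l m. AE x in lebesgue. cmod (V x $ l $ m) \<le> C * japanese x powr (-2)"
    using V_decay by blast
  \<comment> \<open>The factor 2 comes from comparing the two forms of the weight, and there is one
    factor \<open>CARD('N)\<close> for each index in the sum of entries that bounds the operator
    norm.\<close>
  define D where "D = 2 * C * real CARD('N) * real CARD('N)"
  interpret dirac_setup \<alpha> V D
  proof
    show "CARD('n) \<ge> 2" by (rule n_ge_2)
    show "\<alpha> j ** \<alpha> k + \<alpha> k ** \<alpha> j = (if j = k then mat 2 else 0)" for j k
      using dirac by (simp add: dirac_matrices_def)
    show "V \<in> borel_measurable lebesgue" by (rule borel_measurable_matrixI) (use V_Linf in \<open>simp add: Linf_def\<close>)
    show "AE x in lborel. cadjoint (V x) = V x" using V_selfadjoint by (simp add: AE_lebesgue_iff)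
    show "D \<ge> 0" using C(1) by (simp add: D_def)
    have "AE x in lborel. \<forall>l\<in>UNIV. \<forall>m\<in>UNIV. cmod (V x $ l $ m) \<le> C * japanese x powr (-2)"
      using C(2) unfolding AE_lebesgue_iff by (intro AE_finite_allI) auto
    then show "AE x in lborel. \<forall>v. norm (V x *v v) \<le> D * (1 + norm x) powr (- 2) * norm v"
    proof eventually_elim
      case (elim x)
      have "matrix_const (V x) \<le> (\<Sum>l\<in>(UNIV :: 'N set). \<Sum>m\<in>(UNIV :: 'N set). C * (2 * (1 + norm x) powr (- 2)))"
        unfolding matrix_const_def
      proof (intro sum_mono)
        fix l m
        have "cmod (V x $ l $ m) \<le> C * japanese x powr (-2)" using elim by blast
        also have "\<dots> \<le> C * (2 * (1 + norm x) powr (- 2))" using C(1) japanese_decay[of x] by (intro mult_left_mono) auto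
        finally show "cmod (V x $ l $ m) \<le> C * (2 * (1 + norm x) powr (- 2))" .
      qed
      also have "\<dots> = D * (1 + norm x) powr (- 2)" by (simp add: D_def)
      finally have "matrix_const (V x) \<le> D * (1 + norm x) powr (- 2)" .
      then have "matrix_const (V x) * norm v \<le> D * (1 + norm x) powr (- 2) * norm v" for v :: "complex^'N"
        by (intro mult_right_mono) auto
      then show ?case using norm_mv_le[of "V x"] order_trans by blast
    qed
  qed
  have res: "zero_regular \<alpha> V \<longleftrightarrow> \<not> zero_eigenvalue \<alpha> V \<and> \<not> zero_resonance \<alpha> V" by (simp add: zero_regular_def)
  show ?thesis
    using res regular_iff resonance_function_plane eigenfunction_plane no_resonance eigenfunction_higher by blast
qed

end
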